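(* Let $\mathcal{W}$ be the simple graded quotient of the $\mathcal{W}_3$-algebra $\mathcal{W}_3^{c}$ of central charge $c=-2$. The map $\Phi_{\mathcal{W}}: \mathcal{O}((\tilde{X}_{\mathcal{W}})_{\infty}) \to \mathrm{gr}(\mathcal{W})$ is not injective, so $(\tilde{X}_{\mathcal{W}})_{\infty}$ and $\mathrm{SS}(\mathcal{W})$ are not isomorphic as schemes.
   Context: All algebras are over $\mathbb{C}$. For a vertex algebra $\mathcal{V}$, write $a(z)=\sum_{n\in\mathbb{Z}} a_{(n)}z^{-n-1}$ for the field of $a\in\mathcal{V}$, $\partial$ for the translation operator, $:ab:\,=a_{(-1)}b$ for the normally ordered product, and $:a_1a_2\cdots a_k:\,=\,:a_1(:a_2\cdots a_k:):$ inductively. OPEs are written $a(z)b(w)\sim\sum_{n\ge 0}(a_{(n)}b)(w)(z-w)^{-n-1}$. A subset $S=\{a_i\}$ strongly generates $\mathcal{V}$ if $\mathcal{V}$ is spanned by the normally ordered monomials $:\partial^{k_1}a_{i_1}\cdots\partial^{k_m}a_{i_m}:$ with $k_j\ge0$; an ordered set $S$ of even elements freely generates $\mathcal{V}$ if the ordered monomials of this type (ordered by generator, with derivative orders weakly decreasing within each generator) form a basis of $\mathcal{V}$. The algebra $\mathcal{W}$: $\mathcal{W}_3^{c}$ at $c=-2$ is the vertex algebra freely generated by an even Virasoro field $L$ of central charge $-2$ and an even field $W$, primary of conformal weight $3$ with respect to $L$, normalized so that $$W(z)W(w)\sim -\tfrac98(z-w)^{-6}+\tfrac{27}{8}L(w)(z-w)^{-4}+\tfrac{27}{16}\partial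 L(w)(z-w)^{-3}+\big(\tfrac92:LL:-\tfrac{27}{32}\partial^2L\big)(w)(z-w)^{-2}+\big(\tfrac92:(\partial L)L:-\tfrac{3}{16}\partial^3L\big)(w)(z-w)^{-1}.$$ It is isomorphic to the principal $\mathcal{W}$-algebra $\mathcal{W}^k(\mathfrak{sl}_3,f_{\mathrm{prin}})$ with $2-\frac{24(k+2)^2}{k+3}=-2$. It has a nontrivial ideal, and $\mathcal{W}$ denotes its simple graded quotient (the quotient by the maximal proper graded ideal, for the grading by conformal weight). Associated scheme: $C(\mathcal{V})=\mathrm{Span}\{a_{(-2)}b\mid a,b\in\mathcal{V}\}$ and $R_{\mathcal{V}}=\mathcal{V}/C(\mathcal{V})$, a commutative associative algebra with product induced by the normally ordered product; $\tilde{X}_{\mathcal{V}}=\mathrm{Spec}(R_{\mathcal{V}})$. Arc space: for an affine scheme $X=\mathrm{Spec}(R)$ with $R=\mathbb{C}[y_1,\dots,y_r]/\langle f_1,\dots,f_k\rangle$, the arc space is $X_\infty=\mathrm{Spec}(R_\infty)$, where $R_\infty=\mathbb{C}[y_j^{(i)}\mid 1\le j\le r,\ i\ge0]/\langle f_l^{(i)}\mid 1\le l\le k,\ i\ge 0\rangle$, $D$ is the derivation with $D(y_j^{(i)})=y_j^{(i+1)}$, $y_j=y_j^{(0)}$, and $f_l^{(i)}=D^i(f_l)$. Thus $\mathcal{O}(X_\infty)=R_\infty$ is a differential algebra containing $R$, graded by height, where $y_j^{(i)}$ has height $i$. Singular support: Li's decreasing filtration is $\mathcal{V}=F^0(\mathcal{V})\supseteq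 F^1(\mathcal{V})\supseteq\cdots$, where $F^p(\mathcal{V})$ is spanned by the elements $:\partial^{n_1}a^1\cdots\partial^{n_r}a^r:$ with $a^1,\dots,a^r\in\mathcal{V}$, $n_i\ge0$, $n_1+\cdots+n_r\ge p$. Put $\mathrm{gr}(\mathcal{V})=\bigoplus_{p\ge0}F^p(\mathcal{V})/F^{p+1}(\mathcal{V})$ with projections $\sigma_p:F^p(\mathcal{V})\to F^p(\mathcal{V})/F^{p+1}(\mathcal{V})$. This is a graded commutative algebra with product $\sigma_p(a)\sigma_q(b)=\sigma_{p+q}(a_{(-1)}b)$ and derivation $\partial\sigma_p(a)=\sigma_{p+1}(\partial a)$. One has $F^1(\mathcal{V})=C(\mathcal{V})$, so $R_{\mathcal{V}}=F^0(\mathcal{V})/F^1(\mathcal{V})\subseteq\mathrm{gr}(\mathcal{V})$, and $\mathrm{gr}(\mathcal{V})$ is generated by $R_{\mathcal{V}}$ as a differential algebra. The singular support is $\mathrm{SS}(\mathcal{V})=\mathrm{Spec}(\mathrm{gr}(\mathcal{V}))$. The map $\Phi_{\mathcal{V}}:\mathcal{O}((\tilde{X}_{\mathcal{V}})_\infty)\to\mathrm{gr}(\mathcal{V})$ is the surjective homomorphism of differential graded algebras that restricts to the identity on $R_{\mathcal{V}}$ (and intertwines $D$ with $\partial$). *)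

theory Defs
  imports
    "HOL-Algebra.Module"
    "HOL-Algebra.QuotRing"
    "HOL-Analysis.Function_Topology"
    "HOL-Library.Poly_Mapping"
    "HOL-Library.Set_Algebras"
begin

section \<open>Vertex algebras\<close>

text \<open>The underlying vector space is the whole type; \<open>nprod V a n b\<close> is $a_{(n)}b$ and
  \<open>der V\<close> is the translation operator.\<close>

record 'v va =
  scal :: "complex \<Rightarrow> 'v \<Rightarrow> 'v"
  vac :: 'v
  der :: "'v \<Rightarrow> 'v"
  nprod :: "'v \<Rightarrow> int \<Rightarrow> 'v \<Rightarrow> 'v"

text \<open>The last axiom is locality $(z-w)^N[a(z),b(w)]=0$, read off at the coefficient of
  $z^{-m-1}w^{-n-1}$.\<close>

locale vertex_algebra =
  fixes V :: "'v::ab_group_add va"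
  assumes vector_space: "vector_space (scal V)"
    and der_linear: "Vector_Spaces.linear (scal V) (scal V) (der V)"
    and nprod_linear_left: "Vector_Spaces.linear (scal V) (scal V) (\<lambda>a. nprod V a n b)"
    and nprod_linear_right: "Vector_Spaces.linear (scal V) (scal V) (\<lambda>b. nprod V a n b)"
    and truncation: "\<exists>N. \<forall>n\<ge>N. nprod V a n b = 0"
    and vacuum: "nprod V (vac V) n a = (if n = -1 then a else 0)"
    and creation: "nprod V a (-1) (vac V) = a" "n \<ge> 0 \<Longrightarrow> nprod V a n (vac V) = 0"
    and der_vac: "der V (vac V) = 0"
    and translation:
      "der V (nprod V a n b) - nprod V a n (der V b) = scal V (- of_int n) (nprod V a (n - 1) b)"
    and locality:
      "\<exists>N::nat. \<forall>m n c.
         (\<Sum>j\<le>N. scal V ((-1) ^ j * of_nat (N choose j))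
            (nprod V a (m + int N - int j) (nprod V b (n + int j) c)
             - nprod V b (n + int j) (nprod V a (m + int N - int j) c))) = 0"

definition va_span :: "'v::ab_group_add va \<Rightarrow> 'v set \<Rightarrow> 'v set" where
  "va_span V = Modules.module.span (scal V)"

text \<open>The normally ordered product of a list, nested to the right. Starting from the vacuum is
  harmless because $:\!a\,\mathbf{1}\!:\;= a$.\<close>

definition nop :: "'v va \<Rightarrow> 'v list \<Rightarrow> 'v" where
  "nop V as = foldr (\<lambda>a b. nprod V a (-1) b) as (vac V)"

text \<open>An ordered monomial in the generators \<open>gs\<close>: the \<open>i\<close>-th entry of \<open>kss\<close> lists the derivative
  orders of the factors coming from the \<open>i\<close>-th generator.\<close>

definition va_monomial :: "'v va \<Rightarrow> 'v list \<Rightarrow> nat list list \<Rightarrow> 'v" where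
  "va_monomial V gs kss =
     nop V (concat (map2 (\<lambda>a ks. map (\<lambda>k. (der V ^^ k) a) ks) gs kss))"

definition freely_generates :: "'v::ab_group_add va \<Rightarrow> 'v list \<Rightarrow> bool" where
  "freely_generates V gs \<longleftrightarrow>
     (let M = {kss. length kss = length gs \<and> (\<forall>ks\<in>set kss. sorted_wrt (\<ge>) ks)} in
        inj_on (va_monomial V gs) M \<and>
        \<not> Modules.module.dependent (scal V) (va_monomial V gs ` M) \<and>
        va_span V (va_monomial V gs ` M) = UNIV)"

definition virasoro :: "'v::ab_group_add va \<Rightarrow> complex \<Rightarrow> 'v \<Rightarrow> bool" where
  "virasoro V c L \<longleftrightarrow>
     nprod V L 0 L = der V L \<and>
     nprod V L 1 L = scal V 2 L \<and>
     nprod V L 2 L = 0 \<and>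
     nprod V L 3 L = scal V (c / 2) (vac V) \<and>
     (\<forall>n\<ge>4. nprod V L n L = 0)"

definition primary :: "'v::ab_group_add va \<Rightarrow> 'v \<Rightarrow> complex \<Rightarrow> 'v \<Rightarrow> bool" where
  "primary V L h a \<longleftrightarrow>
     nprod V L 0 a = der V a \<and>
     nprod V L 1 a = scal V h a \<and>
     (\<forall>n\<ge>2. nprod V L n a = 0)"

locale W3_minus_two = vertex_algebra V
  for V :: "'v::ab_group_add va" +
  fixes L W :: 'v
  assumes free: "freely_generates V [L, W]"
    and L_virasoro: "virasoro V (-2) L"
    and W_primary: "primary V L 3 W"
    and W_W:
      "\<forall>n\<ge>6. nprod V W n W = 0"
      "nprod V W 5 W = scal V (-9/8) (vac V)"
      "nprod V W 4 W = 0"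
      "nprod V W 3 W = scal V (27/8) L"
      "nprod V W 2 W = scal V (27/16) (der V L)"
      "nprod V W 1 W = scal V (9/2) (nprod V L (-1) L) - scal V (27/32) ((der V ^^ 2) L)"
      "nprod V W 0 W = scal V (9/2) (nprod V (der V L) (-1) L) - scal V (3/16) ((der V ^^ 3) L)"


subsection \<open>The simple graded quotient\<close>

definition va_ideal :: "'v::ab_group_add va \<Rightarrow> 'v set \<Rightarrow> bool" where
  "va_ideal V I \<longleftrightarrow>
     Modules.module.subspace (scal V) I \<and>
     (\<forall>x\<in>I. der V x \<in> I) \<and>
     (\<forall>a n. \<forall>x\<in>I. nprod V a n x \<in> I \<and> nprod V x n a \<in> I)"

text \<open>The conformal weight is the eigenvalue of $L_0 = L_{(1)}$.\<close>

definition weight_space :: "'v::ab_group_add va \<Rightarrow> 'v \<Rightarrow> nat \<Rightarrow> 'v set" where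
  "weight_space V L n = {a. nprod V L 1 a = scal V (of_nat n) a}"

definition proper_graded_ideal :: "'v::ab_group_add va \<Rightarrow> 'v \<Rightarrow> 'v set \<Rightarrow> bool" where
  "proper_graded_ideal V L I \<longleftrightarrow>
     va_ideal V I \<and> I \<noteq> UNIV \<and> va_span V (\<Union>n. I \<inter> weight_space V L n) = I"

definition maximal_proper_graded_ideal :: "'v::ab_group_add va \<Rightarrow> 'v \<Rightarrow> 'v set \<Rightarrow> bool" where
  "maximal_proper_graded_ideal V L I \<longleftrightarrow>
     proper_graded_ideal V L I \<and>
     (\<forall>J. proper_graded_ideal V L J \<longrightarrow> I \<subseteq> J \<longrightarrow> J = I)"

definition va_hom :: "'v::ab_group_add va \<Rightarrow> 'w::ab_group_add va \<Rightarrow> ('v \<Rightarrow> 'w) \<Rightarrow> bool" where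
  "va_hom V Q h \<longleftrightarrow>
     Vector_Spaces.linear (scal V) (scal Q) h \<and>
     h (vac V) = vac Q \<and>
     (\<forall>a. h (der V a) = der Q (h a)) \<and>
     (\<forall>a n b. h (nprod V a n b) = nprod Q (h a) n (h b))"

text \<open>A quotient is given up to isomorphism, by its projection \<open>h\<close>.\<close>

definition simple_graded_quotient ::
    "'v::ab_group_add va \<Rightarrow> 'v \<Rightarrow> 'w::ab_group_add va \<Rightarrow> ('v \<Rightarrow> 'w) \<Rightarrow> bool" where
  "simple_graded_quotient V L Q h \<longleftrightarrow>
     vertex_algebra Q \<and> va_hom V Q h \<and> surj h \<and>
     maximal_proper_graded_ideal V L {a. h a = 0}"


section \<open>Algebras over the complex numbers\<close>

text \<open>They are records of type \<open>(complex, 'a) module\<close>, carrying the scalar multiplication in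
  \<open>smult\<close>.\<close>

definition alg_hom :: "(complex, 'a) module \<Rightarrow> (complex, 'b) module \<Rightarrow> ('a \<Rightarrow> 'b) set" where
  "alg_hom A B =
     {h \<in> ring_hom A B. \<forall>c. \<forall>x\<in>carrier A. h (c \<odot>\<^bsub>A\<^esub> x) = c \<odot>\<^bsub>B\<^esub> h x}"

definition quot_alg :: "(complex, 'a) module \<Rightarrow> 'a set \<Rightarrow> (complex, 'a set) module" where
  "quot_alg A I =
     \<lparr>carrier = carrier (A Quot I), mult = mult (A Quot I), one = one (A Quot I),
      zero = zero (A Quot I), add = add (A Quot I),
      smult = (\<lambda>c X. \<Union>x\<in>X. I +>\<^bsub>A\<^esub> (c \<odot>\<^bsub>A\<^esub> x))\<rparr>"


section \<open>The associated scheme and the singular support\<close>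

definition C2 :: "'v::ab_group_add va \<Rightarrow> 'v set" where
  "C2 V = va_span V {nprod V a (-2) b |a b. True}"

definition R_alg :: "'v::ab_group_add va \<Rightarrow> (complex, 'v set) module" where
  "R_alg V =
     \<lparr>carrier = {a +o C2 V |a. True},
      mult = (\<lambda>X Y. \<Union>x\<in>X. \<Union>y\<in>Y. nprod V x (-1) y +o C2 V),
      one = vac V +o C2 V,
      zero = C2 V,
      add = (+),
      smult = (\<lambda>c X. \<Union>x\<in>X. scal V c x +o C2 V)\<rparr>"

definition li_filtration :: "'v::ab_group_add va \<Rightarrow> nat \<Rightarrow> 'v set" where
  "li_filtration V p =
     va_span V {nop V (map (\<lambda>(n, a). (der V ^^ n) a) xs) |xs. sum_list (map fst xs) \<ge> p}"

text \<open>An element of $\mathrm{gr}(V)$ is the finitely supported sequence of its components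
  $\xi_p\in F^p/F^{p+1}$, each of which is a coset of $F^{p+1}$. The degree \<open>n\<close> component of a
  product is the class of $\sum_{p\le n} (x_p)_{(-1)}y_{n-p}$ for representatives $x_p\in\xi_p$ and
  $y_q\in\eta_q$.\<close>

definition gr_alg :: "'v::ab_group_add va \<Rightarrow> (complex, nat \<Rightarrow> 'v set) module" where
  "gr_alg V = (let F = li_filtration V in
     \<lparr>carrier = {\<xi>. (\<forall>p. \<exists>a\<in>F p. \<xi> p = a +o F (Suc p)) \<and> finite {p. \<xi> p \<noteq> F (Suc p)}},
      mult = (\<lambda>\<xi> \<eta> n. {(\<Sum>p\<le>n. nprod V (x p) (-1) (y (n - p))) + z |x y z.
                (\<forall>p. x p \<in> \<xi> p \<and> y p \<in> \<eta> p) \<and> z \<in> F (Suc n)}),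
      one = (\<lambda>p. if p = 0 then vac V +o F 1 else F (Suc p)),
      zero = (\<lambda>p. F (Suc p)),
      add = (\<lambda>\<xi> \<eta> p. \<xi> p + \<eta> p),
      smult = (\<lambda>c \<xi> p. \<Union>x\<in>\<xi> p. scal V c x +o F (Suc p))\<rparr>)"

definition gr_der :: "'v::ab_group_add va \<Rightarrow> (nat \<Rightarrow> 'v set) \<Rightarrow> nat \<Rightarrow> 'v set" where
  "gr_der V \<xi> p = (let F = li_filtration V in
     case p of 0 \<Rightarrow> F 1 | Suc q \<Rightarrow> (\<Union>x\<in>\<xi> q. der V x +o F (Suc p)))"

definition gr_component :: "'v::ab_group_add va \<Rightarrow> nat \<Rightarrow> (nat \<Rightarrow> 'v set) set" where
  "gr_component V n =
     {\<xi> \<in> carrier (gr_alg V). \<forall>p. p \<noteq> n \<longrightarrow> \<xi> p = li_filtration V (Suc p)}"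

text \<open>The inclusion of $R_V = F^0/F^1$ (recall $F^1 = C(V)$) as the degree 0 component.\<close>

definition R_in_gr :: "'v::ab_group_add va \<Rightarrow> 'v set \<Rightarrow> nat \<Rightarrow> 'v set" where
  "R_in_gr V X p = (if p = 0 then X else li_filtration V (Suc p))"


section \<open>Arc spaces\<close>

text \<open>Polynomials in the variables $y_j^{(i)}$, with \<open>(j, i)\<close> standing for $y_j^{(i)}$ and
  \<open>j\<close> counted from 0. The outer map sends a monomial to its coefficient, a monomial sends a
  variable to its exponent. A polynomial in the $y_j$ is one in the $y_j^{(0)}$.\<close>

type_synonym jet_poly = "((nat \<times> nat) \<Rightarrow>\<^sub>0 nat) \<Rightarrow>\<^sub>0 complex"

definition poly_alg :: "(nat \<times> nat) set \<Rightarrow> (complex, jet_poly) module" where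
  "poly_alg X =
     \<lparr>carrier = {p. \<forall>m\<in>Poly_Mapping.keys p. Poly_Mapping.keys m \<subseteq> X}, mult = (*), one = 1, zero = 0, add = (+),
      smult = (\<lambda>c p. Poly_Mapping.single 0 c * p)\<rparr>"

abbreviation base_alg :: "nat \<Rightarrow> (complex, jet_poly) module" where
  "base_alg r \<equiv> poly_alg ({..<r} \<times> {0})"

abbreviation jet_alg :: "nat \<Rightarrow> (complex, jet_poly) module" where
  "jet_alg r \<equiv> poly_alg ({..<r} \<times> UNIV)"

text \<open>The derivation \<open>D\<close>, by the Leibniz rule on monomials.\<close>

definition jet_der :: "jet_poly \<Rightarrow> jet_poly" where
  "jet_der p =
     (\<Sum>m\<in>Poly_Mapping.keys p. \<Sum>(j, i)\<in>Poly_Mapping.keys m.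
        Poly_Mapping.single
          (m - Poly_Mapping.single (j, i) 1 + Poly_Mapping.single (j, Suc i) 1)
          (of_nat (Poly_Mapping.lookup m (j, i)) * Poly_Mapping.lookup p m))"

definition jet_height :: "((nat \<times> nat) \<Rightarrow>\<^sub>0 nat) \<Rightarrow> nat" where
  "jet_height m = (\<Sum>(j, i)\<in>Poly_Mapping.keys m. i * Poly_Mapping.lookup m (j, i))"

text \<open>\<open>A\<close> is presented as $\mathbb{C}[y_1,\dots,y_r]/\langle F\rangle$ via \<open>\<psi>\<close>.\<close>

definition presentation ::
    "nat \<Rightarrow> jet_poly set \<Rightarrow> (jet_poly \<Rightarrow> 'a) \<Rightarrow> (complex, 'a) module \<Rightarrow> bool" where
  "presentation r F \<psi> A \<longleftrightarrow>
     finite F \<and> F \<subseteq> carrier (base_alg r) \<and>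
     \<psi> \<in> alg_hom (base_alg r) A \<and>
     \<psi> ` carrier (base_alg r) = carrier A \<and>
     {p \<in> carrier (base_alg r). \<psi> p = \<zero>\<^bsub>A\<^esub>} = Idl\<^bsub>base_alg r\<^esub> F"

definition arc_ideal :: "nat \<Rightarrow> jet_poly set \<Rightarrow> jet_poly set" where
  "arc_ideal r F = Idl\<^bsub>jet_alg r\<^esub> {(jet_der ^^ i) f |f i. f \<in> F}"

definition arc_alg :: "nat \<Rightarrow> jet_poly set \<Rightarrow> (complex, jet_poly set) module" where
  "arc_alg r F = quot_alg (jet_alg r) (arc_ideal r F)"

definition arc_class :: "nat \<Rightarrow> jet_poly set \<Rightarrow> jet_poly \<Rightarrow> jet_poly set" where
  "arc_class r F p = arc_ideal r F +>\<^bsub>jet_alg r\<^esub> p"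

definition arc_der :: "nat \<Rightarrow> jet_poly set \<Rightarrow> jet_poly set \<Rightarrow> jet_poly set" where
  "arc_der r F X = (\<Union>p\<in>X. arc_class r F (jet_der p))"

definition arc_component :: "nat \<Rightarrow> jet_poly set \<Rightarrow> nat \<Rightarrow> jet_poly set set" where
  "arc_component r F n =
     {arc_class r F p |p. p \<in> carrier (jet_alg r) \<and> (\<forall>m\<in>Poly_Mapping.keys p. jet_height m = n)}"

text \<open>The map $\Phi_V$, for $R_V$ presented by \<open>r\<close>, \<open>F\<close>, \<open>\<psi>\<close>. The class of a polynomial \<open>p\<close> in
  the $y_j$ is the element \<open>\<psi> p\<close> of $R_V$.\<close>

definition Phi ::
    "'v::ab_group_add va \<Rightarrow> nat \<Rightarrow> jet_poly set \<Rightarrow> (jet_poly \<Rightarrow> 'v set) \<Rightarrow>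
     jet_poly set \<Rightarrow> nat \<Rightarrow> 'v set" where
  "Phi V r F \<psi> = (THE \<Phi>.
     \<Phi> \<in> extensional (carrier (arc_alg r F)) \<and>
     \<Phi> \<in> alg_hom (arc_alg r F) (gr_alg V) \<and>
     \<Phi> ` carrier (arc_alg r F) = carrier (gr_alg V) \<and>
     (\<forall>X\<in>carrier (arc_alg r F). \<Phi> (arc_der r F X) = gr_der V (\<Phi> X)) \<and>
     (\<forall>n. \<Phi> ` arc_component r F n \<subseteq> gr_component V n) \<and>
     (\<forall>p\<in>carrier (base_alg r). \<Phi> (arc_class r F p) = R_in_gr V (\<psi> p)))"


section \<open>Affine schemes\<close>

record ('x, 's) ringed_space =
  top_space :: "'x topology"
  sections :: "'x set \<Rightarrow> 's ring"
  restr :: "'x set \<Rightarrow> 'x set \<Rightarrow> 's \<Rightarrow> 's"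

text \<open>An isomorphism of ringed spaces between schemes is automatically local on stalks, so it is
  the same as an isomorphism of schemes.\<close>

definition isomorphic_schemes ::
    "('x, 's) ringed_space \<Rightarrow> ('y, 't) ringed_space \<Rightarrow> bool" where
  "isomorphic_schemes X Y \<longleftrightarrow>
     (\<exists>\<phi> \<theta>. homeomorphic_map (top_space X) (top_space Y) \<phi> \<and>
        (let pre = (\<lambda>U. {x \<in> topspace (top_space X). \<phi> x \<in> U}) in
         (\<forall>U. openin (top_space Y) U \<longrightarrow> \<theta> U \<in> ring_iso (sections Y U) (sections X (pre U))) \<and>
         (\<forall>U V. openin (top_space Y) U \<longrightarrow> openin (top_space Y) V \<longrightarrow> V \<subseteq> U \<longrightarrow>
            (\<forall>s\<in>carrier (sections Y U).
               \<theta> V (restr Y U V s) = restr X (pre U) (pre V) (\<theta> U s)))))"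

text \<open>The fraction $a/s$ in the localization at the prime \<open>P\<close>, as an equivalence class of pairs.\<close>

definition fraction :: "('a, 'm) ring_scheme \<Rightarrow> 'a set \<Rightarrow> 'a \<Rightarrow> 'a \<Rightarrow> ('a \<times> 'a) set" where
  "fraction A P a s =
     {(b, t). b \<in> carrier A \<and> t \<in> carrier A - P \<and>
        (\<exists>u\<in>carrier A - P. u \<otimes>\<^bsub>A\<^esub> (a \<otimes>\<^bsub>A\<^esub> t) = u \<otimes>\<^bsub>A\<^esub> (b \<otimes>\<^bsub>A\<^esub> s))}"

definition localization :: "('a, 'm) ring_scheme \<Rightarrow> 'a set \<Rightarrow> ('a \<times> 'a) set ring" where
  "localization A P =
     \<lparr>carrier = {fraction A P a s |a s. a \<in> carrier A \<and> s \<in> carrier A - P},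
      mult = (\<lambda>X Y. \<Union>(a, s)\<in>X. \<Union>(b, t)\<in>Y. fraction A P (a \<otimes>\<^bsub>A\<^esub> b) (s \<otimes>\<^bsub>A\<^esub> t)),
      one = fraction A P \<one>\<^bsub>A\<^esub> \<one>\<^bsub>A\<^esub>,
      zero = fraction A P \<zero>\<^bsub>A\<^esub> \<one>\<^bsub>A\<^esub>,
      add = (\<lambda>X Y. \<Union>(a, s)\<in>X. \<Union>(b, t)\<in>Y.
               fraction A P (a \<otimes>\<^bsub>A\<^esub> t \<oplus>\<^bsub>A\<^esub> b \<otimes>\<^bsub>A\<^esub> s) (s \<otimes>\<^bsub>A\<^esub> t))\<rparr>"

definition zariski :: "('a, 'm) ring_scheme \<Rightarrow> 'a set topology" where
  "zariski A = topology_generated_by {{P. primeideal P A \<and> f \<notin> P} |f. f \<in> carrier A}"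

text \<open>Sections of the structure sheaf: functions into the localizations that are locally given by
  a single fraction.\<close>

definition structure_sheaf ::
    "('a, 'm) ring_scheme \<Rightarrow> 'a set set \<Rightarrow> ('a set \<Rightarrow> ('a \<times> 'a) set) ring" where
  "structure_sheaf A U =
     \<lparr>carrier = {\<sigma> \<in> (\<Pi>\<^sub>E P\<in>U. carrier (localization A P)).
        \<forall>P\<in>U. \<exists>O' a s. openin (zariski A) O' \<and> P \<in> O' \<and> O' \<subseteq> U \<and>
          a \<in> carrier A \<and> s \<in> carrier A \<and>
          (\<forall>Q\<in>O'. s \<notin> Q \<and> \<sigma> Q = fraction A Q a s)},
      mult = (\<lambda>\<sigma> \<tau>. \<lambda>P\<in>U. \<sigma> P \<otimes>\<^bsub>localization A P\<^esub> \<tau> P),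
      one = (\<lambda>P\<in>U. \<one>\<^bsub>localization A P\<^esub>),
      zero = (\<lambda>P\<in>U. \<zero>\<^bsub>localization A P\<^esub>),
      add = (\<lambda>\<sigma> \<tau>. \<lambda>P\<in>U. \<sigma> P \<oplus>\<^bsub>localization A P\<^esub> \<tau> P)\<rparr>"

definition Spec ::
    "('a, 'm) ring_scheme \<Rightarrow> ('a set, 'a set \<Rightarrow> ('a \<times> 'a) set) ringed_space" where
  "Spec A = \<lparr>top_space = zariski A, sections = structure_sheaf A,
             restr = (\<lambda>U V \<sigma>. restrict \<sigma> V)\<rparr>"

end

theory Submission
  imports Defs "HOL-Computational_Algebra.Formal_Power_Series" "HOL-Algebra.Ring_Divisibility"
begin

text \<open>Both schemes are affine, so an isomorphism would identify their rings of functions. These are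
  told apart by the existence of a rigid point: a maximal ideal \<open>m\<close> such that every derivation into
  $A/m^2$ maps \<open>m\<close> into $m/m^2$.

  In the simple quotient the weight 6 vector
  $s=\partial^3W-8\,L_{(-1)}\partial W+12\,(\partial L)_{(-1)}W$ vanishes, because all lowering modes
  kill it and so it generates a graded ideal without a vacuum component. Applying $W_{(2)}$ to
  $s=0$ gives $w^2=\ell^3$ in $R$, and since $:\!LL\!:$ and $:\!LW\!:$ survive in $R$, all relations
  are mapped into $m^2$ by $\partial/\partial\ell$, where \<open>m\<close> is the augmentation ideal. Hence
  $\partial/\partial\ell^{(0)}$ is a derivation of the arc algebra into $A/m^2$ that does not preserve
  \<open>m\<close>; every other maximal ideal is moved by the Euler derivation. In $\mathrm{gr}(\mathcal{W})$,
  however, $s=0$ gives the additional quadratic relation $12\,\ell'w-8\,\ell w'=0$, and comparing the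
  coefficients of $\ell,\ell',w,w'$ in a derivation applied to its derivatives shows that the point
  \<open>m\<close> is rigid.\<close>

section \<open>Locally finite sums and signs\<close>

text \<open>A nonzero element in the kernel of Phi would not by itself rule out an abstract
  isomorphism, which need not respect the derivation, the grading or even the complex scalars. So
  the invariant is one of bare rings, its derivations are merely additive, and non-injectivity is
  read off backwards: an injective Phi would be a ring isomorphism. The theorem ranges over all
  presentations of R, but the arc algebra does not depend on the presentation, so one cuspidal
  presentation is enough. R is never determined completely: beyond w^2 = l^3 that presentation
  admits the first vanishing l^a and the first vanishing l^a w, if any, and only lower bounds on a
  matter. Since the axioms state locality only, Borcherds' identity, skew-symmetry and the
  multiplicativity of Li's filtration have to be derived. The ratio 1 : -8 : 12 in s is forced by
  L_(2), and the central charge -2 is what makes L_(3) kill s. In gr the singular vector becomes a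
  purely quadratic relation because T^3 W lies two filtration steps deeper than the quadratic
  terms.\<close>

definition eventually_zero :: "(nat \<Rightarrow> 'a::zero) \<Rightarrow> bool" where
  "eventually_zero f \<longleftrightarrow> (\<exists>K. \<forall>i\<ge>K. f i = 0)"

lemma eventually_zeroI: "(\<And>i. i \<ge> K \<Longrightarrow> f i = 0) \<Longrightarrow> eventually_zero f"
  unfolding eventually_zero_def by blast

lemma eventually_zeroE:
  assumes "eventually_zero f"
  obtains K where "\<And>i. i \<ge> K \<Longrightarrow> f i = 0"
  using assms unfolding eventually_zero_def by blast

lemma eventually_zero_compose:
  assumes "eventually_zero f" and "\<And>i. f i = 0 \<Longrightarrow> g i = 0"
  shows "eventually_zero g"
  using assms unfolding eventually_zero_def by meson

lemma eventually_zero_Suc: "eventually_zero f \<Longrightarrow> eventually_zero (\<lambda>i. f (Suc i))"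
  unfolding eventually_zero_def by (meson Suc_n_not_le_n le_SucI nat_le_linear)

lemma Sum_any_eq_sum_lessThan:
  fixes f :: "nat \<Rightarrow> 'a::comm_monoid_add"
  assumes "\<And>i. i \<ge> K \<Longrightarrow> f i = 0"
  shows "Sum_any f = (\<Sum>i<K. f i)"
  by (rule Sum_any.expand_superset) (use assms in \<open>auto simp: not_le[symmetric]\<close>)

lemma Sum_any_eq_sum_atMost:
  fixes f :: "nat \<Rightarrow> 'a::comm_monoid_add"
  assumes "\<And>i. i > K \<Longrightarrow> f i = 0"
  shows "Sum_any f = (\<Sum>i\<le>K. f i)"
  by (rule Sum_any.expand_superset) (use assms in \<open>auto simp: not_le[symmetric]\<close>)

lemma Sum_any_eq_single:
  fixes f :: "nat \<Rightarrow> 'a::comm_monoid_add"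
  assumes "\<And>i. i \<noteq> k \<Longrightarrow> f i = 0"
  shows "Sum_any f = f k"
  by (subst Sum_any.expand_superset[of "{k}"]) (use assms in auto)

text \<open>\<open>Sum_any\<close> is 0 by convention on a family with infinite support, so
  additivity needs both supports bounded; with a common bound it is additivity of finite
  sums.\<close>

lemma Sum_any_add:
  fixes f g :: "nat \<Rightarrow> 'a::comm_monoid_add"
  assumes "eventually_zero f" "eventually_zero g"
  shows "Sum_any (\<lambda>i. f i + g i) = Sum_any f + Sum_any g"
proof -
  obtain K L where "\<And>i. i \<ge> K \<Longrightarrow> f i = 0" "\<And>i. i \<ge> L \<Longrightarrow> g i = 0"
    using assms by (metis eventually_zeroE)
  then show ?thesis
    by (subst (1 2 3) Sum_any_eq_sum_lessThan[where K = "max K L"]) (auto simp: sum.distrib)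
qed

lemma Sum_any_diff:
  fixes f g :: "nat \<Rightarrow> 'a::ab_group_add"
  assumes "eventually_zero f" "eventually_zero g"
  shows "Sum_any (\<lambda>i. f i - g i) = Sum_any f - Sum_any g"
proof -
  obtain K L where "\<And>i. i \<ge> K \<Longrightarrow> f i = 0" "\<And>i. i \<ge> L \<Longrightarrow> g i = 0"
    using assms by (metis eventually_zeroE)
  then show ?thesis
    by (subst (1 2 3) Sum_any_eq_sum_lessThan[where K = "max K L"]) (auto simp: sum_subtractf)
qed

lemma Sum_any_Suc:
  fixes f :: "nat \<Rightarrow> 'a::comm_monoid_add"
  assumes "eventually_zero f"
  shows "Sum_any f = f 0 + Sum_any (\<lambda>i. f (Suc i))"
proof -
  obtain K where K: "\<And>i. i \<ge> K \<Longrightarrow> f i = 0"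
    using assms by (metis eventually_zeroE)
  then have "Sum_any f = (\<Sum>i<Suc K. f i)" "Sum_any (\<lambda>i. f (Suc i)) = (\<Sum>i<K. f (Suc i))"
    by (auto intro!: Sum_any_eq_sum_lessThan)
  then show ?thesis
    by (simp only: sum.lessThan_Suc_shift)
qed

lemma Sum_any_hom:
  fixes f :: "nat \<Rightarrow> 'a::comm_monoid_add"
  assumes "eventually_zero f" "h 0 = (0::'b::comm_monoid_add)" "\<And>x y. h (x + y) = h x + h y"
  shows "h (Sum_any f) = Sum_any (\<lambda>i. h (f i))"
proof -
  obtain K where K: "\<And>i. i \<ge> K \<Longrightarrow> f i = 0"
    using assms by (metis eventually_zeroE)
  have *: "h (\<Sum>i<n. f i) = (\<Sum>i<n. h (f i))" for n
    by (induction n) (auto simp: assms)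
  have "Sum_any f = (\<Sum>i<K. f i)" "Sum_any (\<lambda>i. h (f i)) = (\<Sum>i<K. h (f i))"
    using K assms(2) by (auto intro!: Sum_any_eq_sum_lessThan)
  then show ?thesis
    by (simp only: *)
qed

section \<open>Signs with integer exponents and binomials with complex upper entry\<close>

definition sign :: "int \<Rightarrow> complex" where
  "sign z = (if even z then 1 else -1)"

lemma sign_add: "sign (x + y) = sign x * sign y"
  by (auto simp: sign_def)

lemma sign_of_nat: "sign (int i) = (-1) ^ i"
  by (auto simp: sign_def)

lemma sign_minus [simp]: "sign (- x) = sign x"
  by (auto simp: sign_def)

lemma sign_simps [simp]: "sign 0 = 1" "sign 1 = -1" "sign (-1) = -1" "sign 2 = 1" "sign (-2) = 1"
  by (auto simp: sign_def)

lemma gbinomial_neg_one: "(-1::complex) gchoose k = (-1) ^ k"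
proof -
  have "of_nat k gchoose k = (1 :: complex)"
    by (simp add: binomial_gbinomial[symmetric])
  then show ?thesis
    using gbinomial_minus[of "1::complex" k] by simp
qed

lemma gbinomial_pascal: "((x + 1 :: complex) gchoose Suc k) = (x gchoose k) + (x gchoose Suc k)"
  by (rule gbinomial_Suc_Suc)

lemma gbinomial_of_nat_eq_0: "k > n \<Longrightarrow> (of_nat n :: complex) gchoose k = 0"
  by (simp add: binomial_gbinomial[symmetric])

text \<open>Up to sign this is the l-th finite difference of the polynomial x choose s, whose degree
  s is below l. Pascal's rule for l choose j peels off one difference, Pascal's rule for the
  polynomial lowers s by one.\<close>

lemma alternating_gbinomial_sum_eq_0:
  "s < l \<Longrightarrow> (\<Sum>j\<le>l. (-1) ^ j * of_nat (l choose j) * ((x + of_nat j :: complex) gchoose s)) = 0"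
proof (induction l arbitrary: s x)
  case (Suc l)
  let ?S = "\<lambda>l x s. \<Sum>j\<le>l. (-1) ^ j * of_nat (l choose j) * ((x + of_nat j :: complex) gchoose s)"
  have "?S (Suc l) x s = ?S l x s - ?S l (x + 1) s"
  proof -
    have "?S (Suc l) x s = (x gchoose s) + (\<Sum>j\<le>l. (-1) ^ Suc j * of_nat (Suc l choose Suc j) * ((x + of_nat (Suc j)) gchoose s))"
      by (simp only: sum.atMost_Suc_shift) simp
    also have "(\<Sum>j\<le>l. (-1) ^ Suc j * of_nat (Suc l choose Suc j) * ((x + of_nat (Suc j)) gchoose s))
        = (\<Sum>j\<le>l. (-1) ^ Suc j * of_nat (l choose Suc j) * ((x + of_nat (Suc j)) gchoose s)) - ?S l (x + 1) s"
      by (subst sum_subtractf[symmetric]) (auto intro!: sum.cong simp: algebra_simps)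
    also have "(\<Sum>j\<le>l. (-1) ^ Suc j * of_nat (l choose Suc j) * ((x + of_nat (Suc j)) gchoose s))
        = ?S (Suc l) x s + (\<Sum>j\<le>Suc l. (-1) ^ j * of_nat (l choose j) * ((x + of_nat j) gchoose s)) - ?S (Suc l) x s - (x gchoose s)"
      by (simp only: sum.atMost_Suc_shift) simp
    also have "(\<Sum>j\<le>Suc l. (-1) ^ j * of_nat (l choose j) * ((x + of_nat j) gchoose s)) = ?S l x s"
      by simp
    finally show ?thesis by simp
  qed
  also have "\<dots> = - (\<Sum>j\<le>l. (-1) ^ j * of_nat (l choose j) * (((x + 1 + of_nat j) gchoose s) - ((x + of_nat j) gchoose s)))"
    by (simp add: sum_subtractf right_diff_distrib)
  also have "\<dots> = 0"
  proof (cases s)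
    case 0
    then show ?thesis by simp
  next
    case (Suc s')
    have "((x + 1 + of_nat j) gchoose s) - ((x + of_nat j) gchoose s) = ((x + of_nat j) gchoose s')" for j
      using gbinomial_pascal[of "x + of_nat j" s'] by (simp add: Suc add_ac)
    moreover have "s' < l" using Suc.prems Suc by simp
    ultimately show ?thesis using Suc.IH by simp
  qed
  finally show ?case .
qed simp

section \<open>The Borcherds identity\<close>

context vertex_algebra
begin

sublocale vs: vector_space "scal V"
  by (rule vector_space)

abbreviation mode :: "'v \<Rightarrow> int \<Rightarrow> 'v \<Rightarrow> 'v" (\<open>(_\<langle>_\<rangle> _)\<close> [81, 0, 80] 80) where
  "a\<langle>n\<rangle> b \<equiv> nprod V a n b"

abbreviation sc :: "complex \<Rightarrow> 'v \<Rightarrow> 'v" (infixr \<open>\<cdot>\<close> 75) where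
  "c \<cdot> x \<equiv> scal V c x"

abbreviation T :: "'v \<Rightarrow> 'v" where "T \<equiv> der V"

text \<open>Divided powers T^j / j!: with them a_(-1-k) applied to the vacuum is
  \<open>dpow k a\<close>, and the formulas below carry binomial coefficients without
  factorials.\<close>

definition dpow :: "nat \<Rightarrow> 'v \<Rightarrow> 'v" where
  "dpow j x = (1 / fact j) \<cdot> (T ^^ j) x"

lemma mode_left_linear [simp]:
  "(a + b)\<langle>n\<rangle> x = a\<langle>n\<rangle> x + b\<langle>n\<rangle> x" "(a - b)\<langle>n\<rangle> x = a\<langle>n\<rangle> x - b\<langle>n\<rangle> x"
  "(c \<cdot> a)\<langle>n\<rangle> x = c \<cdot> a\<langle>n\<rangle> x" "0\<langle>n\<rangle> x = 0" "(- a)\<langle>n\<rangle> x = - (a\<langle>n\<rangle> x)"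
  and mode_left_sum: "(sum f A)\<langle>n\<rangle> x = (\<Sum>i\<in>A. (f i)\<langle>n\<rangle> x)"
proof -
  interpret l: Vector_Spaces.linear "scal V" "scal V" "\<lambda>a. nprod V a n x" by (rule nprod_linear_left)
  show "(a + b)\<langle>n\<rangle> x = a\<langle>n\<rangle> x + b\<langle>n\<rangle> x" "(a - b)\<langle>n\<rangle> x = a\<langle>n\<rangle> x - b\<langle>n\<rangle> x"
    "(c \<cdot> a)\<langle>n\<rangle> x = c \<cdot> a\<langle>n\<rangle> x" "0\<langle>n\<rangle> x = 0" "(- a)\<langle>n\<rangle> x = - (a\<langle>n\<rangle> x)"
    "(sum f A)\<langle>n\<rangle> x = (\<Sum>i\<in>A. (f i)\<langle>n\<rangle> x)"
    using l.add l.diff l.scale l.zero l.neg l.sum by auto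
qed

lemma mode_right_linear [simp]:
  "x\<langle>n\<rangle> (a + b) = x\<langle>n\<rangle> a + x\<langle>n\<rangle> b" "x\<langle>n\<rangle> (a - b) = x\<langle>n\<rangle> a - x\<langle>n\<rangle> b"
  "x\<langle>n\<rangle> (c \<cdot> a) = c \<cdot> x\<langle>n\<rangle> a" "x\<langle>n\<rangle> 0 = 0" "x\<langle>n\<rangle> (- a) = - (x\<langle>n\<rangle> a)"
  and mode_right_sum: "x\<langle>n\<rangle> (sum f A) = (\<Sum>i\<in>A. x\<langle>n\<rangle> (f i))"
proof -
  interpret l: Vector_Spaces.linear "scal V" "scal V" "nprod V x n" by (rule nprod_linear_right)
  show "x\<langle>n\<rangle> (a + b) = x\<langle>n\<rangle> a + x\<langle>n\<rangle> b" "x\<langle>n\<rangle> (a - b) = x\<langle>n\<rangle> a - x\<langle>n\<rangle> b"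
    "x\<langle>n\<rangle> (c \<cdot> a) = c \<cdot> x\<langle>n\<rangle> a" "x\<langle>n\<rangle> 0 = 0" "x\<langle>n\<rangle> (- a) = - (x\<langle>n\<rangle> a)"
    "x\<langle>n\<rangle> (sum f A) = (\<Sum>i\<in>A. x\<langle>n\<rangle> (f i))"
    using l.add l.diff l.scale l.zero l.neg l.sum by auto
qed

lemma T_linear [simp]:
  "T (a + b) = T a + T b" "T (a - b) = T a - T b" "T (c \<cdot> a) = c \<cdot> T a" "T 0 = 0" "T (- a) = - T a"
  and T_sum: "T (sum f A) = (\<Sum>i\<in>A. T (f i))"
proof -
  interpret l: Vector_Spaces.linear "scal V" "scal V" T by (rule der_linear)
  show "T (a + b) = T a + T b" "T (a - b) = T a - T b" "T (c \<cdot> a) = c \<cdot> T a" "T 0 = 0" "T (- a) = - T a"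
    "T (sum f A) = (\<Sum>i\<in>A. T (f i))"
    using l.add l.diff l.scale l.zero l.neg l.sum by auto
qed

lemma T_mode: "T (a\<langle>n\<rangle> b) = a\<langle>n\<rangle> (T b) + (- of_int n) \<cdot> a\<langle>n - 1\<rangle> b"
  using translation[of a n b] by (simp add: algebra_simps)

lemma T_pow_linear [simp]:
  "(T ^^ k) (a + b) = (T ^^ k) a + (T ^^ k) b" "(T ^^ k) (a - b) = (T ^^ k) a - (T ^^ k) b"
  "(T ^^ k) (c \<cdot> a) = c \<cdot> (T ^^ k) a" "(T ^^ k) 0 = 0" "(T ^^ k) (- a) = - (T ^^ k) a"
  by (induction k) auto

lemma dpow_0 [simp]: "dpow 0 x = x"
  by (simp add: dpow_def)

lemma dpow_linear [simp]:
  "dpow j (a + b) = dpow j a + dpow j b" "dpow j (a - b) = dpow j a - dpow j b"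
  "dpow j (c \<cdot> a) = c \<cdot> dpow j a" "dpow j 0 = 0" "dpow j (- a) = - dpow j a"
  by (simp_all add: dpow_def vs.scale_right_distrib vs.scale_right_diff_distrib mult.commute)

lemma dpow_sum: "dpow j (sum f A) = (\<Sum>i\<in>A. dpow j (f i))"
  by (induction A rule: infinite_finite_induct) auto

lemma T_dpow: "T (dpow j x) = of_nat (Suc j) \<cdot> dpow (Suc j) x"
  by (simp add: dpow_def field_simps del: of_nat_Suc)

lemma dpow_Suc: "dpow (Suc j) x = (1 / of_nat (Suc j)) \<cdot> T (dpow j x)"
  by (simp add: T_dpow del: of_nat_Suc)

text \<open>T annihilates the vacuum, so translation expresses a_(-2-k) 1 through T (a_(-1-k) 1);
  the creation axiom starts the recursion.\<close>

lemma mode_vac: "a\<langle>n\<rangle> vac V = (if n < 0 then dpow (nat (- 1 - n)) a else 0)"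
proof -
  have *: "a\<langle>- 1 - int k\<rangle> vac V = dpow k a" for k
  proof (induction k)
    case 0
    then show ?case by (simp add: creation)
  next
    case (Suc k)
    have "T (a\<langle>- 1 - int k\<rangle> vac V) = of_nat (Suc k) \<cdot> a\<langle>- 1 - int (Suc k)\<rangle> vac V"
      using T_mode[of a "- 1 - int k" "vac V"] by (simp add: der_vac algebra_simps)
    then have "of_nat (Suc k) \<cdot> dpow (Suc k) a = of_nat (Suc k) \<cdot> a\<langle>- 1 - int (Suc k)\<rangle> vac V"
      by (simp only: Suc T_dpow)
    then show ?case
      by (metis vs.scale_left_imp_eq of_nat_neq_0)
  qed
  show ?thesis
    using *[of "nat (- 1 - n)"] creation(2) by auto
qed

text \<open>Coefficient form of a(x) e^{zT} = e^{zT} a(x - z), proved by adding one derivative at a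
  time.\<close>

lemma mode_dpow:
  "a\<langle>p\<rangle> (dpow j b) = (\<Sum>k\<le>j. (of_int p gchoose k) \<cdot> dpow (j - k) (a\<langle>p - int k\<rangle> b))"
proof (induction j arbitrary: p)
  case 0
  then show ?case by simp
next
  case (Suc j)
  let ?t = "\<lambda>k. dpow (Suc j - k) (a\<langle>p - int k\<rangle> b)"
  have *: "of_int p * ((of_int (p - 1) :: complex) gchoose k) = (of_int p gchoose Suc k) * of_nat (Suc k)" for k
    using gbinomial_absorption[of k "of_int p :: complex"] by (simp add: mult.commute)
  have **: "p - 1 - int k = p - int (Suc k)" for k
    by simp
  have 1: "T (a\<langle>p\<rangle> (dpow j b)) = (\<Sum>k\<le>Suc j. ((of_int p gchoose k) * of_nat (Suc j - k)) \<cdot> ?t k)"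
    by (auto simp: Suc.IH T_sum T_dpow Suc_diff_le intro!: sum.cong)
  have 2: "of_int p \<cdot> a\<langle>p - 1\<rangle> (dpow j b) = (\<Sum>k\<le>Suc j. ((of_int p gchoose k) * of_nat k) \<cdot> ?t k)"
    by (simp only: Suc.IH vs.scale_sum_right vs.scale_scale diff_Suc_Suc sum.atMost_Suc_shift * **) simp
  \<comment> \<open>In the two sums the k-th term carries the weights Suc j - k and k; together they
    give the factor Suc j that \<open>T_dpow\<close> introduces.\<close>
  have 3: "((of_int p gchoose k) * of_nat (Suc j - k)) \<cdot> ?t k + ((of_int p gchoose k) * of_nat k) \<cdot> ?t k =
      of_nat (Suc j) \<cdot> ((of_int p gchoose k) \<cdot> ?t k)" if "k \<le> Suc j" for k
  proof -
    have "(of_nat (Suc j - k) + of_nat k :: complex) = of_nat (Suc j)"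
      using that by (simp flip: of_nat_add)
    then have "(of_int p gchoose k) * of_nat (Suc j - k) + (of_int p gchoose k) * of_nat k =
        of_nat (Suc j) * ((of_int p :: complex) gchoose k)"
      by (simp only: distrib_left[symmetric]) (rule mult.commute)
    then show ?thesis
      by (simp only: vs.scale_left_distrib[symmetric] vs.scale_scale)
  qed
  have "of_nat (Suc j) \<cdot> a\<langle>p\<rangle> (dpow (Suc j) b) = a\<langle>p\<rangle> (T (dpow j b))"
    by (simp only: T_dpow mode_right_linear)
  also have "\<dots> = T (a\<langle>p\<rangle> (dpow j b)) + of_int p \<cdot> a\<langle>p - 1\<rangle> (dpow j b)"
    by (simp add: T_mode)
  also have "\<dots> = (\<Sum>k\<le>Suc j. of_nat (Suc j) \<cdot> ((of_int p gchoose k) \<cdot> ?t k))"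
    unfolding 1 2 sum.distrib[symmetric] by (intro sum.cong refl 3) simp
  also have "\<dots> = of_nat (Suc j) \<cdot> (\<Sum>k\<le>Suc j. (of_int p gchoose k) \<cdot> ?t k)"
    by (rule vs.scale_sum_right[symmetric])
  finally show ?case
    by (rule vs.scale_left_imp_eq[rotated]) (simp del: of_nat_Suc)
qed

lemma truncation_nat: "\<exists>K. \<forall>i\<ge>K. a\<langle>p + int i\<rangle> b = 0"
proof -
  obtain N where N: "\<forall>n\<ge>N. a\<langle>n\<rangle> b = 0" using truncation by blast
  then show ?thesis by (intro exI[of _ "nat (N - p)"]) auto
qed

section \<open>Locality of arbitrarily large order and skew-symmetry\<close>

lemma binomial_sum_Suc:
  "(\<Sum>j\<le>Suc l. ((-1) ^ j * of_nat (Suc l choose j)) \<cdot> F j) =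
   (\<Sum>j\<le>l. ((-1) ^ j * of_nat (l choose j)) \<cdot> F j) - (\<Sum>j\<le>l. ((-1) ^ j * of_nat (l choose j)) \<cdot> F (Suc j))"
proof -
  have *: "((-1) ^ Suc j * of_nat ((l choose j) + (l choose Suc j))) \<cdot> F (Suc j) =
      ((-1) ^ Suc j * of_nat (l choose Suc j)) \<cdot> F (Suc j) - ((-1) ^ j * of_nat (l choose j)) \<cdot> F (Suc j)" for j
    by (subst vs.scale_left_diff_distrib[symmetric]) (simp add: algebra_simps)
  have "(\<Sum>j\<le>Suc l. ((-1) ^ j * of_nat (Suc l choose j)) \<cdot> F j) = F 0 +
      (\<Sum>j\<le>l. ((-1) ^ Suc j * of_nat (l choose Suc j)) \<cdot> F (Suc j) - ((-1) ^ j * of_nat (l choose j)) \<cdot> F (Suc j))"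
    by (simp only: sum.atMost_Suc_shift binomial_Suc_Suc *) simp
  also have "F 0 + (\<Sum>j\<le>l. ((-1) ^ Suc j * of_nat (l choose Suc j)) \<cdot> F (Suc j) - ((-1) ^ j * of_nat (l choose j)) \<cdot> F (Suc j))
     = (\<Sum>j\<le>Suc l. ((-1) ^ j * of_nat (l choose j)) \<cdot> F j) - (\<Sum>j\<le>l. ((-1) ^ j * of_nat (l choose j)) \<cdot> F (Suc j))"
    by (simp only: sum.atMost_Suc_shift sum_subtractf) simp
  finally show ?thesis by simp
qed

definition local_order :: "'v \<Rightarrow> 'v \<Rightarrow> nat \<Rightarrow> bool" where
  "local_order a b l \<longleftrightarrow> (\<forall>m n c. (\<Sum>j\<le>l. ((-1) ^ j * of_nat (l choose j)) \<cdot>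
     (a\<langle>m + int l - int j\<rangle> (b\<langle>n + int j\<rangle> c) - b\<langle>n + int j\<rangle> (a\<langle>m + int l - int j\<rangle> c))) = 0)"

text \<open>The relation (z-w)^l [a(z), b(w)] = 0 is multiplied by one further factor z - w; on
  coefficients that factor is the difference of two index shifts.\<close>

lemma local_order_Suc:
  assumes "local_order a b l"
  shows "local_order a b (Suc l)"
  unfolding local_order_def
proof (intro allI)
  fix m n c
  let ?G = "\<lambda>p q. a\<langle>p\<rangle> (b\<langle>q\<rangle> c) - b\<langle>q\<rangle> (a\<langle>p\<rangle> c)"
  have "(\<Sum>j\<le>l. ((-1) ^ j * of_nat (l choose j)) \<cdot> ?G (m + 1 + int l - int j) (n + int j)) = 0"
    "(\<Sum>j\<le>l. ((-1) ^ j * of_nat (l choose j)) \<cdot> ?G (m + int l - int j) (n + 1 + int j)) = 0"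
    using assms unfolding local_order_def by blast+
  then show "(\<Sum>j\<le>Suc l. ((-1) ^ j * of_nat (Suc l choose j)) \<cdot> ?G (m + int (Suc l) - int j) (n + int j)) = 0"
    unfolding binomial_sum_Suc by (simp add: algebra_simps)
qed

lemma local_order_ex: "\<exists>N. \<forall>l\<ge>N. local_order a b l"
proof -
  obtain N where N: "local_order a b N"
    using locality[of a b] unfolding local_order_def by blast
  have "local_order a b l" if "l \<ge> N" for l
    using that by (induction rule: dec_induct) (use N local_order_Suc in auto)
  then show ?thesis by blast
qed

text \<open>The conditional is the coefficient of \<open>dpow t\<close> of b_(s) a, s = p + t, in
  the j-th locality term of \<open>skew_symmetry\<close>. For s \<ge> 0 it agrees with the
  polynomial (j - 1) choose s except at j = 0, where the polynomial is (-1)^s; the l-th difference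
  of the polynomial vanishes and the exception remains. For s < 0 only j = 0 contributes.\<close>

lemma skew_coefficient:
  fixes s :: int
  assumes "s < int l"
  shows "(\<Sum>j\<le>l. ((-1) ^ j * of_nat (l choose j)) *
      (if s \<le> int j - 1 then (of_int (int j - 1) :: complex) gchoose nat (int j - 1 - s) else 0)) = sign (s + 1)"
proof (cases "s \<ge> 0")
  case True
  define t where "t = nat s"
  have t: "s = int t" "t < l" using True assms by (auto simp: t_def)
  have *: "(if s \<le> int j - 1 then (of_int (int j - 1) :: complex) gchoose nat (int j - 1 - s) else 0)
     = ((-1 + of_nat j) gchoose t) - (if j = 0 then (-1) ^ t else 0)" for j
  proof (cases j)
    case 0
    then show ?thesis using True by (simp add: gbinomial_neg_one)
  next
    case (Suc i)
    show ?thesis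
    proof (cases "t \<le> i")
      case True
      then have "nat (int j - 1 - s) = i - t" using Suc t by auto
      then show ?thesis using Suc t True binomial_symmetric[OF True]
        by (simp add: binomial_gbinomial[symmetric])
    next
      case False
      then show ?thesis using Suc t by (simp add: binomial_gbinomial[symmetric])
    qed
  qed
  have "(\<Sum>j\<le>l. ((-1) ^ j * of_nat (l choose j)) * (if j = 0 then (-1) ^ t else 0 :: complex)) =
      (\<Sum>j\<le>l. if j = 0 then (-1) ^ t else 0)"
    by (rule sum.cong) auto
  then have "(\<Sum>j\<le>l. ((-1) ^ j * of_nat (l choose j)) * (if j = 0 then (-1) ^ t else 0 :: complex)) = (-1) ^ t"
    by simp
  then have "(\<Sum>j\<le>l. ((-1) ^ j * of_nat (l choose j)) *
      (((-1 + of_nat j) gchoose t) - (if j = 0 then (-1) ^ t else 0 :: complex))) = - ((-1) ^ t)"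
    using alternating_gbinomial_sum_eq_0[OF t(2), of "-1"]
    by (simp only: right_diff_distrib sum_subtractf diff_0)
  moreover have "sign (s + 1) = - ((-1) ^ t)"
    by (simp add: t(1) sign_add sign_of_nat)
  ultimately show ?thesis
    unfolding * by (rule trans[OF _ sym])
next
  case False
  define t where "t = nat (- 1 - s)"
  have t: "s = - 1 - int t" using False by (auto simp: t_def)
  have *: "(if s \<le> int j - 1 then (of_int (int j - 1) :: complex) gchoose nat (int j - 1 - s) else 0)
     = (if j = 0 then (-1) ^ t else 0)" for j
  proof (cases j)
    case 0
    then show ?thesis using t by (simp add: gbinomial_neg_one)
  next
    case (Suc i)
    have "nat (int j - 1 - s) = Suc (i + t)" using Suc t by auto
    then show ?thesis using Suc t gbinomial_of_nat_eq_0[of i "Suc (i + t)"] by simp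
  qed
  have "(\<Sum>j\<le>l. ((-1) ^ j * of_nat (l choose j)) * (if j = 0 then (-1) ^ t else 0 :: complex)) =
      (\<Sum>j\<le>l. if j = 0 then (-1) ^ t else 0)"
    by (rule sum.cong) auto
  then show ?thesis
    unfolding * by (simp add: t sign_of_nat)
qed

text \<open>Locality of a and b is applied to the vacuum. There b_(-1+j) annihilates 1 for j > 0, so
  one side collapses to a_(p) b; on the other side a_(p-j) 1 is a divided power of a or 0, and b
  moves past the divided power by \<open>mode_dpow\<close>.\<close>

lemma skew_symmetry:
  assumes "\<And>t. t \<ge> J \<Longrightarrow> b\<langle>p + int t\<rangle> a = 0"
  shows "a\<langle>p\<rangle> b = (\<Sum>t<J. sign (p + int t + 1) \<cdot> dpow t (b\<langle>p + int t\<rangle> a))"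
proof -
  obtain N where N: "\<And>l. l \<ge> N \<Longrightarrow> local_order a b l" using local_order_ex by blast
  obtain M where M: "\<And>n. n \<ge> M \<Longrightarrow> b\<langle>n\<rangle> a = 0" using truncation by blast
  \<comment> \<open>The order exceeds both the locality order and the truncation bound of b on a:
    \<open>skew_coefficient\<close> covers the indices below l, and from l on b_(p+t) a is already
    0.\<close>
  define l where "l = max N (nat M)"
  define K where "K = max J (l + nat (- p))"
  let ?c = "\<lambda>s j. (if s \<le> int j - 1 then (of_int (int j - 1) :: complex) gchoose nat (int j - 1 - s) else 0)"
  have "local_order a b l" using N by (simp add: l_def)
  then have "(\<Sum>j\<le>l. ((-1) ^ j * of_nat (l choose j)) \<cdot>
     (a\<langle>(p - int l) + int l - int j\<rangle> (b\<langle>-1 + int j\<rangle> vac V) - b\<langle>-1 + int j\<rangle> (a\<langle>(p - int l) + int l - int j\<rangle> vac V))) = 0"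
    unfolding local_order_def by blast
  then have eq: "(\<Sum>j\<le>l. ((-1) ^ j * of_nat (l choose j)) \<cdot> a\<langle>p - int j\<rangle> (b\<langle>-1 + int j\<rangle> vac V)) =
     (\<Sum>j\<le>l. ((-1) ^ j * of_nat (l choose j)) \<cdot> b\<langle>-1 + int j\<rangle> (a\<langle>p - int j\<rangle> vac V))"
    by (simp add: vs.scale_right_diff_distrib sum_subtractf)
  have "(\<Sum>j\<le>l. ((-1) ^ j * of_nat (l choose j)) \<cdot> a\<langle>p - int j\<rangle> (b\<langle>-1 + int j\<rangle> vac V)) =
      (\<Sum>j\<le>l. if j = 0 then a\<langle>p\<rangle> b else 0)"
    by (rule sum.cong) (auto simp: mode_vac)
  also have "\<dots> = a\<langle>p\<rangle> b" by simp
  finally have "a\<langle>p\<rangle> b = (\<Sum>j\<le>l. ((-1) ^ j * of_nat (l choose j)) \<cdot> b\<langle>int j - 1\<rangle> (a\<langle>p - int j\<rangle> vac V))"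
    using eq by (simp add: add.commute)
  also have "\<dots> = (\<Sum>j\<le>l. ((-1) ^ j * of_nat (l choose j)) \<cdot> (\<Sum>t<K. ?c (p + int t) j \<cdot> dpow t (b\<langle>p + int t\<rangle> a)))"
  proof (rule sum.cong)
    fix j assume "j \<in> {..l}"
    then have j: "j \<le> l" by simp
    show "((-1) ^ j * of_nat (l choose j)) \<cdot> b\<langle>int j - 1\<rangle> (a\<langle>p - int j\<rangle> vac V) =
       ((-1) ^ j * of_nat (l choose j)) \<cdot> (\<Sum>t<K. ?c (p + int t) j \<cdot> dpow t (b\<langle>p + int t\<rangle> a))"
    proof (cases "p - int j < 0")
      case False
      then have "(\<Sum>t<K. ?c (p + int t) j \<cdot> dpow t (b\<langle>p + int t\<rangle> a)) = 0"
        by (intro sum.neutral) auto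
      then show ?thesis using False by (simp add: mode_vac)
    next
      case True
      define k where "k = nat (int j - p - 1)"
      have k: "int k = int j - p - 1" using True by (simp add: k_def)
      have "b\<langle>int j - 1\<rangle> (a\<langle>p - int j\<rangle> vac V) = b\<langle>int j - 1\<rangle> (dpow k a)"
        using True by (simp add: mode_vac k_def algebra_simps)
      also have "\<dots> = (\<Sum>i\<le>k. (of_int (int j - 1) gchoose i) \<cdot> dpow (k - i) (b\<langle>int j - 1 - int i\<rangle> a))"
        by (rule mode_dpow)
      also have "\<dots> = (\<Sum>t\<le>k. (of_int (int j - 1) gchoose (k - t)) \<cdot> dpow t (b\<langle>int j - 1 - int (k - t)\<rangle> a))"
        by (rule sum.reindex_bij_witness[of _ "\<lambda>t. k - t" "\<lambda>t. k - t"]) auto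
      also have "\<dots> = (\<Sum>t\<le>k. ?c (p + int t) j \<cdot> dpow t (b\<langle>p + int t\<rangle> a))"
      proof (rule sum.cong)
        fix t assume "t \<in> {..k}"
        then have t: "t \<le> k" by simp
        have "int j - 1 - int (k - t) = p + int t" "nat (int j - 1 - (p + int t)) = k - t" "p + int t \<le> int j - 1"
          using t k by auto
        then show "(of_int (int j - 1) gchoose (k - t)) \<cdot> dpow t (b\<langle>int j - 1 - int (k - t)\<rangle> a) =
            ?c (p + int t) j \<cdot> dpow t (b\<langle>p + int t\<rangle> a)" by simp
      qed simp
      also have "\<dots> = (\<Sum>t<K. ?c (p + int t) j \<cdot> dpow t (b\<langle>p + int t\<rangle> a))"
        by (rule sum.mono_neutral_left) (use k j in \<open>auto simp: K_def\<close>)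
      finally show ?thesis by simp
    qed
  qed simp
  also have "\<dots> = (\<Sum>t<K. (\<Sum>j\<le>l. ((-1) ^ j * of_nat (l choose j)) * ?c (p + int t) j) \<cdot> dpow t (b\<langle>p + int t\<rangle> a))"
    unfolding vs.scale_sum_right vs.scale_sum_left by (subst sum.swap) simp
  also have "\<dots> = (\<Sum>t<K. sign (p + int t + 1) \<cdot> dpow t (b\<langle>p + int t\<rangle> a))"
  proof (rule sum.cong)
    fix t assume "t \<in> {..<K}"
    show "(\<Sum>j\<le>l. ((-1) ^ j * of_nat (l choose j)) * ?c (p + int t) j) \<cdot> dpow t (b\<langle>p + int t\<rangle> a) =
       sign (p + int t + 1) \<cdot> dpow t (b\<langle>p + int t\<rangle> a)"
    proof (cases "p + int t < int l")
      case True
      then show ?thesis by (simp only: skew_coefficient)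
    next
      case False
      then have "b\<langle>p + int t\<rangle> a = 0" by (intro M) (auto simp: l_def)
      then show ?thesis by simp
    qed
  qed simp
  also have "\<dots> = (\<Sum>t<J. sign (p + int t + 1) \<cdot> dpow t (b\<langle>p + int t\<rangle> a))"
    by (rule sum.mono_neutral_right) (use assms in \<open>auto simp: K_def\<close>)
  finally show ?thesis .
qed

lemma skew_symmetry_Sum_any:
  "a\<langle>p\<rangle> b = Sum_any (\<lambda>t. sign (p + int t + 1) \<cdot> dpow t (b\<langle>p + int t\<rangle> a))"
proof -
  obtain K where K: "\<And>i. i \<ge> K \<Longrightarrow> b\<langle>p + int i\<rangle> a = 0" using truncation_nat[of b p a] by auto
  have "a\<langle>p\<rangle> b = (\<Sum>t<K. sign (p + int t + 1) \<cdot> dpow t (b\<langle>p + int t\<rangle> a))"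
    by (rule skew_symmetry) (rule K)
  also have "\<dots> = Sum_any (\<lambda>t. sign (p + int t + 1) \<cdot> dpow t (b\<langle>p + int t\<rangle> a))"
    by (rule Sum_any_eq_sum_lessThan[symmetric]) (simp add: K)
  finally show ?thesis .
qed

end

section \<open>Weak associativity and the Borcherds identity\<close>

context vertex_algebra
begin

text \<open>Negating the upper entry turns (m + x - i) choose (s - i) into a binomial whose upper
  entry is independent of i; then Vandermonde's convolution applies.\<close>

lemma associator_coefficient:
  "(\<Sum>i\<le>s. (-1) ^ i * ((x gchoose i) * ((of_nat m + x - of_nat i) gchoose (s - i)))) =
   (of_nat m gchoose s :: complex)"
proof -
  have "(-1) ^ i * ((x gchoose i) * ((of_nat m + x - of_nat i) gchoose (s - i))) =
      (-1) ^ s * ((x gchoose i) * ((of_nat s - 1 - of_nat m - x) gchoose (s - i)))"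
    if "i \<le> s" for i
  proof -
    have "(of_nat m + x - of_nat i) gchoose (s - i) =
        (-1) ^ (s - i) * ((of_nat (s - i) - (of_nat m + x - of_nat i) - 1) gchoose (s - i))"
      by (rule gbinomial_negated_upper)
    also have "of_nat (s - i) - (of_nat m + x - of_nat i) - 1 = of_nat s - 1 - of_nat m - x"
      using that by (simp add: of_nat_diff)
    finally have *: "(of_nat m + x - of_nat i) gchoose (s - i) =
        (-1) ^ (s - i) * ((of_nat s - 1 - of_nat m - x) gchoose (s - i))" .
    have "(-1 :: complex) ^ s = (-1) ^ i * (-1) ^ (s - i)"
      using that by (simp flip: power_add)
    then show ?thesis
      unfolding * by (simp only: mult_ac)
  qed
  then have "(\<Sum>i\<le>s. (-1) ^ i * ((x gchoose i) * ((of_nat m + x - of_nat i) gchoose (s - i)))) =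
      (-1) ^ s * (\<Sum>i\<le>s. (x gchoose i) * ((of_nat s - 1 - of_nat m - x) gchoose (s - i)))"
    unfolding sum_distrib_left by (intro sum.cong) auto
  also have "\<dots> = (-1) ^ s * ((of_nat s - of_nat m - 1) gchoose s)"
    by (simp only: atMost_atLeast0 gbinomial_Vandermonde) (simp add: algebra_simps)
  also have "\<dots> = of_nat m gchoose s"
    by (rule gbinomial_negated_upper[symmetric])
  finally show ?thesis .
qed

text \<open>Coefficient form of (z+w)^m a(z+w) b(w) c = (z+w)^m (a(z) b)(w) c. Skew-symmetry turns
  b_(n+i) c into modes of c acting on b, locality moves a past c, and skew-symmetry is undone on the
  vectors a_(k) b. Everything is summed over a finite box so that sums can be interchanged.\<close>

lemma weak_associativity:
  assumes loc: "local_order a c m"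
  shows "Sum_any (\<lambda>i. ((-1) ^ i * (of_int l gchoose i)) \<cdot> a\<langle>int m + l - int i\<rangle> (b\<langle>n + int i\<rangle> c)) =
    Sum_any (\<lambda>i. (of_nat m gchoose i) \<cdot> (a\<langle>l + int i\<rangle> b)\<langle>int m + n - int i\<rangle> c)"
proof -
  obtain R where R: "\<And>i. i \<ge> R \<Longrightarrow> c\<langle>n + int i\<rangle> b = 0" using truncation_nat[of c n b] by auto
  obtain R' where R': "\<And>i. i \<ge> R' \<Longrightarrow> b\<langle>n + int i\<rangle> c = 0" using truncation_nat[of b n c] by auto
  \<comment> \<open>The final skew-symmetry involves the m + 1 vectors a_(l+m-s) b; their truncation
    bounds are merged into one.\<close>
  have "\<exists>S. \<forall>s\<le>m. \<forall>t\<ge>S. c\<langle>n + int s + int t\<rangle> (a\<langle>l + int m - int s\<rangle> b) = 0"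
  proof -
    have "\<forall>s. \<exists>S. \<forall>t\<ge>S. c\<langle>n + int s + int t\<rangle> (a\<langle>l + int m - int s\<rangle> b) = 0"
      by (intro allI truncation_nat)
    then have "\<exists>S. \<forall>s. \<forall>t\<ge>S s. c\<langle>n + int s + int t\<rangle> (a\<langle>l + int m - int s\<rangle> b) = 0"
      by (rule choice)
    then obtain S where S: "\<And>s t. t \<ge> S s \<Longrightarrow> c\<langle>n + int s + int t\<rangle> (a\<langle>l + int m - int s\<rangle> b) = 0"
      by auto
    have "c\<langle>n + int s + int t\<rangle> (a\<langle>l + int m - int s\<rangle> b) = 0" if "s \<le> m" "t \<ge> Max (S ` {..m})" for s t
      using that by (intro S) (meson Max_ge atMost_iff finite_atMost finite_imageI imageI le_trans)
    then show ?thesis by blast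
  qed
  then obtain S where S: "\<And>s t. s \<le> m \<Longrightarrow> t \<ge> S \<Longrightarrow> c\<langle>n + int s + int t\<rangle> (a\<langle>l + int m - int s\<rangle> b) = 0"
    by blast
  \<comment> \<open>All expansions are cut off at the same J; the summand Suc m keeps every s \<le>
    m inside the range.\<close>
  define J where "J = R + R' + S + Suc m"
  let ?Z = "\<lambda>t s. dpow t (a\<langle>int m + l - int s\<rangle> (c\<langle>n + int s + int t\<rangle> b))"
  let ?e = "\<lambda>i k. (-1) ^ i * ((of_int l gchoose i) * ((of_nat m + of_int l - of_nat i) gchoose k)) :: complex"
  have Z0: "?Z t s = 0" if "s + t \<ge> J" for s t
  proof -
    have "c\<langle>n + int (s + t)\<rangle> b = 0" by (rule R) (use that in \<open>simp add: J_def\<close>)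
    then show ?thesis by (simp add: add.assoc)
  qed
  have "Sum_any (\<lambda>i. ((-1) ^ i * (of_int l gchoose i)) \<cdot> a\<langle>int m + l - int i\<rangle> (b\<langle>n + int i\<rangle> c)) =
      (\<Sum>i<J. ((-1) ^ i * (of_int l gchoose i)) \<cdot> a\<langle>int m + l - int i\<rangle> (b\<langle>n + int i\<rangle> c))"
    by (rule Sum_any_eq_sum_lessThan) (simp add: J_def R')
  also have "\<dots> = (\<Sum>i<J. \<Sum>k<J. \<Sum>t<J. (sign (n + int (i + k) + int t + 1) * ?e i k) \<cdot> ?Z t (i + k))"
  proof (rule sum.cong)
    fix i
    let ?X = "\<lambda>j k. (of_int (int m + l - int i) gchoose k) \<cdot> (sign (n + int i + int j + 1) \<cdot>
        dpow (j - k) (a\<langle>int m + l - int i - int k\<rangle> (c\<langle>n + int i + int j\<rangle> b)))"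
    have c0: "c\<langle>n + int i + int j\<rangle> b = 0" if "j \<ge> J" for j
    proof -
      have "c\<langle>n + int (i + j)\<rangle> b = 0" by (rule R) (use that in \<open>simp add: J_def\<close>)
      then show ?thesis by (simp add: add.assoc)
    qed
    have X0: "?X (k + t) k = 0" if "\<not> k + t < J" for k t
      using c0[of "k + t"] that by (simp only: not_less mode_right_linear dpow_linear vs.scale_zero_right)
    have "a\<langle>int m + l - int i\<rangle> (b\<langle>n + int i\<rangle> c) =
        a\<langle>int m + l - int i\<rangle> (\<Sum>j<J. sign (n + int i + int j + 1) \<cdot> dpow j (c\<langle>n + int i + int j\<rangle> b))"
      by (subst skew_symmetry[OF c0]) simp_all
    also have "\<dots> = (\<Sum>j<J. \<Sum>k\<le>j. ?X j k)"
      by (simp add: mode_right_sum mode_dpow vs.scale_sum_right mult.commute)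
    also have "\<dots> = (\<Sum>j<J. \<Sum>k\<le>j. ?X (k + (j - k)) k)"
      by (intro sum.cong) auto
    also have "\<dots> = (\<Sum>(k, t)\<in>{(k, t). k + t < J}. ?X (k + t) k)"
      by (rule sum.triangle_reindex[symmetric])
    also have "\<dots> = (\<Sum>(k, t)\<in>{..<J} \<times> {..<J}. ?X (k + t) k)"
    proof (rule sum.mono_neutral_left)
      show "\<forall>p\<in>{..<J} \<times> {..<J} - {(k, t). k + t < J}. (case p of (k, t) \<Rightarrow> ?X (k + t) k) = 0"
      proof (intro ballI)
        fix p assume p: "p \<in> {..<J} \<times> {..<J} - {(k, t). k + t < J}"
        obtain k t where pt: "p = (k, t)" by (cases p)
        then have "\<not> k + t < J" using p by simp
        then have "?X (k + t) k = 0" by (rule X0)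
        then show "(case p of (k, t) \<Rightarrow> ?X (k + t) k) = 0" by (simp only: pt prod.case)
      qed
    qed auto
    also have "\<dots> = (\<Sum>k<J. \<Sum>t<J. ?X (k + t) k)"
      by (simp only: sum.cartesian_product)
    finally have "((-1) ^ i * (of_int l gchoose i)) \<cdot> a\<langle>int m + l - int i\<rangle> (b\<langle>n + int i\<rangle> c) =
        ((-1) ^ i * (of_int l gchoose i)) \<cdot> (\<Sum>k<J. \<Sum>t<J. ?X (k + t) k)"
      by (simp only:)
    also have "\<dots> =
        (\<Sum>k<J. \<Sum>t<J. (sign (n + int (i + k) + int t + 1) * ?e i k) \<cdot> ?Z t (i + k))"
      unfolding vs.scale_sum_right
    proof (intro sum.cong refl)
      fix k t
      have "int m + l - int i - int k = int m + l - int (i + k)"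
        "n + int i + int (k + t) = n + int (i + k) + int t" "k + t - k = t"
        "(of_int (int m + l - int i) :: complex) = of_nat m + of_int l - of_nat i"
        by simp_all
      then show "((-1) ^ i * (of_int l gchoose i)) \<cdot> ?X (k + t) k =
          (sign (n + int (i + k) + int t + 1) * ?e i k) \<cdot> ?Z t (i + k)"
        by (simp only: vs.scale_scale mult_ac)
    qed
    finally show "((-1) ^ i * (of_int l gchoose i)) \<cdot> a\<langle>int m + l - int i\<rangle> (b\<langle>n + int i\<rangle> c) =
       (\<Sum>k<J. \<Sum>t<J. (sign (n + int (i + k) + int t + 1) * ?e i k) \<cdot> ?Z t (i + k))" .
  qed simp
  also have "\<dots> = (\<Sum>(i, k)\<in>{..<J} \<times> {..<J}. \<Sum>t<J. (sign (n + int (i + k) + int t + 1) * ?e i k) \<cdot> ?Z t (i + k))"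
    by (rule sum.cartesian_product)
  also have "\<dots> = (\<Sum>(i, k)\<in>{(i, k). i + k < J}. \<Sum>t<J. (sign (n + int (i + k) + int t + 1) * ?e i k) \<cdot> ?Z t (i + k))"
  proof (rule sum.mono_neutral_right)
    show "\<forall>p\<in>{..<J} \<times> {..<J} - {(i, k). i + k < J}.
       (case p of (i, k) \<Rightarrow> \<Sum>t<J. (sign (n + int (i + k) + int t + 1) * ?e i k) \<cdot> ?Z t (i + k)) = 0"
    proof (intro ballI)
      fix p assume p: "p \<in> {..<J} \<times> {..<J} - {(i, k). i + k < J}"
      obtain i k where pk: "p = (i, k)" by (cases p)
      then have "J \<le> (i + k) + t" for t using p by simp
      then have "?Z t (i + k) = 0" for t by (rule Z0)
      then show "(case p of (i, k) \<Rightarrow> \<Sum>t<J. (sign (n + int (i + k) + int t + 1) * ?e i k) \<cdot> ?Z t (i + k)) = 0"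
        by (simp only: pk prod.case vs.scale_zero_right sum.neutral_const)
    qed
  qed auto
  also have "\<dots> = (\<Sum>s<J. \<Sum>i\<le>s. \<Sum>t<J. (sign (n + int (i + (s - i)) + int t + 1) * ?e i (s - i)) \<cdot> ?Z t (i + (s - i)))"
    by (rule sum.triangle_reindex)
  also have "\<dots> = (\<Sum>s<J. \<Sum>t<J. (sign (n + int s + int t + 1) * (of_nat m gchoose s)) \<cdot> ?Z t s)"
  proof (rule sum.cong)
    fix s
    have "(\<Sum>i\<le>s. \<Sum>t<J. (sign (n + int (i + (s - i)) + int t + 1) * ?e i (s - i)) \<cdot> ?Z t (i + (s - i))) =
      (\<Sum>i\<le>s. \<Sum>t<J. (sign (n + int s + int t + 1) * ?e i (s - i)) \<cdot> ?Z t s)"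
      by (intro sum.cong refl) (simp del: of_nat_add)
    also have "\<dots> = (\<Sum>t<J. (sign (n + int s + int t + 1) * (\<Sum>i\<le>s. ?e i (s - i))) \<cdot> ?Z t s)"
      unfolding sum_distrib_left vs.scale_sum_left by (rule sum.swap)
    finally show "(\<Sum>i\<le>s. \<Sum>t<J. (sign (n + int (i + (s - i)) + int t + 1) * ?e i (s - i)) \<cdot> ?Z t (i + (s - i))) =
      (\<Sum>t<J. (sign (n + int s + int t + 1) * (of_nat m gchoose s)) \<cdot> ?Z t s)"
      by (simp only: associator_coefficient)
  qed simp
  also have "\<dots> = (\<Sum>s\<le>m. \<Sum>t<J. (sign (n + int s + int t + 1) * (of_nat m gchoose s)) \<cdot> ?Z t s)"
    by (rule sum.mono_neutral_right) (auto intro!: sum.neutral simp: J_def gbinomial_of_nat_eq_0)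
  also have "\<dots> = (\<Sum>t<J. dpow t (sign (n + int t + 1) \<cdot> (\<Sum>s\<le>m. ((-1) ^ s * of_nat (m choose s)) \<cdot>
      (a\<langle>l + int m - int s\<rangle> (c\<langle>n + int t + int s\<rangle> b)))))"
    by (subst sum.swap)
      (auto intro!: sum.cong simp: vs.scale_sum_right dpow_sum sign_add sign_of_nat binomial_gbinomial algebra_simps)
  \<comment> \<open>The inner alternating sum is locality of order m for a and c, acting on b: here
    the two modes change places.\<close>
  also have "\<dots> = (\<Sum>t<J. dpow t (sign (n + int t + 1) \<cdot> (\<Sum>s\<le>m. ((-1) ^ s * of_nat (m choose s)) \<cdot>
      (c\<langle>n + int t + int s\<rangle> (a\<langle>l + int m - int s\<rangle> b)))))"
    using loc unfolding local_order_def by (simp add: vs.scale_right_diff_distrib sum_subtractf)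
  also have "\<dots> = (\<Sum>s\<le>m. \<Sum>t<J. (of_nat m gchoose s) \<cdot> (sign (n + int s + int t + 1) \<cdot>
      dpow t (c\<langle>n + int s + int t\<rangle> (a\<langle>l + int m - int s\<rangle> b))))"
    by (subst sum.swap)
      (auto intro!: sum.cong simp: vs.scale_sum_right dpow_sum sign_add sign_of_nat binomial_gbinomial algebra_simps)
  also have "\<dots> = (\<Sum>s\<le>m. (of_nat m gchoose s) \<cdot> (a\<langle>l + int m - int s\<rangle> b)\<langle>n + int s\<rangle> c)"
  proof (rule sum.cong)
    fix s assume "s \<in> {..m}"
    then have "\<And>t. t \<ge> J \<Longrightarrow> c\<langle>n + int s + int t\<rangle> (a\<langle>l + int m - int s\<rangle> b) = 0"
      by (intro S) (auto simp: J_def)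
    then have "(a\<langle>l + int m - int s\<rangle> b)\<langle>n + int s\<rangle> c =
        (\<Sum>t<J. sign (n + int s + int t + 1) \<cdot> dpow t (c\<langle>n + int s + int t\<rangle> (a\<langle>l + int m - int s\<rangle> b)))"
      by (rule skew_symmetry)
    then show "(\<Sum>t<J. (of_nat m gchoose s) \<cdot> (sign (n + int s + int t + 1) \<cdot>
        dpow t (c\<langle>n + int s + int t\<rangle> (a\<langle>l + int m - int s\<rangle> b)))) =
        (of_nat m gchoose s) \<cdot> (a\<langle>l + int m - int s\<rangle> b)\<langle>n + int s\<rangle> c"
      by (simp only: vs.scale_sum_right)
  qed simp
  also have "\<dots> = (\<Sum>i\<le>m. (of_nat m gchoose i) \<cdot> (a\<langle>l + int i\<rangle> b)\<langle>int m + n - int i\<rangle> c)"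
    by (rule sum.reindex_bij_witness[of _ "\<lambda>i. m - i" "\<lambda>i. m - i"])
      (auto simp: binomial_gbinomial[symmetric] binomial_symmetric[symmetric] of_nat_diff algebra_simps)
  also have "\<dots> = Sum_any (\<lambda>i. (of_nat m gchoose i) \<cdot> (a\<langle>l + int i\<rangle> b)\<langle>int m + n - int i\<rangle> c)"
    by (rule Sum_any_eq_sum_atMost[symmetric]) (simp add: gbinomial_of_nat_eq_0)
  finally show ?thesis .
qed

lemma gbinomial_Sum_any_step:
  assumes "eventually_zero F"
  shows "Sum_any (\<lambda>i. (x + 1 gchoose i) \<cdot> F i) =
    Sum_any (\<lambda>i. (x gchoose i) \<cdot> F i) + Sum_any (\<lambda>i. (x gchoose i) \<cdot> F (Suc i))"
proof -
  have ev: "eventually_zero (\<lambda>i. c i \<cdot> F i)" "eventually_zero (\<lambda>i. c i \<cdot> F (Suc i))" for c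
    using assms eventually_zero_Suc[OF assms] by (auto elim: eventually_zero_compose)
  have "Sum_any (\<lambda>i. (x + 1 gchoose i) \<cdot> F i) =
      F 0 + Sum_any (\<lambda>i. (x + 1 gchoose Suc i) \<cdot> F (Suc i))"
    by (subst Sum_any_Suc[OF ev(1)]) simp
  also have "\<dots> = F 0 + (Sum_any (\<lambda>i. (x gchoose i) \<cdot> F (Suc i)) + Sum_any (\<lambda>i. (x gchoose Suc i) \<cdot> F (Suc i)))"
    by (subst Sum_any_add[symmetric]) (simp_all add: ev gbinomial_pascal vs.scale_left_distrib)
  also have "\<dots> = Sum_any (\<lambda>i. (x gchoose i) \<cdot> F i) + Sum_any (\<lambda>i. (x gchoose i) \<cdot> F (Suc i))"
    using Sum_any_Suc[OF ev(1)[of "\<lambda>i. x gchoose i"]] by (simp add: add_ac)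
  finally show ?thesis .
qed

lemma gbinomial_alternating_Sum_any_step:
  assumes "eventually_zero F"
  shows "Sum_any (\<lambda>i. ((-1) ^ i * (x + 1 gchoose i)) \<cdot> F i) =
    Sum_any (\<lambda>i. ((-1) ^ i * (x gchoose i)) \<cdot> F i) - Sum_any (\<lambda>i. ((-1) ^ i * (x gchoose i)) \<cdot> F (Suc i))"
proof -
  have ev: "eventually_zero (\<lambda>i. c i \<cdot> F i)" "eventually_zero (\<lambda>i. c i \<cdot> F (Suc i))" for c
    using assms eventually_zero_Suc[OF assms] by (auto elim: eventually_zero_compose)
  have "Sum_any (\<lambda>i. (x + 1 gchoose i) \<cdot> ((-1) ^ i \<cdot> F i)) =
     Sum_any (\<lambda>i. (x gchoose i) \<cdot> ((-1) ^ i \<cdot> F i)) + Sum_any (\<lambda>i. (x gchoose i) \<cdot> ((-1) ^ Suc i \<cdot> F (Suc i)))"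
    by (rule gbinomial_Sum_any_step) (rule ev)
  moreover have "- Sum_any (\<lambda>i. ((-1) ^ i * (x gchoose i)) \<cdot> F (Suc i)) =
      Sum_any (\<lambda>i. - (((-1) ^ i * (x gchoose i)) \<cdot> F (Suc i)))"
    by (rule Sum_any_hom[OF ev(2)]) auto
  ultimately show ?thesis by (simp add: mult.commute)
qed

definition borcherds_defect :: "'v \<Rightarrow> 'v \<Rightarrow> 'v \<Rightarrow> int \<Rightarrow> int \<Rightarrow> int \<Rightarrow> 'v" where
  "borcherds_defect a b c l m n =
     Sum_any (\<lambda>i. ((-1) ^ i * (of_int l gchoose i)) \<cdot> a\<langle>m + l - int i\<rangle> (b\<langle>n + int i\<rangle> c))
     - sign l \<cdot> Sum_any (\<lambda>i. ((-1) ^ i * (of_int l gchoose i)) \<cdot> b\<langle>n + l - int i\<rangle> (a\<langle>m + int i\<rangle> c))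
     - Sum_any (\<lambda>i. (of_int m gchoose i) \<cdot> (a\<langle>l + int i\<rangle> b)\<langle>m + n - int i\<rangle> c)"

lemma eventually_zero_modes:
  "eventually_zero (\<lambda>i. a\<langle>f i\<rangle> (b\<langle>n + int i\<rangle> c))" "eventually_zero (\<lambda>i. (a\<langle>n + int i\<rangle> b)\<langle>f i\<rangle> c)"
proof -
  obtain K L where "\<And>i. i \<ge> K \<Longrightarrow> b\<langle>n + int i\<rangle> c = 0" "\<And>i. i \<ge> L \<Longrightarrow> a\<langle>n + int i\<rangle> b = 0"
    using truncation_nat[of b n c] truncation_nat[of a n b] by auto
  then show "eventually_zero (\<lambda>i. a\<langle>f i\<rangle> (b\<langle>n + int i\<rangle> c))" "eventually_zero (\<lambda>i. (a\<langle>n + int i\<rangle> b)\<langle>f i\<rangle> c)"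
    by (auto intro: eventually_zeroI[where K = K] eventually_zeroI[where K = L])
qed

text \<open>Pascal's rule in l for the two products of modes and in m for the iterate. Solved for
  its last term, the equation trades a defect at (l, m) for defects at (l + 1, m) and (l, m +
  1).\<close>

lemma borcherds_defect_step:
  "borcherds_defect a b c (l + 1) m n = borcherds_defect a b c l (m + 1) n - borcherds_defect a b c l m (n + 1)"
proof -
  let ?A = "\<lambda>l m n. Sum_any (\<lambda>i. ((-1) ^ i * (of_int l gchoose i)) \<cdot> a\<langle>m + l - int i\<rangle> (b\<langle>n + int i\<rangle> c))"
  let ?B = "\<lambda>l m n. Sum_any (\<lambda>i. ((-1) ^ i * (of_int l gchoose i)) \<cdot> b\<langle>n + l - int i\<rangle> (a\<langle>m + int i\<rangle> c))"
  let ?C = "\<lambda>l m n. Sum_any (\<lambda>i. (of_int m gchoose i) \<cdot> (a\<langle>l + int i\<rangle> b)\<langle>m + n - int i\<rangle> c)"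
  have A: "?A (l + 1) m n = ?A l (m + 1) n - ?A l m (n + 1)"
    using gbinomial_alternating_Sum_any_step[of "\<lambda>i. a\<langle>m + (l + 1) - int i\<rangle> (b\<langle>n + int i\<rangle> c)" "of_int l"]
    by (simp add: eventually_zero_modes algebra_simps)
  have B: "?B (l + 1) m n = ?B l m (n + 1) - ?B l (m + 1) n"
    using gbinomial_alternating_Sum_any_step[of "\<lambda>i. b\<langle>n + (l + 1) - int i\<rangle> (a\<langle>m + int i\<rangle> c)" "of_int l"]
    by (simp add: eventually_zero_modes algebra_simps)
  have C: "?C l (m + 1) n = ?C l m (n + 1) + ?C (l + 1) m n"
    using gbinomial_Sum_any_step[of "\<lambda>i. (a\<langle>l + int i\<rangle> b)\<langle>m + 1 + n - int i\<rangle> c" "of_int m"]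
    by (simp add: eventually_zero_modes algebra_simps)
  show ?thesis
    unfolding borcherds_defect_def A B C
    by (simp add: sign_add vs.scale_right_diff_distrib algebra_simps)
qed

lemma alternating_binomial_reflect:
  "Sum_any (\<lambda>i. ((-1) ^ i * (of_nat l gchoose i)) \<cdot> F (int l - int i)) =
   (\<Sum>i\<le>l. ((-1) ^ (l - i) * of_nat (l choose i)) \<cdot> F (int i))"
proof -
  have "Sum_any (\<lambda>i. ((-1) ^ i * (of_nat l gchoose i)) \<cdot> F (int l - int i)) =
      (\<Sum>i\<le>l. ((-1) ^ i * of_nat (l choose i)) \<cdot> F (int l - int i))"
    by (subst Sum_any_eq_sum_atMost[where K = l]) (auto simp: gbinomial_of_nat_eq_0 binomial_gbinomial)
  also have "\<dots> = (\<Sum>i\<le>l. ((-1) ^ (l - i) * of_nat (l choose i)) \<cdot> F (int i))"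
    by (rule sum.reindex_bij_witness[of _ "\<lambda>i. l - i" "\<lambda>i. l - i"])
      (auto simp: binomial_symmetric[symmetric] of_nat_diff)
  finally show ?thesis .
qed

text \<open>The Borcherds identity holds for large \<open>l\<close> by locality and for large \<open>m\<close> by weak
  associativity, and the recursion above propagates it to all \<open>l\<close> and \<open>m\<close>.\<close>

theorem borcherds_identity:
  "Sum_any (\<lambda>i. ((-1) ^ i * (of_int l gchoose i)) \<cdot> a\<langle>m + l - int i\<rangle> (b\<langle>n + int i\<rangle> c))
     - sign l \<cdot> Sum_any (\<lambda>i. ((-1) ^ i * (of_int l gchoose i)) \<cdot> b\<langle>n + l - int i\<rangle> (a\<langle>m + int i\<rangle> c))
   = Sum_any (\<lambda>i. (of_int m gchoose i) \<cdot> (a\<langle>l + int i\<rangle> b)\<langle>m + n - int i\<rangle> c)"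
proof -
  obtain N1 where N1: "\<And>l. l \<ge> N1 \<Longrightarrow> local_order a b l" using local_order_ex by blast
  obtain N2 where N2: "\<And>n. n \<ge> N2 \<Longrightarrow> a\<langle>n\<rangle> b = 0" using truncation by blast
  obtain M1 where M1: "\<And>l. l \<ge> M1 \<Longrightarrow> local_order a c l" using local_order_ex by blast
  obtain M2 where M2: "\<And>n. n \<ge> M2 \<Longrightarrow> a\<langle>n\<rangle> c = 0" using truncation by blast
  define N where "N = max N1 (nat N2)"
  define M where "M = max M1 (nat M2)"
  \<comment> \<open>For large l all a_(l+i) b vanish, so the sum of iterates is 0 and what remains
    is locality.\<close>
  have large_l: "borcherds_defect a b c (int l) m n = 0" if "l \<ge> N" for l m n
  proof -
    have "local_order a b l" using that N1 by (simp add: N_def)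
    then have *: "(\<Sum>j\<le>l. ((-1) ^ j * of_nat (l choose j)) \<cdot> a\<langle>m + int l - int j\<rangle> (b\<langle>n + int j\<rangle> c)) =
        (\<Sum>j\<le>l. ((-1) ^ j * of_nat (l choose j)) \<cdot> b\<langle>n + int j\<rangle> (a\<langle>m + int l - int j\<rangle> c))"
      unfolding local_order_def by (simp add: vs.scale_right_diff_distrib sum_subtractf)
    have 1: "Sum_any (\<lambda>i. ((-1) ^ i * (of_int (int l) gchoose i)) \<cdot> a\<langle>m + int l - int i\<rangle> (b\<langle>n + int i\<rangle> c)) =
        (\<Sum>j\<le>l. ((-1) ^ j * of_nat (l choose j)) \<cdot> a\<langle>m + int l - int j\<rangle> (b\<langle>n + int j\<rangle> c))"
      by (subst Sum_any_eq_sum_atMost[where K = l]) (auto simp: gbinomial_of_nat_eq_0 binomial_gbinomial)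
    have "sign (int l) \<cdot> Sum_any (\<lambda>i. ((-1) ^ i * (of_int (int l) gchoose i)) \<cdot> b\<langle>n + int l - int i\<rangle> (a\<langle>m + int i\<rangle> c)) =
        sign (int l) \<cdot> (\<Sum>i\<le>l. ((-1) ^ (l - i) * of_nat (l choose i)) \<cdot> b\<langle>n + int i\<rangle> (a\<langle>m + int l - int i\<rangle> c))"
      using alternating_binomial_reflect[of l "\<lambda>i. b\<langle>n + i\<rangle> (a\<langle>m + int l - i\<rangle> c)"]
      by (simp add: algebra_simps)
    also have "\<dots> = (\<Sum>j\<le>l. ((-1) ^ j * of_nat (l choose j)) \<cdot> b\<langle>n + int j\<rangle> (a\<langle>m + int l - int j\<rangle> c))"
      unfolding vs.scale_sum_right
    proof (intro sum.cong refl)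
      fix j assume "j \<in> {..l}"
      then have "sign (int l) = (-1) ^ (l - j) * (-1) ^ j"
        by (simp add: sign_of_nat flip: power_add)
      moreover have "(-1 :: complex) ^ (l - j) * (-1) ^ (l - j) = 1"
        by (simp flip: power_add mult_2)
      ultimately have "sign (int l) * ((-1) ^ (l - j)) = (-1) ^ j"
        by (metis mult.assoc mult.commute mult.left_neutral)
      then show "sign (int l) \<cdot> ((-1) ^ (l - j) * of_nat (l choose j)) \<cdot> b\<langle>n + int j\<rangle> (a\<langle>m + int l - int j\<rangle> c) =
        ((-1) ^ j * of_nat (l choose j)) \<cdot> b\<langle>n + int j\<rangle> (a\<langle>m + int l - int j\<rangle> c)"
        by (simp add: mult.assoc[symmetric])
    qed
    finally have 2: "sign (int l) \<cdot> Sum_any (\<lambda>i. ((-1) ^ i * (of_int (int l) gchoose i)) \<cdot> b\<langle>n + int l - int i\<rangle> (a\<langle>m + int i\<rangle> c)) =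
       (\<Sum>j\<le>l. ((-1) ^ j * of_nat (l choose j)) \<cdot> b\<langle>n + int j\<rangle> (a\<langle>m + int l - int j\<rangle> c))" .
    have "a\<langle>int l + int i\<rangle> b = 0" for i
      by (rule N2) (use that in \<open>auto simp: N_def\<close>)
    then show ?thesis
      unfolding borcherds_defect_def 1 2 * by simp
  qed
  \<comment> \<open>For large m all a_(m+i) c vanish, which removes the second sum and leaves weak
    associativity.\<close>
  have large_m: "borcherds_defect a b c l (int m) n = 0" if "m \<ge> M" for l m n
  proof -
    have "a\<langle>int m + int i\<rangle> c = 0" for i
      by (rule M2) (use that in \<open>auto simp: M_def\<close>)
    moreover have "local_order a c m" using that M1 by (simp add: M_def)
    ultimately show ?thesis
      unfolding borcherds_defect_def by (simp add: weak_associativity)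
  qed
  have "borcherds_defect a b c l m n = 0" for l m n
  \<comment> \<open>The measure counts the steps still missing to the two thresholds. The recursion
    raises l or m and shifts n, which is therefore arbitrary.\<close>
  proof (induction "nat (int N - l) + nat (int M - m)" arbitrary: l m n rule: less_induct)
    case less
    show ?case
    proof (cases "l \<ge> int N \<or> m \<ge> int M")
      case True
      then show ?thesis using large_l[of "nat l" m n] large_m[of "nat m" l n] by auto
    next
      case False
      then have "borcherds_defect a b c l (m + 1) (n - 1) = 0" "borcherds_defect a b c (l + 1) m (n - 1) = 0"
        by (auto intro!: less)
      then show ?thesis using borcherds_defect_step[of a b c l m "n - 1"] by simp
    qed
  qed
  then show ?thesis unfolding borcherds_defect_def by (simp add: algebra_simps)
qed

section \<open>Specializations of the Borcherds identity\<close>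

corollary commutator_formula:
  "a\<langle>m\<rangle> (b\<langle>n\<rangle> c) - b\<langle>n\<rangle> (a\<langle>m\<rangle> c) =
     Sum_any (\<lambda>i. (of_int m gchoose i) \<cdot> (a\<langle>int i\<rangle> b)\<langle>m + n - int i\<rangle> c)"
proof -
  have z: "(0 :: complex) gchoose i = 0" if "i \<noteq> 0" for i
    using that by (cases i) auto
  have "Sum_any (\<lambda>i. ((-1) ^ i * (of_int 0 gchoose i)) \<cdot> a\<langle>m + 0 - int i\<rangle> (b\<langle>n + int i\<rangle> c)) = a\<langle>m\<rangle> (b\<langle>n\<rangle> c)"
    "Sum_any (\<lambda>i. ((-1) ^ i * (of_int 0 gchoose i)) \<cdot> b\<langle>n + 0 - int i\<rangle> (a\<langle>m + int i\<rangle> c)) = b\<langle>n\<rangle> (a\<langle>m\<rangle> c)"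
    by (subst Sum_any_eq_single[where k = 0]; simp add: z)+
  then show ?thesis using borcherds_identity[of 0 a m b n c] by simp
qed

corollary commutator_formula_nat:
  "a\<langle>int m\<rangle> (b\<langle>n\<rangle> c) - b\<langle>n\<rangle> (a\<langle>int m\<rangle> c) =
     (\<Sum>i\<le>m. of_nat (m choose i) \<cdot> (a\<langle>int i\<rangle> b)\<langle>int m + n - int i\<rangle> c)"
  by (subst commutator_formula, subst Sum_any_eq_sum_atMost[where K = m])
    (auto simp: gbinomial_of_nat_eq_0 binomial_gbinomial)

text \<open>The case m = 0, where only i = 0 survives in the sum of iterates.\<close>

corollary iterate_formula:
  "(a\<langle>l\<rangle> b)\<langle>n\<rangle> c = Sum_any (\<lambda>i. ((-1) ^ i * (of_int l gchoose i)) \<cdot>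
     (a\<langle>l - int i\<rangle> (b\<langle>n + int i\<rangle> c) - sign l \<cdot> b\<langle>n + l - int i\<rangle> (a\<langle>int i\<rangle> c)))"
proof -
  have z: "(0 :: complex) gchoose i = 0" if "i \<noteq> 0" for i
    using that by (cases i) auto
  have ev: "eventually_zero (\<lambda>i. k i \<cdot> a\<langle>f i\<rangle> (b\<langle>n + int i\<rangle> c))" for a b n c k f
    using eventually_zero_modes(1)[of a f b n c] by (rule eventually_zero_compose) simp
  have ev0: "eventually_zero (\<lambda>i. k i \<cdot> b\<langle>f i\<rangle> (a\<langle>int i\<rangle> c))" for k f
    using ev[of k b f a 0 c] by simp
  have "(a\<langle>l\<rangle> b)\<langle>n\<rangle> c = Sum_any (\<lambda>i. (of_int 0 gchoose i) \<cdot> (a\<langle>l + int i\<rangle> b)\<langle>0 + n - int i\<rangle> c)"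
    by (subst Sum_any_eq_single[where k = 0]; simp add: z)
  also have "\<dots> = Sum_any (\<lambda>i. ((-1) ^ i * (of_int l gchoose i)) \<cdot> a\<langle>l - int i\<rangle> (b\<langle>n + int i\<rangle> c))
     - sign l \<cdot> Sum_any (\<lambda>i. ((-1) ^ i * (of_int l gchoose i)) \<cdot> b\<langle>n + l - int i\<rangle> (a\<langle>int i\<rangle> c))"
    by (subst borcherds_identity[symmetric]) simp
  finally have 1: "(a\<langle>l\<rangle> b)\<langle>n\<rangle> c = Sum_any (\<lambda>i. ((-1) ^ i * (of_int l gchoose i)) \<cdot> a\<langle>l - int i\<rangle> (b\<langle>n + int i\<rangle> c))
     - sign l \<cdot> Sum_any (\<lambda>i. ((-1) ^ i * (of_int l gchoose i)) \<cdot> b\<langle>n + l - int i\<rangle> (a\<langle>int i\<rangle> c))" .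
  have 2: "sign l \<cdot> Sum_any (\<lambda>i. ((-1) ^ i * (of_int l gchoose i)) \<cdot> b\<langle>n + l - int i\<rangle> (a\<langle>int i\<rangle> c)) =
     Sum_any (\<lambda>i. sign l \<cdot> (((-1) ^ i * (of_int l gchoose i)) \<cdot> b\<langle>n + l - int i\<rangle> (a\<langle>int i\<rangle> c)))"
    by (rule Sum_any_hom[OF ev0]) (auto simp: vs.scale_right_distrib)
  have 3: "eventually_zero (\<lambda>i. sign l \<cdot> (((-1) ^ i * (of_int l gchoose i)) \<cdot> b\<langle>n + l - int i\<rangle> (a\<langle>int i\<rangle> c)))"
    by (rule eventually_zero_compose[OF ev0[of "\<lambda>i. (-1) ^ i * (of_int l gchoose i)" "\<lambda>i. n + l - int i"]]) simp
  show ?thesis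
    unfolding 1 2 by (subst Sum_any_diff[symmetric, OF ev 3])
      (simp only: vs.scale_right_diff_distrib vs.scale_scale mult.commute)
qed

corollary normal_product_modes:
  "(a\<langle>-1\<rangle> b)\<langle>n\<rangle> c = Sum_any (\<lambda>i. a\<langle>- 1 - int i\<rangle> (b\<langle>n + int i\<rangle> c) + b\<langle>n - 1 - int i\<rangle> (a\<langle>int i\<rangle> c))"
  using iterate_formula[of a "-1" b n c]
  by (simp add: gbinomial_neg_one algebra_simps flip: power_add mult_2)

text \<open>T a = a_(-2) 1, and in the iterate formula the vacuum modes leave at most one term: from
  the first product for n < 0, from the second for n > 0, none for n = 0.\<close>

lemma T_left: "(T a)\<langle>n\<rangle> c = (- of_int n) \<cdot> a\<langle>n - 1\<rangle> c"
proof -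
  have g: "(-1) ^ i * ((-2::complex) gchoose i) = of_nat (Suc i)" for i
    using gbinomial_minus[of "2::complex" i] binomial_symmetric[of i "Suc i"]
      binomial_gbinomial[of "Suc i" i, where 'a = complex]
    by (simp add: add.commute flip: power_add mult_2)
  have Ta: "T a = a\<langle>-2\<rangle> vac V"
    by (simp add: mode_vac dpow_def)
  have "(T a)\<langle>n\<rangle> c = Sum_any (\<lambda>i. of_nat (Suc i) \<cdot>
     (a\<langle>- 2 - int i\<rangle> (vac V\<langle>n + int i\<rangle> c) - vac V\<langle>n - 2 - int i\<rangle> (a\<langle>int i\<rangle> c)))"
    unfolding Ta using iterate_formula[of a "-2" "vac V" n c] g by simp
  also have "\<dots> = (- of_int n) \<cdot> a\<langle>n - 1\<rangle> c"
  proof (cases "n < 0")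
    case True
    define k where "k = nat (- 1 - n)"
    have k: "n = - 1 - int k" using True by (simp add: k_def)
    show ?thesis
      by (subst Sum_any_eq_single[where k = k]) (auto simp: k vacuum)
  next
    case n0: False
    show ?thesis
    proof (cases "n = 0")
      case True
      have "Sum_any (\<lambda>i. of_nat (Suc i) \<cdot>
        (a\<langle>- 2 - int i\<rangle> (vac V\<langle>n + int i\<rangle> c) - vac V\<langle>n - 2 - int i\<rangle> (a\<langle>int i\<rangle> c))) = (0::'v)"
        by (subst Sum_any_eq_single[where k = 0]) (auto simp: True vacuum)
      then show ?thesis using True by simp
    next
      case False
      define k where "k = nat (n - 1)"
      have k: "n = 1 + int k" using n0 False by (simp add: k_def)
      show ?thesis
        by (subst Sum_any_eq_single[where k = k])
          (auto simp: k vacuum vs.scale_left_distrib vs.scale_left_diff_distrib)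
    qed
  qed
  finally show ?thesis .
qed

lemma T_derivation: "T (a\<langle>n\<rangle> b) = (T a)\<langle>n\<rangle> b + a\<langle>n\<rangle> (T b)"
  by (simp add: T_mode T_left)

lemma dpow_left: "(dpow k a)\<langle>n\<rangle> c = ((-1) ^ k * (of_int n gchoose k)) \<cdot> a\<langle>n - int k\<rangle> c"
proof (induction k arbitrary: n)
  case (Suc k)
  have 1: "- of_int n * ((-1) ^ k * (of_int (n - 1) gchoose k)) = of_nat (Suc k) * ((-1) ^ Suc k * ((of_int n :: complex) gchoose Suc k))"
    using gbinomial_absorption[of k "of_int n :: complex"] by (simp add: mult_ac)
  have 2: "n - 1 - int k = n - int (Suc k)"
    by simp
  have "of_nat (Suc k) \<cdot> (dpow (Suc k) a)\<langle>n\<rangle> c = (T (dpow k a))\<langle>n\<rangle> c"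
    by (simp only: T_dpow mode_left_linear)
  also have "\<dots> = (- of_int n * ((-1) ^ k * (of_int (n - 1) gchoose k))) \<cdot> a\<langle>n - 1 - int k\<rangle> c"
    by (simp add: T_left Suc.IH)
  also have "\<dots> = of_nat (Suc k) \<cdot> (((-1) ^ Suc k * (of_int n gchoose Suc k)) \<cdot> a\<langle>n - int (Suc k)\<rangle> c)"
    unfolding 1 2 vs.scale_scale by (rule refl)
  finally show ?case
    by (rule vs.scale_left_imp_eq[rotated]) (simp del: of_nat_Suc)
qed simp

lemma dpow_minus_one: "(dpow k a)\<langle>-1\<rangle> c = a\<langle>- 1 - int k\<rangle> c"
  by (simp add: dpow_left gbinomial_neg_one flip: power_add mult_2)

lemma T_pow_dpow: "(T ^^ k) a = fact k \<cdot> dpow k a"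
  by (simp add: dpow_def)

end

section \<open>Li's filtration\<close>

context vertex_algebra
begin

lemma subspace_Sum_any:
  assumes "vs.subspace S" "\<And>i::nat. f i \<in> S"
  shows "Sum_any f \<in> S"
  unfolding Sum_any.expand_set by (rule vs.subspace_sum) (use assms in auto)

abbreviation F :: "nat \<Rightarrow> 'v set" where "F \<equiv> li_filtration V"

text \<open>The spanning monomials of \<open>li_filtration\<close> once more, generated inductively
  and labelled by their exact total derivative order, so that rule induction is available.\<close>

inductive li_monomial :: "nat \<Rightarrow> 'v \<Rightarrow> bool" where
  li_vac: "li_monomial 0 (vac V)"
| li_step: "li_monomial q x \<Longrightarrow> li_monomial (k + q) (((T ^^ k) a)\<langle>-1\<rangle> x)"

lemma li_monomial_iff:
  "li_monomial q x \<longleftrightarrow> (\<exists>xs. x = nop V (map (\<lambda>(n, a). (T ^^ n) a) xs) \<and> q = sum_list (map fst xs))"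
proof
  assume "li_monomial q x"
  then show "\<exists>xs. x = nop V (map (\<lambda>(n, a). (T ^^ n) a) xs) \<and> q = sum_list (map fst xs)"
  proof induction
    case li_vac
    then show ?case by (intro exI[of _ "[]"]) (simp add: nop_def)
  next
    case (li_step q x k a)
    then obtain xs where "x = nop V (map (\<lambda>(n, a). (T ^^ n) a) xs)" "q = sum_list (map fst xs)" by blast
    then show ?case by (intro exI[of _ "(k, a) # xs"]) (simp add: nop_def)
  qed
next
  assume "\<exists>xs. x = nop V (map (\<lambda>(n, a). (T ^^ n) a) xs) \<and> q = sum_list (map fst xs)"
  then obtain xs where "x = nop V (map (\<lambda>(n, a). (T ^^ n) a) xs)" "q = sum_list (map fst xs)" by blast
  moreover have "li_monomial (sum_list (map fst xs)) (nop V (map (\<lambda>(n, a). (T ^^ n) a) xs))"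
  proof (induction xs)
    case Nil
    then show ?case by (simp add: nop_def li_vac)
  next
    case (Cons y ys)
    then show ?case using li_step[OF Cons, of "fst y" "snd y"] by (cases y) (simp add: nop_def)
  qed
  ultimately show "li_monomial q x" by simp
qed

lemma F_eq: "F p = vs.span {x. \<exists>q\<ge>p. li_monomial q x}"
  unfolding li_filtration_def va_span_def li_monomial_iff by (rule arg_cong[where f = vs.span]) blast

lemma F_subspace: "vs.subspace (F p)"
  unfolding F_eq by (rule vs.subspace_span)

lemma F_0I [simp]: "0 \<in> F p"
  by (rule vs.subspace_0[OF F_subspace])

lemma F_add: "x \<in> F p \<Longrightarrow> y \<in> F p \<Longrightarrow> x + y \<in> F p"
  by (rule vs.subspace_add[OF F_subspace])

lemma F_diff: "x \<in> F p \<Longrightarrow> y \<in> F p \<Longrightarrow> x - y \<in> F p"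
  by (rule vs.subspace_diff[OF F_subspace])

lemma F_neg: "x \<in> F p \<Longrightarrow> - x \<in> F p"
  by (rule vs.subspace_neg[OF F_subspace])

lemma F_scale: "x \<in> F p \<Longrightarrow> c \<cdot> x \<in> F p"
  by (rule vs.subspace_scale[OF F_subspace])

lemma F_sum: "(\<And>i. i \<in> A \<Longrightarrow> f i \<in> F p) \<Longrightarrow> sum f A \<in> F p"
  by (rule vs.subspace_sum[OF F_subspace])

lemma F_induct [consumes 1, case_names base zero add scale]:
  assumes "x \<in> F p" and "\<And>q x. q \<ge> p \<Longrightarrow> li_monomial q x \<Longrightarrow> P x"
    and "P 0" "\<And>x y. P x \<Longrightarrow> P y \<Longrightarrow> P (x + y)" "\<And>c x. P x \<Longrightarrow> P (c \<cdot> x)"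
  shows "P x"
proof (rule vs.span_induct[where P = P, OF assms(1)[unfolded F_eq]])
  show "vs.subspace (Collect P)"
    using assms(3-5) by (auto simp: vs.subspace_def)
qed (use assms(2) in auto)

lemma li_monomial_in_F: "li_monomial q x \<Longrightarrow> p \<le> q \<Longrightarrow> x \<in> F p"
  unfolding F_eq by (rule vs.span_base) blast

lemma F_antimono: "p \<le> q \<Longrightarrow> F q \<subseteq> F p"
  unfolding F_eq by (rule vs.span_mono) (auto intro: order_trans)

lemma F_antimonoD: "x \<in> F q \<Longrightarrow> p \<le> q \<Longrightarrow> x \<in> F p"
  using F_antimono by blast

lemma F_0 [simp]: "x \<in> F 0"
  using li_monomial_in_F[OF li_step[OF li_vac, of 0 x]] by (simp add: creation)

lemma T_pow_normal_product: "((T ^^ k) a)\<langle>-1\<rangle> x = fact k \<cdot> a\<langle>- 1 - int k\<rangle> x"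
  by (simp add: T_pow_dpow dpow_minus_one)

lemma F_mode_negative:
  assumes "x \<in> F q" "r \<le> q + k"
  shows "a\<langle>- 1 - int k\<rangle> x \<in> F r"
proof -
  have "a\<langle>- 1 - int k\<rangle> x \<in> F (q + k)"
    using assms(1)
  proof (induction rule: F_induct)
    case (base q' x)
    have "(1 / fact k) \<cdot> ((T ^^ k) a)\<langle>-1\<rangle> x \<in> F (q + k)"
      by (intro F_scale li_monomial_in_F[OF li_step[OF base(2)]]) (use base(1) in auto)
    then show ?case by (simp add: T_pow_normal_product)
  qed (auto simp: F_add F_scale)
  then show ?thesis using assms(2) F_antimonoD by blast
qed

text \<open>A nonnegative mode lowers the filtration by at most its index. It is commuted past the
  leading factor; the commutators are modes of a_(i) b, which is why a is arbitrary in the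
  induction. The maximum with 0 encodes that \<open>F 0\<close> is everything.\<close>

lemma F_mode_nonneg_monomial:
  "li_monomial q x \<Longrightarrow> int r \<le> max 0 (int q - n) \<Longrightarrow> n \<ge> 0 \<Longrightarrow> a\<langle>n\<rangle> x \<in> F r"
proof (induction arbitrary: a n r rule: li_monomial.induct)
  case li_vac
  then show ?case by (simp add: mode_vac)
next
  case (li_step q u k b)
  define m where "m = nat n"
  have m: "n = int m" using li_step.prems by (simp add: m_def)
  have "a\<langle>int m\<rangle> (b\<langle>- 1 - int k\<rangle> u) = b\<langle>- 1 - int k\<rangle> (a\<langle>int m\<rangle> u) +
     (\<Sum>i\<le>m. of_nat (m choose i) \<cdot> (a\<langle>int i\<rangle> b)\<langle>int m + (- 1 - int k) - int i\<rangle> u)"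
    using commutator_formula_nat[of a m b "- 1 - int k" u] by (simp add: algebra_simps)
  also have "\<dots> \<in> F r"
  proof (intro F_add F_sum F_scale)
    have "a\<langle>int m\<rangle> u \<in> F (nat (int q - int m))"
      by (rule li_step.IH) auto
    then show "b\<langle>- 1 - int k\<rangle> (a\<langle>int m\<rangle> u) \<in> F r"
      by (rule F_mode_negative) (use li_step.prems m in auto)
    fix i assume i: "i \<in> {..m}"
    show "(a\<langle>int i\<rangle> b)\<langle>int m + (- 1 - int k) - int i\<rangle> u \<in> F r"
    proof (cases "int m + (- 1 - int k) - int i \<ge> 0")
      case True
      then show ?thesis by (intro li_step.IH) (use li_step.prems m in auto)
    next
      case False
      define j where "j = nat (int k + int i - int m)"
      have j: "int m + (- 1 - int k) - int i = - 1 - int j" using False by (simp add: j_def)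
      have "u \<in> F q" using li_step.hyps by (auto intro: li_monomial_in_F)
      then show ?thesis unfolding j by (rule F_mode_negative) (use li_step.prems m j in auto)
    qed
  qed
  finally show ?case by (simp add: T_pow_normal_product F_scale m)
qed

lemma F_mode_nonneg:
  assumes "x \<in> F q" "int r \<le> max 0 (int q - n)" "n \<ge> 0"
  shows "a\<langle>n\<rangle> x \<in> F r"
  using assms(1)
proof (induction rule: F_induct)
  case (base q' x)
  show ?case by (rule F_mode_nonneg_monomial[OF base(2)]) (use base(1) assms in auto)
qed (auto simp: F_add F_scale)

text \<open>The left factor is dismantled by the iterate formula. Nonnegative modes land one step
  deeper than the pattern p + q - n - 1 of the negative ones; this gain is what makes the graded
  product commutative and associative.\<close>

lemma F_mode_monomial:
  "li_monomial p a \<Longrightarrow> x \<in> F q \<Longrightarrow> int r \<le> max 0 (int p + int q - (if n < 0 then n + 1 else n)) \<Longrightarrow>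
   a\<langle>n\<rangle> x \<in> F r"
proof (induction arbitrary: x q n r rule: li_monomial.induct)
  case li_vac
  then show ?case by (auto simp: vacuum elim: F_antimonoD)
next
  case (li_step p u k b)
  have "(b\<langle>- 1 - int k\<rangle> u)\<langle>n\<rangle> x \<in> F r"
    unfolding iterate_formula
  proof (intro subspace_Sum_any F_subspace F_scale F_diff)
    fix i
    define m where "m = nat (int p + int q - (if n + int i < 0 then n + int i + 1 else n + int i))"
    have "u\<langle>n + int i\<rangle> x \<in> F m"
      using li_step.prems(1) by (rule li_step.IH) (simp add: m_def)
    then have "b\<langle>- 1 - int (k + i)\<rangle> (u\<langle>n + int i\<rangle> x) \<in> F r"
      by (rule F_mode_negative) (use li_step.prems(2) in \<open>auto simp: m_def split: if_splits\<close>)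
    then show "b\<langle>- 1 - int k - int i\<rangle> (u\<langle>n + int i\<rangle> x) \<in> F r"
      by (simp add: algebra_simps)
    have "b\<langle>int i\<rangle> x \<in> F (nat (int q - int i))"
      using li_step.prems(1) by (rule F_mode_nonneg) auto
    then show "u\<langle>n + (- 1 - int k) - int i\<rangle> (b\<langle>int i\<rangle> x) \<in> F r"
      by (rule li_step.IH) (use li_step.prems(2) in \<open>auto split: if_splits\<close>)
  qed
  then show ?case by (simp add: T_pow_normal_product F_scale)
qed

lemma F_mode:
  assumes "a \<in> F p" "x \<in> F q" "int r \<le> max 0 (int p + int q - (if n < 0 then n + 1 else n))"
  shows "a\<langle>n\<rangle> x \<in> F r"
  using assms(1)
proof (induction rule: F_induct)
  case (base p' a)
  show ?case using base(2) assms(2) by (rule F_mode_monomial) (use base(1) assms(3) in auto)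
qed (auto simp: F_add F_scale)

lemma F_mult: "a \<in> F p \<Longrightarrow> b \<in> F q \<Longrightarrow> r \<le> p + q \<Longrightarrow> a\<langle>-1\<rangle> b \<in> F r"
  by (rule F_mode) auto

lemma F_T: "a \<in> F p \<Longrightarrow> T a \<in> F (Suc p)"
proof -
  assume a: "a \<in> F p"
  have "T a = a\<langle>-2\<rangle> vac V" by (simp add: mode_vac dpow_def)
  moreover have "a\<langle>-2\<rangle> vac V \<in> F (Suc p)" using a F_0 by (rule F_mode) auto
  ultimately show ?thesis by simp
qed

lemma F_dpow: "a \<in> F p \<Longrightarrow> dpow k a \<in> F (p + k)"
  by (induction k) (auto simp: dpow_Suc F_scale F_T simp del: of_nat_Suc)

text \<open>By skew-symmetry the difference consists of (t+1)-fold divided derivatives of b_(t) a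
  with t \<ge> 0: the mode costs t steps and the derivatives give back t + 1.\<close>

lemma F_commute:
  assumes "a \<in> F p" "b \<in> F q" "r \<le> Suc (p + q)"
  shows "a\<langle>-1\<rangle> b - b\<langle>-1\<rangle> a \<in> F r"
proof -
  let ?f = "\<lambda>t. sign (- 1 + int t + 1) \<cdot> dpow t (b\<langle>- 1 + int t\<rangle> a)"
  have "eventually_zero (\<lambda>t. b\<langle>- 1 + int t\<rangle> a)"
    using truncation_nat[of b "-1" a] unfolding eventually_zero_def .
  then have "eventually_zero ?f"
    by (rule eventually_zero_compose) simp
  then have "a\<langle>-1\<rangle> b = ?f 0 + Sum_any (\<lambda>t. ?f (Suc t))"
    unfolding skew_symmetry_Sum_any[of a "-1" b] by (rule Sum_any_Suc)
  then have "a\<langle>-1\<rangle> b - b\<langle>-1\<rangle> a = Sum_any (\<lambda>t. ?f (Suc t))"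
    by simp
  also have "\<dots> \<in> F r"
  proof (intro subspace_Sum_any F_subspace F_scale)
    fix t
    have "b\<langle>- 1 + int (Suc t)\<rangle> a \<in> F (nat (int p + int q - int t))"
      using assms(2,1) by (rule F_mode) auto
    then have "dpow (Suc t) (b\<langle>- 1 + int (Suc t)\<rangle> a) \<in> F (nat (int p + int q - int t) + Suc t)"
      by (rule F_dpow)
    then show "dpow (Suc t) (b\<langle>- 1 + int (Suc t)\<rangle> a) \<in> F r"
      by (rule F_antimonoD) (use assms(3) in auto)
  qed
  finally show ?thesis .
qed

text \<open>Apart from the leading term, \<open>normal_product_modes\<close> pairs an inner mode of
  index i \<ge> 0 with an outer mode of index -2 - i, a net gain of one step.\<close>

lemma F_associate:
  assumes "a \<in> F p" "b \<in> F q" "c \<in> F s" "r \<le> Suc (p + q + s)"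
  shows "(a\<langle>-1\<rangle> b)\<langle>-1\<rangle> c - a\<langle>-1\<rangle> (b\<langle>-1\<rangle> c) \<in> F r"
proof -
  let ?f = "\<lambda>i. a\<langle>- 1 - int i\<rangle> (b\<langle>- 1 + int i\<rangle> c)" and ?g = "\<lambda>i. b\<langle>- 1 - 1 - int i\<rangle> (a\<langle>int i\<rangle> c)"
  have f: "eventually_zero ?f" by (rule eventually_zero_modes)
  have g: "eventually_zero ?g" using eventually_zero_modes(1)[of b "\<lambda>i. - 1 - 1 - int i" a 0 c] by simp
  have "(a\<langle>-1\<rangle> b)\<langle>-1\<rangle> c = Sum_any ?f + Sum_any ?g"
    unfolding normal_product_modes by (rule Sum_any_add[OF f g])
  also have "Sum_any ?f = ?f 0 + Sum_any (\<lambda>i. ?f (Suc i))"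
    by (rule Sum_any_Suc[OF f])
  finally have "(a\<langle>-1\<rangle> b)\<langle>-1\<rangle> c - a\<langle>-1\<rangle> (b\<langle>-1\<rangle> c) = Sum_any (\<lambda>i. ?f (Suc i)) + Sum_any ?g"
    by simp
  also have "\<dots> \<in> F r"
  proof (intro F_add subspace_Sum_any F_subspace)
    fix i
    have "b\<langle>- 1 + int (Suc i)\<rangle> c \<in> F (nat (int q + int s - int i))"
      using assms(2,3) by (rule F_mode) auto
    with assms(1) show "?f (Suc i) \<in> F r"
      by (rule F_mode) (use assms(4) in auto)
    have "a\<langle>int i\<rangle> c \<in> F (nat (int p + int s - int i))"
      using assms(1,3) by (rule F_mode) auto
    with assms(2) show "?g i \<in> F r"
      by (rule F_mode) (use assms(4) in auto)
  qed
  finally show ?thesis .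
qed

text \<open>A monomial of positive order has a differentiated factor. If it is the leading one, the
  monomial is a multiple of some a_(-2-k) x and lies in \<open>C2\<close>; otherwise stability of
  \<open>C2\<close> under a_(-1) reduces to the tail.\<close>

lemma C2_eq_F: "C2 V = F 1"
proof
  have "{a\<langle>-2\<rangle> b |a b. True} \<subseteq> F 1"
  proof clarify
    fix a b
    show "a\<langle>-2\<rangle> b \<in> F 1" by (rule F_mode[OF F_0 F_0]) simp
  qed
  then show "C2 V \<subseteq> F 1"
    unfolding C2_def va_span_def by (rule vs.span_minimal) (rule F_subspace)
  have sub: "vs.subspace (C2 V)"
    unfolding C2_def va_span_def by (rule vs.subspace_span)
  have mode: "a\<langle>- 2 - int k\<rangle> b \<in> C2 V" for a b k
  proof -
    have "(dpow k a)\<langle>-2\<rangle> b \<in> C2 V"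
      unfolding C2_def va_span_def by (rule vs.span_base) blast
    moreover have "(dpow k a)\<langle>-2\<rangle> b = ((-1) ^ k * (of_int (-2) gchoose k)) \<cdot> a\<langle>- 2 - int k\<rangle> b"
      by (rule dpow_left)
    \<comment> \<open>The scalar is k + 1 and hence nonzero, so a_(-2-k) b is recovered from the
      generator built from \<open>dpow k a\<close>.\<close>
    moreover have "(-1) ^ k * ((of_int (-2) :: complex) gchoose k) = of_nat (Suc k)"
      using gbinomial_minus[of "2::complex" k] binomial_symmetric[of k "Suc k"]
        binomial_gbinomial[of "Suc k" k, where 'a = complex]
      by (simp add: add.commute flip: power_add mult_2)
    ultimately have "of_nat (Suc k) \<cdot> a\<langle>- 2 - int k\<rangle> b \<in> C2 V" by simp
    then have "(1 / of_nat (Suc k)) \<cdot> of_nat (Suc k) \<cdot> a\<langle>- 2 - int k\<rangle> b \<in> C2 V"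
      by (rule vs.subspace_scale[OF sub])
    then show ?thesis by (simp del: of_nat_Suc)
  qed
  have stable: "a\<langle>-1\<rangle> x \<in> C2 V" if "x \<in> C2 V" for a x
    using that unfolding C2_def va_span_def
  proof (rule vs.span_induct)
    show "vs.subspace {x. a\<langle>-1\<rangle> x \<in> vs.span {a\<langle>-2\<rangle> b |a b. True}}"
      by (auto simp: vs.subspace_def vs.span_add vs.span_scale vs.span_zero)
    fix x assume "x \<in> {a\<langle>-2\<rangle> b |a b. True}"
    then obtain b c where x: "x = b\<langle>-2\<rangle> c" by blast
    have "a\<langle>-1\<rangle> (b\<langle>-2\<rangle> c) = b\<langle>-2\<rangle> (a\<langle>-1\<rangle> c) + Sum_any (\<lambda>i. (of_int (-1) gchoose i) \<cdot> (a\<langle>int i\<rangle> b)\<langle>- 1 + - 2 - int i\<rangle> c)"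
      using commutator_formula[of a "-1" b "-2" c] by (simp add: algebra_simps)
    moreover have "(a\<langle>int i\<rangle> b)\<langle>- 1 + - 2 - int i\<rangle> c \<in> C2 V" for i
    proof -
      have "- 2 - int (Suc i) = - 1 + - 2 - int i" by simp
      then show ?thesis using mode[of "a\<langle>int i\<rangle> b" "Suc i" c] by (simp only:)
    qed
    then have "Sum_any (\<lambda>i. (of_int (-1) gchoose i) \<cdot> (a\<langle>int i\<rangle> b)\<langle>- 1 + - 2 - int i\<rangle> c) \<in> C2 V"
      by (intro subspace_Sum_any sub vs.subspace_scale[OF sub])
    moreover have "b\<langle>-2\<rangle> (a\<langle>-1\<rangle> c) \<in> C2 V" using mode[of b 0] by simp
    ultimately show "a\<langle>-1\<rangle> x \<in> vs.span {a\<langle>-2\<rangle> b |a b. True}"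
      unfolding x using vs.subspace_add[OF sub] by (simp add: C2_def va_span_def)
  qed
  have "li_monomial q x \<Longrightarrow> q \<ge> 1 \<Longrightarrow> x \<in> C2 V" for q x
  proof (induction rule: li_monomial.induct)
    case (li_step q x k a)
    show ?case
    proof (cases k)
      case 0
      then show ?thesis using li_step stable by simp
    next
      case (Suc k')
      then have "- 1 - int k = - 2 - int k'" by simp
      then show ?thesis using mode[of a k' x] unfolding T_pow_normal_product
        by (intro vs.subspace_scale[OF sub]) (simp only:)
    qed
  qed simp
  then show "F 1 \<subseteq> C2 V"
    unfolding F_eq by (intro vs.span_minimal sub) auto
qed

end

section \<open>The associated graded algebra\<close>

text \<open>Operations on cosets are unions over all representatives; the union collapses as soon as
  the result does not depend on them.\<close>

lemma UN_const: "a \<in> X \<Longrightarrow> (\<And>x. x \<in> X \<Longrightarrow> g x = K) \<Longrightarrow> (\<Union>x\<in>X. g x) = K"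
  by auto

lemma UN_UN_const:
  assumes "\<And>x y. x \<in> X \<Longrightarrow> y \<in> Y \<Longrightarrow> g x y = K" "\<And>a. a \<in> h a" "X = h a" "Y = h b"
  shows "(\<Union>x\<in>X. \<Union>y\<in>Y. g x y) = K"
proof -
  have "a \<in> X" "b \<in> Y" using assms(2-4) by auto
  with assms(1) show ?thesis by auto
qed

context vertex_algebra
begin

lemma coset_iff: "y \<in> a +o F p \<longleftrightarrow> y - a \<in> F p"
  by (force simp: elt_set_plus_def algebra_simps)

lemma coset_eq_iff: "a +o F p = b +o F p \<longleftrightarrow> a - b \<in> F p"
proof
  assume "a +o F p = b +o F p"
  moreover have "a \<in> a +o F p" by (simp add: coset_iff)
  ultimately show "a - b \<in> F p" by (simp add: coset_iff)
next
  assume *: "a - b \<in> F p"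
  have "y - a \<in> F p \<longleftrightarrow> y - b \<in> F p" for y
    using F_add[OF _ *, of "y - a"] F_diff[OF _ *, of "y - b"] by auto
  then show "a +o F p = b +o F p" by (auto simp: coset_iff)
qed

lemma coset_zero: "0 +o F p = F p"
  by (auto simp: coset_iff)

lemma coset_add: "(a +o F p) + (b +o F p) = (a + b) +o F p"
proof -
  have "F p + F p = F p"
    by (force simp: set_plus_def intro: F_add)
  then show ?thesis by (simp add: set_plus_rearrange)
qed

lemma coset_scale: "(\<Union>x\<in>a +o F p. c \<cdot> x +o F p) = c \<cdot> a +o F p"
proof -
  have "c \<cdot> x +o F p = c \<cdot> a +o F p" if "x \<in> a +o F p" for x
    using that F_scale[of "x - a" p c] by (simp add: coset_iff coset_eq_iff vs.scale_right_diff_distrib)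
  moreover have "a \<in> a +o F p" by (simp add: coset_iff)
  ultimately show ?thesis by blast
qed

section \<open>The algebra R_V in terms of representatives\<close>

definition rcl :: "'v \<Rightarrow> 'v set" where "rcl a = a +o F 1"

lemma rcl_eq_iff: "rcl a = rcl b \<longleftrightarrow> a - b \<in> F 1"
  by (simp add: rcl_def coset_eq_iff)

lemma R_alg_simps:
  "carrier (R_alg V) = range rcl" "rcl a \<otimes>\<^bsub>R_alg V\<^esub> rcl b = rcl (a\<langle>-1\<rangle> b)"
  "rcl a \<oplus>\<^bsub>R_alg V\<^esub> rcl b = rcl (a + b)" "\<one>\<^bsub>R_alg V\<^esub> = rcl (vac V)" "\<zero>\<^bsub>R_alg V\<^esub> = rcl 0"
  "c \<odot>\<^bsub>R_alg V\<^esub> rcl a = rcl (c \<cdot> a)"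
proof -
  have "x\<langle>-1\<rangle> y +o F 1 = a\<langle>-1\<rangle> b +o F 1" if "x \<in> a +o F 1" "y \<in> b +o F 1" for x y
  proof -
    have "(x - a)\<langle>-1\<rangle> y + a\<langle>-1\<rangle> (y - b) \<in> F 1"
      using that F_add[OF F_mult[of "x - a" 1 y 0 1] F_mult[of a 0 "y - b" 1 1]] by (simp only: coset_iff) simp
    then show ?thesis by (simp add: coset_eq_iff)
  qed
  moreover have "a \<in> a +o F 1" for a by (simp add: coset_iff)
  ultimately show "rcl a \<otimes>\<^bsub>R_alg V\<^esub> rcl b = rcl (a\<langle>-1\<rangle> b)"
    unfolding R_alg_def rcl_def monoid.select_convs C2_eq_F by (rule UN_UN_const[where h = "\<lambda>a. a +o F 1"]) auto
  show "carrier (R_alg V) = range rcl"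
    by (auto simp: R_alg_def rcl_def C2_eq_F)
  show "rcl a \<oplus>\<^bsub>R_alg V\<^esub> rcl b = rcl (a + b)"
    by (simp only: R_alg_def ring.select_convs rcl_def coset_add)
  show "\<one>\<^bsub>R_alg V\<^esub> = rcl (vac V)"
    by (simp only: R_alg_def monoid.select_convs rcl_def C2_eq_F)
  show "\<zero>\<^bsub>R_alg V\<^esub> = rcl 0"
    by (simp only: R_alg_def ring.select_convs rcl_def C2_eq_F coset_zero)
  show "c \<odot>\<^bsub>R_alg V\<^esub> rcl a = rcl (c \<cdot> a)"
    by (simp only: R_alg_def module.select_convs rcl_def C2_eq_F coset_scale)
qed

lemma rcl_commute: "rcl (a\<langle>-1\<rangle> b) = rcl (b\<langle>-1\<rangle> a)"
  unfolding rcl_eq_iff by (rule F_commute[OF F_0 F_0]) simp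

lemma rcl_assoc: "rcl ((a\<langle>-1\<rangle> b)\<langle>-1\<rangle> c) = rcl (a\<langle>-1\<rangle> (b\<langle>-1\<rangle> c))"
  unfolding rcl_eq_iff by (rule F_associate[OF F_0 F_0 F_0]) simp

lemma R_alg_cring: "cring (R_alg V)"
proof (intro cringI abelian_groupI comm_monoidI)
  show "\<And>x. x \<in> carrier (R_alg V) \<Longrightarrow> \<exists>y\<in>carrier (R_alg V). y \<oplus>\<^bsub>R_alg V\<^esub> x = \<zero>\<^bsub>R_alg V\<^esub>"
  proof -
    fix x assume "x \<in> carrier (R_alg V)"
    then obtain a where "x = rcl a" by (auto simp: R_alg_simps)
    then show "\<exists>y\<in>carrier (R_alg V). y \<oplus>\<^bsub>R_alg V\<^esub> x = \<zero>\<^bsub>R_alg V\<^esub>"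
      by (intro bexI[of _ "rcl (- a)"]) (auto simp: R_alg_simps)
  qed
  fix x y assume "x \<in> carrier (R_alg V)" "y \<in> carrier (R_alg V)"
  then obtain a b where "x = rcl a" "y = rcl b" by (auto simp: R_alg_simps(1))
  then show "x \<otimes>\<^bsub>R_alg V\<^esub> y = y \<otimes>\<^bsub>R_alg V\<^esub> x"
    by (simp only: R_alg_simps) (rule rcl_commute)
qed (auto simp: R_alg_simps rcl_assoc vacuum add_ac)

text \<open>Elements of gr are handled through sequences of representatives: \<open>gcl\<close>
  takes classes, \<open>gr_rep\<close> says which sequences are admissible, \<open>conv\<close> and
  \<open>shift_der\<close> are product and derivation before passing to classes, and
  \<open>gcl (conc p a)\<close> is the symbol sigma_p(a).\<close>

definition gcl :: "(nat \<Rightarrow> 'v) \<Rightarrow> nat \<Rightarrow> 'v set" where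
  "gcl x p = x p +o F (Suc p)"

definition gr_rep :: "(nat \<Rightarrow> 'v) \<Rightarrow> bool" where
  "gr_rep x \<longleftrightarrow> (\<forall>p. x p \<in> F p) \<and> (\<exists>N. \<forall>p>N. x p = 0)"

definition conv :: "(nat \<Rightarrow> 'v) \<Rightarrow> (nat \<Rightarrow> 'v) \<Rightarrow> nat \<Rightarrow> 'v" where
  "conv x y n = (\<Sum>p\<le>n. x p\<langle>-1\<rangle> y (n - p))"

definition shift_der :: "(nat \<Rightarrow> 'v) \<Rightarrow> nat \<Rightarrow> 'v" where
  "shift_der x p = (case p of 0 \<Rightarrow> 0 | Suc q \<Rightarrow> T (x q))"

definition conc :: "nat \<Rightarrow> 'v \<Rightarrow> nat \<Rightarrow> 'v" where
  "conc p a q = (if q = p then a else 0)"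

lemma gcl_eq_iff: "gcl x = gcl y \<longleftrightarrow> (\<forall>p. x p - y p \<in> F (Suc p))"
  by (auto simp: gcl_def fun_eq_iff coset_eq_iff)

lemma gcl_eqI: "(\<And>p. x p - y p \<in> F (Suc p)) \<Longrightarrow> gcl x = gcl y"
  by (simp add: gcl_eq_iff)

lemma gr_repD: "gr_rep x \<Longrightarrow> x p \<in> F p"
  by (simp add: gr_rep_def)

lemma gr_rep_add: "gr_rep x \<Longrightarrow> gr_rep y \<Longrightarrow> gr_rep (\<lambda>p. x p + y p)"
proof -
  assume *: "gr_rep x" "gr_rep y"
  obtain N M where "\<forall>p>N. x p = 0" "\<forall>p>M. y p = 0" using * by (auto simp: gr_rep_def)
  then show ?thesis using * unfolding gr_rep_def
    by (intro conjI allI F_add exI[of _ "max N M"]) auto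
qed

lemma gr_rep_scale: "gr_rep x \<Longrightarrow> gr_rep (\<lambda>p. c \<cdot> x p)"
  unfolding gr_rep_def by (auto simp: F_scale)

lemma gr_rep_neg: "gr_rep x \<Longrightarrow> gr_rep (\<lambda>p. - x p)"
  unfolding gr_rep_def by (auto simp: F_neg)

lemma gr_rep_zero: "gr_rep (\<lambda>p. 0)"
  unfolding gr_rep_def by auto

lemma gr_rep_conc: "a \<in> F p \<Longrightarrow> gr_rep (conc p a)"
  unfolding gr_rep_def conc_def by (auto intro!: exI[of _ p])

lemma gr_rep_conv: "gr_rep x \<Longrightarrow> gr_rep y \<Longrightarrow> gr_rep (conv x y)"
proof -
  assume *: "gr_rep x" "gr_rep y"
  obtain N M where NM: "\<forall>p>N. x p = 0" "\<forall>p>M. y p = 0" using * by (auto simp: gr_rep_def)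
  have "x p\<langle>-1\<rangle> y (n - p) = 0" if "n > N + M" for n p
  proof (cases "p > N")
    case False
    then have "n - p > M" using that by auto
    then show ?thesis using NM by simp
  qed (use NM in simp)
  then have "\<forall>n>N + M. conv x y n = 0" by (auto simp: conv_def intro: sum.neutral)
  moreover have "conv x y n \<in> F n" for n
    unfolding conv_def by (intro F_sum F_mult[OF gr_repD[OF *(1)] gr_repD[OF *(2)]]) auto
  ultimately show ?thesis unfolding gr_rep_def by blast
qed

lemma gr_rep_shift_der: "gr_rep x \<Longrightarrow> gr_rep (shift_der x)"
proof -
  assume *: "gr_rep x"
  obtain N where "\<forall>p>N. x p = 0" using * by (auto simp: gr_rep_def)
  then have "\<forall>p>Suc N. shift_der x p = 0" by (auto simp: shift_der_def split: nat.split)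
  moreover have "shift_der x p \<in> F p" for p
    using F_T[OF gr_repD[OF *]] by (auto simp: shift_der_def split: nat.split)
  ultimately show ?thesis unfolding gr_rep_def by blast
qed

lemma gr_carrier: "carrier (gr_alg V) = gcl ` Collect gr_rep"
proof (intro equalityI subsetI)
  fix \<xi> assume "\<xi> \<in> carrier (gr_alg V)"
  then have 1: "\<forall>p. \<exists>a\<in>F p. \<xi> p = a +o F (Suc p)" and 2: "finite {p. \<xi> p \<noteq> F (Suc p)}"
    by (auto simp: gr_alg_def Let_def)
  from 1 obtain a where a: "\<And>p. a p \<in> F p" "\<And>p. \<xi> p = a p +o F (Suc p)" by metis
  define x where "x p = (if \<xi> p = F (Suc p) then 0 else a p)" for p
  obtain N where "\<forall>p\<in>{p. \<xi> p \<noteq> F (Suc p)}. p \<le> N" using finite_nat_set_iff_bounded_le 2 by blast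
  then have "\<forall>p>N. x p = 0" by (auto simp: x_def)
  moreover have "x p \<in> F p" for p using a(1) by (simp add: x_def)
  ultimately have "gr_rep x" unfolding gr_rep_def by blast
  moreover have "\<xi> = gcl x" using a(2) by (auto simp: fun_eq_iff gcl_def x_def coset_zero)
  ultimately show "\<xi> \<in> gcl ` Collect gr_rep" by blast
next
  fix \<xi> assume "\<xi> \<in> gcl ` Collect gr_rep"
  then obtain x where x: "gr_rep x" "\<xi> = gcl x" by blast
  obtain N where "\<forall>p>N. x p = 0" using x by (auto simp: gr_rep_def)
  then have "{p. gcl x p \<noteq> F (Suc p)} \<subseteq> {..N}" by (auto simp: gcl_def coset_zero not_less[symmetric])
  then have "finite {p. gcl x p \<noteq> F (Suc p)}" by (rule finite_subset) auto
  then show "\<xi> \<in> carrier (gr_alg V)"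
    using x by (auto simp: gr_alg_def Let_def gcl_def gr_rep_def)
qed

lemma gr_carrierI: "gr_rep x \<Longrightarrow> gcl x \<in> carrier (gr_alg V)"
  by (auto simp: gr_carrier)

lemma gr_carrierE:
  assumes "\<xi> \<in> carrier (gr_alg V)"
  obtains x where "gr_rep x" "\<xi> = gcl x"
  using assms by (auto simp: gr_carrier)

lemma gr_add: "gcl x \<oplus>\<^bsub>gr_alg V\<^esub> gcl y = gcl (\<lambda>p. x p + y p)"
proof
  fix p
  show "(gcl x \<oplus>\<^bsub>gr_alg V\<^esub> gcl y) p = gcl (\<lambda>p. x p + y p) p"
    by (simp only: gr_alg_def Let_def ring.select_convs gcl_def coset_add)
qed

lemma gr_zero: "\<zero>\<^bsub>gr_alg V\<^esub> = gcl (\<lambda>p. 0)"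
proof
  fix p
  show "\<zero>\<^bsub>gr_alg V\<^esub> p = gcl (\<lambda>p. 0) p"
    by (simp only: gr_alg_def Let_def ring.select_convs gcl_def coset_zero)
qed

lemma gr_one: "\<one>\<^bsub>gr_alg V\<^esub> = gcl (conc 0 (vac V))"
proof
  fix p
  show "\<one>\<^bsub>gr_alg V\<^esub> p = gcl (conc 0 (vac V)) p"
  proof (cases p)
    case 0
    then show ?thesis
      by (simp only: gr_alg_def Let_def monoid.select_convs gcl_def conc_def if_True One_nat_def refl)
  next
    case (Suc q)
    then show ?thesis
      by (simp only: gr_alg_def Let_def monoid.select_convs gcl_def conc_def nat.distinct if_False coset_zero)
  qed
qed

lemma gr_smult: "c \<odot>\<^bsub>gr_alg V\<^esub> gcl x = gcl (\<lambda>p. c \<cdot> x p)"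
proof
  fix p
  show "(c \<odot>\<^bsub>gr_alg V\<^esub> gcl x) p = gcl (\<lambda>p. c \<cdot> x p) p"
    by (simp only: gr_alg_def Let_def module.select_convs gcl_def coset_scale)
qed

lemma gr_der_gcl: "gr_der V (gcl x) = gcl (shift_der x)"
proof
  fix p
  show "gr_der V (gcl x) p = gcl (shift_der x) p"
  proof (cases p)
    case 0
    then show ?thesis by (simp add: gr_der_def gcl_def shift_der_def coset_zero)
  next
    case (Suc q)
    have "T y +o F (Suc p) = T (x q) +o F (Suc p)" if "y \<in> x q +o F p" for y
      using that F_T[of "y - x q" p] by (simp add: coset_iff coset_eq_iff)
    moreover have "x q \<in> x q +o F p" by (simp add: coset_iff)
    ultimately have "(\<Union>y\<in>x q +o F (Suc q). T y +o F (Suc p)) = T (x q) +o F (Suc p)"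
      unfolding Suc by (rule UN_const[rotated])
    then show ?thesis
      unfolding gr_der_def gcl_def Suc by (simp only: Let_def nat.case shift_der_def)
  qed
qed

lemma gr_mult:
  assumes "gr_rep x" "gr_rep y"
  shows "gcl x \<otimes>\<^bsub>gr_alg V\<^esub> gcl y = gcl (conv x y)"
proof
  fix n
  have "(gcl x \<otimes>\<^bsub>gr_alg V\<^esub> gcl y) n = {(\<Sum>p\<le>n. x' p\<langle>-1\<rangle> y' (n - p)) + z |x' y' z.
      (\<forall>p. x' p \<in> gcl x p \<and> y' p \<in> gcl y p) \<and> z \<in> F (Suc n)}"
    by (simp only: gr_alg_def Let_def monoid.select_convs)
  also have "\<dots> = gcl (conv x y) n"
  proof (intro equalityI subsetI)
    fix u assume "u \<in> {(\<Sum>p\<le>n. x' p\<langle>-1\<rangle> y' (n - p)) + z |x' y' z.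
      (\<forall>p. x' p \<in> gcl x p \<and> y' p \<in> gcl y p) \<and> z \<in> F (Suc n)}"
    then obtain x' y' z where u: "u = (\<Sum>p\<le>n. x' p\<langle>-1\<rangle> y' (n - p)) + z"
      and x': "\<And>p. x' p - x p \<in> F (Suc p)" and y': "\<And>p. y' p - y p \<in> F (Suc p)" and z: "z \<in> F (Suc n)"
      by (auto simp: gcl_def coset_iff)
    have y'F: "y' p \<in> F p" for p
      using F_add[OF F_antimonoD[OF y'[of p]] gr_repD[OF assms(2)], of p] by simp
    have "x' p\<langle>-1\<rangle> y' (n - p) - x p\<langle>-1\<rangle> y (n - p) \<in> F (Suc n)" if "p \<le> n" for p
    proof -
      have "x' p\<langle>-1\<rangle> y' (n - p) - x p\<langle>-1\<rangle> y (n - p) =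
          (x' p - x p)\<langle>-1\<rangle> y' (n - p) + x p\<langle>-1\<rangle> (y' (n - p) - y (n - p))"
        by simp
      also have "\<dots> \<in> F (Suc n)"
        by (intro F_add F_mult[OF x' y'F] F_mult[OF gr_repD[OF assms(1)] y']) (use that in auto)
      finally show ?thesis .
    qed
    then have "(\<Sum>p\<le>n. x' p\<langle>-1\<rangle> y' (n - p) - x p\<langle>-1\<rangle> y (n - p)) \<in> F (Suc n)"
      by (intro F_sum) auto
    from F_add[OF this z] show "u \<in> gcl (conv x y) n"
      by (simp add: gcl_def coset_iff conv_def u sum_subtractf algebra_simps)
  next
    fix u assume "u \<in> gcl (conv x y) n"
    then have "u - conv x y n \<in> F (Suc n)" by (simp add: gcl_def coset_iff)
    moreover have "u = (\<Sum>p\<le>n. x p\<langle>-1\<rangle> y (n - p)) + (u - conv x y n)" by (simp add: conv_def)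
    moreover have "x p \<in> gcl x p" "y p \<in> gcl y p" for p by (auto simp: gcl_def coset_iff)
    ultimately show "u \<in> {(\<Sum>p\<le>n. x' p\<langle>-1\<rangle> y' (n - p)) + z |x' y' z.
      (\<forall>p. x' p \<in> gcl x p \<and> y' p \<in> gcl y p) \<and> z \<in> F (Suc n)}" by blast
  qed
  finally show "(gcl x \<otimes>\<^bsub>gr_alg V\<^esub> gcl y) n = gcl (conv x y) n" .
qed

lemma conv_commute:
  assumes "gr_rep x" "gr_rep y"
  shows "gcl (conv x y) = gcl (conv y x)"
proof (rule gcl_eqI)
  fix n
  have "conv y x n = (\<Sum>p\<le>n. y (n - p)\<langle>-1\<rangle> x p)"
    unfolding conv_def by (rule sum.reindex_bij_witness[of _ "\<lambda>p. n - p" "\<lambda>p. n - p"]) auto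
  then have "conv x y n - conv y x n = (\<Sum>p\<le>n. x p\<langle>-1\<rangle> y (n - p) - y (n - p)\<langle>-1\<rangle> x p)"
    by (simp add: conv_def sum_subtractf)
  also have "\<dots> \<in> F (Suc n)"
    by (intro F_sum F_commute[OF gr_repD[OF assms(1)] gr_repD[OF assms(2)]]) auto
  finally show "conv x y n - conv y x n \<in> F (Suc n)" .
qed

lemma conv_assoc:
  assumes "gr_rep x" "gr_rep y" "gr_rep z"
  shows "gcl (conv (conv x y) z) = gcl (conv x (conv y z))"
proof (rule gcl_eqI)
  fix n
  let ?l = "\<lambda>i j k. (x i\<langle>-1\<rangle> y j)\<langle>-1\<rangle> z k" and ?r = "\<lambda>i j k. x i\<langle>-1\<rangle> (y j\<langle>-1\<rangle> z k)"
  have "conv (conv x y) z n = (\<Sum>j=0..n. \<Sum>i=0..j. ?l i (j - i) (n - j))"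
    by (simp add: conv_def mode_left_sum atMost_atLeast0)
  \<comment> \<open>The same interchange of indices as for the product of three power
    series.\<close>
  also have "\<dots> = (\<Sum>j=0..n. \<Sum>i=0..n - j. ?l j i (n - j - i))"
    by (rule fps_mult_assoc_lemma)
  finally have 1: "conv (conv x y) z n = (\<Sum>j=0..n. \<Sum>i=0..n - j. ?l j i (n - j - i))" .
  have 2: "conv x (conv y z) n = (\<Sum>j=0..n. \<Sum>i=0..n - j. ?r j i (n - j - i))"
    by (simp add: conv_def mode_right_sum atMost_atLeast0)
  have "conv (conv x y) z n - conv x (conv y z) n =
      (\<Sum>j=0..n. \<Sum>i=0..n - j. ?l j i (n - j - i) - ?r j i (n - j - i))"
    unfolding 1 2 by (simp add: sum_subtractf)
  also have "\<dots> \<in> F (Suc n)"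
    by (intro F_sum F_associate[OF gr_repD[OF assms(1)] gr_repD[OF assms(2)] gr_repD[OF assms(3)]]) auto
  finally show "conv (conv x y) z n - conv x (conv y z) n \<in> F (Suc n)" .
qed

lemma conv_conc: "conv (conc p a) (conc q b) = conc (p + q) (a\<langle>-1\<rangle> b)"
proof
  fix n
  have "conv (conc p a) (conc q b) n = (\<Sum>i\<le>n. if i = p then a\<langle>-1\<rangle> conc q b (n - p) else 0)"
    unfolding conv_def by (rule sum.cong) (auto simp: conc_def)
  also have "\<dots> = (if p \<le> n then a\<langle>-1\<rangle> conc q b (n - p) else 0)" by simp
  also have "\<dots> = conc (p + q) (a\<langle>-1\<rangle> b) n" by (auto simp: conc_def)
  finally show "conv (conc p a) (conc q b) n = conc (p + q) (a\<langle>-1\<rangle> b) n" .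
qed

lemma conv_one: "conv (conc 0 (vac V)) x = x"
proof
  fix n
  have "conv (conc 0 (vac V)) x n = (\<Sum>i\<le>n. if i = 0 then x n else 0)"
    unfolding conv_def by (rule sum.cong) (auto simp: conc_def vacuum)
  then show "conv (conc 0 (vac V)) x n = x n" by simp
qed

lemma conv_add_left: "conv (\<lambda>p. x p + y p) z = (\<lambda>p. conv x z p + conv y z p)"
  by (simp add: conv_def sum.distrib fun_eq_iff)

lemma gr_cring: "cring (gr_alg V)"
proof (intro cringI abelian_groupI comm_monoidI)
  fix x y z assume "x \<in> carrier (gr_alg V)" "y \<in> carrier (gr_alg V)" "z \<in> carrier (gr_alg V)"
  then obtain a b c where [simp]: "gr_rep a" "gr_rep b" "gr_rep c" and xyz: "x = gcl a" "y = gcl b" "z = gcl c"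
    by (elim gr_carrierE)
  show "x \<oplus>\<^bsub>gr_alg V\<^esub> y \<in> carrier (gr_alg V)"
    unfolding xyz gr_add by (intro gr_carrierI gr_rep_add) simp_all
  show "x \<oplus>\<^bsub>gr_alg V\<^esub> y \<oplus>\<^bsub>gr_alg V\<^esub> z = x \<oplus>\<^bsub>gr_alg V\<^esub> (y \<oplus>\<^bsub>gr_alg V\<^esub> z)"
    by (simp only: xyz gr_add add.assoc)
  show "x \<oplus>\<^bsub>gr_alg V\<^esub> y = y \<oplus>\<^bsub>gr_alg V\<^esub> x"
    by (simp only: xyz gr_add add.commute)
  show "\<zero>\<^bsub>gr_alg V\<^esub> \<oplus>\<^bsub>gr_alg V\<^esub> x = x"
    by (simp only: xyz gr_add gr_zero add_0_left)
  show "\<exists>y\<in>carrier (gr_alg V). y \<oplus>\<^bsub>gr_alg V\<^esub> x = \<zero>\<^bsub>gr_alg V\<^esub>"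
    unfolding xyz by (intro bexI[of _ "gcl (\<lambda>p. - a p)"] gr_carrierI gr_rep_neg) (simp_all add: gr_add gr_zero)
  show "x \<otimes>\<^bsub>gr_alg V\<^esub> y \<in> carrier (gr_alg V)"
    unfolding xyz by (subst gr_mult) (simp_all add: gr_carrierI gr_rep_conv)
  show "x \<otimes>\<^bsub>gr_alg V\<^esub> y \<otimes>\<^bsub>gr_alg V\<^esub> z = x \<otimes>\<^bsub>gr_alg V\<^esub> (y \<otimes>\<^bsub>gr_alg V\<^esub> z)"
    by (simp add: xyz gr_mult gr_rep_conv conv_assoc)
  show "x \<otimes>\<^bsub>gr_alg V\<^esub> y = y \<otimes>\<^bsub>gr_alg V\<^esub> x"
    unfolding xyz by (subst (1 2) gr_mult) (auto intro: conv_commute)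
  show "\<one>\<^bsub>gr_alg V\<^esub> \<otimes>\<^bsub>gr_alg V\<^esub> x = x"
    by (simp add: xyz gr_one gr_mult gr_rep_conc conv_one)
  show "(x \<oplus>\<^bsub>gr_alg V\<^esub> y) \<otimes>\<^bsub>gr_alg V\<^esub> z = x \<otimes>\<^bsub>gr_alg V\<^esub> z \<oplus>\<^bsub>gr_alg V\<^esub> y \<otimes>\<^bsub>gr_alg V\<^esub> z"
    by (simp add: xyz gr_add gr_mult gr_rep_add conv_add_left)
qed (simp_all add: gr_zero gr_one gr_carrierI gr_rep_zero gr_rep_conc)

lemma shift_der_conv: "shift_der (conv x y) = (\<lambda>p. conv (shift_der x) y p + conv x (shift_der y) p)"
proof
  fix p
  show "shift_der (conv x y) p = conv (shift_der x) y p + conv x (shift_der y) p"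
  proof (cases p)
    case 0
    then show ?thesis by (simp add: shift_der_def conv_def)
  next
    case (Suc n)
    have 1: "conv (shift_der x) y (Suc n) = (\<Sum>p\<le>n. (T (x p))\<langle>-1\<rangle> y (n - p))"
      unfolding conv_def by (subst sum.atMost_Suc_shift) (simp add: shift_der_def)
    have 2: "conv x (shift_der y) (Suc n) = (\<Sum>p\<le>n. x p\<langle>-1\<rangle> (T (y (n - p))))"
      unfolding conv_def by (simp add: shift_der_def Suc_diff_le)
    show ?thesis
      unfolding Suc 1 2 by (simp add: shift_der_def conv_def T_sum T_derivation sum.distrib)
  qed
qed

lemma shift_der_conc: "shift_der (conc p a) = conc (Suc p) (T a)"
proof
  fix q
  show "shift_der (conc p a) q = conc (Suc p) (T a) q"
    by (cases q) (simp_all add: shift_der_def conc_def)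
qed

lemma gr_der_conc: "gr_der V (gcl (conc p a)) = gcl (conc (Suc p) (T a))"
proof -
  have 1: "gr_der V (gcl (conc p a)) = gcl (shift_der (conc p a))" by (rule gr_der_gcl)
  show ?thesis unfolding 1 shift_der_conc by (rule refl)
qed

lemma gr_der_pow_conc: "(gr_der V ^^ k) (gcl (conc p a)) = gcl (conc (k + p) ((T ^^ k) a))"
proof (induction k)
  case (Suc k)
  then show ?case by (simp only: funpow.simps comp_apply gr_der_conc add_Suc)
qed (simp only: funpow.simps id_apply add_0)

lemma gr_mult_conc:
  assumes "a \<in> F p" "b \<in> F q"
  shows "gcl (conc p a) \<otimes>\<^bsub>gr_alg V\<^esub> gcl (conc q b) = gcl (conc (p + q) (a\<langle>-1\<rangle> b))"
proof -
  have 1: "gr_rep (conc p a)" using assms(1) by (rule gr_rep_conc)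
  have 2: "gr_rep (conc q b)" using assms(2) by (rule gr_rep_conc)
  have 3: "gcl (conc p a) \<otimes>\<^bsub>gr_alg V\<^esub> gcl (conc q b) = gcl (conv (conc p a) (conc q b))" using 1 2 by (rule gr_mult)
  show ?thesis unfolding 3 conv_conc by (rule refl)
qed

lemma gr_add_conc: "gcl (conc p a) \<oplus>\<^bsub>gr_alg V\<^esub> gcl (conc p b) = gcl (conc p (a + b))"
proof -
  have "(\<lambda>q. conc p a q + conc p b q) = conc p (a + b)"
    by (rule ext) (simp add: conc_def)
  then show ?thesis by (simp only: gr_add)
qed

lemma gr_smult_conc: "c \<odot>\<^bsub>gr_alg V\<^esub> gcl (conc p a) = gcl (conc p (c \<cdot> a))"
proof -
  have "(\<lambda>q. c \<cdot> conc p a q) = conc p (c \<cdot> a)"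
    by (rule ext) (simp add: conc_def)
  then show ?thesis by (simp only: gr_smult)
qed

lemma gcl_conc_eq_zero: "a \<in> F (Suc p) \<Longrightarrow> gcl (conc p a) = \<zero>\<^bsub>gr_alg V\<^esub>"
proof -
  assume "a \<in> F (Suc p)"
  then have "conc p a q - 0 \<in> F (Suc q)" for q by (simp add: conc_def)
  then show ?thesis unfolding gr_zero by (rule gcl_eqI)
qed

lemma R_in_gr_rcl: "R_in_gr V (rcl a) = gcl (conc 0 a)"
proof
  fix p
  show "R_in_gr V (rcl a) p = gcl (conc 0 a) p"
    by (simp add: R_in_gr_def rcl_def gcl_def conc_def coset_zero)
qed

text \<open>gr is generated by its degree 0 part as a differential algebra: the symbol of a Li
  monomial is the product of iterated derivatives of the degree 0 symbols of its factors. This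
  yields the surjectivity of Phi.\<close>

lemma gr_generated:
  assumes sub: "S \<subseteq> carrier (gr_alg V)"
    and R: "\<And>a. gcl (conc 0 a) \<in> S"
    and add: "\<And>x y. x \<in> S \<Longrightarrow> y \<in> S \<Longrightarrow> x \<oplus>\<^bsub>gr_alg V\<^esub> y \<in> S"
    and mult: "\<And>x y. x \<in> S \<Longrightarrow> y \<in> S \<Longrightarrow> x \<otimes>\<^bsub>gr_alg V\<^esub> y \<in> S"
    and smult: "\<And>c x. x \<in> S \<Longrightarrow> c \<odot>\<^bsub>gr_alg V\<^esub> x \<in> S"
    and der: "\<And>x. x \<in> S \<Longrightarrow> gr_der V x \<in> S"
  shows "S = carrier (gr_alg V)"
proof -
  have zero: "\<zero>\<^bsub>gr_alg V\<^esub> \<in> S"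
    unfolding gcl_conc_eq_zero[OF F_0I, of 0, symmetric] by (rule R)
  have derk: "(gr_der V ^^ k) x \<in> S" if "x \<in> S" for k x
  proof (induction k)
    case (Suc k)
    then show ?case unfolding funpow.simps comp_apply by (rule der)
  qed (unfold funpow.simps id_apply, rule that)
  have mon: "li_monomial q x \<Longrightarrow> gcl (conc q x) \<in> S" for q x
  proof (induction rule: li_monomial.induct)
    case (li_step q x k a)
    have "gcl (conc (k + 0) ((T ^^ k) a)) \<in> S"
      unfolding gr_der_pow_conc[symmetric] by (rule derk[OF R])
    then have "gcl (conc k ((T ^^ k) a)) \<in> S" by (simp only: add_0_right)
    then have "gcl (conc k ((T ^^ k) a)) \<otimes>\<^bsub>gr_alg V\<^esub> gcl (conc q x) \<in> S"
      using li_step.IH by (rule mult)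
    moreover have "(T ^^ k) a \<in> F k" using F_dpow[OF F_0, of k a] by (simp add: T_pow_dpow F_scale)
    moreover have "x \<in> F q" using li_step.hyps by (auto intro: li_monomial_in_F)
    ultimately show ?case by (simp only: gr_mult_conc)
  qed (rule R)
  have comp: "gcl (conc p x) \<in> S" if "x \<in> F p" for p x
    using that
  proof (induction rule: F_induct)
    case (base q x)
    show ?case
    proof (cases "q = p")
      case False
      then have "x \<in> F (Suc p)" using base by (auto intro: li_monomial_in_F)
      then show ?thesis using zero by (simp add: gcl_conc_eq_zero)
    qed (use mon base in simp)
  next
    case zero
    then show ?case using \<open>\<zero>\<^bsub>gr_alg V\<^esub> \<in> S\<close> gcl_conc_eq_zero[of 0 p] by simp
  next
    case (add x y)
    from assms(3)[OF add] show ?case by (simp only: gr_add_conc)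
  next
    case (scale c x)
    from smult[OF scale] show ?case by (simp only: gr_smult_conc)
  qed
  have "gcl x \<in> S" if "gr_rep x" "\<forall>p\<ge>N. x p = 0" for x N
    using that
  proof (induction N arbitrary: x)
    case 0
    then have "x = (\<lambda>p. 0)" by auto
    then show ?case using zero by (simp add: gr_zero)
  next
    case (Suc N)
    have "gcl (x(N := 0)) \<in> S"
    proof (rule Suc.IH)
      show "gr_rep (x(N := 0))"
        using Suc.prems(1) by (auto simp: gr_rep_def)
      show "\<forall>p\<ge>N. (x(N := 0)) p = 0" using Suc.prems(2) by auto
    qed
    moreover have "gcl (conc N (x N)) \<in> S" by (rule comp) (rule gr_repD[OF Suc.prems(1)])
    ultimately have "gcl (x(N := 0)) \<oplus>\<^bsub>gr_alg V\<^esub> gcl (conc N (x N)) \<in> S" by (rule add)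
    moreover have "(\<lambda>p. (x(N := 0)) p + conc N (x N) p) = x" by (auto simp: conc_def)
    ultimately show ?case by (simp only: gr_add)
  qed
  then have "gcl x \<in> S" if "gr_rep x" for x
    using that unfolding gr_rep_def by (metis Suc_le_eq)
  then show ?thesis using sub by (auto simp: gr_carrier)
qed

end

section \<open>Polynomial algebras and their derivations\<close>

abbreviation lk where "lk \<equiv> Poly_Mapping.lookup"
abbreviation ks where "ks \<equiv> Poly_Mapping.keys"
abbreviation sg where "sg \<equiv> Poly_Mapping.single"

definition pvar :: "nat \<times> nat \<Rightarrow> jet_poly" where "pvar v = sg (sg v 1) 1"

definition pconst :: "complex \<Rightarrow> jet_poly" where "pconst c = sg 0 c"

lemma poly_mapping_sum_single: "(\<Sum>m\<in>ks p. sg m (lk p m)) = p"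
proof (rule poly_mapping_eqI)
  fix k
  have "lk (\<Sum>m\<in>ks p. sg m (lk p m)) k = (\<Sum>m\<in>ks p. if m = k then lk p k else 0)"
    by (simp add: lookup_sum lookup_single when_def)
  then show "lk (\<Sum>m\<in>ks p. sg m (lk p m)) k = lk p k"
    by (simp add: in_keys_iff)
qed

lemma single_eq_const_mult: "sg m c = pconst c * sg m 1"
  by (simp add: pconst_def mult_single)

lemma pvar_power: "pvar v ^ n = sg (sg v n) 1"
  by (induction n) (simp_all add: pvar_def mult_single flip: single_add)

lemma single_eq_prod_pvar: "sg m 1 = (\<Prod>v\<in>ks m. pvar v ^ lk m v)"
proof -
  have "(\<Prod>v\<in>S. pvar v ^ lk m v) = sg (\<Sum>v\<in>S. sg v (lk m v)) 1" if "finite S" for S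
    using that by induction (simp_all add: pvar_power mult_single)
  then show ?thesis by (simp add: poly_mapping_sum_single)
qed

lemma poly_alg_simps [simp]:
  "carrier (poly_alg X) = {p. \<forall>m\<in>ks p. ks m \<subseteq> X}" "x \<otimes>\<^bsub>poly_alg X\<^esub> y = x * y" "\<one>\<^bsub>poly_alg X\<^esub> = 1"
  "\<zero>\<^bsub>poly_alg X\<^esub> = 0" "x \<oplus>\<^bsub>poly_alg X\<^esub> y = x + y" "c \<odot>\<^bsub>poly_alg X\<^esub> x = pconst c * x"
  by (simp_all add: poly_alg_def pconst_def)

definition in_vars :: "(nat \<times> nat) set \<Rightarrow> jet_poly \<Rightarrow> bool" where
  "in_vars X p \<longleftrightarrow> (\<forall>m\<in>ks p. ks m \<subseteq> X)"

lemma poly_carrier: "p \<in> carrier (poly_alg X) \<longleftrightarrow> in_vars X p"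
  by (simp add: in_vars_def)

declare poly_alg_simps(1) [simp del]

lemma carrier_poly_alg: "carrier (poly_alg X) = {p. in_vars X p}"
  by (auto simp: poly_carrier)

lemma in_vars_0 [simp]: "in_vars X 0" and in_vars_1 [simp]: "in_vars X 1"
  by (simp_all add: in_vars_def)

lemma in_vars_single: "ks m \<subseteq> X \<Longrightarrow> in_vars X (sg m c)"
  by (auto simp: in_vars_def)

lemma in_vars_pconst [simp]: "in_vars X (pconst c)"
  by (simp add: pconst_def in_vars_single)

lemma in_vars_pvar: "v \<in> X \<Longrightarrow> in_vars X (pvar v)"
  by (simp add: pvar_def in_vars_single)

lemma in_vars_add [simp]: "in_vars X p \<Longrightarrow> in_vars X q \<Longrightarrow> in_vars X (p + q)"
  unfolding in_vars_def using Poly_Mapping.keys_add[of p q] by blast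

lemma in_vars_uminus [simp]: "in_vars X p \<Longrightarrow> in_vars X (- p)"
  unfolding in_vars_def by (simp add: in_keys_iff)

lemma in_vars_diff [simp]: "in_vars X p \<Longrightarrow> in_vars X q \<Longrightarrow> in_vars X (p - q)"
  using in_vars_add[of X p "- q"] by simp

lemma in_vars_mult [simp]: 
  assumes "in_vars X p" "in_vars X q"
  shows "in_vars X (p * q)"
  unfolding in_vars_def
proof
  fix m assume "m \<in> ks (p * q)"
  then obtain a b where ab: "m = a + b" "a \<in> ks p" "b \<in> ks q" using keys_mult[of p q] by blast
  then have "ks m \<subseteq> ks a \<union> ks b" using Poly_Mapping.keys_add[of a b] by simp
  then show "ks m \<subseteq> X" using assms ab unfolding in_vars_def by blast
qed

lemma in_vars_power: "in_vars X p \<Longrightarrow> in_vars X (p ^ n)"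
  by (induction n) auto

lemma in_vars_mono: "in_vars X p \<Longrightarrow> X \<subseteq> Y \<Longrightarrow> in_vars Y p"
  unfolding in_vars_def by blast

lemma in_vars_induct [consumes 1, case_names const var add mult]:
  assumes "in_vars X p"
    and const: "\<And>c. P (pconst c)"
    and var: "\<And>v. v \<in> X \<Longrightarrow> P (pvar v)"
    and add: "\<And>p q. in_vars X p \<Longrightarrow> in_vars X q \<Longrightarrow> P p \<Longrightarrow> P q \<Longrightarrow> P (p + q)"
    and mult: "\<And>p q. in_vars X p \<Longrightarrow> in_vars X q \<Longrightarrow> P p \<Longrightarrow> P q \<Longrightarrow> P (p * q)"
  shows "P p"
proof -
  have one: "P 1" using const[of 1] by (simp add: pconst_def)
  have zero: "P 0" using const[of 0] by (simp add: pconst_def)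
  have pow: "P (pvar v ^ n)" if "v \<in> X" for v n
    by (induction n) (auto intro: one mult var that in_vars_pvar in_vars_power)
  have "in_vars X (\<Prod>v\<in>S. pvar v ^ lk m v) \<and> P (\<Prod>v\<in>S. pvar v ^ lk m v)" if "finite S" "S \<subseteq> X" for S and m :: "(nat \<times> nat) \<Rightarrow>\<^sub>0 nat"
    using that by (induction S) (auto intro!: one mult pow in_vars_mult in_vars_power intro: in_vars_pvar)
  then have "P (sg m c)" if "ks m \<subseteq> X" for m c
    using that by (subst single_eq_const_mult) (auto intro!: mult const simp: in_vars_single single_eq_prod_pvar)
  then have *: "in_vars X (sg m (lk p m)) \<and> P (sg m (lk p m))" if "m \<in> ks p" for m
    using assms(1) that by (auto simp: in_vars_def intro: in_vars_single)
  have "in_vars X (\<Sum>m\<in>S. sg m (lk p m)) \<and> P (\<Sum>m\<in>S. sg m (lk p m))" if "finite S" "S \<subseteq> ks p" for S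
    using that by (induction S) (use * in \<open>auto intro: zero add\<close>)
  from this[of "ks p"] show ?thesis by (simp add: poly_mapping_sum_single)
qed

lemma poly_alg_cring: "cring (poly_alg X)"
proof (intro cringI abelian_groupI comm_monoidI)
  fix x assume "x \<in> carrier (poly_alg X)"
  then show "\<exists>y\<in>carrier (poly_alg X). y \<oplus>\<^bsub>poly_alg X\<^esub> x = \<zero>\<^bsub>poly_alg X\<^esub>"
    by (intro bexI[of _ "- x"]) (simp_all add: poly_carrier)
qed (simp_all add: poly_carrier algebra_simps)

text \<open>The derivation over the complex numbers with the prescribed value \<open>g v\<close> on
  each variable v. \<open>jet_der\<close>, the Euler derivations and the partial derivative used
  below are all of this form.\<close>

definition deriv_along :: "(nat \<times> nat \<Rightarrow> jet_poly) \<Rightarrow> jet_poly \<Rightarrow> jet_poly" where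
  "deriv_along g p = (\<Sum>m\<in>ks p. \<Sum>v\<in>ks m. sg (m - sg v 1) (of_nat (lk m v) * lk p m) * g v)"

lemma deriv_along_superset:
  assumes "finite S" "ks p \<subseteq> S"
  shows "deriv_along g p = (\<Sum>m\<in>S. \<Sum>v\<in>ks m. sg (m - sg v 1) (of_nat (lk m v) * lk p m) * g v)"
  unfolding deriv_along_def
  by (rule sum.mono_neutral_left) (use assms in \<open>auto simp: in_keys_iff\<close>)

lemma deriv_along_add: "deriv_along g (p + q) = deriv_along g p + deriv_along g q"
proof -
  have "ks (p + q) \<subseteq> ks p \<union> ks q" by (rule Poly_Mapping.keys_add)
  then show ?thesis
    by (subst (1 2 3) deriv_along_superset[of "ks p \<union> ks q"])
      (auto simp: lookup_add distrib_left distrib_right single_add sum.distrib)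
qed

lemma deriv_along_0 [simp]: "deriv_along g 0 = 0"
  by (simp add: deriv_along_def)

lemma deriv_along_sum: "deriv_along g (sum f A) = (\<Sum>i\<in>A. deriv_along g (f i))"
  by (induction A rule: infinite_finite_induct) (simp_all add: deriv_along_add)

lemma deriv_along_uminus: "deriv_along g (- p) = - deriv_along g p"
  using deriv_along_add[of g p "- p"] by (simp add: eq_neg_iff_add_eq_0 add.commute)

lemma deriv_along_diff: "deriv_along g (p - q) = deriv_along g p - deriv_along g q"
  using deriv_along_add[of g p "- q"] by (simp add: deriv_along_uminus)

lemma deriv_along_single:
  assumes "finite S" "ks m \<subseteq> S"
  shows "deriv_along g (sg m c) = (\<Sum>v\<in>S. sg (m - sg v 1) (of_nat (lk m v) * c) * g v)"
proof -
  have "deriv_along g (sg m c) = (\<Sum>m'\<in>{m}. \<Sum>v\<in>ks m'. sg (m' - sg v 1) (of_nat (lk m' v) * lk (sg m c) m') * g v)"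
    by (rule deriv_along_superset) auto
  also have "\<dots> = (\<Sum>v\<in>ks m. sg (m - sg v 1) (of_nat (lk m v) * c) * g v)"
    by simp
  also have "\<dots> = (\<Sum>v\<in>S. sg (m - sg v 1) (of_nat (lk m v) * c) * g v)"
    by (rule sum.mono_neutral_left) (use assms in \<open>auto simp: in_keys_iff\<close>)
  finally show ?thesis .
qed

lemma minus_single_add:
  fixes m n :: "(nat \<times> nat) \<Rightarrow>\<^sub>0 nat"
  assumes "lk m v \<noteq> 0"
  shows "m + n - sg v 1 = (m - sg v 1) + n"
  by (rule poly_mapping_eqI) (use assms in \<open>auto simp: lookup_add lookup_minus lookup_single when_def\<close>)

lemma deriv_along_mult_single:
  "deriv_along g (sg m c * sg n d) = deriv_along g (sg m c) * sg n d + sg m c * deriv_along g (sg n d)"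
proof -
  let ?S = "ks m \<union> ks n"
  have sub: "ks (m + n) \<subseteq> ?S" by (rule Poly_Mapping.keys_add)
  \<comment> \<open>If v does not occur in m both coefficients are 0, so the truncated subtraction
    of exponents does no harm.\<close>
  have 1: "sg (m + n - sg v 1) (of_nat (lk m v) * (c * d)) = sg (m - sg v 1) (of_nat (lk m v) * c) * sg n d" for v
    by (cases "lk m v = 0") (simp_all add: mult_single minus_single_add mult.assoc del: One_nat_def)
  have 2: "sg (m + n - sg v 1) (of_nat (lk n v) * (c * d)) = sg m c * sg (n - sg v 1) (of_nat (lk n v) * d)" for v
    using minus_single_add[of n v m]
    by (cases "lk n v = 0") (simp_all add: mult_single add.commute mult.left_commute del: One_nat_def)
  have "deriv_along g (sg m c * sg n d) = (\<Sum>v\<in>?S. sg (m + n - sg v 1) (of_nat (lk (m + n) v) * (c * d)) * g v)"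
    unfolding mult_single by (rule deriv_along_single) (use sub in auto)
  also have "\<dots> = (\<Sum>v\<in>?S. (sg (m - sg v 1) (of_nat (lk m v) * c) * sg n d + sg m c * sg (n - sg v 1) (of_nat (lk n v) * d)) * g v)"
    by (simp only: lookup_add of_nat_add distrib_right single_add 1 2)
  also have "\<dots> = (\<Sum>v\<in>?S. sg (m - sg v 1) (of_nat (lk m v) * c) * g v) * sg n d +
      sg m c * (\<Sum>v\<in>?S. sg (n - sg v 1) (of_nat (lk n v) * d) * g v)"
    by (simp add: sum_distrib_left sum_distrib_right sum.distrib algebra_simps)
  also have "\<dots> = deriv_along g (sg m c) * sg n d + sg m c * deriv_along g (sg n d)"
    using deriv_along_single[of ?S m g c] deriv_along_single[of ?S n g d] by simp
  finally show ?thesis .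
qed

lemma deriv_along_mult: "deriv_along g (p * q) = deriv_along g p * q + p * deriv_along g q"
proof -
  let ?p = "\<lambda>m. sg m (lk p m)" and ?q = "\<lambda>m. sg m (lk q m)"
  have "deriv_along g ((\<Sum>m\<in>ks p. ?p m) * (\<Sum>n\<in>ks q. ?q n)) =
      (\<Sum>m\<in>ks p. \<Sum>n\<in>ks q. deriv_along g (?p m * ?q n))"
    by (simp only: sum_product deriv_along_sum)
  also have "\<dots> = (\<Sum>m\<in>ks p. \<Sum>n\<in>ks q. deriv_along g (?p m) * ?q n) + (\<Sum>m\<in>ks p. \<Sum>n\<in>ks q. ?p m * deriv_along g (?q n))"
    by (simp only: deriv_along_mult_single sum.distrib)
  also have "\<dots> = deriv_along g (\<Sum>m\<in>ks p. ?p m) * (\<Sum>n\<in>ks q. ?q n) + (\<Sum>m\<in>ks p. ?p m) * deriv_along g (\<Sum>n\<in>ks q. ?q n)"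
    by (simp only: sum_product deriv_along_sum)
  finally show ?thesis by (simp only: poly_mapping_sum_single)
qed

lemma deriv_along_pconst [simp]: "deriv_along g (pconst c) = 0"
  using deriv_along_single[of "{}" 0 g c] by (simp add: pconst_def)

lemma deriv_along_1 [simp]: "deriv_along g 1 = 0"
  using deriv_along_pconst[of g 1] by (simp add: pconst_def)

lemma deriv_along_pvar [simp]: "deriv_along g (pvar v) = g v"
  using deriv_along_single[of "{v}" "sg v 1" g 1] by (simp add: pvar_def)

lemma deriv_along_in_vars:
  assumes "in_vars X p" "\<And>v. v \<in> X \<Longrightarrow> in_vars X (g v)"
  shows "in_vars X (deriv_along g p)"
  using assms(1) by (induction rule: in_vars_induct) (auto simp: deriv_along_add deriv_along_mult assms(2))

lemma jet_der_eq: "jet_der = deriv_along (\<lambda>(j, i). pvar (j, Suc i))"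
proof
  fix p
  show "jet_der p = deriv_along (\<lambda>(j, i). pvar (j, Suc i)) p"
    unfolding jet_der_def deriv_along_def
    by (intro sum.cong refl) (auto simp: pvar_def mult_single)
qed

lemma jet_der_add: "jet_der (p + q) = jet_der p + jet_der q"
  and jet_der_diff: "jet_der (p - q) = jet_der p - jet_der q"
  and jet_der_mult: "jet_der (p * q) = jet_der p * q + p * jet_der q"
  and jet_der_pconst [simp]: "jet_der (pconst c) = 0"
  and jet_der_0 [simp]: "jet_der 0 = 0"
  and jet_der_1 [simp]: "jet_der 1 = 0"
  and jet_der_pvar [simp]: "jet_der (pvar (j, i)) = pvar (j, Suc i)"
  by (simp_all add: jet_der_eq deriv_along_add deriv_along_diff deriv_along_mult)

lemma jet_der_in_vars: "in_vars ({..<r} \<times> UNIV) p \<Longrightarrow> in_vars ({..<r} \<times> UNIV) (jet_der p)"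
  unfolding jet_der_eq by (rule deriv_along_in_vars) (auto intro: in_vars_pvar)

lemma jet_der_pow_in_vars: "in_vars ({..<r} \<times> UNIV) p \<Longrightarrow> in_vars ({..<r} \<times> UNIV) ((jet_der ^^ k) p)"
  by (induction k) (simp_all add: jet_der_in_vars)

lemma base_in_jet: "in_vars ({..<r} \<times> {0}) p \<Longrightarrow> in_vars ({..<r} \<times> UNIV) p"
  by (rule in_vars_mono) auto

section \<open>Evaluation homomorphisms\<close>

locale calg = cring B for B :: "(complex, 'b) module" (structure) +
  assumes smult_closed [simp, intro]: "x \<in> carrier B \<Longrightarrow> c \<odot> x \<in> carrier B"
    and smult_l_distr: "x \<in> carrier B \<Longrightarrow> (c + d) \<odot> x = c \<odot> x \<oplus> d \<odot> x"
    and smult_r_distr: "x \<in> carrier B \<Longrightarrow> y \<in> carrier B \<Longrightarrow> c \<odot> (x \<oplus> y) = c \<odot> x \<oplus> c \<odot> y"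
    and smult_assoc: "x \<in> carrier B \<Longrightarrow> (c * d) \<odot> x = c \<odot> (d \<odot> x)"
    and smult_one [simp]: "x \<in> carrier B \<Longrightarrow> 1 \<odot> x = x"
    and smult_mult: "x \<in> carrier B \<Longrightarrow> y \<in> carrier B \<Longrightarrow> (c \<odot> x) \<otimes> y = c \<odot> (x \<otimes> y)"
begin

lemma smult_zero_left [simp]: "x \<in> carrier B \<Longrightarrow> 0 \<odot> x = \<zero>"
proof -
  assume x: "x \<in> carrier B"
  have "0 \<odot> x \<oplus> 0 \<odot> x = 0 \<odot> x" using smult_l_distr[OF x, of 0 0] by simp
  then show ?thesis using x by simp
qed

lemma smult_mult_right: "x \<in> carrier B \<Longrightarrow> y \<in> carrier B \<Longrightarrow> x \<otimes> (c \<odot> y) = c \<odot> (x \<otimes> y)"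
  using smult_mult[of y x c] by (simp add: m_comm)

lemma smult_smult_mult:
  "x \<in> carrier B \<Longrightarrow> y \<in> carrier B \<Longrightarrow> (c \<odot> x) \<otimes> (d \<odot> y) = (c * d) \<odot> (x \<otimes> y)"
  by (simp only: smult_mult[of x "d \<odot> y"] smult_mult_right[of x y] smult_assoc[of "x \<otimes> y"] smult_closed m_closed)

definition mon_eval :: "(nat \<times> nat \<Rightarrow> 'b) \<Rightarrow> ((nat \<times> nat) \<Rightarrow>\<^sub>0 nat) \<Rightarrow> 'b" where
  "mon_eval g m = (\<Otimes>v\<in>ks m. g v [^] lk m v)"

definition poly_eval :: "(nat \<times> nat \<Rightarrow> 'b) \<Rightarrow> jet_poly \<Rightarrow> 'b" where
  "poly_eval g p = (\<Oplus>m\<in>ks p. lk p m \<odot> mon_eval g m)"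

context
  fixes g :: "nat \<times> nat \<Rightarrow> 'b"
  assumes g: "\<And>v. g v \<in> carrier B"
begin

lemma mon_eval_closed [simp]: "mon_eval g m \<in> carrier B"
  unfolding mon_eval_def by (rule finprod_closed) (use g in auto)

lemma mon_eval_superset:
  assumes "finite S" "ks m \<subseteq> S"
  shows "mon_eval g m = (\<Otimes>v\<in>S. g v [^] lk m v)"
  unfolding mon_eval_def
  by (rule finprod_mono_neutral_cong_left) (use assms g in \<open>auto simp: in_keys_iff\<close>)

lemma mon_eval_add: "mon_eval g (m + n) = mon_eval g m \<otimes> mon_eval g n"
proof -
  let ?S = "ks m \<union> ks n"
  have "mon_eval g (m + n) = (\<Otimes>v\<in>?S. g v [^] lk (m + n) v)"
    by (rule mon_eval_superset) (use Poly_Mapping.keys_add[of m n] in auto)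
  also have "\<dots> = (\<Otimes>v\<in>?S. g v [^] lk m v \<otimes> g v [^] lk n v)"
    by (rule finprod_cong') (use g in \<open>auto simp: lookup_add nat_pow_mult\<close>)
  also have "\<dots> = (\<Otimes>v\<in>?S. g v [^] lk m v) \<otimes> (\<Otimes>v\<in>?S. g v [^] lk n v)"
    by (rule finprod_multf) (use g in auto)
  also have "\<dots> = mon_eval g m \<otimes> mon_eval g n"
    using mon_eval_superset[of ?S m] mon_eval_superset[of ?S n] by simp
  finally show ?thesis .
qed

lemma mon_eval_0 [simp]: "mon_eval g 0 = \<one>"
  by (simp add: mon_eval_def)

lemma poly_eval_closed [simp]: "poly_eval g p \<in> carrier B"
  unfolding poly_eval_def by (rule finsum_closed) auto

lemma poly_eval_superset:
  assumes "finite S" "ks p \<subseteq> S"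
  shows "poly_eval g p = (\<Oplus>m\<in>S. lk p m \<odot> mon_eval g m)"
  unfolding poly_eval_def
  by (rule add.finprod_mono_neutral_cong_left) (use assms in \<open>auto simp: in_keys_iff\<close>)

lemma poly_eval_add: "poly_eval g (p + q) = poly_eval g p \<oplus> poly_eval g q"
proof -
  let ?S = "ks p \<union> ks q"
  have "poly_eval g (p + q) = (\<Oplus>m\<in>?S. lk (p + q) m \<odot> mon_eval g m)"
    by (rule poly_eval_superset) (use Poly_Mapping.keys_add[of p q] in auto)
  also have "\<dots> = (\<Oplus>m\<in>?S. lk p m \<odot> mon_eval g m \<oplus> lk q m \<odot> mon_eval g m)"
    by (rule add.finprod_cong') (auto simp: lookup_add smult_l_distr)
  also have "\<dots> = (\<Oplus>m\<in>?S. lk p m \<odot> mon_eval g m) \<oplus> (\<Oplus>m\<in>?S. lk q m \<odot> mon_eval g m)"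
    by (rule finsum_addf) auto
  also have "\<dots> = poly_eval g p \<oplus> poly_eval g q"
    using poly_eval_superset[of ?S p] poly_eval_superset[of ?S q] by simp
  finally show ?thesis .
qed

lemma poly_eval_single: "poly_eval g (sg m c) = c \<odot> mon_eval g m"
  by (subst poly_eval_superset[of "{m}"]) auto

lemma poly_eval_0 [simp]: "poly_eval g 0 = \<zero>"
  by (simp add: poly_eval_def)

lemma poly_eval_mult_single: "poly_eval g (sg m c * p) = (c \<odot> mon_eval g m) \<otimes> poly_eval g p"
proof -
  have "poly_eval g (sg m c * (\<Sum>n\<in>S. sg n (lk p n))) = (c \<odot> mon_eval g m) \<otimes> poly_eval g (\<Sum>n\<in>S. sg n (lk p n))"
    if "finite S" for S
    using that
  proof induction
    case (insert n S)
    then show ?case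
      by (simp add: distrib_left poly_eval_add mult_single poly_eval_single mon_eval_add r_distr smult_smult_mult)
  qed simp
  from this[of "ks p"] show ?thesis by (simp add: poly_mapping_sum_single)
qed

lemma poly_eval_mult: "poly_eval g (p * q) = poly_eval g p \<otimes> poly_eval g q"
proof -
  have "poly_eval g ((\<Sum>n\<in>S. sg n (lk p n)) * q) = poly_eval g (\<Sum>n\<in>S. sg n (lk p n)) \<otimes> poly_eval g q"
    if "finite S" for S
    using that
  proof induction
    case (insert n S)
    then show ?case
      by (simp add: distrib_right poly_eval_add poly_eval_mult_single poly_eval_single l_distr)
  qed simp
  from this[of "ks p"] show ?thesis by (simp add: poly_mapping_sum_single)
qed

lemma poly_eval_pconst: "poly_eval g (pconst c) = c \<odot> \<one>"
  by (simp add: pconst_def poly_eval_single)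

lemma poly_eval_1 [simp]: "poly_eval g 1 = \<one>"
  using poly_eval_pconst[of 1] by (simp add: pconst_def)

lemma poly_eval_pvar [simp]: "poly_eval g (pvar v) = g v"
proof -
  have "mon_eval g (sg v 1) = g v"
    using g by (subst mon_eval_superset[of "{v}"]) auto
  then show ?thesis using g by (simp add: pvar_def poly_eval_single)
qed

lemma poly_eval_alg_hom: "poly_eval g \<in> alg_hom (poly_alg X) B"
  unfolding alg_hom_def ring_hom_def
  by (auto simp: poly_eval_mult poly_eval_add poly_eval_pconst smult_mult)

end

end

lemma alg_homD:
  assumes "h \<in> alg_hom A B"
  shows "x \<in> carrier A \<Longrightarrow> h x \<in> carrier B"
    "x \<in> carrier A \<Longrightarrow> y \<in> carrier A \<Longrightarrow> h (x \<otimes>\<^bsub>A\<^esub> y) = h x \<otimes>\<^bsub>B\<^esub> h y"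
    "x \<in> carrier A \<Longrightarrow> y \<in> carrier A \<Longrightarrow> h (x \<oplus>\<^bsub>A\<^esub> y) = h x \<oplus>\<^bsub>B\<^esub> h y"
    "h \<one>\<^bsub>A\<^esub> = \<one>\<^bsub>B\<^esub>" "x \<in> carrier A \<Longrightarrow> h (c \<odot>\<^bsub>A\<^esub> x) = c \<odot>\<^bsub>B\<^esub> h x"
  using assms unfolding alg_hom_def ring_hom_def by auto

lemma poly_alg_hom_pconst:
  assumes "h \<in> alg_hom (poly_alg X) B"
  shows "h (pconst c) = c \<odot>\<^bsub>B\<^esub> \<one>\<^bsub>B\<^esub>"
  using alg_homD(5)[OF assms, of 1 c] alg_homD(4)[OF assms] by (simp add: poly_carrier)

lemma poly_alg_hom_eq:
  assumes h: "h \<in> alg_hom (poly_alg X) B" and k: "k \<in> alg_hom (poly_alg X) B"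
    and eq: "\<And>v. v \<in> X \<Longrightarrow> h (pvar v) = k (pvar v)" and p: "in_vars X p"
  shows "h p = k p"
  using p
proof (induction rule: in_vars_induct)
  case (const c)
  then show ?case by (simp add: poly_alg_hom_pconst[OF h] poly_alg_hom_pconst[OF k])
next
  case (add p q)
  then show ?case using alg_homD(3)[OF h, of p q] alg_homD(3)[OF k, of p q] by (simp add: poly_carrier)
next
  case (mult p q)
  then show ?case using alg_homD(2)[OF h, of p q] alg_homD(2)[OF k, of p q] by (simp add: poly_carrier)
qed (rule eq)

section \<open>Quotients of polynomial algebras\<close>

locale poly_ideal =
  fixes X :: "(nat \<times> nat) set" and I :: "jet_poly set"
  assumes ideal: "ideal I (poly_alg X)"
begin

sublocale I: ideal I "poly_alg X" by (rule ideal)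

abbreviation Q where "Q \<equiv> quot_alg (poly_alg X) I"

definition cls :: "jet_poly \<Rightarrow> jet_poly set" where
  "cls p = I +>\<^bsub>poly_alg X\<^esub> p"

lemma I_in_vars: "p \<in> I \<Longrightarrow> in_vars X p"
  using I.a_subset by (auto simp: poly_carrier)

lemma I_0 [simp]: "0 \<in> I"
  using additive_subgroup.zero_closed[OF I.is_additive_subgroup] by simp

lemma I_add: "p \<in> I \<Longrightarrow> q \<in> I \<Longrightarrow> p + q \<in> I"
  using additive_subgroup.a_closed[OF I.is_additive_subgroup, of p q] by simp

lemma I_mult: "p \<in> I \<Longrightarrow> in_vars X q \<Longrightarrow> q * p \<in> I"
  using I.I_l_closed[of p q] by (simp add: poly_carrier)

lemma I_uminus: "p \<in> I \<Longrightarrow> - p \<in> I"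
  using I_mult[of p "- 1"] by simp

lemma I_diff: "p \<in> I \<Longrightarrow> q \<in> I \<Longrightarrow> p - q \<in> I"
  using I_add[of p "- q"] I_uminus by simp

lemma in_cls_iff: "q \<in> cls p \<longleftrightarrow> q - p \<in> I"
  unfolding cls_def a_r_coset_def' by force

lemma cls_eq_iff: "cls p = cls q \<longleftrightarrow> p - q \<in> I"
proof
  assume "cls p = cls q"
  moreover have "p \<in> cls p" by (simp add: in_cls_iff)
  ultimately show "p - q \<in> I" by (simp add: in_cls_iff)
next
  assume *: "p - q \<in> I"
  show "cls p = cls q"
  proof (intro equalityI subsetI)
    fix x assume "x \<in> cls p"
    then have "(x - p) + (p - q) \<in> I" using * by (intro I_add) (auto simp: in_cls_iff)
    then show "x \<in> cls q" by (simp add: in_cls_iff)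
  next
    fix x assume "x \<in> cls q"
    then have "(x - q) - (p - q) \<in> I" using * I_diff[of "x - q" "p - q"] by (simp only: in_cls_iff)
    then show "x \<in> cls p" by (simp add: in_cls_iff)
  qed
qed

lemma Q_carrier: "carrier Q = cls ` {p. in_vars X p}"
  unfolding quot_alg_def FactRing_def A_RCOSETS_def' cls_def by (auto simp: poly_carrier)

lemma Q_carrierI: "in_vars X p \<Longrightarrow> cls p \<in> carrier Q"
  by (auto simp: Q_carrier)

lemma Q_carrierE:
  assumes "x \<in> carrier Q"
  obtains p where "in_vars X p" "x = cls p"
  using assms by (auto simp: Q_carrier)

lemma Q_mult: "in_vars X p \<Longrightarrow> in_vars X q \<Longrightarrow> cls p \<otimes>\<^bsub>Q\<^esub> cls q = cls (p * q)"
  using I.rcoset_mult_add[of p q] by (simp add: quot_alg_def FactRing_def cls_def poly_carrier)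

lemma Q_add: "in_vars X p \<Longrightarrow> in_vars X q \<Longrightarrow> cls p \<oplus>\<^bsub>Q\<^esub> cls q = cls (p + q)"
  using I.a_rcos_sum[of p q] by (simp add: quot_alg_def FactRing_def cls_def poly_carrier)

lemma Q_one: "\<one>\<^bsub>Q\<^esub> = cls 1"
  by (simp add: quot_alg_def FactRing_def cls_def)

lemma cls_0: "cls 0 = I"
  by (auto simp: in_cls_iff)

lemma Q_zero: "\<zero>\<^bsub>Q\<^esub> = cls 0"
  by (simp add: quot_alg_def FactRing_def cls_0)

lemma Q_smult: "in_vars X p \<Longrightarrow> c \<odot>\<^bsub>Q\<^esub> cls p = cls (pconst c * p)"
proof -
  have "(\<Union>x\<in>cls p. I +>\<^bsub>poly_alg X\<^esub> (pconst c * x)) = cls (pconst c * p)"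
  proof (rule UN_const)
    show "p \<in> cls p" by (simp add: in_cls_iff)
    fix x assume "x \<in> cls p"
    then have "pconst c * (x - p) \<in> I" by (intro I_mult) (auto simp: in_cls_iff)
    then show "I +>\<^bsub>poly_alg X\<^esub> (pconst c * x) = cls (pconst c * p)"
      unfolding cls_def[symmetric] cls_eq_iff by (simp only: right_diff_distrib)
  qed
  then show ?thesis by (simp add: quot_alg_def)
qed

lemma Q_cring: "cring Q"
proof -
  interpret P: cring "poly_alg X" by (rule poly_alg_cring)
  have "cring (poly_alg X Quot I)" by (rule I.quotient_is_cring) (rule poly_alg_cring)
  then interpret R: cring "poly_alg X Quot I" .
  have c: "carrier Q = carrier (poly_alg X Quot I)" "monoid.mult Q = monoid.mult (poly_alg X Quot I)" "monoid.one Q = monoid.one (poly_alg X Quot I)"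
    "ring.zero Q = ring.zero (poly_alg X Quot I)" "ring.add Q = ring.add (poly_alg X Quot I)"
    by (simp_all add: quot_alg_def)
  show ?thesis
  proof (intro cringI abelian_groupI comm_monoidI, unfold c)
    fix x assume "x \<in> carrier (poly_alg X Quot I)"
    then show "\<exists>y\<in>carrier (poly_alg X Quot I). y \<oplus>\<^bsub>poly_alg X Quot I\<^esub> x = \<zero>\<^bsub>poly_alg X Quot I\<^esub>"
      by (intro bexI[of _ "\<ominus>\<^bsub>poly_alg X Quot I\<^esub> x"]) (simp_all add: R.l_neg)
  qed (simp_all add: R.a_assoc R.m_assoc R.l_distr, (rule R.a_comm R.m_comm; assumption)+)
qed

lemma Q_calg: "calg Q"
proof (intro calg.intro Q_cring calg_axioms.intro)
  show "\<And>x c. x \<in> carrier Q \<Longrightarrow> c \<odot>\<^bsub>Q\<^esub> x \<in> carrier Q"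
    by (elim Q_carrierE) (simp add: Q_smult Q_carrierI)
  show "\<And>x c d. x \<in> carrier Q \<Longrightarrow> (c + d) \<odot>\<^bsub>Q\<^esub> x = c \<odot>\<^bsub>Q\<^esub> x \<oplus>\<^bsub>Q\<^esub> d \<odot>\<^bsub>Q\<^esub> x"
    by (elim Q_carrierE) (simp add: Q_smult Q_add pconst_def single_add distrib_right in_vars_single)
  show "\<And>x y c. x \<in> carrier Q \<Longrightarrow> y \<in> carrier Q \<Longrightarrow> c \<odot>\<^bsub>Q\<^esub> (x \<oplus>\<^bsub>Q\<^esub> y) = c \<odot>\<^bsub>Q\<^esub> x \<oplus>\<^bsub>Q\<^esub> c \<odot>\<^bsub>Q\<^esub> y"
    by (elim Q_carrierE) (simp add: Q_smult Q_add distrib_left)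
  show "\<And>x c d. x \<in> carrier Q \<Longrightarrow> (c * d) \<odot>\<^bsub>Q\<^esub> x = c \<odot>\<^bsub>Q\<^esub> (d \<odot>\<^bsub>Q\<^esub> x)"
  proof -
    fix x c d assume "x \<in> carrier Q"
    moreover have "pconst (c * d) = pconst c * pconst d" by (simp add: pconst_def mult_single)
    ultimately show "(c * d) \<odot>\<^bsub>Q\<^esub> x = c \<odot>\<^bsub>Q\<^esub> (d \<odot>\<^bsub>Q\<^esub> x)"
      by (elim Q_carrierE) (simp add: Q_smult mult.assoc)
  qed
  show "\<And>x. x \<in> carrier Q \<Longrightarrow> 1 \<odot>\<^bsub>Q\<^esub> x = x"
    by (elim Q_carrierE) (simp add: Q_smult pconst_def)
  show "\<And>x y c. x \<in> carrier Q \<Longrightarrow> y \<in> carrier Q \<Longrightarrow> (c \<odot>\<^bsub>Q\<^esub> x) \<otimes>\<^bsub>Q\<^esub> y = c \<odot>\<^bsub>Q\<^esub> (x \<otimes>\<^bsub>Q\<^esub> y)"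
    by (elim Q_carrierE) (simp add: Q_smult Q_mult mult.assoc)
qed

end

section \<open>Arc algebras\<close>

locale diff_calg = calg B for B :: "(complex, 'b) module" (structure) +
  fixes \<delta> :: "'b \<Rightarrow> 'b"
  assumes \<delta>_closed [simp, intro]: "x \<in> carrier B \<Longrightarrow> \<delta> x \<in> carrier B"
    and \<delta>_add: "x \<in> carrier B \<Longrightarrow> y \<in> carrier B \<Longrightarrow> \<delta> (x \<oplus> y) = \<delta> x \<oplus> \<delta> y"
    and \<delta>_mult: "x \<in> carrier B \<Longrightarrow> y \<in> carrier B \<Longrightarrow> \<delta> (x \<otimes> y) = \<delta> x \<otimes> y \<oplus> x \<otimes> \<delta> y"
    and \<delta>_smult: "x \<in> carrier B \<Longrightarrow> \<delta> (c \<odot> x) = c \<odot> \<delta> x"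
begin

lemma \<delta>_one [simp]: "\<delta> \<one> = \<zero>"
  using \<delta>_mult[of \<one> \<one>] by simp

lemma \<delta>_pow_closed [simp]: "x \<in> carrier B \<Longrightarrow> (\<delta> ^^ k) x \<in> carrier B"
  by (induction k) auto

lemma smult_zero_right [simp]: "c \<odot> \<zero> = \<zero>"
  using smult_assoc[of \<zero> c 0] by simp

lemma \<delta>_zero [simp]: "\<delta> \<zero> = \<zero>"
  using \<delta>_smult[of \<zero> 0] by simp

definition jets :: "(nat \<Rightarrow> 'b) \<Rightarrow> nat \<times> nat \<Rightarrow> 'b" where
  "jets a = (\<lambda>(j, i). (\<delta> ^^ i) (a j))"

lemma jets_apply [simp]: "jets a (j, i) = (\<delta> ^^ i) (a j)"
  by (simp add: jets_def)

lemma jets_closed: "(\<And>j. a j \<in> carrier B) \<Longrightarrow> jets a v \<in> carrier B"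
  by (cases v) (simp add: jets_def)

lemma poly_eval_jet_der:
  assumes a: "\<And>j. a j \<in> carrier B" and p: "in_vars X p"
  shows "poly_eval (jets a) (jet_der p) = \<delta> (poly_eval (jets a) p)"
  using p
proof (induction rule: in_vars_induct)
  case (const c)
  then show ?case
    by (simp add: poly_eval_pconst[OF jets_closed[OF a]] poly_eval_0[OF jets_closed[OF a]] \<delta>_smult)
next
  case (var v)
  obtain j i where "v = (j, i)" by (cases v)
  then show ?case by (simp add: poly_eval_pvar[OF jets_closed[OF a]])
next
  case (add p q)
  then show ?case
    by (simp add: jet_der_add poly_eval_add[OF jets_closed[OF a]] poly_eval_closed[OF jets_closed[OF a]] \<delta>_add)
next
  case (mult p q)
  then show ?case
    by (simp add: jet_der_mult poly_eval_add[OF jets_closed[OF a]] poly_eval_mult[OF jets_closed[OF a]]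
        poly_eval_closed[OF jets_closed[OF a]] \<delta>_mult)
qed

end

definition presented :: "nat \<Rightarrow> jet_poly set \<Rightarrow> bool" where
  "presented r F \<longleftrightarrow> (\<forall>f\<in>F. in_vars ({..<r} \<times> {0}) f)"

lemma presentation_presented: "presentation r F \<psi> A \<Longrightarrow> presented r F"
  unfolding presentation_def presented_def by (auto simp: poly_carrier)

lemma arc_generators_subset:
  "presented r F \<Longrightarrow> {(jet_der ^^ i) f |f i. f \<in> F} \<subseteq> carrier (jet_alg r)"
  unfolding presented_def by (auto simp: poly_carrier) (rule jet_der_pow_in_vars, rule base_in_jet, blast)

lemma arc_ideal_is_ideal: "presented r F \<Longrightarrow> ideal (arc_ideal r F) (jet_alg r)"
  unfolding arc_ideal_def
  using arc_generators_subset ring.genideal_ideal[OF cring.axioms(1)[OF poly_alg_cring]] by blast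

locale arc_presentation =
  fixes r :: nat and F :: "jet_poly set"
  assumes presented: "presented r F"
begin

sublocale poly_ideal "{..<r} \<times> UNIV" "arc_ideal r F"
  by (rule poly_ideal.intro) (rule arc_ideal_is_ideal[OF presented])

lemma arc_alg_Q: "arc_alg r F = Q"
  by (simp add: arc_alg_def)

lemma arc_class_cls: "arc_class r F = cls"
  by (simp add: arc_class_def cls_def fun_eq_iff)

lemma jet_der_generator_in_ideal: "f \<in> F \<Longrightarrow> (jet_der ^^ i) f \<in> arc_ideal r F"
  unfolding arc_ideal_def
  using ring.genideal_self[OF cring.axioms(1)[OF poly_alg_cring] arc_generators_subset[OF presented]] by blast

lemma arc_ideal_minimal:
  assumes "ideal J (jet_alg r)" "\<And>f i. f \<in> F \<Longrightarrow> (jet_der ^^ i) f \<in> J"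
  shows "arc_ideal r F \<subseteq> J"
  unfolding arc_ideal_def
  by (rule ring.genideal_minimal[OF cring.axioms(1)[OF poly_alg_cring] assms(1)]) (use assms(2) in auto)

lemma poly_idealI:
  assumes "J \<subseteq> {p. in_vars X p}" "0 \<in> J" "\<And>p q. p \<in> J \<Longrightarrow> q \<in> J \<Longrightarrow> p + q \<in> J"
    "\<And>p q. p \<in> J \<Longrightarrow> in_vars X q \<Longrightarrow> q * p \<in> J"
  shows "ideal J (poly_alg X)"
proof -
  interpret P: cring "poly_alg X" by (rule poly_alg_cring)
  have neg: "\<ominus>\<^bsub>poly_alg X\<^esub> p = - p" if "p \<in> J" for p
    by (rule P.minus_equality) (use that assms(1) in \<open>auto simp: poly_carrier\<close>)
  show ?thesis
  proof (rule idealI)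
    show "ring (poly_alg X)" by (rule P.ring_axioms)
    show "subgroup J (add_monoid (poly_alg X))"
    proof
      show "J \<subseteq> carrier (add_monoid (poly_alg X))" using assms(1) by (auto simp: poly_carrier)
      fix x y assume xy: "x \<in> J" "y \<in> J"
      show "x \<otimes>\<^bsub>add_monoid (poly_alg X)\<^esub> y \<in> J" using assms(3)[OF xy] by simp
      have "inv\<^bsub>add_monoid (poly_alg X)\<^esub> x = - x" using neg[OF xy(1)] by (simp add: a_inv_def)
      moreover have "- 1 * x \<in> J" by (rule assms(4)[OF xy(1)]) simp
      ultimately show "inv\<^bsub>add_monoid (poly_alg X)\<^esub> x \<in> J" by simp
    qed (use assms(2) in simp)
  next
    fix a x assume "a \<in> J" "x \<in> carrier (poly_alg X)"
    then have "x * a \<in> J" by (intro assms(4)) (auto simp: poly_carrier)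
    then show "x \<otimes>\<^bsub>poly_alg X\<^esub> a \<in> J" "a \<otimes>\<^bsub>poly_alg X\<^esub> x \<in> J" by (simp_all add: mult.commute)
  qed
qed

text \<open>By the Leibniz rule the elements that \<open>d\<close> keeps inside the ideal form an
  ideal, so generators suffice. It is applied to \<open>jet_der\<close> and to an Euler
  derivation.\<close>

lemma arc_ideal_closed_under:
  assumes d: "\<And>p q. d (p + q) = d p + d q" "\<And>p q. d (p * q) = d p * q + p * d q"
    and d_vars: "\<And>p. in_vars ({..<r} \<times> UNIV) p \<Longrightarrow> in_vars ({..<r} \<times> UNIV) (d p)"
    and gen: "\<And>f i. f \<in> F \<Longrightarrow> d ((jet_der ^^ i) f) \<in> arc_ideal r F"
    and p: "p \<in> arc_ideal r F"
  shows "d p \<in> arc_ideal r F"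
proof -
  let ?J = "{p \<in> arc_ideal r F. d p \<in> arc_ideal r F}"
  have "d 0 = 0" using d(1)[of 0 0] by simp
  then have "ideal ?J (jet_alg r)"
    by (intro poly_idealI) (auto simp: I_in_vars I_add d I_mult d_vars intro!: I_add)
  then have "arc_ideal r F \<subseteq> ?J"
    by (rule arc_ideal_minimal) (use gen jet_der_generator_in_ideal in auto)
  then show ?thesis using p by blast
qed

lemma jet_der_in_ideal: "p \<in> arc_ideal r F \<Longrightarrow> jet_der p \<in> arc_ideal r F"
proof (rule arc_ideal_closed_under[where d = jet_der])
  fix f i assume "f \<in> F"
  then have "(jet_der ^^ Suc i) f \<in> arc_ideal r F" by (rule jet_der_generator_in_ideal)
  then show "jet_der ((jet_der ^^ i) f) \<in> arc_ideal r F" by simp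
qed (auto simp: jet_der_add jet_der_mult jet_der_in_vars)

lemma arc_der_cls: "arc_der r F (cls p) = cls (jet_der p)"
  unfolding arc_der_def arc_class_cls
proof (rule UN_const)
  show "p \<in> cls p" by (simp add: in_cls_iff)
  fix q assume "q \<in> cls p"
  then show "cls (jet_der q) = cls (jet_der p)"
    by (simp add: in_cls_iff cls_eq_iff jet_der_in_ideal flip: jet_der_diff)
qed

lemma arc_diff_calg: "diff_calg (arc_alg r F) (arc_der r F)"
proof -
  interpret C: calg Q by (rule Q_calg)
  show ?thesis
    unfolding arc_alg_Q
    by unfold_locales (auto elim!: Q_carrierE simp: arc_der_cls Q_carrierI jet_der_in_vars Q_add Q_mult Q_smult jet_der_add jet_der_mult)
qed

text \<open>Compatibility with the derivations propagates agreement from the y_j to all their jets,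
  which generate.\<close>

lemma arc_hom_unique:
  assumes "diff_calg B \<delta>"
    and h: "h \<in> alg_hom (arc_alg r F) B" "\<And>x. x \<in> carrier (arc_alg r F) \<Longrightarrow> h (arc_der r F x) = \<delta> (h x)"
    and k: "k \<in> alg_hom (arc_alg r F) B" "\<And>x. x \<in> carrier (arc_alg r F) \<Longrightarrow> k (arc_der r F x) = \<delta> (k x)"
    and eq: "\<And>j. j < r \<Longrightarrow> h (cls (pvar (j, 0))) = k (cls (pvar (j, 0)))"
    and x: "x \<in> carrier (arc_alg r F)"
  shows "h x = k x"
proof -
  have c: "cls p \<in> carrier (arc_alg r F)" if "in_vars ({..<r} \<times> UNIV) p" for p
    using that by (simp add: arc_alg_Q Q_carrierI)
  have comp: "(\<lambda>p. h (cls p)) \<in> alg_hom (jet_alg r) B" if h: "h \<in> alg_hom (arc_alg r F) B" for h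
  proof -
    note hD = alg_homD[OF h, unfolded arc_alg_Q] and c = c[unfolded arc_alg_Q]
    have "h (cls (p * q)) = h (cls p) \<otimes>\<^bsub>B\<^esub> h (cls q)" "h (cls (p + q)) = h (cls p) \<oplus>\<^bsub>B\<^esub> h (cls q)"
      "h (cls (pconst d * p)) = d \<odot>\<^bsub>B\<^esub> h (cls p)" "h (cls p) \<in> carrier B"
      if "in_vars ({..<r} \<times> UNIV) p" "in_vars ({..<r} \<times> UNIV) q" for p q d
      using hD(2)[OF c[OF that(1)] c[OF that(2)]] hD(3)[OF c[OF that(1)] c[OF that(2)]]
        hD(5)[OF c[OF that(1)]] hD(1)[OF c[OF that(1)]] that by (simp_all only: Q_mult Q_add Q_smult)
    moreover have "h (cls 1) = \<one>\<^bsub>B\<^esub>" using hD(4) by (simp only: Q_one)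
    ultimately show ?thesis
      unfolding alg_hom_def ring_hom_def by (simp add: poly_carrier)
  qed
  have vars: "h (cls (pvar (j, i))) = k (cls (pvar (j, i)))" if "j < r" for j i
  proof (induction i)
    case (Suc i)
    have v: "cls (pvar (j, i)) \<in> carrier (arc_alg r F)" by (rule c) (use that in \<open>auto intro: in_vars_pvar\<close>)
    from h(2)[OF v] k(2)[OF v] Suc show ?case by (simp add: arc_der_cls)
  qed (rule eq[OF that])
  obtain p where p: "in_vars ({..<r} \<times> UNIV) p" "x = cls p"
    using x unfolding arc_alg_Q by (rule Q_carrierE)
  show ?thesis
    unfolding p(2) by (rule poly_alg_hom_eq[OF comp[OF h(1)] comp[OF k(1)] _ p(1)]) (use vars in auto)
qed

end

lemma alg_hom_comp:
  assumes "f \<in> alg_hom A B" "g \<in> alg_hom B C"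
  shows "g \<circ> f \<in> alg_hom A C"
  unfolding alg_hom_def ring_hom_def
  using alg_homD[OF assms(1)] alg_homD[OF assms(2)] by auto

text \<open>The universal property of the arc space: an algebra map from R to a differential algebra
  extends to the arc algebra. With gr as target it produces Phi, with the arc algebra of another
  presentation the change of presentation. R carries no ring axioms here, so preservation of zero is
  an explicit assumption.\<close>

locale arc_target = arc_presentation r F + B: diff_calg B \<delta>
  for r F and B :: "(complex, 'b) module" (structure) and \<delta> +
  fixes \<psi> :: "jet_poly \<Rightarrow> 'a" and R :: "(complex, 'a) module" and \<iota> :: "'a \<Rightarrow> 'b"
  assumes pres: "presentation r F \<psi> R" and \<iota>: "\<iota> \<in> alg_hom R B" and \<iota>_zero: "\<iota> \<zero>\<^bsub>R\<^esub> = \<zero>"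
begin

lemma \<psi>_hom: "\<psi> \<in> alg_hom (base_alg r) R"
  using pres by (simp add: presentation_def)

text \<open>Indices from r on get the value zero because evaluation asks for values in the carrier
  at every index.\<close>

definition jet_values :: "nat \<times> nat \<Rightarrow> 'b" where
  "jet_values = B.jets (\<lambda>j. if j < r then \<iota> (\<psi> (pvar (j, 0))) else \<zero>)"

lemma start_closed: "(if j < r then \<iota> (\<psi> (pvar (j, 0))) else \<zero>) \<in> carrier B"
  using alg_homD(1)[OF \<iota>] alg_homD(1)[OF \<psi>_hom, of "pvar (j, 0)"]
  by (auto simp: poly_carrier in_vars_pvar)

lemma jet_values_closed: "jet_values v \<in> carrier B"
  unfolding jet_values_def by (rule B.jets_closed) (rule start_closed)

abbreviation ev where "ev \<equiv> B.poly_eval jet_values"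

lemma ev_alg_hom: "ev \<in> alg_hom (poly_alg X) B"
  by (rule B.poly_eval_alg_hom) (rule jet_values_closed)

lemma ev_base: "in_vars ({..<r} \<times> {0}) p \<Longrightarrow> ev p = \<iota> (\<psi> p)"
proof -
  have *: "ev (pvar v) = (\<iota> \<circ> \<psi>) (pvar v)" if "v \<in> {..<r} \<times> {0}" for v
    using that by (auto simp: B.poly_eval_pvar[OF jet_values_closed]) (simp add: jet_values_def)
  show "in_vars ({..<r} \<times> {0}) p \<Longrightarrow> ev p = \<iota> (\<psi> p)"
    using poly_alg_hom_eq[OF ev_alg_hom alg_hom_comp[OF \<psi>_hom \<iota>] *] by simp
qed

lemma ev_jet_der: "ev (jet_der p) = \<delta> (ev p)" if "in_vars X p"
  unfolding jet_values_def by (rule B.poly_eval_jet_der[OF start_closed that])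

lemma ev_generator: "f \<in> F \<Longrightarrow> ev ((jet_der ^^ i) f) = \<zero>"
proof -
  assume f: "f \<in> F"
  then have base: "in_vars ({..<r} \<times> {0}) f" using presented by (auto simp: presented_def)
  have "f \<in> Idl\<^bsub>base_alg r\<^esub> F"
    using ring.genideal_self[OF cring.axioms(1)[OF poly_alg_cring], of F "{..<r} \<times> {0}"] presented f
    by (auto simp: presented_def carrier_poly_alg)
  then have "\<psi> f = \<zero>\<^bsub>R\<^esub>" using pres by (auto simp: presentation_def)
  then have 0: "ev f = \<zero>" using ev_base[OF base] \<iota>_zero by simp
  show ?thesis
  proof (induction i)
    case (Suc i)
    have "in_vars ({..<r} \<times> UNIV) ((jet_der ^^ i) f)" by (intro jet_der_pow_in_vars base_in_jet base)
    from ev_jet_der[OF this] Suc show ?case by simp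
  qed (simp add: 0)
qed

lemma ev_arc_ideal:
  assumes "p \<in> arc_ideal r F"
  shows "ev p = \<zero>"
proof -
  note add = B.poly_eval_add[OF jet_values_closed] and mult = B.poly_eval_mult[OF jet_values_closed]
    and zero = B.poly_eval_0[OF jet_values_closed] and closed = B.poly_eval_closed[OF jet_values_closed]
  have "arc_ideal r F \<subseteq> {p. in_vars ({..<r} \<times> UNIV) p \<and> ev p = \<zero>}"
  proof (rule arc_ideal_minimal)
    show "ideal {p. in_vars ({..<r} \<times> UNIV) p \<and> ev p = \<zero>} (jet_alg r)"
      by (rule poly_idealI) (auto simp: add mult zero closed)
    fix f i assume "f \<in> F"
    then show "(jet_der ^^ i) f \<in> {p. in_vars ({..<r} \<times> UNIV) p \<and> ev p = \<zero>}"
      using ev_generator presented by (auto simp: presented_def intro: jet_der_pow_in_vars[OF base_in_jet])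
  qed
  then show ?thesis using assms by blast
qed

lemma ev_cong: "cls p = cls q \<Longrightarrow> ev p = ev q"
proof -
  assume "cls p = cls q"
  then have "ev (p - q) = \<zero>" by (intro ev_arc_ideal) (simp add: cls_eq_iff)
  moreover have "ev p = ev (p - q) \<oplus> ev q"
    by (simp add: B.poly_eval_add[OF jet_values_closed, symmetric])
  ultimately show ?thesis by (simp add: B.poly_eval_closed[OF jet_values_closed])
qed

text \<open>Restricted to the carrier because \<open>Phi\<close> is characterized among extensional
  maps.\<close>

definition arc_lift :: "jet_poly set \<Rightarrow> 'b" where
  "arc_lift = restrict (\<lambda>x. ev (SOME p. in_vars ({..<r} \<times> UNIV) p \<and> x = cls p)) (carrier (arc_alg r F))"

lemma arc_lift_cls: "in_vars ({..<r} \<times> UNIV) p \<Longrightarrow> arc_lift (cls p) = ev p"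
proof -
  assume p: "in_vars ({..<r} \<times> UNIV) p"
  let ?q = "SOME q. in_vars ({..<r} \<times> UNIV) q \<and> cls p = cls q"
  have "in_vars ({..<r} \<times> UNIV) ?q \<and> cls p = cls ?q"
    by (rule someI[of _ p]) (simp add: p)
  then have "ev p = ev ?q" by (intro ev_cong) simp
  then show ?thesis by (simp add: arc_lift_def arc_alg_Q Q_carrierI p)
qed

lemma arc_lift_hom: "arc_lift \<in> alg_hom (arc_alg r F) B"
  unfolding alg_hom_def ring_hom_def arc_alg_Q
  by (auto elim!: Q_carrierE simp: arc_lift_cls Q_mult Q_add Q_one Q_smult Q_carrierI
    B.poly_eval_add[OF jet_values_closed] B.poly_eval_mult[OF jet_values_closed] B.poly_eval_1[OF jet_values_closed]
    B.poly_eval_closed[OF jet_values_closed] B.poly_eval_pconst[OF jet_values_closed] B.smult_mult)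

lemma arc_lift_der: "x \<in> carrier (arc_alg r F) \<Longrightarrow> arc_lift (arc_der r F x) = \<delta> (arc_lift x)"
  unfolding arc_alg_Q by (elim Q_carrierE) (simp add: arc_der_cls arc_lift_cls jet_der_in_vars ev_jet_der)

lemma arc_lift_base: "in_vars ({..<r} \<times> {0}) p \<Longrightarrow> arc_lift (cls p) = \<iota> (\<psi> p)"
  by (simp add: arc_lift_cls base_in_jet ev_base)

end

text \<open>The ideal of relations among the y_j is contained in the arc ideal, so the class of a
  preimage under \<open>\<psi>\<close> does not depend on the preimage.\<close>

lemma presentation_inclusion:
  assumes pres: "presentation r F \<psi> R" and R: "cring R"
  obtains \<iota> where "\<iota> \<in> alg_hom R (arc_alg r F)" "\<iota> \<zero>\<^bsub>R\<^esub> = \<zero>\<^bsub>arc_alg r F\<^esub>"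
    "\<And>p. in_vars ({..<r} \<times> {0}) p \<Longrightarrow> \<iota> (\<psi> p) = arc_class r F p"
proof -
  interpret R: cring R by (rule R)
  interpret arc_presentation r F by unfold_locales (rule presentation_presented[OF pres])
  let ?B = "{..<r} \<times> {0::nat}"
  have \<psi>: "\<psi> \<in> alg_hom (base_alg r) R" "\<psi> ` {p. in_vars ?B p} = carrier R"
    and ker: "{p. in_vars ?B p \<and> \<psi> p = \<zero>\<^bsub>R\<^esub>} = Idl\<^bsub>base_alg r\<^esub> F"
    using pres by (auto simp: presentation_def carrier_poly_alg)
  note \<psi>D = alg_homD[OF \<psi>(1), unfolded poly_carrier, simplified]
  have \<psi>0: "\<psi> 0 = \<zero>\<^bsub>R\<^esub>"
    using \<psi>D(3)[of 0 0] \<psi>D(1)[of 0] by simp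
  have base_ideal: "Idl\<^bsub>base_alg r\<^esub> F \<subseteq> arc_ideal r F \<inter> {p. in_vars ?B p}"
  proof (rule ring.genideal_minimal[OF cring.axioms(1)[OF poly_alg_cring]])
    show "ideal (arc_ideal r F \<inter> {p. in_vars ?B p}) (base_alg r)"
      by (rule poly_idealI) (auto simp: I_add I_mult base_in_jet)
    show "F \<subseteq> arc_ideal r F \<inter> {p. in_vars ?B p}"
      using jet_der_generator_in_ideal[of _ 0] presented by (auto simp: presented_def)
  qed
  have cong: "cls p = cls q" if "in_vars ?B p" "in_vars ?B q" "\<psi> p = \<psi> q" for p q
  proof -
    have "\<psi> p = \<psi> (p - q) \<oplus>\<^bsub>R\<^esub> \<psi> q" using \<psi>D(3)[of "p - q" q] that by simp
    then have "\<psi> (p - q) = \<zero>\<^bsub>R\<^esub>" using \<psi>D(1) that by simp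
    then have "p - q \<in> Idl\<^bsub>base_alg r\<^esub> F" using that by (simp flip: ker)
    then show ?thesis using base_ideal by (auto simp: cls_eq_iff)
  qed
  define \<iota> where "\<iota> x = cls (SOME p. in_vars ?B p \<and> x = \<psi> p)" for x
  have \<iota>: "\<iota> (\<psi> p) = cls p" if "in_vars ?B p" for p
  proof -
    have *: "in_vars ?B (SOME q. in_vars ?B q \<and> \<psi> p = \<psi> q) \<and> \<psi> p = \<psi> (SOME q. in_vars ?B q \<and> \<psi> p = \<psi> q)"
      by (rule someI[of _ p]) (simp add: that)
    show ?thesis unfolding \<iota>_def
      by (rule cong[OF _ that]) (use * in auto)
  qed
  have hom: "\<iota> \<in> alg_hom R (arc_alg r F)"
    unfolding alg_hom_def arc_alg_Q
  proof (intro CollectI conjI ballI allI ring_hom_memI)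
    fix x y assume "x \<in> carrier R" "y \<in> carrier R"
    then obtain p q where pq: "in_vars ?B p" "in_vars ?B q" "x = \<psi> p" "y = \<psi> q" using \<psi>(2) by blast
    show "\<iota> (x \<otimes>\<^bsub>R\<^esub> y) = \<iota> x \<otimes>\<^bsub>Q\<^esub> \<iota> y"
      using pq \<iota>[of "p * q"] by (simp add: \<psi>D(2) \<iota> Q_mult base_in_jet)
    show "\<iota> (x \<oplus>\<^bsub>R\<^esub> y) = \<iota> x \<oplus>\<^bsub>Q\<^esub> \<iota> y"
      using pq \<iota>[of "p + q"] by (simp add: \<psi>D(3) \<iota> Q_add base_in_jet)
  next
    fix x c assume "x \<in> carrier R"
    then obtain p where p: "in_vars ?B p" "x = \<psi> p" using \<psi>(2) by blast
    show "\<iota> (c \<odot>\<^bsub>R\<^esub> x) = c \<odot>\<^bsub>Q\<^esub> \<iota> x"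
      using p \<iota>[of "pconst c * p"] by (simp add: \<psi>D(5) \<iota> Q_smult base_in_jet)
  next
    show "\<iota> \<one>\<^bsub>R\<^esub> = \<one>\<^bsub>Q\<^esub>" using \<iota>[of 1] by (simp add: \<psi>D(4) Q_one)
    fix x assume "x \<in> carrier R"
    then obtain p where "in_vars ?B p" "x = \<psi> p" using \<psi>(2) by blast
    then show "\<iota> x \<in> carrier Q" by (simp add: \<iota> Q_carrierI base_in_jet)
  qed
  show ?thesis
    by (rule that[OF hom]) (use \<iota>[of 0] \<iota> in \<open>simp_all add: \<psi>0 arc_alg_Q Q_zero arc_class_cls\<close>)
qed

text \<open>Both arc algebras solve the same universal problem; the two comparison maps are mutually
  inverse by uniqueness. Thus one convenient presentation controls all others.\<close>

theorem arc_alg_independent: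
  assumes P: "presentation r F \<psi> R" and P': "presentation r' F' \<psi>' R" and R: "cring R"
  shows "\<exists>h. h \<in> ring_iso (arc_alg r F) (arc_alg r' F')"
proof -
  obtain \<iota> where \<iota>: "\<iota> \<in> alg_hom R (arc_alg r F)" "\<iota> \<zero>\<^bsub>R\<^esub> = \<zero>\<^bsub>arc_alg r F\<^esub>"
    "\<And>p. in_vars ({..<r} \<times> {0}) p \<Longrightarrow> \<iota> (\<psi> p) = arc_class r F p"
    using presentation_inclusion[OF P R] by blast
  obtain \<iota>' where \<iota>': "\<iota>' \<in> alg_hom R (arc_alg r' F')" "\<iota>' \<zero>\<^bsub>R\<^esub> = \<zero>\<^bsub>arc_alg r' F'\<^esub>"
    "\<And>p. in_vars ({..<r'} \<times> {0}) p \<Longrightarrow> \<iota>' (\<psi>' p) = arc_class r' F' p"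
    using presentation_inclusion[OF P' R] by blast
  interpret A: arc_presentation r F by unfold_locales (rule presentation_presented[OF P])
  interpret A': arc_presentation r' F' by unfold_locales (rule presentation_presented[OF P'])
  interpret DA: diff_calg "arc_alg r F" "arc_der r F" by (rule A.arc_diff_calg)
  interpret DA': diff_calg "arc_alg r' F'" "arc_der r' F'" by (rule A'.arc_diff_calg)
  interpret L: arc_target r F "arc_alg r' F'" "arc_der r' F'" \<psi> R \<iota>'
    by unfold_locales (use P \<iota>' in auto)
  interpret L': arc_target r' F' "arc_alg r F" "arc_der r F" \<psi>' R \<iota>
    by unfold_locales (use P' \<iota> in auto)
  have surj: "\<psi> ` {p. in_vars ({..<r} \<times> {0}) p} = carrier R" "\<psi>' ` {p. in_vars ({..<r'} \<times> {0}) p} = carrier R"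
    using P P' by (auto simp: presentation_def carrier_poly_alg)
  have id: "(\<lambda>x. x) \<in> alg_hom (arc_alg r F) (arc_alg r F)" "(\<lambda>x. x) \<in> alg_hom (arc_alg r' F') (arc_alg r' F')"
    by (auto simp: alg_hom_def ring_hom_def)
  have "(L'.arc_lift \<circ> L.arc_lift) x = x" if "x \<in> carrier (arc_alg r F)" for x
  proof (rule A.arc_hom_unique[OF A.arc_diff_calg alg_hom_comp[OF L.arc_lift_hom L'.arc_lift_hom] _ id(1) _ _ that])
    fix j assume j: "j < r"
    then have v: "in_vars ({..<r} \<times> {0}) (pvar (j, 0))" by (auto intro: in_vars_pvar)
    then obtain q where q: "in_vars ({..<r'} \<times> {0}) q" "\<psi> (pvar (j, 0)) = \<psi>' q" using surj by blast
    have "L.arc_lift (A.cls (pvar (j, 0))) = A'.cls q"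
      using L.arc_lift_base[OF v] q \<iota>'(3)[OF q(1)] by (simp add: A'.arc_class_cls)
    then have "(L'.arc_lift \<circ> L.arc_lift) (A.cls (pvar (j, 0))) = \<iota> (\<psi>' q)"
      using L'.arc_lift_base[OF q(1)] by simp
    also have "\<dots> = A.cls (pvar (j, 0))" using q(2) \<iota>(3)[OF v] by (simp add: A.arc_class_cls)
    finally show "(L'.arc_lift \<circ> L.arc_lift) (A.cls (pvar (j, 0))) = A.cls (pvar (j, 0))" .
  qed (simp_all add: L.arc_lift_der L'.arc_lift_der alg_homD(1)[OF L.arc_lift_hom])
  moreover have "(L.arc_lift \<circ> L'.arc_lift) x = x" if "x \<in> carrier (arc_alg r' F')" for x
  proof (rule A'.arc_hom_unique[OF A'.arc_diff_calg alg_hom_comp[OF L'.arc_lift_hom L.arc_lift_hom] _ id(2) _ _ that])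
    fix j assume j: "j < r'"
    then have v: "in_vars ({..<r'} \<times> {0}) (pvar (j, 0))" by (auto intro: in_vars_pvar)
    then obtain q where q: "in_vars ({..<r} \<times> {0}) q" "\<psi>' (pvar (j, 0)) = \<psi> q" using surj by blast
    have "L'.arc_lift (A'.cls (pvar (j, 0))) = A.cls q"
      using L'.arc_lift_base[OF v] q \<iota>(3)[OF q(1)] by (simp add: A.arc_class_cls)
    then have "(L.arc_lift \<circ> L'.arc_lift) (A'.cls (pvar (j, 0))) = \<iota>' (\<psi> q)"
      using L.arc_lift_base[OF q(1)] by simp
    also have "\<dots> = A'.cls (pvar (j, 0))" using q(2) \<iota>'(3)[OF v] by (simp add: A'.arc_class_cls)
    finally show "(L.arc_lift \<circ> L'.arc_lift) (A'.cls (pvar (j, 0))) = A'.cls (pvar (j, 0))" .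
  qed (simp_all add: L.arc_lift_der L'.arc_lift_der alg_homD(1)[OF L'.arc_lift_hom])
  ultimately have "bij_betw L.arc_lift (carrier (arc_alg r F)) (carrier (arc_alg r' F'))"
    using alg_homD(1)[OF L.arc_lift_hom] alg_homD(1)[OF L'.arc_lift_hom]
    by (intro bij_betwI[where g = L'.arc_lift]) auto
  moreover have "L.arc_lift \<in> ring_hom (arc_alg r F) (arc_alg r' F')"
    using L.arc_lift_hom by (simp add: alg_hom_def)
  ultimately show ?thesis unfolding ring_iso_def by blast
qed

section \<open>Global sections of an affine scheme\<close>

text \<open>An ideal that is maximal among those containing K and missing every power of h is prime;
  Zorn's lemma supplies it. Taking h = 1 gives a prime above a proper ideal.\<close>

lemma (in cring) prime_avoiding:
  assumes K: "ideal K R" and h: "h \<in> carrier R" and avoid: "\<And>n::nat. h [^] n \<notin> K"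
  shows "\<exists>P. primeideal P R \<and> K \<subseteq> P \<and> h \<notin> P"
proof -
  define A where "A = {I. ideal I R \<and> K \<subseteq> I \<and> (\<forall>n::nat. h [^] n \<notin> I)}"
  have "\<exists>M\<in>A. \<forall>X\<in>A. M \<subseteq> X \<longrightarrow> X = M"
  proof (rule subset_Zorn_nonempty)
    show "A \<noteq> {}" using K avoid by (auto simp: A_def)
    fix C assume C: "C \<noteq> {}" "subset.chain A C"
    then have "subset.chain {I. ideal I R} C" by (auto simp: A_def subset_chain_def)
    then have "ideal (\<Union>C) R" using chain_Union_is_ideal[of C] C(1) by simp
    then show "\<Union>C \<in> A" using C by (auto simp: A_def subset_chain_def)
  qed
  then obtain M where M: "M \<in> A" and max: "\<And>X. X \<in> A \<Longrightarrow> M \<subseteq> X \<Longrightarrow> X = M" by blast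
  interpret M: ideal M R using M by (simp add: A_def)
  have hM: "h [^] n \<notin> M" for n :: nat using M by (simp add: A_def)
  \<comment> \<open>By maximality M + (a) meets the powers of h.\<close>
  have larger: "\<exists>(n::nat) m x. m \<in> M \<and> x \<in> carrier R \<and> h [^] n = m \<oplus> x \<otimes> a" if a: "a \<in> carrier R" "a \<notin> M" for a
  proof (rule ccontr)
    assume no: "\<not> ?thesis"
    let ?N = "M <+>\<^bsub>R\<^esub> PIdl a"
    have N: "?N = {m \<oplus> x \<otimes> a | m x. m \<in> M \<and> x \<in> carrier R}"
      unfolding set_add_def' cgenideal_def by blast
    have "ideal ?N R" by (intro add_ideals M.ideal_axioms cgenideal_ideal a(1))
    moreover have "M \<subseteq> ?N"
    proof
      fix m assume m: "m \<in> M"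
      then have "m = m \<oplus> \<zero> \<otimes> a" using a M.a_subset by auto
      then show "m \<in> ?N" unfolding N using m by blast
    qed
    moreover have "h [^] n \<notin> ?N" for n :: nat unfolding N using no by blast
    ultimately have "?N \<in> A" using M unfolding A_def by blast
    then have "?N = M" using \<open>M \<subseteq> ?N\<close> by (rule max)
    moreover have "a = \<zero> \<oplus> \<one> \<otimes> a" using a by simp
    then have "a \<in> ?N" unfolding N using additive_subgroup.zero_closed[OF M.is_additive_subgroup] one_closed by blast
    ultimately show False using a by simp
  qed
  have "primeideal M R"
  proof (rule primeidealI)
    show "ideal M R" "cring R" by (rule M.ideal_axioms, rule is_cring)
    show "carrier R \<noteq> M" using hM[of 0] by auto
    fix a b assume ab: "a \<in> carrier R" "b \<in> carrier R" "a \<otimes> b \<in> M"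
    show "a \<in> M \<or> b \<in> M"
    proof (rule ccontr)
      assume "\<not> ?thesis"
      then obtain n m x n' m' x' where 1: "m \<in> M" "x \<in> carrier R" "h [^] (n::nat) = m \<oplus> x \<otimes> a"
        and 2: "m' \<in> M" "x' \<in> carrier R" "h [^] (n'::nat) = m' \<oplus> x' \<otimes> b"
        using larger[OF ab(1)] larger[OF ab(2)] by metis
      have mm: "m \<in> carrier R" "m' \<in> carrier R" using 1 2 M.a_subset by auto
      have "h [^] (n + n') = (m \<oplus> x \<otimes> a) \<otimes> (m' \<oplus> x' \<otimes> b)"
        using h by (simp add: nat_pow_mult[symmetric] 1(3) 2(3))
      \<comment> \<open>Each of the three terms has a factor in M, so a power of h would lie in
        M.\<close>
      also have "\<dots> = m \<otimes> (m' \<oplus> x' \<otimes> b) \<oplus> (x \<otimes> a) \<otimes> m' \<oplus> (x \<otimes> x') \<otimes> (a \<otimes> b)"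
        using mm 1 2 ab(1,2) by algebra
      also have "\<dots> \<in> M"
        using M.I_r_closed[OF 1(1), of "m' \<oplus> x' \<otimes> b"] M.I_l_closed[OF 2(1), of "x \<otimes> a"] M.I_l_closed[OF ab(3), of "x \<otimes> x'"]
          additive_subgroup.a_closed[OF M.is_additive_subgroup] mm 1(2) 2(2) ab(1,2) by simp
      finally show False using hM by blast
    qed
  qed
  then show ?thesis using M hM[of 1] h by (auto simp: A_def)
qed

lemma (in cring) unit_if_in_no_prime:
  assumes s: "s \<in> carrier R" and no: "\<And>P. primeideal P R \<Longrightarrow> s \<notin> P"
  shows "\<exists>t\<in>carrier R. s \<otimes> t = \<one>"
proof (rule ccontr)
  assume no1: "\<not> ?thesis"
  have "\<one> [^] (n::nat) \<notin> PIdl s" for n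
    using no1 s by (auto simp: cgenideal_def m_comm)
  then obtain P where P: "primeideal P R" "PIdl s \<subseteq> P"
    using prime_avoiding[OF cgenideal_ideal[OF s] one_closed] by blast
  then show False using no[OF P(1)] cgenideal_self[OF s] by blast
qed

section \<open>Localizations, the Zariski topology and global sections\<close>

context cring
begin

lemma prime_compl_closed:
  assumes "primeideal P R" "s \<in> carrier R - P" "t \<in> carrier R - P"
  shows "s \<otimes> t \<in> carrier R - P"
  using assms primeideal.I_prime[OF assms(1), of s t] by auto

lemma prime_one:
  assumes "primeideal P R" shows "\<one> \<in> carrier R - P"
proof -
  interpret primeideal P R by (rule assms)
  show ?thesis using one_imp_carrier I_notcarr by auto
qed

lemma fraction_self:
  assumes "primeideal P R" "a \<in> carrier R" "s \<in> carrier R - P"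
  shows "(a, s) \<in> fraction R P a s"
  using assms prime_one[OF assms(1)] unfolding fraction_def by blast

text \<open>The point is transitivity of the relation between fractions: in \<open>trans\<close> the
  multiplier u w t is again outside P because P is prime.\<close>

lemma fraction_eq_iff:
  assumes P: "primeideal P R" and a: "a \<in> carrier R" and s: "s \<in> carrier R - P"
    and b: "b \<in> carrier R" and t: "t \<in> carrier R - P"
  shows "fraction R P a s = fraction R P b t \<longleftrightarrow> (\<exists>u\<in>carrier R - P. u \<otimes> (a \<otimes> t) = u \<otimes> (b \<otimes> s))"
proof
  assume "fraction R P a s = fraction R P b t"
  with fraction_self[OF P b t] have "(b, t) \<in> fraction R P a s" by simp
  then show "\<exists>u\<in>carrier R - P. u \<otimes> (a \<otimes> t) = u \<otimes> (b \<otimes> s)" by (auto simp: fraction_def)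
next
  have trans: "fraction R P b t \<subseteq> fraction R P a s"
    if abst: "a \<in> carrier R" "s \<in> carrier R - P" "b \<in> carrier R" "t \<in> carrier R - P"
      and u: "u \<in> carrier R - P" "u \<otimes> (a \<otimes> t) = u \<otimes> (b \<otimes> s)" for a b s t u
  proof
    fix p assume "p \<in> fraction R P b t"
    then obtain c v w where p: "p = (c, v)" and c: "c \<in> carrier R" "v \<in> carrier R - P" and w: "w \<in> carrier R - P" "w \<otimes> (b \<otimes> v) = w \<otimes> (c \<otimes> t)"
      unfolding fraction_def by blast
    have [simp]: "u \<in> carrier R" "w \<in> carrier R" "a \<in> carrier R" "b \<in> carrier R" "s \<in> carrier R" "t \<in> carrier R"
      using abst u w by auto
    have [simp]: "v \<in> carrier R" using c by auto
    have "(u \<otimes> (w \<otimes> t)) \<otimes> (a \<otimes> v) = (w \<otimes> v) \<otimes> (u \<otimes> (a \<otimes> t))" using c by (simp add: m_ac)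
    also have "\<dots> = (u \<otimes> s) \<otimes> (w \<otimes> (b \<otimes> v))" unfolding u(2) using c by (simp add: m_ac)
    also have "\<dots> = (u \<otimes> (w \<otimes> t)) \<otimes> (c \<otimes> s)" unfolding w(2) using c by (simp add: m_ac)
    finally show "p \<in> fraction R P a s" unfolding fraction_def p using c
      using prime_compl_closed[OF P u(1) prime_compl_closed[OF P w(1) abst(4)]] by blast
  qed
  assume "\<exists>u\<in>carrier R - P. u \<otimes> (a \<otimes> t) = u \<otimes> (b \<otimes> s)"
  then obtain u where u: "u \<in> carrier R - P" "u \<otimes> (a \<otimes> t) = u \<otimes> (b \<otimes> s)" by blast
  show "fraction R P a s = fraction R P b t"
    using trans[OF a s b t u] trans[OF b t a s u(1) u(2)[symmetric]] by blast
qed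

lemma fractionD:
  assumes "(b, t) \<in> fraction R P a s"
  shows "b \<in> carrier R" "t \<in> carrier R - P" "\<exists>u\<in>carrier R - P. u \<otimes> (a \<otimes> t) = u \<otimes> (b \<otimes> s)"
  using assms by (auto simp: fraction_def)

lemma UN_fraction:
  assumes P: "primeideal P R" and a: "a \<in> carrier R" "s \<in> carrier R - P" and b: "b \<in> carrier R" "t \<in> carrier R - P"
    and g: "\<And>a' s' b' t'. (a', s') \<in> fraction R P a s \<Longrightarrow> (b', t') \<in> fraction R P b t \<Longrightarrow> g a' s' b' t' = K"
  shows "(\<Union>(a, s)\<in>fraction R P a s. \<Union>(b, t)\<in>fraction R P b t. g a s b t) = K"
proof -
  have "(\<Union>(b, t)\<in>fraction R P b t. g a' s' b t) = K" if "(a', s') \<in> fraction R P a s" for a' s'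
    by (rule UN_const[OF fraction_self[OF P b]]) (use g that in auto)
  note inner = this
  show ?thesis
  proof (rule UN_const[OF fraction_self[OF P a]])
    fix p assume p: "p \<in> fraction R P a s"
    obtain a' s' where "p = (a', s')" by (cases p)
    then show "(case p of (a, s) \<Rightarrow> \<Union>(b, t)\<in>fraction R P b t. g a s b t) = K" using p inner by simp
  qed
qed

lemma localization_mult:
  assumes P: "primeideal P R" and a: "a \<in> carrier R" "s \<in> carrier R - P" and b: "b \<in> carrier R" "t \<in> carrier R - P"
  shows "fraction R P a s \<otimes>\<^bsub>localization R P\<^esub> fraction R P b t = fraction R P (a \<otimes> b) (s \<otimes> t)"
  unfolding localization_def monoid.select_convs
proof (rule UN_fraction[OF P a b])
  fix a' s' b' t' assume 1: "(a', s') \<in> fraction R P a s" and 2: "(b', t') \<in> fraction R P b t"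
  obtain u where u: "u \<in> carrier R - P" "u \<otimes> (a \<otimes> s') = u \<otimes> (a' \<otimes> s)" using fractionD[OF 1] by blast
  obtain v where v: "v \<in> carrier R - P" "v \<otimes> (b \<otimes> t') = v \<otimes> (b' \<otimes> t)" using fractionD[OF 2] by blast
  note cl [simp] = fractionD(1)[OF 1] fractionD(1)[OF 2] a(1) b(1)
  have [simp]: "s \<in> carrier R" "t \<in> carrier R" "s' \<in> carrier R" "t' \<in> carrier R" "u \<in> carrier R" "v \<in> carrier R"
    using a b u v fractionD(2)[OF 1] fractionD(2)[OF 2] by auto
  have "(u \<otimes> v) \<otimes> ((a' \<otimes> b') \<otimes> (s \<otimes> t)) = (u \<otimes> (a' \<otimes> s)) \<otimes> (v \<otimes> (b' \<otimes> t))" by (simp add: m_ac)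
  also have "\<dots> = (u \<otimes> v) \<otimes> ((a \<otimes> b) \<otimes> (s' \<otimes> t'))" unfolding u(2)[symmetric] v(2)[symmetric] by (simp add: m_ac)
  finally show "fraction R P (a' \<otimes> b') (s' \<otimes> t') = fraction R P (a \<otimes> b) (s \<otimes> t)"
    using prime_compl_closed[OF P u(1) v(1)]
      fraction_eq_iff[OF P _ prime_compl_closed[OF P fractionD(2)[OF 1] fractionD(2)[OF 2]] _ prime_compl_closed[OF P a(2) b(2)],
        of "a' \<otimes> b'" "a \<otimes> b"] by auto
qed

lemma localization_add:
  assumes P: "primeideal P R" and a: "a \<in> carrier R" "s \<in> carrier R - P" and b: "b \<in> carrier R" "t \<in> carrier R - P"
  shows "fraction R P a s \<oplus>\<^bsub>localization R P\<^esub> fraction R P b t = fraction R P (a \<otimes> t \<oplus> b \<otimes> s) (s \<otimes> t)"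
  unfolding localization_def ring.select_convs
proof (rule UN_fraction[OF P a b])
  fix a' s' b' t' assume 1: "(a', s') \<in> fraction R P a s" and 2: "(b', t') \<in> fraction R P b t"
  obtain u where u: "u \<in> carrier R - P" "u \<otimes> (a \<otimes> s') = u \<otimes> (a' \<otimes> s)" using fractionD[OF 1] by blast
  obtain v where v: "v \<in> carrier R - P" "v \<otimes> (b \<otimes> t') = v \<otimes> (b' \<otimes> t)" using fractionD[OF 2] by blast
  note cl [simp] = fractionD(1)[OF 1] fractionD(1)[OF 2] a(1) b(1)
  have [simp]: "s \<in> carrier R" "t \<in> carrier R" "s' \<in> carrier R" "t' \<in> carrier R" "u \<in> carrier R" "v \<in> carrier R"
    using a b u v fractionD(2)[OF 1] fractionD(2)[OF 2] by auto
  have "(u \<otimes> v) \<otimes> ((a' \<otimes> t' \<oplus> b' \<otimes> s') \<otimes> (s \<otimes> t)) =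
      (v \<otimes> (t' \<otimes> t)) \<otimes> (u \<otimes> (a' \<otimes> s)) \<oplus> (u \<otimes> (s' \<otimes> s)) \<otimes> (v \<otimes> (b' \<otimes> t))" by (simp add: m_ac l_distr r_distr)
  also have "\<dots> = (u \<otimes> v) \<otimes> ((a \<otimes> t \<oplus> b \<otimes> s) \<otimes> (s' \<otimes> t'))"
    unfolding u(2)[symmetric] v(2)[symmetric] by (simp add: m_ac l_distr r_distr)
  finally show "fraction R P (a' \<otimes> t' \<oplus> b' \<otimes> s') (s' \<otimes> t') = fraction R P (a \<otimes> t \<oplus> b \<otimes> s) (s \<otimes> t)"
    using prime_compl_closed[OF P u(1) v(1)]
      fraction_eq_iff[OF P _ prime_compl_closed[OF P fractionD(2)[OF 1] fractionD(2)[OF 2]] _ prime_compl_closed[OF P a(2) b(2)],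
        of "a' \<otimes> t' \<oplus> b' \<otimes> s'" "a \<otimes> t \<oplus> b \<otimes> s"] by auto
qed

abbreviation primes where "primes \<equiv> {P. primeideal P R}"

definition basic_open :: "'a \<Rightarrow> 'a set set" where
  "basic_open f = {P. primeideal P R \<and> f \<notin> P}"

lemma basic_open_inter:
  assumes "f \<in> carrier R" "g \<in> carrier R"
  shows "basic_open f \<inter> basic_open g = basic_open (f \<otimes> g)"
proof (intro equalityI subsetI)
  fix P assume "P \<in> basic_open f \<inter> basic_open g"
  then show "P \<in> basic_open (f \<otimes> g)"
    using assms primeideal.I_prime[of P R f g] by (auto simp: basic_open_def)
next
  fix P assume P: "P \<in> basic_open (f \<otimes> g)"
  then interpret primeideal P R by (simp add: basic_open_def)
  show "P \<in> basic_open f \<inter> basic_open g"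
    using P assms I_l_closed[of g f] I_r_closed[of f g] primeideal_axioms by (auto simp: basic_open_def)
qed

lemma zariski_eq: "zariski R = topology_generated_by (basic_open ` carrier R)"
  unfolding zariski_def basic_open_def by (rule arg_cong[where f = topology_generated_by]) auto

lemma basic_open_one: "basic_open \<one> = primes"
  using prime_one by (auto simp: basic_open_def)

lemma topspace_zariski: "topspace (zariski R) = primes"
proof -
  have "\<Union> (basic_open ` carrier R) = primes"
    using basic_open_one by (auto simp: basic_open_def)
  then show ?thesis unfolding zariski_eq by (simp add: topology_generated_by_topspace)
qed

lemma openin_zariski_basis:
  assumes "openin (zariski R) U" "P \<in> U"
  shows "\<exists>f\<in>carrier R. P \<in> basic_open f \<and> basic_open f \<subseteq> U"
proof -
  have "generate_topology_on (basic_open ` carrier R) U"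
    using assms(1) unfolding zariski_eq by (simp add: openin_topology_generated_by_iff)
  then show ?thesis using assms(2)
  proof induction
    case (Int A B)
    then obtain f g where fg: "f \<in> carrier R" "P \<in> basic_open f" "basic_open f \<subseteq> A" "g \<in> carrier R" "P \<in> basic_open g" "basic_open g \<subseteq> B"
      by blast
    show ?case
      by (rule bexI[of _ "f \<otimes> g"]) (use fg in \<open>auto simp: basic_open_inter[symmetric]\<close>)
  next
    case (UN K)
    then show ?case by blast
  qed auto
qed

definition global_section :: "'a \<Rightarrow> 'a set \<Rightarrow> ('a \<times> 'a) set" where
  "global_section a = (\<lambda>P\<in>primes. fraction R P a \<one>)"

lemma fraction_in_localization:
  "a \<in> carrier R \<Longrightarrow> s \<in> carrier R - P \<Longrightarrow> fraction R P a s \<in> carrier (localization R P)"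
  unfolding localization_def by auto

lemma global_section_carrier:
  assumes "a \<in> carrier R"
  shows "global_section a \<in> carrier (structure_sheaf R primes)"
proof -
  have "\<forall>P\<in>primes. \<exists>O' a' s. openin (zariski R) O' \<and> P \<in> O' \<and> O' \<subseteq> primes \<and> a' \<in> carrier R \<and> s \<in> carrier R \<and>
          (\<forall>Q\<in>O'. s \<notin> Q \<and> global_section a Q = fraction R Q a' s)"
  proof
    fix P assume "P \<in> primes"
    moreover have "openin (zariski R) primes" using openin_topspace[of "zariski R"] by (simp add: topspace_zariski)
    ultimately show "\<exists>O' a' s. openin (zariski R) O' \<and> P \<in> O' \<and> O' \<subseteq> primes \<and> a' \<in> carrier R \<and> s \<in> carrier R \<and>
          (\<forall>Q\<in>O'. s \<notin> Q \<and> global_section a Q = fraction R Q a' s)"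
      using assms prime_one by (intro exI[of _ primes] exI[of _ a] exI[of _ \<one>]) (auto simp: global_section_def)
  qed
  moreover have "global_section a \<in> (\<Pi>\<^sub>E P\<in>primes. carrier (localization R P))"
    using assms prime_one by (auto simp: global_section_def intro!: fraction_in_localization)
  ultimately show ?thesis unfolding structure_sheaf_def by simp
qed

text \<open>The u with u a = u b form an ideal. Equality of the fractions at P puts such a u outside
  P, so this ideal lies in no prime and contains 1.\<close>

lemma global_section_inj:
  assumes a: "a \<in> carrier R" and b: "b \<in> carrier R" and eq: "global_section a = global_section b"
  shows "a = b"
proof -
  let ?K = "{u \<in> carrier R. u \<otimes> a = u \<otimes> b}"
  have K: "ideal ?K R"
  proof (rule idealI)
    show "subgroup ?K (add_monoid R)"
    proof
      fix x assume "x \<in> ?K"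
      then show "inv\<^bsub>add_monoid R\<^esub> x \<in> ?K"
        using a b by (auto simp: l_minus simp flip: a_inv_def)
    qed (use a b in \<open>auto simp: l_distr\<close>)
  next
    fix u x assume u: "u \<in> ?K" "x \<in> carrier R"
    then have "x \<otimes> (u \<otimes> a) = x \<otimes> (u \<otimes> b)" by simp
    then show "x \<otimes> u \<in> ?K" using u a b by (simp add: m_assoc)
    then show "u \<otimes> x \<in> ?K" using u by (simp add: m_comm)
  qed (rule ring_axioms)
  have "\<exists>n::nat. \<one> [^] n \<in> ?K"
  proof (rule ccontr)
    assume "\<not> ?thesis"
    then obtain P where P: "primeideal P R" "?K \<subseteq> P" using prime_avoiding[OF K one_closed] by blast
    have "fraction R P a \<one> = fraction R P b \<one>"
      using fun_cong[OF eq, of P] P by (simp add: global_section_def)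
    then obtain u where "u \<in> carrier R - P" "u \<otimes> (a \<otimes> \<one>) = u \<otimes> (b \<otimes> \<one>)"
      using fraction_eq_iff[OF P(1) a prime_one[OF P(1)] b prime_one[OF P(1)]] by blast
    then show False using P a b by auto
  qed
  then show ?thesis using a b by simp
qed

text \<open>In the expansion of (f + g)^(i+j) every term is divisible by f^i or by g^j; the
  induction on i + j splits off one factor f + g.\<close>

lemma pow_sum_in_ideal:
  assumes f: "f \<in> carrier R" and g: "g \<in> carrier R"
  shows "\<exists>u\<in>carrier R. \<exists>v\<in>carrier R. (f \<oplus> g) [^] (i + j :: nat) = f [^] i \<otimes> u \<oplus> g [^] j \<otimes> v"
proof (induction "i + j" arbitrary: i j)
  case 0
  then show ?case using f g by (intro bexI[of _ \<one>] bexI[of _ \<zero>]) auto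
next
  case (Suc k)
  show ?case
  proof (cases "i = 0 \<or> j = 0")
    case True
    then show ?thesis
    proof
      assume "i = 0"
      then show ?thesis using f g by (intro bexI[of _ "(f \<oplus> g) [^] j"] bexI[of _ \<zero>]) auto
    next
      assume "j = 0"
      then show ?thesis using f g by (intro bexI[of _ \<zero>] bexI[of _ "(f \<oplus> g) [^] i"]) auto
    qed
  next
    case False
    then obtain i' j' where ij: "i = Suc i'" "j = Suc j'" by (metis not0_implies_Suc)
    obtain u v where 1: "u \<in> carrier R" "v \<in> carrier R" "(f \<oplus> g) [^] (i' + j) = f [^] i' \<otimes> u \<oplus> g [^] j \<otimes> v"
      using Suc(1)[of i' j] Suc(2) ij by auto
    obtain u' v' where 2: "u' \<in> carrier R" "v' \<in> carrier R" "(f \<oplus> g) [^] (i + j') = f [^] i \<otimes> u' \<oplus> g [^] j' \<otimes> v'"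
      using Suc(1)[of i j'] Suc(2) ij by auto
    have "(f \<oplus> g) [^] (i + j) = (f \<oplus> g) [^] (i' + j) \<otimes> f \<oplus> (f \<oplus> g) [^] (i + j') \<otimes> g"
      using f g by (simp add: ij r_distr)
    also have "\<dots> = f [^] i \<otimes> (u \<oplus> u' \<otimes> g) \<oplus> g [^] j \<otimes> (v \<otimes> f \<oplus> v')"
      unfolding 1(3) 2(3) using 1(1,2) 2(1,2) f g by (simp add: ij l_distr r_distr m_ac a_ac)
    finally show ?thesis using 1 2 f g by (intro bexI[of _ "u \<oplus> u' \<otimes> g"] bexI[of _ "v \<otimes> f \<oplus> v'"]) auto
  qed
qed

lemma power_in_PIdl:
  assumes f: "f \<in> carrier R" and s: "s \<in> carrier R" and sub: "basic_open f \<subseteq> basic_open s"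
  shows "\<exists>(n::nat). \<exists>y\<in>carrier R. f [^] n = s \<otimes> y"
proof (rule ccontr)
  assume no: "\<not> ?thesis"
  then have "f [^] (n::nat) \<notin> PIdl s" for n using s by (auto simp: cgenideal_def m_comm)
  then obtain P where P: "primeideal P R" "PIdl s \<subseteq> P" "f \<notin> P"
    using prime_avoiding[OF cgenideal_ideal[OF s] f] by blast
  then have "s \<in> P" using cgenideal_self[OF s] by blast
  then show False using P sub by (auto simp: basic_open_def)
qed

text \<open>The elements on whose basic open set a given section is a single fraction form an ideal; for
  a section of the structure sheaf no prime contains it, so it contains 1.\<close>

definition fraction_locus :: "('a set \<Rightarrow> ('a \<times> 'a) set) \<Rightarrow> 'a set" where
  "fraction_locus \<sigma> = {f \<in> carrier R. \<exists>c\<in>carrier R. \<exists>s\<in>carrier R. \<forall>Q\<in>basic_open f. s \<notin> Q \<and> \<sigma> Q = fraction R Q c s}"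

text \<open>Gluing over two basic open sets. On D(f g) the fractions c/s and d/t agree, so a power
  of f g annihilates c t - d s; expanding both fractions by n-th powers makes c' t' = d' s' hold
  exactly. Some power of f + g has the form s' y u + t' z v, and the same combination of c' and d'
  is the numerator of a fraction valid on all of D(f + g).\<close>

lemma fraction_locus_add:
  assumes "f \<in> fraction_locus \<sigma>" "g \<in> fraction_locus \<sigma>"
  shows "f \<oplus> g \<in> fraction_locus \<sigma>"
proof -
  obtain c s where f: "f \<in> carrier R" "c \<in> carrier R" "s \<in> carrier R" "\<And>Q. Q \<in> basic_open f \<Longrightarrow> s \<notin> Q \<and> \<sigma> Q = fraction R Q c s"
    using assms(1) unfolding fraction_locus_def by blast
  obtain d t where g: "g \<in> carrier R" "d \<in> carrier R" "t \<in> carrier R" "\<And>Q. Q \<in> basic_open g \<Longrightarrow> t \<notin> Q \<and> \<sigma> Q = fraction R Q d t"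
    using assms(2) unfolding fraction_locus_def by blast
  let ?K = "{u \<in> carrier R. u \<otimes> (c \<otimes> t) = u \<otimes> (d \<otimes> s)}"
  note [simp] = f(1-3) g(1-3)
  have K: "ideal ?K R"
  proof (rule idealI)
    show "subgroup ?K (add_monoid R)"
    proof
      fix x assume "x \<in> ?K"
      then show "inv\<^bsub>add_monoid R\<^esub> x \<in> ?K"
        by (auto simp: l_minus simp flip: a_inv_def)
    qed (auto simp: l_distr)
  next
    fix a x assume ax: "a \<in> ?K" "x \<in> carrier R"
    then have "x \<otimes> (a \<otimes> (c \<otimes> t)) = x \<otimes> (a \<otimes> (d \<otimes> s))" by simp
    then show "x \<otimes> a \<in> ?K" using ax by (simp add: m_assoc)
    then show "a \<otimes> x \<in> ?K" using ax by (simp add: m_comm)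
  qed (rule ring_axioms)
  have "\<exists>n::nat. (f \<otimes> g) [^] n \<in> ?K"
  proof (rule ccontr)
    assume "\<not> ?thesis"
    then obtain P where P: "primeideal P R" "?K \<subseteq> P" "f \<otimes> g \<notin> P" using prime_avoiding[OF K, of "f \<otimes> g"] by auto
    then have PD: "P \<in> basic_open f" "P \<in> basic_open g" using basic_open_inter[of f g] by (auto simp: basic_open_def)
    then have "fraction R P c s = fraction R P d t" using f(4) g(4) by metis
    then obtain u where "u \<in> carrier R - P" "u \<otimes> (c \<otimes> t) = u \<otimes> (d \<otimes> s)"
      using fraction_eq_iff[OF P(1), of c s d t] f(4)[OF PD(1)] g(4)[OF PD(2)] by auto
    then show False using P by auto
  qed
  then obtain n :: nat where n: "(f \<otimes> g) [^] n \<otimes> (c \<otimes> t) = (f \<otimes> g) [^] n \<otimes> (d \<otimes> s)" by blast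
  define c' s' d' t' where "c' = c \<otimes> f [^] n" and "s' = s \<otimes> f [^] n" and "d' = d \<otimes> g [^] n" and "t' = t \<otimes> g [^] n"
  have [simp]: "c' \<in> carrier R" "s' \<in> carrier R" "d' \<in> carrier R" "t' \<in> carrier R"
    by (simp_all add: c'_def s'_def d'_def t'_def)
  have ct: "c' \<otimes> t' = d' \<otimes> s'"
    using n by (simp add: c'_def s'_def d'_def t'_def nat_pow_distrib m_ac)
  have pow: "h [^] n \<notin> Q" if "Q \<in> basic_open h" "h \<in> carrier R" for h Q
  proof -
    interpret primeideal Q R using that by (simp add: basic_open_def)
    show ?thesis
    proof (induction n)
      case 0
      then show ?case using prime_one[OF primeideal_axioms] by simp
    next
      case (Suc n)
      then show ?case using that I_prime[of "h [^] n" h] by (auto simp: basic_open_def)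
    qed
  qed
  have f': "s' \<notin> Q \<and> \<sigma> Q = fraction R Q c' s'" if Q: "Q \<in> basic_open f" for Q
  proof -
    have P: "primeideal Q R" using Q by (simp add: basic_open_def)
    have s: "s \<in> carrier R - Q" and fn: "f [^] n \<in> carrier R - Q" using f(4)[OF Q] pow[OF Q] by auto
    have s': "s' \<in> carrier R - Q" unfolding s'_def by (rule prime_compl_closed[OF P s fn])
    have "\<one> \<otimes> (c \<otimes> s') = \<one> \<otimes> (c' \<otimes> s)" by (simp add: s'_def c'_def m_ac)
    then have "fraction R Q c s = fraction R Q c' s'"
      using fraction_eq_iff[OF P _ s _ s', of c c'] prime_one[OF P] by auto
    then show ?thesis using f(4)[OF Q] s' by simp
  qed
  have g': "t' \<notin> Q \<and> \<sigma> Q = fraction R Q d' t'" if Q: "Q \<in> basic_open g" for Q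
  proof -
    have P: "primeideal Q R" using Q by (simp add: basic_open_def)
    have t: "t \<in> carrier R - Q" and gn: "g [^] n \<in> carrier R - Q" using g(4)[OF Q] pow[OF Q] by auto
    have t': "t' \<in> carrier R - Q" unfolding t'_def by (rule prime_compl_closed[OF P t gn])
    have "\<one> \<otimes> (d \<otimes> t') = \<one> \<otimes> (d' \<otimes> t)" by (simp add: t'_def d'_def m_ac)
    then have "fraction R Q d t = fraction R Q d' t'"
      using fraction_eq_iff[OF P _ t _ t', of d d'] prime_one[OF P] by auto
    then show ?thesis using g(4)[OF Q] t' by simp
  qed
  \<comment> \<open>D(f) is contained in D(s'), hence s' divides a power of f; likewise t' divides a
    power of g.\<close>
  obtain k :: nat and y where k: "y \<in> carrier R" "f [^] k = s' \<otimes> y"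
    using power_in_PIdl[of f s'] f' by (auto simp: basic_open_def)
  obtain l :: nat and z where l: "z \<in> carrier R" "g [^] l = t' \<otimes> z"
    using power_in_PIdl[of g t'] g' by (auto simp: basic_open_def)
  obtain u v where uv: "u \<in> carrier R" "v \<in> carrier R" "(f \<oplus> g) [^] (k + l) = f [^] k \<otimes> u \<oplus> g [^] l \<otimes> v"
    using pow_sum_in_ideal[OF f(1) g(1)] by blast
  note [simp] = uv(1,2) k(1) l(1)
  define s'' c'' where "s'' = s' \<otimes> (y \<otimes> u) \<oplus> t' \<otimes> (z \<otimes> v)" and "c'' = c' \<otimes> (y \<otimes> u) \<oplus> d' \<otimes> (z \<otimes> v)"
  have [simp]: "s'' \<in> carrier R" "c'' \<in> carrier R" by (simp_all add: s''_def c''_def)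
  have pow_s'': "(f \<oplus> g) [^] (k + l) = s''" unfolding uv(3) k(2) l(2) s''_def by (simp add: m_assoc)
  have 1: "c' \<otimes> s'' = c'' \<otimes> s'"
  proof -
    have "c' \<otimes> s'' = (c' \<otimes> s') \<otimes> (y \<otimes> u) \<oplus> (c' \<otimes> t') \<otimes> (z \<otimes> v)" by (simp add: s''_def r_distr m_assoc)
    then show ?thesis unfolding ct by (simp add: c''_def l_distr r_distr m_ac)
  qed
  have 2: "d' \<otimes> s'' = c'' \<otimes> t'"
  proof -
    have "d' \<otimes> s'' = (d' \<otimes> s') \<otimes> (y \<otimes> u) \<oplus> (d' \<otimes> t') \<otimes> (z \<otimes> v)" by (simp add: s''_def r_distr m_assoc)
    then show ?thesis unfolding ct[symmetric] by (simp add: c''_def l_distr r_distr m_ac)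
  qed
  have "s'' \<notin> Q \<and> \<sigma> Q = fraction R Q c'' s''" if Q: "Q \<in> basic_open (f \<oplus> g)" for Q
  proof -
    interpret primeideal Q R using Q by (simp add: basic_open_def)
    have P: "primeideal Q R" by (rule primeideal_axioms)
    have "(f \<oplus> g) [^] m \<notin> Q" for m :: nat
    proof (induction m)
      case 0
      then show ?case using prime_one[OF P] by simp
    next
      case (Suc m)
      then show ?case using Q I_prime[of "(f \<oplus> g) [^] m" "f \<oplus> g"] by (auto simp: basic_open_def)
    qed
    then have s'': "s'' \<in> carrier R - Q" using pow_s'' by auto
    have "f \<notin> Q \<or> g \<notin> Q"
      using Q additive_subgroup.a_closed[OF is_additive_subgroup, of f g] by (auto simp: basic_open_def)
    then have "\<sigma> Q = fraction R Q c'' s''"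
    proof
      assume "f \<notin> Q"
      then have "Q \<in> basic_open f" using P by (simp add: basic_open_def)
      then have *: "s' \<in> carrier R - Q" "\<sigma> Q = fraction R Q c' s'" using f' by auto
      have "\<one> \<otimes> (c' \<otimes> s'') = \<one> \<otimes> (c'' \<otimes> s')" using 1 by simp
      then show ?thesis using fraction_eq_iff[OF P _ *(1) _ s'', of c' c''] prime_one[OF P] *(2) by auto
    next
      assume "g \<notin> Q"
      then have "Q \<in> basic_open g" using P by (simp add: basic_open_def)
      then have *: "t' \<in> carrier R - Q" "\<sigma> Q = fraction R Q d' t'" using g' by auto
      have "\<one> \<otimes> (d' \<otimes> s'') = \<one> \<otimes> (c'' \<otimes> t')" using 2 by simp
      then show ?thesis using fraction_eq_iff[OF P _ *(1) _ s'', of d' c''] prime_one[OF P] *(2) by auto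
    qed
    then show ?thesis using s'' by simp
  qed
  moreover have "f \<oplus> g \<in> carrier R" by simp
  ultimately show ?thesis
    unfolding fraction_locus_def using \<open>s'' \<in> carrier R\<close> \<open>c'' \<in> carrier R\<close> by blast
qed

lemma fraction_locus_ideal: "ideal (fraction_locus \<sigma>) R"
proof -
  have mult: "x \<otimes> f \<in> fraction_locus \<sigma>" if "f \<in> fraction_locus \<sigma>" "x \<in> carrier R" for f x
  proof -
    have "f \<in> carrier R" using that(1) by (simp add: fraction_locus_def)
    moreover have "\<exists>c\<in>carrier R. \<exists>s\<in>carrier R. \<forall>Q\<in>basic_open f. s \<notin> Q \<and> \<sigma> Q = fraction R Q c s"
      using that(1) unfolding fraction_locus_def mem_Collect_eq by (rule conjunct2)
    then obtain c s where "c \<in> carrier R" "s \<in> carrier R" "\<forall>Q\<in>basic_open f. s \<notin> Q \<and> \<sigma> Q = fraction R Q c s"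
      by (elim bexE)
    ultimately have f: "f \<in> carrier R" "c \<in> carrier R" "s \<in> carrier R" "\<forall>Q\<in>basic_open f. s \<notin> Q \<and> \<sigma> Q = fraction R Q c s" by auto
    have "basic_open (x \<otimes> f) \<subseteq> basic_open f" using basic_open_inter[OF that(2) f(1)] by blast
    then show ?thesis unfolding fraction_locus_def using f that by blast
  qed
  have zero: "\<zero> \<in> fraction_locus \<sigma>"
  proof -
    have "basic_open \<zero> = {}"
      using additive_subgroup.zero_closed[OF ideal.axioms(1)[OF primeideal.axioms(1)]] by (auto simp: basic_open_def)
    then show ?thesis unfolding fraction_locus_def by blast
  qed
  have sub: "fraction_locus \<sigma> \<subseteq> carrier R" by (auto simp: fraction_locus_def)
  show ?thesis
  proof (rule idealI)
    show "subgroup (fraction_locus \<sigma>) (add_monoid R)"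
    proof
      fix x assume x: "x \<in> fraction_locus \<sigma>"
      then have "\<ominus> x = (\<ominus> \<one>) \<otimes> x" using sub by (auto simp: l_minus)
      then show "inv\<^bsub>add_monoid R\<^esub> x \<in> fraction_locus \<sigma>" using mult[OF x, of "\<ominus> \<one>"] by (simp flip: a_inv_def)
    qed (use sub zero fraction_locus_add in auto)
  next
    fix a x assume "a \<in> fraction_locus \<sigma>" "x \<in> carrier R"
    moreover from this have "a \<otimes> x = x \<otimes> a" using sub by (intro m_comm) auto
    ultimately show "x \<otimes> a \<in> fraction_locus \<sigma>" "a \<otimes> x \<in> fraction_locus \<sigma>" using mult by auto
  qed (rule ring_axioms)
qed

text \<open>Once 1 lies in the locus, the section is one fraction c/s on the whole spectrum; s
  avoids every prime, so it is a unit and the fraction is an element of the ring.\<close>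

lemma global_section_surj:
  assumes \<sigma>: "\<sigma> \<in> carrier (structure_sheaf R primes)"
  shows "\<exists>a\<in>carrier R. \<sigma> = global_section a"
proof -
  have ext: "\<sigma> \<in> (\<Pi>\<^sub>E P\<in>primes. carrier (localization R P))"
    and loc: "\<And>P. P \<in> primes \<Longrightarrow> \<exists>O' a s. openin (zariski R) O' \<and> P \<in> O' \<and> O' \<subseteq> primes \<and>
          a \<in> carrier R \<and> s \<in> carrier R \<and> (\<forall>Q\<in>O'. s \<notin> Q \<and> \<sigma> Q = fraction R Q a s)"
    using \<sigma> unfolding structure_sheaf_def by auto
  have "\<exists>n::nat. \<one> [^] n \<in> fraction_locus \<sigma>"
  proof (rule ccontr)
    assume "\<not> ?thesis"
    then obtain P where P: "primeideal P R" "fraction_locus \<sigma> \<subseteq> P"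
      using prime_avoiding[OF fraction_locus_ideal one_closed] by blast
    then obtain O' a s where O': "openin (zariski R) O'" "P \<in> O'" "a \<in> carrier R" "s \<in> carrier R"
      "\<forall>Q\<in>O'. s \<notin> Q \<and> \<sigma> Q = fraction R Q a s" using loc[of P] by blast
    then obtain f where "f \<in> carrier R" "P \<in> basic_open f" "basic_open f \<subseteq> O'"
      using openin_zariski_basis by blast
    then have "f \<in> fraction_locus \<sigma>" "f \<notin> P" using O' unfolding fraction_locus_def by (blast, simp add: basic_open_def)
    then show False using P by blast
  qed
  then have "\<one> \<in> fraction_locus \<sigma>" by simp
  then have "\<exists>c\<in>carrier R. \<exists>s\<in>carrier R. \<forall>Q\<in>primes. s \<notin> Q \<and> \<sigma> Q = fraction R Q c s"
    unfolding fraction_locus_def basic_open_one mem_Collect_eq by (rule conjunct2)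
  then obtain c s where cs: "c \<in> carrier R" "s \<in> carrier R" and "\<forall>Q\<in>primes. s \<notin> Q \<and> \<sigma> Q = fraction R Q c s"
    by (elim bexE)
  then have cs3: "s \<notin> Q \<and> \<sigma> Q = fraction R Q c s" if "primeideal Q R" for Q using that by simp
  have "\<exists>t\<in>carrier R. s \<otimes> t = \<one>" by (rule unit_if_in_no_prime[OF cs(2) conjunct1[OF cs3]])
  then obtain t where t: "t \<in> carrier R" "s \<otimes> t = \<one>" by (elim bexE)
  have "\<sigma> = global_section (c \<otimes> t)"
  proof (rule PiE_ext[OF ext])
    show "global_section (c \<otimes> t) \<in> (\<Pi>\<^sub>E P\<in>primes. carrier (localization R P))"
      using global_section_carrier[of "c \<otimes> t"] cs t by (simp add: structure_sheaf_def)
    fix P assume "P \<in> primes"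
    then have P: "primeideal P R" by simp
    have "c = (c \<otimes> t) \<otimes> s" using cs(1,2) t by (simp add: m_assoc m_comm[of t s])
    then have "\<one> \<otimes> (c \<otimes> \<one>) = \<one> \<otimes> ((c \<otimes> t) \<otimes> s)" using cs(1,2) t by simp
    then have "fraction R P c s = fraction R P (c \<otimes> t) \<one>"
      using fraction_eq_iff[OF P cs(1) _ _ prime_one[OF P], of s "c \<otimes> t"] cs(2) cs3[OF P] t cs(1) prime_one[OF P] by auto
    then show "\<sigma> P = global_section (c \<otimes> t) P" using cs3[OF P] P by (simp add: global_section_def)
  qed
  then show ?thesis using cs t by blast
qed

lemma global_section_iso: "global_section \<in> ring_iso R (structure_sheaf R primes)"
proof -
  have 1: "primeideal P R \<Longrightarrow> \<one> \<otimes> \<one> \<in> carrier R - P" for P using prime_one by simp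
  have mult: "global_section (a \<otimes> b) = global_section a \<otimes>\<^bsub>structure_sheaf R primes\<^esub> global_section b"
    if "a \<in> carrier R" "b \<in> carrier R" for a b
    using that by (auto simp: structure_sheaf_def global_section_def fun_eq_iff restrict_def localization_mult prime_one[unfolded Diff_iff])
  have add: "global_section (a \<oplus> b) = global_section a \<oplus>\<^bsub>structure_sheaf R primes\<^esub> global_section b"
    if "a \<in> carrier R" "b \<in> carrier R" for a b
    using that by (auto simp: structure_sheaf_def global_section_def fun_eq_iff restrict_def localization_add prime_one[unfolded Diff_iff])
  have one: "global_section \<one> = \<one>\<^bsub>structure_sheaf R primes\<^esub>"
    by (auto simp: structure_sheaf_def global_section_def localization_def)
  have "bij_betw global_section (carrier R) (carrier (structure_sheaf R primes))"
    unfolding bij_betw_def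
  proof
    show "inj_on global_section (carrier R)" by (intro inj_onI global_section_inj)
    show "global_section ` carrier R = carrier (structure_sheaf R primes)"
    proof
      show "global_section ` carrier R \<subseteq> carrier (structure_sheaf R primes)" using global_section_carrier by blast
      show "carrier (structure_sheaf R primes) \<subseteq> global_section ` carrier R" using global_section_surj by blast
    qed
  qed
  then show ?thesis
    unfolding ring_iso_def ring_hom_def using mult add one global_section_carrier by auto
qed

end

text \<open>A scheme isomorphism contains a contravariant isomorphism on global sections, which are
  the rings themselves by \<open>global_section_iso\<close>.\<close>

lemma isomorphic_Spec_ring_iso:
  assumes A: "cring A" and B: "cring B" and iso: "isomorphic_schemes (Spec A) (Spec B)"
  shows "\<exists>h. h \<in> ring_iso B A"
proof -
  interpret A: cring A by (rule A)
  interpret B: cring B by (rule B)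
  obtain \<phi> \<theta> where \<phi>: "homeomorphic_map (zariski A) (zariski B) \<phi>"
    and \<theta>: "\<And>U. openin (zariski B) U \<Longrightarrow>
      \<theta> U \<in> ring_iso (structure_sheaf B U) (structure_sheaf A {x \<in> topspace (zariski A). \<phi> x \<in> U})"
    using iso unfolding isomorphic_schemes_def Spec_def by (auto simp: Let_def)
  have "{x \<in> topspace (zariski A). \<phi> x \<in> topspace (zariski B)} = topspace (zariski A)"
    using homeomorphic_imp_surjective_map[OF \<phi>] by blast
  then have iso: "\<theta> B.primes \<in> ring_iso (structure_sheaf B B.primes) (structure_sheaf A A.primes)"
    using \<theta>[OF openin_topspace] by (simp add: A.topspace_zariski B.topspace_zariski)
  define germ where "germ = inv_into (carrier A) A.global_section"
  have bij: "bij_betw A.global_section (carrier A) (carrier (structure_sheaf A A.primes))"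
    using A.global_section_iso by (simp add: ring_iso_def)
  have inv_in: "germ y \<in> carrier A" and inv_eq: "A.global_section (germ y) = y"
    if "y \<in> carrier (structure_sheaf A A.primes)" for y
    using bij that unfolding germ_def by (simp_all add: bij_betw_def inv_into_into f_inv_into_f)
  have gh: "A.global_section \<in> ring_hom A (structure_sheaf A A.primes)"
    using A.global_section_iso by (simp add: ring_iso_def)
  have inv_unique: "germ y = x" if "x \<in> carrier A" "A.global_section x = y" for x y
    using that bij unfolding germ_def bij_betw_def by auto
  have "germ \<in> ring_hom (structure_sheaf A A.primes) A"
  proof (rule ring_hom_memI)
    show "germ \<one>\<^bsub>structure_sheaf A A.primes\<^esub> = \<one>\<^bsub>A\<^esub>"
      by (rule inv_unique) (auto simp: ring_hom_one[OF gh])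
    fix x y assume xy: "x \<in> carrier (structure_sheaf A A.primes)" "y \<in> carrier (structure_sheaf A A.primes)"
    show "germ (x \<otimes>\<^bsub>structure_sheaf A A.primes\<^esub> y) = germ x \<otimes>\<^bsub>A\<^esub> germ y"
      "germ (x \<oplus>\<^bsub>structure_sheaf A A.primes\<^esub> y) = germ x \<oplus>\<^bsub>A\<^esub> germ y"
      using xy by (auto intro!: inv_unique simp: ring_hom_mult[OF gh] ring_hom_add[OF gh] inv_in inv_eq)
  qed (rule inv_in)
  moreover have "bij_betw germ (carrier (structure_sheaf A A.primes)) (carrier A)"
    unfolding germ_def by (rule bij_betw_inv_into[OF bij])
  ultimately have inv_iso: "germ \<in> ring_iso (structure_sheaf A A.primes) A" by (simp add: ring_iso_def)
  have "germ \<circ> (\<theta> B.primes \<circ> B.global_section) \<in> ring_iso B A"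
    by (rule ring_iso_set_trans[OF ring_iso_set_trans[OF B.global_section_iso iso] inv_iso])
  then show ?thesis by blast
qed

section \<open>A ring invariant\<close>

definition square_ideal :: "('a, 'm) ring_scheme \<Rightarrow> 'a set \<Rightarrow> 'a set" where
  "square_ideal A m = Idl\<^bsub>A\<^esub> {x \<otimes>\<^bsub>A\<^esub> y | x y. x \<in> m \<and> y \<in> m}"

text \<open>Derivations into $A/m^2$ are represented by maps into \<open>A\<close>.\<close>

definition derivation_mod_square :: "('a, 'm) ring_scheme \<Rightarrow> 'a set \<Rightarrow> ('a \<Rightarrow> 'a) \<Rightarrow> bool" where
  "derivation_mod_square A m d \<longleftrightarrow> d \<in> carrier A \<rightarrow> carrier A \<and>
     (\<forall>x\<in>carrier A. \<forall>y\<in>carrier A.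
        d (x \<oplus>\<^bsub>A\<^esub> y) \<ominus>\<^bsub>A\<^esub> (d x \<oplus>\<^bsub>A\<^esub> d y) \<in> square_ideal A m \<and>
        d (x \<otimes>\<^bsub>A\<^esub> y) \<ominus>\<^bsub>A\<^esub> (d x \<otimes>\<^bsub>A\<^esub> y \<oplus>\<^bsub>A\<^esub> x \<otimes>\<^bsub>A\<^esub> d y) \<in> square_ideal A m)"

text \<open>The derivations are only additive: a scheme isomorphism yields a ring isomorphism that
  may move the complex scalars, and the notion has to be transported along it.\<close>

definition has_rigid_point :: "('a, 'm) ring_scheme \<Rightarrow> bool" where
  "has_rigid_point A \<longleftrightarrow> (\<exists>m. maximalideal m A \<and> (\<forall>d. derivation_mod_square A m d \<longrightarrow> d ` m \<subseteq> m))"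

lemma preimage_ideal:
  assumes A: "ring A" and B: "ring B" and h: "h \<in> ring_hom A B" and I: "ideal I B"
  shows "ideal {x \<in> carrier A. h x \<in> I} A"
proof -
  interpret h: ring_hom_ring A B h using A B h by (rule ring_hom_ringI2)
  interpret I: ideal I B by (rule I)
  show ?thesis
  proof (rule idealI)
    show "subgroup {x \<in> carrier A. h x \<in> I} (add_monoid A)"
    proof
      fix x assume x: "x \<in> {x \<in> carrier A. h x \<in> I}"
      then have "\<ominus>\<^bsub>B\<^esub> h x \<in> I" using additive_subgroup.a_inv_closed[OF I.is_additive_subgroup] by blast
      then show "inv\<^bsub>add_monoid A\<^esub> x \<in> {x \<in> carrier A. h x \<in> I}"
        using x by (simp flip: a_inv_def)
    qed (auto simp: additive_subgroup.zero_closed[OF I.is_additive_subgroup]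
        additive_subgroup.a_closed[OF I.is_additive_subgroup])
  qed (use A in \<open>auto simp: I.I_l_closed I.I_r_closed\<close>)
qed

lemma square_ideal_subset:
  assumes A: "ring A" and J: "ideal J A" and prod: "\<And>x y. x \<in> m \<Longrightarrow> y \<in> m \<Longrightarrow> x \<otimes>\<^bsub>A\<^esub> y \<in> J"
  shows "square_ideal A m \<subseteq> J"
  unfolding square_ideal_def by (rule ring.genideal_minimal[OF A J]) (use prod in auto)

lemma square_ideal_ideal:
  assumes A: "ring A" and m: "m \<subseteq> carrier A"
  shows "ideal (square_ideal A m) A"
  unfolding square_ideal_def
  by (rule ring.genideal_ideal[OF A]) (use m ring.ring_simprules(5)[OF A] in auto)

lemma mult_in_square_ideal:
  assumes A: "ring A" and m: "m \<subseteq> carrier A" and xy: "x \<in> m" "y \<in> m"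
  shows "x \<otimes>\<^bsub>A\<^esub> y \<in> square_ideal A m"
proof -
  have "{x \<otimes>\<^bsub>A\<^esub> y | x y. x \<in> m \<and> y \<in> m} \<subseteq> carrier A"
    using m ring.ring_simprules(5)[OF A] by auto
  from ring.genideal_self[OF A this] show ?thesis
    unfolding square_ideal_def using xy by blast
qed

lemma has_rigid_point_iso:
  assumes A: "cring A" and B: "cring B" and h: "h \<in> ring_iso A B" and rigid: "has_rigid_point B"
  shows "has_rigid_point A"
proof -
  interpret A: cring A by (rule A)
  interpret B: cring B by (rule B)
  obtain m where m: "maximalideal m B" and md: "\<And>d. derivation_mod_square B m d \<Longrightarrow> d ` m \<subseteq> m"
    using rigid unfolding has_rigid_point_def by blast
  interpret m: maximalideal m B by (rule m)
  define g where "g = inv_into (carrier A) h"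
  have hh: "h \<in> ring_hom A B" and bij: "bij_betw h (carrier A) (carrier B)"
    using h by (auto simp: ring_iso_def)
  have gi: "g \<in> ring_iso B A" unfolding g_def by (rule ring_iso_set_sym[OF A.ring_axioms h])
  then have gh: "g \<in> ring_hom B A" by (simp add: ring_iso_def)
  interpret h: ring_hom_ring A B h by (rule ring_hom_ringI2[OF A.ring_axioms B.ring_axioms hh])
  interpret g: ring_hom_ring B A g by (rule ring_hom_ringI2[OF B.ring_axioms A.ring_axioms gh])
  have gh_id [simp]: "g (h x) = x" if "x \<in> carrier A" for x
    using bij that by (simp add: g_def bij_betw_def)
  have hg_id [simp]: "h (g y) = y" if "y \<in> carrier B" for y
    using bij that by (simp add: g_def bij_betw_def f_inv_into_f)
  let ?m = "{x \<in> carrier A. h x \<in> m}"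
  have "maximalideal ?m A"
  proof (rule maximalidealI)
    show "ideal ?m A" by (rule preimage_ideal[OF A.ring_axioms B.ring_axioms hh m.ideal_axioms])
    show "carrier A \<noteq> ?m"
    proof
      assume eq: "carrier A = ?m"
      have "carrier B \<subseteq> m"
      proof
        fix y assume y: "y \<in> carrier B"
        then have "g y \<in> ?m" using eq by (metis g.hom_closed)
        then show "y \<in> m" using y by simp
      qed
      then show False using m.I_notcarr m.a_subset by blast
    qed
    fix J assume J: "ideal J A" "?m \<subseteq> J" "J \<subseteq> carrier A"
    let ?J = "{y \<in> carrier B. g y \<in> J}"
    have "ideal ?J B" by (rule preimage_ideal[OF B.ring_axioms A.ring_axioms gh J(1)])
    moreover have "m \<subseteq> ?J" using J(2) m.a_subset by auto
    ultimately have "?J = m \<or> ?J = carrier B" using m.I_maximal[of ?J] by blast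
    then show "J = ?m \<or> J = carrier A"
    proof
      assume *: "?J = m"
      have "x \<in> ?m" if "x \<in> J" for x
      proof -
        have "h x \<in> ?J" using that J(3) by auto
        then show ?thesis using that J(3) * by auto
      qed
      then show ?thesis using J(2) by blast
    next
      assume *: "?J = carrier B"
      have "x \<in> J" if "x \<in> carrier A" for x
      proof -
        have "h x \<in> ?J" using * that by simp
        then show ?thesis using that by simp
      qed
      then show ?thesis using J(3) by blast
    qed
  qed
  moreover have "d ` ?m \<subseteq> ?m" if d: "derivation_mod_square A ?m d" for d
  proof -
    have dc: "d x \<in> carrier A" if "x \<in> carrier A" for x using d that by (auto simp: derivation_mod_square_def)
    have sq: "square_ideal A ?m \<subseteq> {x \<in> carrier A. h x \<in> square_ideal B m}"
    proof (rule square_ideal_subset[OF A.ring_axioms])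
      show "ideal {x \<in> carrier A. h x \<in> square_ideal B m} A"
        by (rule preimage_ideal[OF A.ring_axioms B.ring_axioms hh square_ideal_ideal[OF B.ring_axioms m.a_subset]])
      fix x y assume "x \<in> ?m" "y \<in> ?m"
      then show "x \<otimes>\<^bsub>A\<^esub> y \<in> {x \<in> carrier A. h x \<in> square_ideal B m}"
        by (auto intro: mult_in_square_ideal[OF B.ring_axioms m.a_subset])
    qed
    have "derivation_mod_square B m (\<lambda>y. h (d (g y)))"
      unfolding derivation_mod_square_def
    proof (intro conjI ballI)
      show "(\<lambda>y. h (d (g y))) \<in> carrier B \<rightarrow> carrier B" using dc by simp
      fix x y assume xy: "x \<in> carrier B" "y \<in> carrier B"
      have "d (g x \<oplus>\<^bsub>A\<^esub> g y) \<ominus>\<^bsub>A\<^esub> (d (g x) \<oplus>\<^bsub>A\<^esub> d (g y)) \<in> square_ideal A ?m"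
        using d xy unfolding derivation_mod_square_def by simp
      then have "h (d (g x \<oplus>\<^bsub>A\<^esub> g y) \<ominus>\<^bsub>A\<^esub> (d (g x) \<oplus>\<^bsub>A\<^esub> d (g y))) \<in> square_ideal B m" using sq by blast
      then show "h (d (g (x \<oplus>\<^bsub>B\<^esub> y))) \<ominus>\<^bsub>B\<^esub> (h (d (g x)) \<oplus>\<^bsub>B\<^esub> h (d (g y))) \<in> square_ideal B m"
        using xy dc by (simp add: a_minus_def)
      have "d (g x \<otimes>\<^bsub>A\<^esub> g y) \<ominus>\<^bsub>A\<^esub> (d (g x) \<otimes>\<^bsub>A\<^esub> g y \<oplus>\<^bsub>A\<^esub> g x \<otimes>\<^bsub>A\<^esub> d (g y)) \<in> square_ideal A ?m"
        using d xy unfolding derivation_mod_square_def by simp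
      then have "h (d (g x \<otimes>\<^bsub>A\<^esub> g y) \<ominus>\<^bsub>A\<^esub> (d (g x) \<otimes>\<^bsub>A\<^esub> g y \<oplus>\<^bsub>A\<^esub> g x \<otimes>\<^bsub>A\<^esub> d (g y))) \<in> square_ideal B m" using sq by blast
      then show "h (d (g (x \<otimes>\<^bsub>B\<^esub> y))) \<ominus>\<^bsub>B\<^esub> (h (d (g x)) \<otimes>\<^bsub>B\<^esub> y \<oplus>\<^bsub>B\<^esub> x \<otimes>\<^bsub>B\<^esub> h (d (g y))) \<in> square_ideal B m"
        using xy dc by (simp add: a_minus_def)
    qed
    from md[OF this] show ?thesis using dc by auto
  qed
  ultimately show ?thesis unfolding has_rigid_point_def by blast
qed

section \<open>Arc algebras of cuspidal presentations have no rigid point\<close>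

text \<open>The weight of a variable depends only on its index j and not on the order of the jet, so
  \<open>jet_der\<close> preserves it; constant weight 1 gives the total degree.\<close>

definition wdeg :: "(nat \<Rightarrow> nat) \<Rightarrow> ((nat \<times> nat) \<Rightarrow>\<^sub>0 nat) \<Rightarrow> nat" where
  "wdeg w m = (\<Sum>v\<in>ks m. lk m v * w (fst v))"

lemma wdeg_add: "wdeg w (m + n) = wdeg w m + wdeg w n"
  unfolding wdeg_def by (rule setsum_keys_plus_distrib) (auto simp: distrib_right)

lemma wdeg_0 [simp]: "wdeg w 0 = 0"
  by (simp add: wdeg_def)

lemma wdeg_single [simp]: "wdeg w (sg v n) = n * w (fst v)"
  by (cases "n = 0") (simp_all add: wdeg_def)

lemma minus_single_self:
  fixes m :: "(nat \<times> nat) \<Rightarrow>\<^sub>0 nat"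
  assumes "v \<in> ks m"
  shows "m - sg v 1 + sg v 1 = m"
  by (rule poly_mapping_eqI) (use assms in \<open>auto simp: lookup_add lookup_minus lookup_single when_def in_keys_iff\<close>)

lemma wdeg_pos: "v \<in> ks m \<Longrightarrow> wdeg w m = wdeg w (m - sg v 1) + w (fst v)"
  by (subst minus_single_self[symmetric], assumption) (simp only: wdeg_add wdeg_single mult_1)

lemma keys_deriv_along:
  assumes "k \<in> ks (deriv_along g p)"
  obtains m v b where "m \<in> ks p" "v \<in> ks m" "b \<in> ks (g v)" "k = m - sg v 1 + b"
proof -
  obtain m where m: "m \<in> ks p" "k \<in> ks (\<Sum>v\<in>ks m. sg (m - sg v 1) (of_nat (lk m v) * lk p m) * g v)"
    using assms keys_sum[of "\<lambda>m. \<Sum>v\<in>ks m. sg (m - sg v 1) (of_nat (lk m v) * lk p m) * g v" "ks p"]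
    unfolding deriv_along_def by blast
  then obtain v where v: "v \<in> ks m" "k \<in> ks (sg (m - sg v 1) (of_nat (lk m v) * lk p m) * g v)"
    using keys_sum[of "\<lambda>v. sg (m - sg v 1) (of_nat (lk m v) * lk p m) * g v" "ks m"] by blast
  then obtain a b where "k = a + b" "a \<in> ks (sg (m - sg v 1) (of_nat (lk m v) * lk p m))" "b \<in> ks (g v)"
    using keys_mult by blast
  then show ?thesis using m(1) v(1) that by (auto split: if_splits)
qed

definition euler :: "(nat \<Rightarrow> nat) \<Rightarrow> jet_poly \<Rightarrow> jet_poly" where
  "euler w = deriv_along (\<lambda>v. pconst (of_nat (w (fst v))) * pvar v)"

lemma euler_single: "euler w (sg m c) = sg m (of_nat (wdeg w m) * c)"
proof -
  have "euler w (sg m c) = (\<Sum>v\<in>ks m. sg (m - sg v 1) (of_nat (lk m v) * c) * (pconst (of_nat (w (fst v))) * pvar v))"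
    unfolding euler_def by (rule deriv_along_single) auto
  also have "\<dots> = (\<Sum>v\<in>ks m. sg m (of_nat (lk m v * w (fst v)) * c))"
  proof (rule sum.cong)
    fix v assume v: "v \<in> ks m"
    show "sg (m - sg v 1) (of_nat (lk m v) * c) * (pconst (of_nat (w (fst v))) * pvar v) = sg m (of_nat (lk m v * w (fst v)) * c)"
      unfolding pconst_def pvar_def mult_single by (simp add: minus_single_self[OF v, simplified] mult_ac)
  qed simp
  also have "\<dots> = sg m (\<Sum>v\<in>ks m. of_nat (lk m v * w (fst v)) * c)"
  proof -
    have "(\<Sum>v\<in>S. sg m (f v)) = sg m (\<Sum>v\<in>S. f v)" if "finite S" for S and f :: "nat \<times> nat \<Rightarrow> complex"
      using that by induction (simp_all add: single_add)
    then show ?thesis by simp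
  qed
  also have "\<dots> = sg m (of_nat (wdeg w m) * c)"
    by (simp add: wdeg_def sum_distrib_right)
  finally show ?thesis .
qed

lemma lookup_euler: "lk (euler w p) m = of_nat (wdeg w m) * lk p m"
proof -
  have "euler w p = (\<Sum>m\<in>ks p. sg m (of_nat (wdeg w m) * lk p m))"
    by (subst poly_mapping_sum_single[of p, symmetric]) (simp only: euler_def deriv_along_sum euler_single[unfolded euler_def])
  then show ?thesis
    by (simp add: lookup_sum lookup_single when_def in_keys_iff)
qed

lemma euler_jet_der:
  assumes "in_vars X p"
  shows "euler w (jet_der p) = jet_der (euler w p)"
  using assms
proof (induction rule: in_vars_induct)
  case (var v)
  obtain j i where "v = (j, i)" by (cases v)
  then show ?case by (simp add: euler_def jet_der_mult)
qed (simp_all add: euler_def jet_der_add deriv_along_add jet_der_mult deriv_along_mult algebra_simps)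

lemma euler_jet_der_pow:
  assumes "in_vars ({..<r} \<times> UNIV) p"
  shows "euler w ((jet_der ^^ k) p) = (jet_der ^^ k) (euler w p)"
  by (induction k) (simp_all add: euler_jet_der[OF jet_der_pow_in_vars[OF assms]])

text \<open>Monomials that may occur in relations singular enough for \<open>\<partial>/\<partial>y\<^sub>0\<close> to map them into the square
  of the augmentation ideal.\<close>

definition cuspidal :: "((nat \<times> nat) \<Rightarrow>\<^sub>0 nat) \<Rightarrow> bool" where
  "cuspidal m \<longleftrightarrow> wdeg (\<lambda>_. 1) m \<ge> 3 \<or> wdeg (\<lambda>_. 1) m = 2 \<and> (\<forall>i. lk m (0, i) = 0)"

text \<open>A nonconstant factor raises the total degree from at least 2 to at least 3.\<close>

lemma cuspidal_add: "cuspidal n \<Longrightarrow> cuspidal (m + n)"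
proof (cases "m = 0")
  case False
  then obtain v where "v \<in> ks m" by (metis keys_eq_empty all_not_in_conv)
  then have "wdeg (\<lambda>_. 1) m \<ge> 1" using wdeg_pos[of v m "\<lambda>_. 1"] by simp
  moreover assume "cuspidal n"
  ultimately show ?thesis by (auto simp: cuspidal_def wdeg_add)
qed simp

text \<open>\<open>jet_der\<close> replaces one variable by another of the same index j, so neither
  the total degree nor the absence of index 0 changes.\<close>

lemma cuspidal_jet_der:
  assumes "\<And>m. m \<in> ks p \<Longrightarrow> cuspidal m" "k \<in> ks (jet_der p)"
  shows "cuspidal k"
proof -
  obtain m v b where m: "m \<in> ks p" "v \<in> ks m" "b \<in> ks (case v of (j, i) \<Rightarrow> pvar (j, Suc i))" "k = m - sg v 1 + b"
    using assms(2) unfolding jet_der_eq by (rule keys_deriv_along)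
  obtain j i where v: "v = (j, i)" by (cases v)
  have b: "b = sg (j, Suc i) 1" using m(3) by (simp add: v pvar_def)
  have "wdeg (\<lambda>_. 1) k = wdeg (\<lambda>_. 1) m" using wdeg_pos[OF m(2), of "\<lambda>_. 1"] by (simp add: m(4) b wdeg_add)
  moreover have "lk k (0, i') = 0" if "\<forall>i. lk m (0, i) = 0" for i'
  proof -
    have "j \<noteq> 0"
    proof
      assume "j = 0"
      then show False using m(2) that by (simp add: v in_keys_iff)
    qed
    then show ?thesis using that by (simp add: m(4) b lookup_add lookup_minus lookup_single)
  qed
  ultimately show ?thesis using assms(1)[OF m(1)] by (auto simp: cuspidal_def)
qed

context arc_presentation
begin

text \<open>\<open>d\<close> need not preserve the arc ideal; it is enough that the ideal lands in
  the square of m. The choice of representatives then changes \<open>d\<close> only modulo m^2, and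
  the invariant applies to the induced map.\<close>

lemma derivation_lift:
  fixes d :: "jet_poly \<Rightarrow> jet_poly"
  assumes m: "maximalideal m (arc_alg r F)" and rigid: "\<And>d. derivation_mod_square (arc_alg r F) m d \<Longrightarrow> d ` m \<subseteq> m"
    and add: "\<And>p q. d (p + q) = d p + d q" and mult: "\<And>p q. d (p * q) = d p * q + p * d q"
    and vars: "\<And>p. in_vars ({..<r} \<times> UNIV) p \<Longrightarrow> in_vars ({..<r} \<times> UNIV) (d p)"
    and I: "\<And>p. p \<in> arc_ideal r F \<Longrightarrow> cls (d p) \<in> square_ideal (arc_alg r F) m"
    and p: "in_vars ({..<r} \<times> UNIV) p" "cls p \<in> m"
  shows "cls (d p) \<in> m"
proof -
  interpret Q: cring Q by (rule Q_cring)
  interpret m: maximalideal m Q using m by (simp add: arc_alg_Q)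
  let ?X = "{..<r} \<times> (UNIV :: nat set)"
  define rep where "rep x = (SOME p. in_vars ?X p \<and> x = cls p)" for x
  have rep: "in_vars ?X (rep x) \<and> x = cls (rep x)" if "x \<in> carrier Q" for x
    unfolding rep_def by (rule someI_ex) (use that in \<open>auto simp: Q_carrier\<close>)
  have cls_minus: "cls a \<ominus>\<^bsub>Q\<^esub> cls b = cls (a - b)" if "in_vars ?X a" "in_vars ?X b" for a b
  proof -
    have "cls (a - b) \<oplus>\<^bsub>Q\<^esub> cls b = cls a" using that by (simp add: Q_add)
    then show ?thesis using that by (metis Q.add.inv_solve_right Q_carrierI a_minus_def in_vars_diff)
  qed
  have d_diff: "d (a - b) = d a - d b" for a b using add[of "a - b" b] by (simp add: algebra_simps)
  have sq_I: "cls (d a) \<ominus>\<^bsub>Q\<^esub> cls (d b) \<in> square_ideal Q m" if "in_vars ?X a" "in_vars ?X b" "cls a = cls b" for a b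
  proof -
    have "a - b \<in> arc_ideal r F" using that(3) by (simp add: cls_eq_iff)
    then have "cls (d (a - b)) \<in> square_ideal Q m" using I by (simp add: arc_alg_Q)
    then show ?thesis using that by (simp add: cls_minus vars d_diff)
  qed
  have "derivation_mod_square Q m (\<lambda>x. cls (d (rep x)))"
    unfolding derivation_mod_square_def
  proof (intro conjI ballI)
    show "(\<lambda>x. cls (d (rep x))) \<in> carrier Q \<rightarrow> carrier Q" using rep by (auto intro: Q_carrierI vars)
    fix x y assume xy: "x \<in> carrier Q" "y \<in> carrier Q"
    note r = rep[OF xy(1)] rep[OF xy(2)]
    have "cls (rep (x \<oplus>\<^bsub>Q\<^esub> y)) = cls (rep x + rep y)" "in_vars ?X (rep (x \<oplus>\<^bsub>Q\<^esub> y))"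
      using rep[of "x \<oplus>\<^bsub>Q\<^esub> y"] xy r by (auto simp: Q_add[symmetric])
    from sq_I[OF this(2) _ this(1)] r
    show "cls (d (rep (x \<oplus>\<^bsub>Q\<^esub> y))) \<ominus>\<^bsub>Q\<^esub> (cls (d (rep x)) \<oplus>\<^bsub>Q\<^esub> cls (d (rep y))) \<in> square_ideal Q m"
      by (simp add: add Q_add vars)
    have "cls (rep (x \<otimes>\<^bsub>Q\<^esub> y)) = cls (rep x * rep y)" "in_vars ?X (rep (x \<otimes>\<^bsub>Q\<^esub> y))"
      using rep[of "x \<otimes>\<^bsub>Q\<^esub> y"] xy r by (auto simp: Q_mult[symmetric])
    moreover have "cls (d (rep x)) \<otimes>\<^bsub>Q\<^esub> y \<oplus>\<^bsub>Q\<^esub> x \<otimes>\<^bsub>Q\<^esub> cls (d (rep y)) = cls (d (rep x * rep y))"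
    proof -
      have "cls (d (rep x)) \<otimes>\<^bsub>Q\<^esub> cls (rep y) \<oplus>\<^bsub>Q\<^esub> cls (rep x) \<otimes>\<^bsub>Q\<^esub> cls (d (rep y)) = cls (d (rep x * rep y))"
        using r(1)[THEN conjunct1] r(2)[THEN conjunct1] by (simp add: mult Q_add Q_mult vars)
      then show ?thesis unfolding r(1)[THEN conjunct2, symmetric] r(2)[THEN conjunct2, symmetric] .
    qed
    ultimately show "cls (d (rep (x \<otimes>\<^bsub>Q\<^esub> y))) \<ominus>\<^bsub>Q\<^esub> (cls (d (rep x)) \<otimes>\<^bsub>Q\<^esub> y \<oplus>\<^bsub>Q\<^esub> x \<otimes>\<^bsub>Q\<^esub> cls (d (rep y))) \<in> square_ideal Q m"
      using sq_I[of "rep (x \<otimes>\<^bsub>Q\<^esub> y)" "rep x * rep y"] r by simp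
  qed
  then have 1: "cls (d (rep (cls p))) \<in> m" using rigid p(2) by (auto simp: arc_alg_Q)
  have r: "in_vars ?X (rep (cls p))" "cls p = cls (rep (cls p))" using rep[OF Q_carrierI[OF p(1)]] by auto
  have "cls (d p) \<ominus>\<^bsub>Q\<^esub> cls (d (rep (cls p))) \<in> square_ideal Q m" by (rule sq_I[OF p(1) r])
  moreover have "square_ideal Q m \<subseteq> m"
    by (rule square_ideal_subset[OF Q.ring_axioms m.ideal_axioms]) (use m.I_l_closed m.a_subset in auto)
  ultimately have "cls (d p) \<ominus>\<^bsub>Q\<^esub> cls (d (rep (cls p))) \<in> m" by blast
  then have "cls (d p - d (rep (cls p))) \<oplus>\<^bsub>Q\<^esub> cls (d (rep (cls p))) \<in> m"
    using 1 additive_subgroup.a_closed[OF m.is_additive_subgroup] by (simp add: cls_minus vars p(1) r(1))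
  then show ?thesis using vars[OF p(1)] vars[OF r(1)] by (simp add: Q_add)
qed

lemma arc_ideal_cuspidal:
  assumes "\<And>f m. f \<in> F \<Longrightarrow> m \<in> ks f \<Longrightarrow> cuspidal m" "p \<in> arc_ideal r F" "m \<in> ks p"
  shows "cuspidal m"
proof -
  let ?J = "{p. in_vars ({..<r} \<times> UNIV) p \<and> (\<forall>m\<in>ks p. cuspidal m)}"
  have "arc_ideal r F \<subseteq> ?J"
  proof (rule arc_ideal_minimal)
    show "ideal ?J (jet_alg r)"
    proof (rule poly_idealI)
      fix p q assume pq: "p \<in> ?J" "q \<in> ?J"
      then show "p + q \<in> ?J" using Poly_Mapping.keys_add[of p q] by auto
    next
      fix p q assume pq: "p \<in> ?J" "in_vars ({..<r} \<times> UNIV) q"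
      have "cuspidal k" if k: "k \<in> ks (q * p)" for k
      proof -
        obtain a b where "k = a + b" "b \<in> ks p" using k keys_mult[of q p] by blast
        then show ?thesis using pq(1) cuspidal_add by auto
      qed
      then show "q * p \<in> ?J" using pq by simp
    qed auto
    fix f i assume f: "f \<in> F"
    then have "in_vars ({..<r} \<times> UNIV) ((jet_der ^^ i) f)" using presented by (auto simp: presented_def intro: jet_der_pow_in_vars[OF base_in_jet])
    moreover have "\<forall>m\<in>ks ((jet_der ^^ i) f). cuspidal m"
    proof (induction i)
      case 0
      then show ?case using assms(1)[OF f] by simp
    next
      case (Suc i)
      then show ?case using cuspidal_jet_der[of "(jet_der ^^ i) f"] by simp
    qed
    ultimately show "(jet_der ^^ i) f \<in> ?J" by simp
  qed
  then show ?thesis using assms(2,3) by blast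
qed

text \<open>Rigidity under the Euler derivation forces m to be the augmentation ideal; rigidity
  under the partial derivative by y_0 then puts 1 into m.\<close>

theorem arc_not_rigid:
  assumes r: "r > 0" and cusp: "\<And>f m. f \<in> F \<Longrightarrow> m \<in> ks f \<Longrightarrow> cuspidal m"
    and w: "\<And>j. w j > 0" and euler: "\<And>f. f \<in> F \<Longrightarrow> euler w f \<in> Idl\<^bsub>base_alg r\<^esub> F"
  shows "\<not> has_rigid_point (arc_alg r F)"
proof
  assume "has_rigid_point (arc_alg r F)"
  then obtain m where m: "maximalideal m (arc_alg r F)"
    and rigid: "\<And>d. derivation_mod_square (arc_alg r F) m d \<Longrightarrow> d ` m \<subseteq> m"
    unfolding has_rigid_point_def by blast
  interpret Q: cring Q by (rule Q_cring)
  interpret m: maximalideal m Q using m by (simp add: arc_alg_Q)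
  let ?X = "{..<r} \<times> (UNIV :: nat set)"
  have one: "cls 1 \<notin> m" using m.one_imp_carrier m.I_notcarr by (auto simp: Q_one[symmetric])
  have sq0: "cls p \<in> square_ideal Q m" if "p \<in> arc_ideal r F" for p
  proof -
    have "cls p = \<zero>\<^bsub>Q\<^esub>" using that by (simp add: Q_zero cls_eq_iff)
    then show ?thesis
      using additive_subgroup.zero_closed[OF ideal.axioms(1)[OF square_ideal_ideal[OF Q.ring_axioms m.a_subset]]] by simp
  qed
  have euler_vars: "in_vars ?X (euler w p)" if "in_vars ?X p" for p
    unfolding euler_def by (rule deriv_along_in_vars[OF that]) (auto intro!: in_vars_mult in_vars_pvar)
  have euler_I: "euler w p \<in> arc_ideal r F" if "p \<in> arc_ideal r F" for p
  proof (rule arc_ideal_closed_under[where d = "euler w", OF _ _ euler_vars _ that])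
    fix f i assume f: "f \<in> F"
    \<comment> \<open>The Euler derivation of f is only known to lie in the ideal generated by F
      among polynomials in the y_j. Since it commutes with \<open>jet_der\<close>, all derivatives
      of that smaller ideal have to be located in the arc ideal.\<close>
    have "Idl\<^bsub>base_alg r\<^esub> F \<subseteq> {p. in_vars ({..<r} \<times> {0}) p \<and> (\<forall>i. (jet_der ^^ i) p \<in> arc_ideal r F)}"
    proof (rule ring.genideal_minimal[OF cring.axioms(1)[OF poly_alg_cring]])
      show "ideal {p. in_vars ({..<r} \<times> {0}) p \<and> (\<forall>i. (jet_der ^^ i) p \<in> arc_ideal r F)} (base_alg r)"
      proof (rule poly_idealI)
        have D: "(jet_der ^^ i) p \<in> arc_ideal r F" if "p \<in> arc_ideal r F" for p i
          using that by (induction i) (simp_all add: jet_der_in_ideal)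
        show "0 \<in> {p. in_vars ({..<r} \<times> {0}) p \<and> (\<forall>i. (jet_der ^^ i) p \<in> arc_ideal r F)}" using D[of 0] by simp
        fix p q assume "p \<in> {p. in_vars ({..<r} \<times> {0}) p \<and> (\<forall>i. (jet_der ^^ i) p \<in> arc_ideal r F)}"
        then have p: "in_vars ({..<r} \<times> {0}) p" "p \<in> arc_ideal r F" by (auto dest: spec[of _ 0])
        { assume "q \<in> {p. in_vars ({..<r} \<times> {0}) p \<and> (\<forall>i. (jet_der ^^ i) p \<in> arc_ideal r F)}"
          then have "in_vars ({..<r} \<times> {0}) q" "q \<in> arc_ideal r F" by (auto dest: spec[of _ 0])
          then show "p + q \<in> {p. in_vars ({..<r} \<times> {0}) p \<and> (\<forall>i. (jet_der ^^ i) p \<in> arc_ideal r F)}"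
            using p D I_add by simp }
        assume "in_vars ({..<r} \<times> {0}) q"
        then show "q * p \<in> {p. in_vars ({..<r} \<times> {0}) p \<and> (\<forall>i. (jet_der ^^ i) p \<in> arc_ideal r F)}"
          using p D I_mult base_in_jet by simp
      qed auto
      show "F \<subseteq> {p. in_vars ({..<r} \<times> {0}) p \<and> (\<forall>i. (jet_der ^^ i) p \<in> arc_ideal r F)}"
        using presented jet_der_generator_in_ideal by (auto simp: presented_def)
    qed
    then have "(jet_der ^^ i) (euler w f) \<in> arc_ideal r F" using euler[OF f] by blast
    moreover have "in_vars ?X f" using presented f by (auto simp: presented_def intro: base_in_jet)
    ultimately show "euler w ((jet_der ^^ i) f) \<in> arc_ideal r F" by (simp add: euler_jet_der_pow)
  qed (auto simp: euler_def deriv_along_add deriv_along_mult)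
  have stable: "cls (euler w p) \<in> m" if "in_vars ?X p" "cls p \<in> m" for p
    by (rule derivation_lift[OF m rigid _ _ euler_vars _ that])
      (auto simp: euler_def deriv_along_add deriv_along_mult arc_alg_Q intro!: sq0 euler_I[unfolded euler_def])
  have const_0: "lk p 0 = 0" if p: "in_vars ?X p" "cls p \<in> m" for p
  proof (rule ccontr)
    assume c: "lk p 0 \<noteq> 0"
    \<comment> \<open>Applying E - 1, ..., E - n for the Euler derivation E keeps the class in m and
      multiplies the coefficient of a monomial of weight k by (k - 1) ... (k - n). With n the
      largest weight in p only the constant term survives, times the nonzero number (-1)^n
      n!.\<close>
    have "\<exists>q. in_vars ?X q \<and> cls q \<in> m \<and> (\<forall>k. lk q k = (\<Prod>j=1..n. (of_nat (wdeg w k) - of_nat j)) * lk p k)" for n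
    proof (induction n)
      case 0
      then show ?case using p by (intro exI[of _ p]) simp
    next
      case (Suc n)
      then obtain q where q: "in_vars ?X q" "cls q \<in> m" "\<And>k. lk q k = (\<Prod>j=1..n. (of_nat (wdeg w k) - of_nat j)) * lk p k"
        by blast
      let ?q = "euler w q + pconst (- of_nat (Suc n)) * q"
      have "cls (pconst (- of_nat (Suc n)) * q) \<in> m"
        using m.I_l_closed[OF q(2), of "cls (pconst (- of_nat (Suc n)))"] q(1) by (simp add: Q_carrierI Q_mult)
      then have "cls ?q \<in> m"
        using additive_subgroup.a_closed[OF m.is_additive_subgroup stable[OF q(1,2)]]
        by (simp only: Q_add[symmetric, OF euler_vars[OF q(1)] in_vars_mult[OF in_vars_pconst q(1)]])
      moreover have "in_vars ?X ?q" using euler_vars[OF q(1)] q(1) by simp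
      moreover have "lk ?q k = (\<Prod>j=1..Suc n. (of_nat (wdeg w k) - of_nat j)) * lk p k" for k
      proof -
        have "lk (pconst (- of_nat (Suc n)) * q) k = - of_nat (Suc n) * lk q k"
          unfolding pconst_def mult_map_scale_conv_mult[symmetric] by (simp add: Poly_Mapping.map.rep_eq when_def)
        then show ?thesis unfolding lookup_add lookup_euler \<open>lk (pconst (- of_nat (Suc n)) * q) k = - of_nat (Suc n) * lk q k\<close> q(3) by (simp add: algebra_simps)
      qed
      ultimately show ?case by blast
    qed
    from this[of "Max (insert 0 (wdeg w ` ks p))"] obtain q where q: "in_vars ?X q" "cls q \<in> m"
      "\<And>k. lk q k = (\<Prod>j=1..Max (insert 0 (wdeg w ` ks p)). (of_nat (wdeg w k) - of_nat j)) * lk p k" by blast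
    have "lk q k = 0" if knz: "k \<noteq> 0" for k
    proof (cases "k \<in> ks p")
      case True
      then have "wdeg w k \<le> Max (insert 0 (wdeg w ` ks p))" by simp
      moreover obtain v where "v \<in> ks k" using knz by (metis keys_eq_empty all_not_in_conv)
      then have "wdeg w k \<ge> 1" using wdeg_pos[of v k w] w[of "fst v"] by simp
      ultimately have "(\<Prod>j=1..Max (insert 0 (wdeg w ` ks p)). (of_nat (wdeg w k) - of_nat j :: complex)) = 0"
        by (intro prod_zero) auto
      then show ?thesis by (simp add: q(3))
    qed (simp add: q(3) in_keys_iff)
    then have q_const: "q = pconst (lk q 0)"
      by (intro poly_mapping_eqI) (auto simp: pconst_def lookup_single when_def)
    have "lk q 0 \<noteq> 0" using c by (simp add: q(3))
    then have "pconst (1 / lk q 0) * q = 1"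
      by (subst q_const) (simp add: pconst_def mult_single)
    moreover have "cls (pconst (1 / lk q 0) * q) \<in> m"
      using m.I_l_closed[OF q(2), of "cls (pconst (1 / lk q 0))"] q(1) by (simp add: Q_carrierI Q_mult)
    ultimately show False using one by simp
  qed
  have I_const: "lk p 0 = 0" if "p \<in> arc_ideal r F" for p
    using arc_ideal_cuspidal[of p 0, OF cusp that] by (cases "0 \<in> ks p") (auto simp: cuspidal_def in_keys_iff)
  let ?J = "cls ` {p. in_vars ?X p \<and> lk p 0 = 0}"
  have lk_mult: "lk (q * p) 0 = lk q 0 * lk p 0" for p q :: jet_poly
  proof -
    have z: "a = 0 \<and> b = 0" if "0 = a + b" for a b :: "(nat \<times> nat) \<Rightarrow>\<^sub>0 nat"
    proof -
      have "lk a v = 0 \<and> lk b v = 0" for v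
        using arg_cong[OF that, of "\<lambda>m. lk m v"] by (simp add: lookup_add)
      then show ?thesis by (auto intro: poly_mapping_eqI)
    qed
    have q: "q * p = pconst (lk q 0) * p + (q - pconst (lk q 0)) * p" by (simp add: algebra_simps)
    have "0 \<notin> ks ((q - pconst (lk q 0)) * p)"
    proof
      assume "0 \<in> ks ((q - pconst (lk q 0)) * p)"
      then obtain a b where "0 = a + b" "a \<in> ks (q - pconst (lk q 0))" using keys_mult by blast
      then show False using z[of a b] by (auto simp: in_keys_iff lookup_minus pconst_def)
    qed
    then have "lk ((q - pconst (lk q 0)) * p) 0 = 0" by (simp add: in_keys_iff)
    moreover have "lk (pconst (lk q 0) * p) 0 = lk q 0 * lk p 0"
      unfolding pconst_def mult_map_scale_conv_mult[symmetric] by (simp add: Poly_Mapping.map.rep_eq when_def)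
    ultimately show ?thesis unfolding q by (simp only: lookup_add add_0_right)
  qed
  have J_ideal: "ideal ?J Q"
  proof -
    have J: "x \<otimes>\<^bsub>Q\<^esub> a \<in> ?J" if "a \<in> ?J" "x \<in> carrier Q" for a x
      using that by (auto elim!: Q_carrierE simp: Q_mult lk_mult intro!: image_eqI)
    show ?thesis
    proof (rule idealI)
      show "subgroup ?J (add_monoid Q)"
      proof
        show "?J \<subseteq> carrier (add_monoid Q)" by (auto intro: Q_carrierI)
        show "\<one>\<^bsub>add_monoid Q\<^esub> \<in> ?J" by (auto simp: Q_zero intro!: image_eqI[of _ _ 0])
        fix x assume x: "x \<in> ?J"
        then have xc: "x \<in> carrier Q" by (auto intro: Q_carrierI)
        have "\<ominus>\<^bsub>Q\<^esub> \<one>\<^bsub>Q\<^esub> \<otimes>\<^bsub>Q\<^esub> x \<in> ?J" by (rule J[OF x]) simp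
        then show "inv\<^bsub>add_monoid Q\<^esub> x \<in> ?J" using xc by (simp add: Q.l_minus flip: a_inv_def)
        fix y assume y: "y \<in> ?J"
        then show "x \<otimes>\<^bsub>add_monoid Q\<^esub> y \<in> ?J" using x
          by (auto simp: Q_add lookup_add intro!: image_eqI)
      qed
    next
      fix a x assume ax: "a \<in> ?J" "x \<in> carrier Q"
      show "x \<otimes>\<^bsub>Q\<^esub> a \<in> ?J" by (rule J[OF ax])
      moreover have "a \<in> carrier Q" using ax(1) by (auto intro: Q_carrierI)
      ultimately show "a \<otimes>\<^bsub>Q\<^esub> x \<in> ?J" using ax(2) by (simp only: Q.m_comm)
    qed (rule Q.ring_axioms)
  qed
  have "m \<subseteq> ?J"
  proof
    fix x assume x: "x \<in> m"
    then obtain p where "in_vars ?X p" "x = cls p" using m.a_subset by (auto elim: Q_carrierE)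
    then show "x \<in> ?J" using const_0 x by auto
  qed
  moreover have "?J \<noteq> carrier Q"
  proof
    assume "?J = carrier Q"
    then have "cls 1 \<in> ?J" by (simp add: Q_carrierI)
    then obtain p where p: "lk p 0 = 0" "cls 1 = cls p" by auto
    then have "1 - p \<in> arc_ideal r F" by (simp add: cls_eq_iff)
    from I_const[OF this] p(1) show False by (simp add: lookup_minus)
  qed
  moreover have "?J \<subseteq> carrier Q" by (auto intro: Q_carrierI)
  ultimately have m_eq: "m = ?J" using m.I_maximal[OF J_ideal] by blast
  have lk_pvar: "lk (pvar v) 0 = 0" for v :: "nat \<times> nat"
  proof -
    have "sg v (1 :: nat) \<noteq> 0" using lookup_single_eq[of v "1 :: nat"] by (metis lookup_zero zero_neq_one)
    then show ?thesis unfolding pvar_def by (rule lookup_single_not_eq)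
  qed
  \<comment> \<open>A monomial of total degree at least 2 is a variable times a nonconstant
    monomial, and both classes lie in m.\<close>
  have sq2: "cls p \<in> square_ideal Q m" if p: "in_vars ?X p" "\<And>k. k \<in> ks p \<Longrightarrow> wdeg (\<lambda>_. 1) k \<ge> 2" for p
  proof -
    have "in_vars ?X (\<Sum>k\<in>S. sg k (lk p k)) \<and> cls (\<Sum>k\<in>S. sg k (lk p k)) \<in> square_ideal Q m" if "finite S" "S \<subseteq> ks p" for S
      using that
    proof induction
      case empty
      then show ?case using sq0[of 0] by simp
    next
      case (insert k S)
      have k: "wdeg (\<lambda>_. 1) k \<ge> 2" "ks k \<subseteq> ?X" using insert p by (auto simp: in_vars_def)
      then have "k \<noteq> 0" by auto
      then obtain v where v: "v \<in> ks k" by (metis keys_eq_empty all_not_in_conv)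
      have "wdeg (\<lambda>_. 1) (k - sg v 1) \<ge> 1" using k(1) wdeg_pos[OF v, of "\<lambda>_. 1"] by simp
      then have nz: "k - sg v 1 \<noteq> 0" by (metis not_one_le_zero wdeg_0)
      have "ks (k - sg v 1) \<subseteq> ks k" by (auto simp: in_keys_iff lookup_minus)
      then have iv: "in_vars ?X (sg (k - sg v 1) (lk p k))" "in_vars ?X (pvar v)" "in_vars ?X (sg k (lk p k))"
        using k(2) v by (auto intro: in_vars_single in_vars_pvar)
      have prod: "sg k (lk p k) = sg (k - sg v 1) (lk p k) * pvar v"
        unfolding pvar_def mult_single minus_single_self[OF v] by simp
      have "cls (sg (k - sg v 1) (lk p k)) \<in> m"
        unfolding m_eq by (rule imageI, rule CollectI, rule conjI[OF iv(1) lookup_single_not_eq[OF nz]])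
      moreover have "cls (pvar v) \<in> m"
        unfolding m_eq by (rule imageI) (simp add: iv lk_pvar)
      ultimately have "cls (sg (k - sg v 1) (lk p k)) \<otimes>\<^bsub>Q\<^esub> cls (pvar v) \<in> square_ideal Q m"
        by (rule mult_in_square_ideal[OF Q.ring_axioms m.a_subset])
      then have "cls (sg k (lk p k)) \<in> square_ideal Q m" unfolding Q_mult[OF iv(1,2)] prod[symmetric] .
      then show ?case
        using insert iv additive_subgroup.a_closed[OF ideal.axioms(1)[OF square_ideal_ideal[OF Q.ring_axioms m.a_subset]]]
        by (simp add: Q_add[symmetric])
    qed
    from this[of "ks p"] show ?thesis by (simp add: poly_mapping_sum_single)
  qed
  \<comment> \<open>The partial derivative by the undifferentiated y_0, whose class lies in m and
    which is mapped to 1.\<close>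
  let ?d = "deriv_along (\<lambda>v. if v = (0, 0) then 1 else 0)"
  have d_vars: "in_vars ?X (?d p)" if "in_vars ?X p" for p
    by (rule deriv_along_in_vars[OF that]) auto
  have d_I: "cls (?d p) \<in> square_ideal Q m" if p: "p \<in> arc_ideal r F" for p
  proof (rule sq2[OF d_vars[OF I_in_vars[OF p]]])
    fix k assume "k \<in> ks (?d p)"
    then obtain n v b where n: "n \<in> ks p" "v \<in> ks n" "b \<in> ks (if v = (0, 0) then 1 else 0 :: jet_poly)" "k = n - sg v 1 + b"
      by (rule keys_deriv_along)
    then have v: "v = (0, 0)" "b = 0" by (auto split: if_splits)
    have "cuspidal n" by (rule arc_ideal_cuspidal[OF cusp p n(1)])
    \<comment> \<open>The differentiated monomial contains y_0, which excludes the degree 2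
      alternative in \<open>cuspidal\<close>.\<close>
    then have "wdeg (\<lambda>_. 1) n \<ge> 3" using n(2) v by (auto simp: cuspidal_def in_keys_iff)
    then show "wdeg (\<lambda>_. 1) k \<ge> 2" using wdeg_pos[OF n(2), of "\<lambda>_. 1"] n(4) v(2) by simp
  qed
  have v0: "in_vars ?X (pvar (0, 0))" using r by (intro in_vars_pvar) auto
  then have "cls (pvar (0, 0)) \<in> m" unfolding m_eq using lk_pvar by blast
  then have "cls (?d (pvar (0, 0))) \<in> m"
    by (intro derivation_lift[OF m rigid _ _ d_vars _ v0]) (auto simp: deriv_along_add deriv_along_mult arc_alg_Q d_I)
  then show False using one by simp
qed

end

section \<open>Simple quotients of the W3 algebra\<close>

text \<open>The properties that pass from the universal algebra to its nonzero quotients: operator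
  products and strong generation, but not freeness. Both algebras are instances, so weights can be
  compared along the projection.\<close>

locale W3_algebra = vertex_algebra V for V :: "'v::ab_group_add va" +
  fixes L W :: 'v
  assumes L_virasoro: "virasoro V (-2) L"
    and W_primary: "primary V L 3 W"
    and W_W:
      "\<forall>n\<ge>6. nprod V W n W = 0"
      "nprod V W 5 W = scal V (-9/8) (vac V)"
      "nprod V W 4 W = 0"
      "nprod V W 3 W = scal V (27/8) L"
      "nprod V W 2 W = scal V (27/16) (der V L)"
      "nprod V W 1 W = scal V (9/2) (nprod V L (-1) L) - scal V (27/32) ((der V ^^ 2) L)"
      "nprod V W 0 W = scal V (9/2) (nprod V (der V L) (-1) L) - scal V (3/16) ((der V ^^ 3) L)"
    and strong: "va_span V {nop V xs |xs. set xs \<subseteq> range (\<lambda>k. (der V ^^ k) L) \<union> range (\<lambda>k. (der V ^^ k) W)} = UNIV"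
    and nontrivial: "vac V \<noteq> 0"
begin

lemma state_induct [case_names zero add scale vac L W]:
  assumes "P 0" "\<And>x y. P x \<Longrightarrow> P y \<Longrightarrow> P (x + y)" "\<And>c x. P x \<Longrightarrow> P (c \<cdot> x)" "P (vac V)"
    "\<And>k x. P x \<Longrightarrow> P (L\<langle>- 1 - int k\<rangle> x)" "\<And>k x. P x \<Longrightarrow> P (W\<langle>- 1 - int k\<rangle> x)"
  shows "P x"
proof -
  have nop: "P (nop V xs)" if "set xs \<subseteq> range (\<lambda>k. (T ^^ k) L) \<union> range (\<lambda>k. (T ^^ k) W)" for xs
    using that
  proof (induction xs)
    case Nil
    then show ?case using assms(4) by (simp add: nop_def)
  next
    case (Cons a xs)
    then have x: "P (nop V xs)" by simp
    have "nop V (a # xs) = a\<langle>-1\<rangle> nop V xs" by (simp add: nop_def)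
    moreover obtain k where "a = (T ^^ k) L \<or> a = (T ^^ k) W" using Cons.prems by auto
    ultimately show ?case using assms(3)[OF assms(5)[OF x]] assms(3)[OF assms(6)[OF x]]
      by (auto simp: T_pow_normal_product)
  qed
  have "x \<in> vs.span {nop V xs |xs. set xs \<subseteq> range (\<lambda>k. (T ^^ k) L) \<union> range (\<lambda>k. (T ^^ k) W)}"
    using strong by (simp add: va_span_def)
  then show ?thesis
  proof (induction rule: vs.span_induct_alt)
    case base
    show ?case by (rule assms(1))
  next
    case (step c y z)
    then show ?case using assms(2)[OF assms(3)] nop by auto
  qed
qed

lemma L_L [simp]: "L\<langle>0\<rangle> L = T L" "L\<langle>1\<rangle> L = 2 \<cdot> L" "L\<langle>2\<rangle> L = 0" "L\<langle>3\<rangle> L = (-1) \<cdot> vac V" "n \<ge> 4 \<Longrightarrow> L\<langle>n\<rangle> L = 0"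
  using L_virasoro by (auto simp: virasoro_def)

lemma L_W [simp]: "L\<langle>0\<rangle> W = T W" "L\<langle>1\<rangle> W = 3 \<cdot> W" "n \<ge> 2 \<Longrightarrow> L\<langle>n\<rangle> W = 0"
  using W_primary by (auto simp: primary_def)

lemma dpow_1: "dpow 1 x = T x" and dpow_2: "dpow 2 x = (1/2) \<cdot> T (T x)" and dpow_3: "dpow 3 x = (1/6) \<cdot> T (T (T x))"
  by (simp_all add: dpow_def numeral_2_eq_2 numeral_3_eq_3)

lemma mode_T: "a\<langle>n\<rangle> (T b) = T (a\<langle>n\<rangle> b) + of_int n \<cdot> a\<langle>n - 1\<rangle> b"
  by (simp add: T_mode)

lemma W_L [simp]: "W\<langle>0\<rangle> L = 2 \<cdot> T W" "W\<langle>1\<rangle> L = 3 \<cdot> W" "n \<ge> 2 \<Longrightarrow> W\<langle>n\<rangle> L = 0"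
proof -
  have "W\<langle>0\<rangle> L = (\<Sum>t<2. sign (0 + int t + 1) \<cdot> dpow t (L\<langle>0 + int t\<rangle> W))"
    by (rule skew_symmetry) simp
  also have "\<dots> = - T W + 3 \<cdot> T W"
    using dpow_1 by (simp add: numeral_2_eq_2)
  also have "\<dots> = 2 \<cdot> T W"
    using vs.scale_left_distrib[of "-1" 3 "T W"] by simp
  finally show "W\<langle>0\<rangle> L = 2 \<cdot> T W" .
  have "W\<langle>1\<rangle> L = (\<Sum>t<1. sign (1 + int t + 1) \<cdot> dpow t (L\<langle>1 + int t\<rangle> W))"
    by (rule skew_symmetry) simp
  then show "W\<langle>1\<rangle> L = 3 \<cdot> W" by simp
  assume n: "n \<ge> 2"
  have "W\<langle>n\<rangle> L = (\<Sum>t<0. sign (n + int t + 1) \<cdot> dpow t (L\<langle>n + int t\<rangle> W))"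
    by (rule skew_symmetry) (use n in simp)
  then show "W\<langle>n\<rangle> L = 0" by simp
qed

text \<open>L_(0) and T are derivations of all n-th products, agree on L and W and both kill the
  vacuum.\<close>

lemma L_zero_mode [simp]: "L\<langle>0\<rangle> x = T x"
proof (induction x rule: state_induct)
  have step: "L\<langle>0\<rangle> (a\<langle>n\<rangle> x) = T (a\<langle>n\<rangle> x)" if "L\<langle>0\<rangle> a = T a" "L\<langle>0\<rangle> x = T x" for a n x
    using commutator_formula_nat[of L 0 a n x] that by (simp add: T_derivation algebra_simps)
  case (L k x)
  then show ?case by (intro step) simp_all
  case (W k x)
  then show ?case by (intro step) simp_all
qed (simp_all add: mode_vac der_vac)

lemma L_one_mode: "L\<langle>1\<rangle> (a\<langle>n\<rangle> x) = a\<langle>n\<rangle> (L\<langle>1\<rangle> x) + (T a)\<langle>n + 1\<rangle> x + (L\<langle>1\<rangle> a)\<langle>n\<rangle> x"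
  using commutator_formula_nat[of L 1 a n x] by (simp add: algebra_simps)

lemma L_two_mode:
  "L\<langle>2\<rangle> (a\<langle>n\<rangle> x) = a\<langle>n\<rangle> (L\<langle>2\<rangle> x) + (T a)\<langle>n + 2\<rangle> x + 2 \<cdot> (L\<langle>1\<rangle> a)\<langle>n + 1\<rangle> x + (L\<langle>2\<rangle> a)\<langle>n\<rangle> x"
proof -
  have "(\<Sum>i\<le>2. of_nat (2 choose i) \<cdot> (L\<langle>int i\<rangle> a)\<langle>int 2 + n - int i\<rangle> x) =
     (T a)\<langle>n + 2\<rangle> x + 2 \<cdot> (L\<langle>1\<rangle> a)\<langle>n + 1\<rangle> x + (L\<langle>2\<rangle> a)\<langle>n\<rangle> x"
    by (simp add: numeral_2_eq_2 add.commute)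
  then show ?thesis using commutator_formula_nat[of L 2 a n x] by (simp add: algebra_simps)
qed

lemma L_three_mode:
  "L\<langle>3\<rangle> (a\<langle>n\<rangle> x) = a\<langle>n\<rangle> (L\<langle>3\<rangle> x) + (T a)\<langle>n + 3\<rangle> x + 3 \<cdot> (L\<langle>1\<rangle> a)\<langle>n + 2\<rangle> x
     + 3 \<cdot> (L\<langle>2\<rangle> a)\<langle>n + 1\<rangle> x + (L\<langle>3\<rangle> a)\<langle>n\<rangle> x"
proof -
  have "{..3::nat} = {0, 1, 2, 3}" by auto
  moreover have "(3::nat) choose 2 = 3" by (simp add: numeral_eq_Suc)
  ultimately have "(\<Sum>i\<le>3. of_nat (3 choose i) \<cdot> (L\<langle>int i\<rangle> a)\<langle>int 3 + n - int i\<rangle> x) =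
     (T a)\<langle>n + 3\<rangle> x + 3 \<cdot> (L\<langle>1\<rangle> a)\<langle>n + 2\<rangle> x + 3 \<cdot> (L\<langle>2\<rangle> a)\<langle>n + 1\<rangle> x + (L\<langle>3\<rangle> a)\<langle>n\<rangle> x"
    by (simp add: algebra_simps)
  then show ?thesis using commutator_formula_nat[of L 3 a n x] by (simp add: algebra_simps)
qed

lemma L_two_W: "L\<langle>2\<rangle> (W\<langle>n\<rangle> x) = W\<langle>n\<rangle> (L\<langle>2\<rangle> x) + (4 - of_int n) \<cdot> W\<langle>n + 1\<rangle> x"
proof -
  have "(- of_int (n + 2)) \<cdot> W\<langle>n + 1\<rangle> x + 6 \<cdot> W\<langle>n + 1\<rangle> x = (4 - of_int n) \<cdot> W\<langle>n + 1\<rangle> x"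
    by (subst vs.scale_left_distrib[symmetric]) (simp add: algebra_simps)
  then show ?thesis by (simp add: L_two_mode T_left add.commute add.left_commute add.assoc)
qed

lemma L_three_W: "L\<langle>3\<rangle> (W\<langle>n\<rangle> x) = W\<langle>n\<rangle> (L\<langle>3\<rangle> x) + (6 - of_int n) \<cdot> W\<langle>n + 2\<rangle> x"
proof -
  have "(- of_int (n + 3)) \<cdot> W\<langle>n + 2\<rangle> x + 9 \<cdot> W\<langle>n + 2\<rangle> x = (6 - of_int n) \<cdot> W\<langle>n + 2\<rangle> x"
    by (subst vs.scale_left_distrib[symmetric]) (simp add: algebra_simps)
  then show ?thesis by (simp add: L_three_mode T_left add.commute add.left_commute add.assoc)
qed

lemma L_two_L: "L\<langle>2\<rangle> (L\<langle>n\<rangle> x) = L\<langle>n\<rangle> (L\<langle>2\<rangle> x) + (2 - of_int n) \<cdot> L\<langle>n + 1\<rangle> x"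
proof -
  have "(- of_int (n + 2)) \<cdot> L\<langle>n + 1\<rangle> x + 4 \<cdot> L\<langle>n + 1\<rangle> x = (2 - of_int n) \<cdot> L\<langle>n + 1\<rangle> x"
    by (subst vs.scale_left_distrib[symmetric]) (simp add: algebra_simps)
  then show ?thesis by (simp add: L_two_mode T_left add.commute add.left_commute add.assoc)
qed

text \<open>The last term is the central one: L_(3) L is c/2 = -1 times the vacuum, whose only
  nonzero mode is the identity at index -1.\<close>

lemma L_three_L:
  "L\<langle>3\<rangle> (L\<langle>n\<rangle> x) = L\<langle>n\<rangle> (L\<langle>3\<rangle> x) + (3 - of_int n) \<cdot> L\<langle>n + 2\<rangle> x - (if n = -1 then x else 0)"
proof -
  have "(- of_int (n + 3)) \<cdot> L\<langle>n + 2\<rangle> x + 6 \<cdot> L\<langle>n + 2\<rangle> x = (3 - of_int n) \<cdot> L\<langle>n + 2\<rangle> x"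
    by (subst vs.scale_left_distrib[symmetric]) (simp add: algebra_simps)
  then show ?thesis by (simp add: L_three_mode T_left vacuum add.commute add.left_commute add.assoc)
qed

lemma W_mode_L: "W\<langle>m\<rangle> (L\<langle>n\<rangle> x) = L\<langle>n\<rangle> (W\<langle>m\<rangle> x) + of_int (m - 2 * n) \<cdot> W\<langle>m + n - 1\<rangle> x"
proof -
  have "Sum_any (\<lambda>i. (of_int m gchoose i) \<cdot> (W\<langle>int i\<rangle> L)\<langle>m + n - int i\<rangle> x) =
      (\<Sum>i<2. (of_int m gchoose i) \<cdot> (W\<langle>int i\<rangle> L)\<langle>m + n - int i\<rangle> x)"
    by (rule Sum_any_eq_sum_lessThan) simp
  also have "\<dots> = (- 2 * of_int (m + n)) \<cdot> W\<langle>m + n - 1\<rangle> x + (3 * of_int m) \<cdot> W\<langle>m + n - 1\<rangle> x"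
    by (simp add: numeral_2_eq_2 T_left mult.commute)
  also have "\<dots> = of_int (m - 2 * n) \<cdot> W\<langle>m + n - 1\<rangle> x"
    by (subst vs.scale_left_distrib[symmetric]) (simp add: algebra_simps)
  finally show ?thesis using commutator_formula[of W m L n x] by (simp add: algebra_simps)
qed

lemma W_W_modes [simp]:
  "n \<ge> 6 \<Longrightarrow> W\<langle>n\<rangle> W = 0" "W\<langle>5\<rangle> W = (-9/8) \<cdot> vac V" "W\<langle>4\<rangle> W = 0" "W\<langle>3\<rangle> W = (27/8) \<cdot> L"
  "W\<langle>2\<rangle> W = (27/16) \<cdot> T L" "W\<langle>1\<rangle> W = (9/2) \<cdot> L\<langle>-1\<rangle> L - (27/32) \<cdot> T (T L)"
  "W\<langle>0\<rangle> W = (9/2) \<cdot> L\<langle>-2\<rangle> L - (3/16) \<cdot> T (T (T L))"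
  using W_W by (simp_all add: T_left numeral_2_eq_2 numeral_3_eq_3)

text \<open>The normally ordered product is not commutative: the correction is the commutator of
  L_(-1) and L_(-2) on the vacuum, namely L_(-4) 1. It lets the weight 5 vectors met below be
  written through L_(-2) L and T^3 L.\<close>

lemma L_TL: "L\<langle>-1\<rangle> (T L) = L\<langle>-2\<rangle> L + (1/6) \<cdot> T (T (T L))"
proof -
  have v: "L = L\<langle>-1\<rangle> vac V" "T L = L\<langle>-2\<rangle> vac V" using dpow_1[of L] by (simp_all add: mode_vac)
  have "Sum_any (\<lambda>i. (of_int (-1) gchoose i) \<cdot> (L\<langle>int i\<rangle> L)\<langle>- 1 + - 2 - int i\<rangle> vac V) =
      (\<Sum>i<4. (of_int (-1) gchoose i) \<cdot> (L\<langle>int i\<rangle> L)\<langle>- 1 + - 2 - int i\<rangle> vac V)"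
    by (rule Sum_any_eq_sum_lessThan) simp
  also have "{..<4::nat} = {0, 1, 2, 3}" by auto
  also have "(\<Sum>i\<in>{0::nat, 1, 2, 3}. (of_int (-1) gchoose i) \<cdot> (L\<langle>int i\<rangle> L)\<langle>- 1 + - 2 - int i\<rangle> vac V) =
     3 \<cdot> L\<langle>-4\<rangle> vac V + (-2) \<cdot> L\<langle>-4\<rangle> vac V"
    by (simp add: gbinomial_neg_one T_left vacuum)
  also have "\<dots> = L\<langle>-4\<rangle> vac V"
    by (subst vs.scale_left_distrib[symmetric]) simp
  also have "\<dots> = (1/6) \<cdot> T (T (T L))" by (simp add: mode_vac dpow_3)
  finally show ?thesis
    using commutator_formula[of L "-1" L "-2" "vac V"] unfolding v[symmetric] by (simp add: algebra_simps)
qed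

lemma T_LL: "T (L\<langle>-1\<rangle> L) = 2 \<cdot> L\<langle>-2\<rangle> L + (1/6) \<cdot> T (T (T L))"
  using vs.scale_left_distrib[of 1 1 "L\<langle>-2\<rangle> L"] by (simp add: T_derivation T_left L_TL)

lemma collect: "p \<cdot> x + q \<cdot> x = (p + q) \<cdot> x" "p \<cdot> x - q \<cdot> x = (p - q) \<cdot> x"
  "x + q \<cdot> x = (1 + q) \<cdot> x" "p \<cdot> x + x = (p + 1) \<cdot> x" "x + x = 2 \<cdot> x" "p \<cdot> x - x = (p - 1) \<cdot> x" "- x + q \<cdot> x = (q - 1) \<cdot> x"
  using vs.scale_left_distrib[of 1 1 x] by (simp_all add: vs.scale_left_distrib vs.scale_left_diff_distrib)

lemma L_modes_low:
  "L\<langle>1\<rangle> (T L) = 3 \<cdot> T L" "L\<langle>1\<rangle> (T (T L)) = 4 \<cdot> T (T L)" "L\<langle>1\<rangle> (T W) = 4 \<cdot> T W" "L\<langle>1\<rangle> (T (T W)) = 5 \<cdot> T (T W)"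
  "L\<langle>2\<rangle> (T L) = 4 \<cdot> L" "L\<langle>2\<rangle> (T (T L)) = 10 \<cdot> T L" "L\<langle>2\<rangle> (T (T (T L))) = 18 \<cdot> T (T L)"
  "L\<langle>2\<rangle> (T W) = 6 \<cdot> W" "L\<langle>2\<rangle> (T (T W)) = 14 \<cdot> T W" "L\<langle>2\<rangle> (T (T (T W))) = 24 \<cdot> T (T W)"
  "L\<langle>3\<rangle> (T L) = 0" "L\<langle>3\<rangle> (T (T L)) = 12 \<cdot> L" "L\<langle>3\<rangle> (T (T (T L))) = 42 \<cdot> T L"
  "L\<langle>3\<rangle> (T W) = 0" "L\<langle>3\<rangle> (T (T W)) = 18 \<cdot> W" "L\<langle>3\<rangle> (T (T (T W))) = 60 \<cdot> T W"
  "L\<langle>2\<rangle> (L\<langle>-1\<rangle> L) = 3 \<cdot> T L" "L\<langle>2\<rangle> (L\<langle>-2\<rangle> L) = 4 \<cdot> L\<langle>-1\<rangle> L" "L\<langle>2\<rangle> (L\<langle>-1\<rangle> W) = 3 \<cdot> T W"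
  "L\<langle>3\<rangle> (L\<langle>-1\<rangle> L) = 6 \<cdot> L" "L\<langle>3\<rangle> (L\<langle>-2\<rangle> L) = 4 \<cdot> T L" "L\<langle>3\<rangle> (L\<langle>-1\<rangle> W) = 11 \<cdot> W"
proof -
  show 11: "L\<langle>1\<rangle> (T L) = 3 \<cdot> T L" by (simp add: mode_T collect)
  show 12: "L\<langle>1\<rangle> (T (T L)) = 4 \<cdot> T (T L)" by (subst mode_T, subst 11) (simp add: collect)
  show 13: "L\<langle>1\<rangle> (T W) = 4 \<cdot> T W" by (simp add: mode_T collect)
  show 14: "L\<langle>1\<rangle> (T (T W)) = 5 \<cdot> T (T W)" by (subst mode_T, subst 13) (simp add: collect)
  show 21: "L\<langle>2\<rangle> (T L) = 4 \<cdot> L" by (simp add: mode_T collect)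
  show 22: "L\<langle>2\<rangle> (T (T L)) = 10 \<cdot> T L" by (subst mode_T, subst 21) (simp add: 11 collect)
  show 23: "L\<langle>2\<rangle> (T (T (T L))) = 18 \<cdot> T (T L)" by (subst mode_T, subst 22) (simp add: 12 collect)
  show 24: "L\<langle>2\<rangle> (T W) = 6 \<cdot> W" by (simp add: mode_T collect)
  show 25: "L\<langle>2\<rangle> (T (T W)) = 14 \<cdot> T W" by (subst mode_T, subst 24) (simp add: 13 collect)
  show 26: "L\<langle>2\<rangle> (T (T (T W))) = 24 \<cdot> T (T W)" by (subst mode_T, subst 25) (simp add: 14 collect)
  show 31: "L\<langle>3\<rangle> (T L) = 0" by (simp add: mode_T der_vac)
  show 32: "L\<langle>3\<rangle> (T (T L)) = 12 \<cdot> L" by (subst mode_T, subst 31) (simp add: 21)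
  show 33: "L\<langle>3\<rangle> (T (T (T L))) = 42 \<cdot> T L" by (subst mode_T, subst 32) (simp add: 22 collect)
  show 34: "L\<langle>3\<rangle> (T W) = 0" by (simp add: mode_T)
  show 35: "L\<langle>3\<rangle> (T (T W)) = 18 \<cdot> W" by (subst mode_T, subst 34) (simp add: 24)
  show 36: "L\<langle>3\<rangle> (T (T (T W))) = 60 \<cdot> T W" by (subst mode_T, subst 35) (simp add: 25 collect)
  show "L\<langle>2\<rangle> (L\<langle>-1\<rangle> L) = 3 \<cdot> T L" "L\<langle>2\<rangle> (L\<langle>-2\<rangle> L) = 4 \<cdot> L\<langle>-1\<rangle> L" "L\<langle>2\<rangle> (L\<langle>-1\<rangle> W) = 3 \<cdot> T W"
    by (simp_all add: L_two_L)
  have "- L + 8 \<cdot> L - L = 6 \<cdot> L" by (simp add: collect)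
  then show "L\<langle>3\<rangle> (L\<langle>-1\<rangle> L) = 6 \<cdot> L" by (simp add: L_three_L mode_vac)
  show "L\<langle>3\<rangle> (L\<langle>-2\<rangle> L) = 4 \<cdot> T L" using dpow_1[of L] by (simp add: L_three_L mode_vac collect)
  show "L\<langle>3\<rangle> (L\<langle>-1\<rangle> W) = 11 \<cdot> W" by (simp add: L_three_L collect)
qed

text \<open>The singular vector of weight 6 at central charge \<open>-2\<close>.\<close>

definition s :: 'v where
  "s = T (T (T W)) - 8 \<cdot> L\<langle>-1\<rangle> (T W) + 12 \<cdot> L\<langle>-2\<rangle> W"

text \<open>L_(2) maps T^3 W, L_(-1) T W and L_(-2) W to 24 T^2 W, 6 L_(-1) W + 3 T^2 W and 4 L_(-1)
  W. Cancellation forces the ratio 1 : -8 : 12.\<close>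

lemma L_two_s: "L\<langle>2\<rangle> s = 0"
proof -
  have "L\<langle>2\<rangle> (L\<langle>-1\<rangle> (T W)) = 6 \<cdot> L\<langle>-1\<rangle> W + 3 \<cdot> T (T W)" by (simp add: L_two_L L_modes_low)
  moreover have "L\<langle>2\<rangle> (L\<langle>-2\<rangle> W) = 4 \<cdot> L\<langle>-1\<rangle> W" by (simp add: L_two_L)
  ultimately show ?thesis by (simp add: s_def L_modes_low vs.scale_right_distrib)
qed

text \<open>Here the central charge matters: L_(3) sends L_(-1) T W to 16 + c/2 times T W, and 60 -
  8 (16 + c/2) + 60 vanishes exactly for c = -2.\<close>

lemma L_three_s: "L\<langle>3\<rangle> s = 0"
proof -
  have "L\<langle>3\<rangle> (L\<langle>-1\<rangle> (T W)) = 15 \<cdot> T W" by (simp add: L_three_L L_modes_low collect)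
  moreover have "L\<langle>3\<rangle> (L\<langle>-2\<rangle> W) = 5 \<cdot> T W" by (simp add: L_three_L)
  ultimately show ?thesis by (simp add: s_def L_modes_low collect)
qed

text \<open>A weight 5 computation in the coordinates \<open>v a b\<close>: the terms contribute 189
  - 8 (1215/16) + 12 (279/8) = 0 along L_(-2) L and 63/4 - 12 (21/16) = 0 along T^3 L.\<close>

lemma W_three_s: "W\<langle>3\<rangle> s = 0"
proof -
  define v where "v a b = a \<cdot> L\<langle>-2\<rangle> L + b \<cdot> T (T (T L))" for a b
  have v_simps: "v a b + v c d = v (a + c) (b + d)" "v a b - v c d = v (a - c) (b - d)" "k \<cdot> v a b = v (k * a) (k * b)" for a b c d k
    by (simp_all add: v_def vs.scale_left_distrib vs.scale_left_diff_distrib vs.scale_right_distrib)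
  have A: "T (T (T L)) = v 0 1" and B: "L\<langle>-2\<rangle> L = v 1 0" and C: "L\<langle>-1\<rangle> (T L) = v 1 (1/6)" and D: "T (L\<langle>-1\<rangle> L) = v 2 (1/6)"
    by (simp_all add: v_def L_TL T_LL)
  have w0: "W\<langle>0\<rangle> W = v (9/2) (-3/16)" by (simp add: A B v_simps)
  have w3t: "W\<langle>3\<rangle> (T W) = (135/16) \<cdot> T L" by (simp add: mode_T collect)
  have "(27/16) \<cdot> T (T L) + (9 \<cdot> L\<langle>-1\<rangle> L - (27/16) \<cdot> T (T L)) = 9 \<cdot> L\<langle>-1\<rangle> L" by simp
  then have w2t: "W\<langle>2\<rangle> (T W) = 9 \<cdot> L\<langle>-1\<rangle> L" by (simp add: mode_T vs.scale_right_diff_distrib)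
  have w1t: "W\<langle>1\<rangle> (T W) = v (27/2) (-9/32)"
    by (subst mode_T) (simp add: A[symmetric] w0 del: W_W_modes(7), simp add: A D v_simps)
  have w3tt: "W\<langle>3\<rangle> (T (T W)) = (135/16) \<cdot> T (T L) + 27 \<cdot> L\<langle>-1\<rangle> L"
    by (subst mode_T, subst w3t) (simp add: w2t)
  have w2tt: "W\<langle>2\<rangle> (T (T W)) = v 45 (15/16)"
    by (subst mode_T, subst w2t) (simp add: w1t D v_simps)
  have w3ttt: "W\<langle>3\<rangle> (T (T (T W))) = v 189 (63/4)"
    by (subst mode_T, subst w3tt) (simp add: w2tt A D v_simps)
  have w3l: "W\<langle>3\<rangle> (L\<langle>-1\<rangle> (T W)) = v (1215/16) 0"
    by (subst W_mode_L, subst w3t) (simp add: w1t C v_simps)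
  have w3l2: "W\<langle>3\<rangle> (L\<langle>-2\<rangle> W) = v (279/8) (-21/16)"
    by (subst W_mode_L) (simp add: w0 B v_simps del: W_W_modes(7))
  show ?thesis by (simp add: s_def w3ttt w3l w3l2 v_simps) (simp add: v_def)
qed

text \<open>Commuting L_(2) with L_(n) gives (2 - n) L_(n+1) s = 0. The factor vanishes at n = 2, so
  L_(3) has to be checked separately.\<close>

lemma L_modes_s: "n \<ge> 2 \<Longrightarrow> L\<langle>n\<rangle> s = 0"
proof (induction n rule: int_ge_induct)
  case base
  show ?case by (rule L_two_s)
next
  case (step n)
  show ?case
  proof (cases "n = 2")
    case False
    have "(2 - of_int n) \<cdot> L\<langle>n + 1\<rangle> s = 0" using L_two_L[of n s] step by (simp add: L_two_s)
    moreover have "(2 - of_int n :: complex) \<noteq> 0" using False step by (metis eq_iff_diff_eq_0 of_int_eq_numeral_iff)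
    ultimately show ?thesis by simp
  qed (simp add: L_three_s)
qed

text \<open>The same with the factor 4 - n, which fails to reach W_(5); that mode comes from
  commuting L_(3) with W_(3).\<close>

lemma W_modes_s: "n \<ge> 3 \<Longrightarrow> W\<langle>n\<rangle> s = 0"
proof (induction n rule: int_ge_induct)
  case base
  show ?case by (rule W_three_s)
next
  case (step n)
  show ?case
  proof (cases "n = 4")
    case True
    have "3 \<cdot> W\<langle>5\<rangle> s = 0" using L_three_W[of 3 s] by (simp add: L_three_s W_three_s)
    then show ?thesis using True by simp
  next
    case False
    have "(4 - of_int n) \<cdot> W\<langle>n + 1\<rangle> s = 0" using L_two_W[of n s] step by (simp add: L_two_s)
    moreover have "(4 - of_int n :: complex) \<noteq> 0" using False by (metis eq_iff_diff_eq_0 of_int_eq_numeral_iff)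
    ultimately show ?thesis by simp
  qed
qed

subsection \<open>Conformal weights\<close>

text \<open>Weights are integers, so that the weight p + q - n - 1 of a_(n) b can be written without
  truncation.\<close>

definition wt :: "'v \<Rightarrow> int \<Rightarrow> bool" where
  "wt x d \<longleftrightarrow> L\<langle>1\<rangle> x = of_int d \<cdot> x"

lemma wt_weight_space: "wt x (int n) \<longleftrightarrow> x \<in> weight_space V L n"
  by (simp add: wt_def weight_space_def)

lemma wt_add: "wt x d \<Longrightarrow> wt y d \<Longrightarrow> wt (x + y) d"
  by (simp add: wt_def vs.scale_right_distrib)

lemma wt_scale: "wt x d \<Longrightarrow> wt (c \<cdot> x) d"
  by (simp add: wt_def mult.commute)

lemma wt_zero [simp]: "wt 0 d"
  by (simp add: wt_def)

lemma wt_vac [simp]: "wt (vac V) 0" and wt_L [simp]: "wt L 2" and wt_W [simp]: "wt W 3"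
  by (simp_all add: wt_def mode_vac)

lemma wt_mode: "wt a p \<Longrightarrow> wt b q \<Longrightarrow> d = p + q - n - 1 \<Longrightarrow> wt (a\<langle>n\<rangle> b) d"
proof -
  assume 1: "wt a p" "wt b q" "d = p + q - n - 1"
  have "of_int q \<cdot> a\<langle>n\<rangle> b + (- of_int (n + 1)) \<cdot> a\<langle>n\<rangle> b + of_int p \<cdot> a\<langle>n\<rangle> b = of_int d \<cdot> a\<langle>n\<rangle> b"
    by (simp only: vs.scale_left_distrib[symmetric]) (simp add: 1(3) algebra_simps)
  then show ?thesis using 1 by (simp add: wt_def L_one_mode T_left)
qed

lemma wt_T: "wt a p \<Longrightarrow> wt (T a) (p + 1)"
  using wt_mode[of a p "vac V" 0 "p + 1" "-2"] dpow_1[of a] by (simp add: mode_vac)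

lemma wt_s: "wt s 6"
proof -
  have "wt (T (T (T W))) 6" using wt_T[OF wt_T[OF wt_T[OF wt_W]]] by simp
  moreover have "wt (L\<langle>-1\<rangle> (T W)) 6" by (rule wt_mode[OF wt_L wt_T[OF wt_W]]) simp
  moreover have "wt (L\<langle>-2\<rangle> W) 6" by (rule wt_mode[OF wt_L wt_W]) simp
  ultimately show ?thesis
    unfolding s_def diff_conv_add_uminus vs.scale_minus_left[symmetric] by (intro wt_add wt_scale)
qed

text \<open>Subtracting the eigenvalue of the new vector times the relation from its image under
  L_(1) eliminates that vector.\<close>

lemma eigenvectors_independent:
  fixes e :: "nat \<Rightarrow> int"
  assumes "finite S" "inj_on e S" "\<And>i. i \<in> S \<Longrightarrow> wt (f i) (e i)" "sum f S = 0" "i \<in> S"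
  shows "f i = 0"
  using assms
proof (induction S arbitrary: f i)
  case (insert j S)
  have sum0: "f j + sum f S = 0" using insert by simp
  have "L\<langle>1\<rangle> (f j + sum f S) = 0" unfolding sum0 by simp
  then have 1: "of_int (e j) \<cdot> f j + (\<Sum>i\<in>S. of_int (e i) \<cdot> f i) = 0"
    using insert.prems(2) by (simp add: mode_right_sum wt_def cong: sum.cong)
  have "f j = - sum f S" using sum0 by (simp add: eq_neg_iff_add_eq_0)
  then have "(\<Sum>i\<in>S. of_int (e i) \<cdot> f i) - of_int (e j) \<cdot> sum f S = 0" using 1 by simp
  then have "(\<Sum>i\<in>S. of_int (e i - e j) \<cdot> f i) = 0"
    by (simp add: vs.scale_sum_right sum_subtractf vs.scale_left_diff_distrib)
  then have "of_int (e i - e j) \<cdot> f i = 0" if "i \<in> S" for i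
    using insert.IH[of "\<lambda>i. of_int (e i - e j) \<cdot> f i" i] insert.prems that by (auto intro: wt_scale)
  moreover have "e i \<noteq> e j" if "i \<in> S" for i
    using insert.prems(1) insert.hyps(2) that by (auto simp: inj_on_def)
  ultimately have z: "f i = 0" if "i \<in> S" for i using that by (metis eq_iff_diff_eq_0 of_int_eq_0_iff vs.scale_eq_0_iff)
  then have "f j = 0" using sum0 by simp
  then show ?case using z insert.prems(4) by blast
qed simp

text \<open>Unordered monomials in the creation modes with their weight. Only spanning is asserted
  about them, so they serve the simple quotient as well.\<close>

inductive word :: "nat \<Rightarrow> 'v \<Rightarrow> bool" where
  word_vac: "word 0 (vac V)"
| word_L: "word n x \<Longrightarrow> word (n + 2 + k) (L\<langle>- 1 - int k\<rangle> x)"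
| word_W: "word n x \<Longrightarrow> word (n + 3 + k) (W\<langle>- 1 - int k\<rangle> x)"

lemma word_wt: "word n x \<Longrightarrow> wt x (int n)"
proof (induction rule: word.induct)
  case (word_L n x k)
  show ?case by (rule wt_mode[OF wt_L word_L.IH]) simp
next
  case (word_W n x k)
  show ?case by (rule wt_mode[OF wt_W word_W.IH]) simp
qed simp

lemma spanned_by_words: "x \<in> vs.span {y. \<exists>n. word n y}"
proof -
  let ?S = "vs.span {y. \<exists>n. word n y}"
  have step: "a\<langle>m\<rangle> x \<in> ?S" if "x \<in> ?S" "\<And>n y. word n y \<Longrightarrow> \<exists>n. word n (a\<langle>m\<rangle> y)" for a m x
  proof -
    have "vs.subspace {x. a\<langle>m\<rangle> x \<in> ?S}"
      by (auto simp: vs.subspace_def intro: vs.span_add vs.span_scale vs.span_zero)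
    moreover have "{y. \<exists>n. word n y} \<subseteq> {x. a\<langle>m\<rangle> x \<in> ?S}"
      using that(2) by (auto intro!: vs.span_base)
    ultimately have "?S \<subseteq> {x. a\<langle>m\<rangle> x \<in> ?S}" by (intro vs.span_minimal)
    then show ?thesis using that(1) by blast
  qed
  show ?thesis
  proof (induction x rule: state_induct)
    case (L k x)
    then show ?case by (rule step) (blast intro: word_L)
  next
    case (W k x)
    then show ?case by (rule step) (blast intro: word_W)
  next
    case vac
    show ?case by (rule vs.span_base) (use word_vac in blast)
  qed (auto intro: vs.span_add vs.span_scale vs.span_zero)
qed

definition comps :: "'v \<Rightarrow> (nat \<Rightarrow> 'v) \<Rightarrow> bool" where
  "comps x f \<longleftrightarrow> (\<forall>n. wt (f n) (int n)) \<and> eventually_zero f \<and> x = Sum_any f"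

lemma comps_unique:
  assumes "comps x f" "comps x g"
  shows "f = g"
proof -
  have e: "eventually_zero f" "eventually_zero g" using assms by (auto simp: comps_def)
  obtain K where K: "\<And>i. i \<ge> K \<Longrightarrow> f i = 0" using e(1) unfolding eventually_zero_def by blast
  obtain M where M: "\<And>i. i \<ge> M \<Longrightarrow> g i = 0" using e(2) unfolding eventually_zero_def by blast
  have "Sum_any (\<lambda>n. f n - g n) = 0" using Sum_any_diff[OF e] assms by (simp add: comps_def)
  moreover have "Sum_any (\<lambda>n. f n - g n) = (\<Sum>n<max K M. f n - g n)"
    by (rule Sum_any_eq_sum_lessThan) (simp add: K M)
  ultimately have sum0: "(\<Sum>n<max K M. f n - g n) = 0" by simp
  have wtd: "wt (f n - g n) (int n)" for n
    using assms wt_add[of "f n" "int n" "- 1 \<cdot> g n"] wt_scale[of "g n" "int n" "-1"] by (simp add: comps_def)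
  have "f n - g n = 0" for n
  proof (cases "n < max K M")
    case True
    then show ?thesis
      by (intro eigenvectors_independent[of "{..<max K M}" int "\<lambda>n. f n - g n"]) (use sum0 wtd in auto)
  qed (simp add: K M)
  then show ?thesis by (simp add: fun_eq_iff)
qed

lemma comps_add:
  assumes f: "comps x f" and g: "comps y g"
  shows "comps (x + y) (\<lambda>n. f n + g n)"
proof -
  have e: "eventually_zero f" "eventually_zero g" using f g by (simp_all add: comps_def)
  obtain K where K: "\<And>i. i \<ge> K \<Longrightarrow> f i = 0" using e(1) unfolding eventually_zero_def by blast
  obtain M where M: "\<And>i. i \<ge> M \<Longrightarrow> g i = 0" using e(2) unfolding eventually_zero_def by blast
  have "eventually_zero (\<lambda>n. f n + g n)"
    by (rule eventually_zeroI[of "max K M"]) (simp add: K M)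
  then show ?thesis using f g by (simp add: comps_def wt_add Sum_any_add[OF e])
qed

lemma comps_scale:
  assumes f: "comps x f"
  shows "comps (c \<cdot> x) (\<lambda>n. c \<cdot> f n)"
proof -
  have e: "eventually_zero f" using f by (simp add: comps_def)
  have "c \<cdot> Sum_any f = Sum_any (\<lambda>n. c \<cdot> f n)"
    by (rule Sum_any_hom[OF e]) (simp_all add: vs.scale_right_distrib)
  moreover have "eventually_zero (\<lambda>n. c \<cdot> f n)" by (rule eventually_zero_compose[OF e]) simp
  ultimately show ?thesis using f by (simp add: comps_def wt_scale)
qed

lemma comps_wt: "wt x (int m) \<Longrightarrow> comps x (\<lambda>n. if n = m then x else 0)"
  unfolding comps_def by (auto intro!: eventually_zeroI[of "Suc m"] simp: Sum_any_eq_single[where k = m])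

lemma comps_words: "\<exists>f. comps x f \<and> (\<forall>n. f n \<in> vs.span {y. word n y})"
  using spanned_by_words[of x]
proof (induction rule: vs.span_induct_alt)
  case base
  then show ?case using comps_wt[of 0 0] by (intro exI[of _ "\<lambda>n. 0"]) (simp add: vs.span_zero)
next
  case (step c w y)
  then obtain f m where f: "comps y f" "\<And>n. f n \<in> vs.span {y. word n y}" and m: "word m w" by auto
  have "comps (c \<cdot> w) (\<lambda>n. if n = m then c \<cdot> w else 0)" by (rule comps_wt[OF wt_scale[OF word_wt[OF m]]])
  from comps_add[OF this f(1)] show ?case
    by (intro exI[of _ "\<lambda>n. (if n = m then c \<cdot> w else 0) + f n"] conjI allI)
      (use f(2) m in \<open>auto intro!: vs.span_add vs.span_scale intro: vs.span_base vs.span_zero\<close>)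
qed

definition pr :: "nat \<Rightarrow> 'v \<Rightarrow> 'v" where
  "pr n x = (THE f. comps x f) n"

lemma pr_eqI: "comps x f \<Longrightarrow> pr n x = f n"
  unfolding pr_def by (rule fun_cong[of "THE f. comps x f"], rule the_equality) (auto intro: comps_unique)

lemma comps_pr: "comps x (\<lambda>n. pr n x)"
proof -
  obtain f where f: "comps x f" using comps_words by blast
  then have "(\<lambda>n. pr n x) = f" by (auto simp: pr_eqI)
  then show ?thesis using f by simp
qed

lemma wt_pr [simp]: "wt (pr n x) (int n)"
  using comps_pr by (simp add: comps_def)

lemma pr_words: "pr n x \<in> vs.span {y. word n y}"
  using comps_words[of x] pr_eqI by fastforce

lemma pr_add [simp]: "pr n (x + y) = pr n x + pr n y"
  by (rule pr_eqI[OF comps_add[OF comps_pr comps_pr]])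

lemma pr_scale [simp]: "pr n (c \<cdot> x) = c \<cdot> pr n x"
  by (rule pr_eqI[OF comps_scale[OF comps_pr]])

lemma pr_wt: "wt x (int m) \<Longrightarrow> pr n x = (if n = m then x else 0)"
  by (rule pr_eqI[OF comps_wt])

lemma pr_0 [simp]: "pr n 0 = 0"
  using pr_wt[of 0 0 n] by simp

lemma pr_minus [simp]: "pr n (- x) = - pr n x" and pr_diff [simp]: "pr n (x - y) = pr n x - pr n y"
proof -
  show *: "pr n (- x) = - pr n x" for x using pr_scale[of n "-1" x] by simp
  show "pr n (x - y) = pr n x - pr n y" using pr_add[of n x "- y"] * by simp
qed

lemma pr_sum: "pr n (sum f A) = (\<Sum>i\<in>A. pr n (f i))"
  by (induction A rule: infinite_finite_induct) auto

lemma homogeneous_induct: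
  assumes "\<And>n x. wt x (int n) \<Longrightarrow> P x" "\<And>x y. P x \<Longrightarrow> P y \<Longrightarrow> P (x + y)"
  shows "P x"
proof -
  have "eventually_zero (\<lambda>n. pr n x)" using comps_pr[of x] by (simp add: comps_def)
  then obtain K where K: "\<And>n. n \<ge> K \<Longrightarrow> pr n x = 0" unfolding eventually_zero_def by blast
  have "x = Sum_any (\<lambda>n. pr n x)" using comps_pr[of x] by (simp add: comps_def)
  also have "\<dots> = (\<Sum>n<K. pr n x)" by (rule Sum_any_eq_sum_lessThan) (rule K)
  finally have x: "x = (\<Sum>n<K. pr n x)" .
  have "P (\<Sum>n<M. pr n x)" for M
    by (induction M) (use assms(1)[of 0 0] in \<open>auto intro: assms(2) assms(1)[OF wt_pr]\<close>)
  then show ?thesis using x by metis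
qed

text \<open>a_(-1-l) adds the weights of its arguments and raises the total by l, hence the
  convolution over n - l and the value 0 below l.\<close>

lemma pr_mode:
  "pr n (a\<langle>- 1 - int l\<rangle> b) = (if n < l then 0 else \<Sum>i\<le>n - l. pr i a\<langle>- 1 - int l\<rangle> pr (n - l - i) b)"
proof (induction a rule: homogeneous_induct)
  case (1 p a)
  note a = 1
  show ?case
  proof (induction b rule: homogeneous_induct)
    case (1 q b)
    have "wt (a\<langle>- 1 - int l\<rangle> b) (int (p + q + l))" by (rule wt_mode[OF a 1]) simp
    then have lhs: "pr n (a\<langle>- 1 - int l\<rangle> b) = (if n = p + q + l then a\<langle>- 1 - int l\<rangle> b else 0)" by (rule pr_wt)
    show ?case
    proof (cases "n < l")
      case False
      have "(\<Sum>i\<le>n - l. pr i a\<langle>- 1 - int l\<rangle> pr (n - l - i) b) =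
        (\<Sum>i\<le>n - l. if i = p then a\<langle>- 1 - int l\<rangle> pr (n - l - p) b else 0)"
        by (intro sum.cong refl) (simp add: pr_wt[OF a])
      then show ?thesis using False unfolding lhs by (auto simp: pr_wt[OF 1])
    qed (simp add: lhs)
  next
    case (2 x y)
    then show ?case by (simp add: sum.distrib)
  qed
next
  case (2 x y)
  then show ?case by (simp add: sum.distrib)
qed

text \<open>Generators of weights 2 and 3 leave few words: none in weight 1, and up to weight 4 a
  single genuine product, L_(-1) L.\<close>

lemma words_low:
  "word 0 x \<Longrightarrow> x = vac V" "\<not> word (Suc 0) x" "word 2 x \<Longrightarrow> x = L" "word 3 x \<Longrightarrow> x = T L \<or> x = W"
  "word 4 x \<Longrightarrow> x = (1/2) \<cdot> T (T L) \<or> x = T W \<or> x = L\<langle>-1\<rangle> L"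
proof -
  have w: "n = 0 \<and> x = vac V \<or> (\<exists>m k y. n = m + 2 + k \<and> word m y \<and> x = L\<langle>- 1 - int k\<rangle> y) \<or>
      (\<exists>m k y. n = m + 3 + k \<and> word m y \<and> x = W\<langle>- 1 - int k\<rangle> y)" if "word n x" for n x
    using that by (subst (asm) word.simps) blast
  show 0: "word 0 x \<Longrightarrow> x = vac V" for x using w[of 0 x] by auto
  show 1: "\<not> word (Suc 0) x" for x using w[of "Suc 0" x] by auto
  show 2: "x = L" if "word 2 x" for x
  proof -
    have eq: "m = 0 \<and> k = 0" if "2 = m + 2 + k" for m k :: nat using that by simp
    have no: False if "2 = m + 3 + k" for m k :: nat using that by simp
    from w[OF that] show ?thesis
    proof (elim disjE exE conjE)
      fix m k y assume a: "2 = m + 2 + k" and b: "word m y" and c: "x = L\<langle>- 1 - int k\<rangle> y"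
      have mk: "m = 0" "k = 0" using eq[OF a] by auto
      then have "y = vac V" using 0[of y] b by simp
      then show ?thesis using c mk by (simp add: mode_vac)
    qed (use no in auto)
  qed
  show 3: "x = T L \<or> x = W" if "word 3 x" for x
    using w[OF that]
  proof (elim disjE exE conjE)
    fix m k y assume *: "3 = m + 2 + k" "word m y" "x = L\<langle>- 1 - int k\<rangle> y"
    then have "m = 0 \<and> k = 1 \<or> m = Suc 0" by auto
    then show ?thesis using * 0[of y] 1[of y] dpow_1[of L] by (auto simp: mode_vac)
  next
    fix m k y assume *: "3 = m + 3 + k" "word m y" "x = W\<langle>- 1 - int k\<rangle> y"
    then have "m = 0 \<and> k = 0" by simp
    then show ?thesis using * 0[of y] by (auto simp: mode_vac)
  qed simp
  show "x = (1/2) \<cdot> T (T L) \<or> x = T W \<or> x = L\<langle>-1\<rangle> L" if "word 4 x"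
    using w[OF that]
  proof (elim disjE exE conjE)
    fix m k y assume *: "4 = m + 2 + k" "word m y" "x = L\<langle>- 1 - int k\<rangle> y"
    then have "m = 0 \<and> k = 2 \<or> m = Suc 0 \<or> m = 2 \<and> k = 0" by auto
    then show ?thesis using * 0[of y] 1[of y] 2[of y] dpow_2[of L] by (auto simp: mode_vac)
  next
    fix m k y assume *: "4 = m + 3 + k" "word m y" "x = W\<langle>- 1 - int k\<rangle> y"
    then have "m = 0 \<and> k = 1 \<or> m = Suc 0" by auto
    then show ?thesis using * 0[of y] 1[of y] dpow_1[of W] by (auto simp: mode_vac)
  qed simp
qed

lemma span_pair: "x \<in> vs.span {u, v} \<Longrightarrow> \<exists>a b. x = a \<cdot> u + b \<cdot> v"
proof -
  assume "x \<in> vs.span {u, v}"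
  then obtain k where "x - k \<cdot> u \<in> vs.span {v}" by (auto simp: vs.span_insert[of u])
  then obtain b where "x - k \<cdot> u = b \<cdot> v" by (auto simp: vs.span_singleton)
  then have "x = k \<cdot> u + b \<cdot> v" by (simp add: algebra_simps)
  then show ?thesis by blast
qed

lemma span_triple:
  assumes "x \<in> vs.span {u, v, w}"
  shows "\<exists>a b c. x = a \<cdot> u + b \<cdot> v + c \<cdot> w"
proof -
  obtain k where "x - k \<cdot> u \<in> vs.span {v, w}" using assms by (auto simp: vs.span_insert[of u])
  then obtain b c where "x - k \<cdot> u = b \<cdot> v + c \<cdot> w" using span_pair by blast
  then have "x = k \<cdot> u + b \<cdot> v + c \<cdot> w" by (simp add: algebra_simps)
  then show ?thesis by blast
qed

lemma pr_low:
  "\<exists>c. pr 0 x = c \<cdot> vac V" "pr (Suc 0) x = 0" "\<exists>c. pr 2 x = c \<cdot> L" "\<exists>a b. pr 3 x = a \<cdot> T L + b \<cdot> W"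
  "\<exists>a b c. pr 4 x = a \<cdot> T (T L) + b \<cdot> T W + c \<cdot> L\<langle>-1\<rangle> L"
proof -
  have "pr 0 x \<in> vs.span {vac V}" using pr_words[of 0 x] vs.span_mono[of "{y. word 0 y}" "{vac V}"] words_low(1) by blast
  then show "\<exists>c. pr 0 x = c \<cdot> vac V" by (auto simp: vs.span_singleton)
  have "pr (Suc 0) x \<in> vs.span {}" using pr_words[of "Suc 0" x] vs.span_mono[of "{y. word (Suc 0) y}" "{}"] words_low(2) by blast
  then show "pr (Suc 0) x = 0" by simp
  have "pr 2 x \<in> vs.span {L}" using pr_words[of 2 x] vs.span_mono[of "{y. word 2 y}" "{L}"] words_low(3) by blast
  then show "\<exists>c. pr 2 x = c \<cdot> L" by (auto simp: vs.span_singleton)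
  have "pr 3 x \<in> vs.span {T L, W}" using pr_words[of 3 x] vs.span_mono[of "{y. word 3 y}" "{T L, W}"] words_low(4) by blast
  then show "\<exists>a b. pr 3 x = a \<cdot> T L + b \<cdot> W" by (rule span_pair)
  have "pr 4 x \<in> vs.span {(1/2) \<cdot> T (T L), T W, L\<langle>-1\<rangle> L}"
    using pr_words[of 4 x] vs.span_mono[of "{y. word 4 y}" "{(1/2) \<cdot> T (T L), T W, L\<langle>-1\<rangle> L}"] words_low(5) by blast
  from span_triple[OF this] show "\<exists>a b c. pr 4 x = a \<cdot> T (T L) + b \<cdot> T W + c \<cdot> L\<langle>-1\<rangle> L"
    by (metis vs.scale_scale)
qed

subsection \<open>The singular vector vanishes\<close>

text \<open>For x of weight p the modes with n \<ge> p lower the weight; all of them kill s, not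
  only those of L and W. Strong induction on p, splitting x by the iterate formula.\<close>

lemma lowering_modes_s:
  assumes "wt x (int p)" "n \<ge> int p"
  shows "x\<langle>n\<rangle> s = 0"
  using assms
proof (induction p arbitrary: x n rule: less_induct)
  case (less p)
  have gen: "(g\<langle>- 1 - int k\<rangle> y)\<langle>n\<rangle> s = 0"
    if g: "wt g (int h)" "\<And>m. m \<ge> int h \<Longrightarrow> g\<langle>m\<rangle> s = 0" "h > 0" and y: "wt y (int q)" and p: "p = q + h + k" and n: "n \<ge> int p"
    for g h y q k n
  proof -
    have q: "q < p" using g(3) p by simp
    have y0: "y\<langle>m\<rangle> s = 0" if "m \<ge> int q" for m by (rule less.IH[OF q y that])
    \<comment> \<open>For i < h the inner mode of g need not kill s. Exchanging it with the mode of
      y leaves modes of g_(j) y, whose weight is below p, and the mode of y on s; both vanish by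
      induction.\<close>
    have second: "y\<langle>n + (- 1 - int k) - int i\<rangle> (g\<langle>int i\<rangle> s) = 0" for i
    proof (cases "i < h")
      case True
      have "(g\<langle>int j\<rangle> y)\<langle>int i + (n + (- 1 - int k) - int i) - int j\<rangle> s = 0" if "j \<le> i" for j
      proof (rule less.IH[of "q + h - 1 - j"])
        show "q + h - 1 - j < p" using p g(3) by simp
        show "wt (g\<langle>int j\<rangle> y) (int (q + h - 1 - j))" by (rule wt_mode[OF g(1) y]) (use that True in simp)
        show "int i + (n + (- 1 - int k) - int i) - int j \<ge> int (q + h - 1 - j)" using n p that True by simp
      qed
      then have "(\<Sum>j\<le>i. of_nat (i choose j) \<cdot> (g\<langle>int j\<rangle> y)\<langle>int i + (n + (- 1 - int k) - int i) - int j\<rangle> s) = 0"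
        by (intro sum.neutral) simp
      moreover have "y\<langle>n + (- 1 - int k) - int i\<rangle> s = 0" by (rule y0) (use n p True in simp)
      ultimately show ?thesis
        using commutator_formula_nat[of g i y "n + (- 1 - int k) - int i" s] by simp
    qed (simp add: g(2))
    have first: "y\<langle>n + int i\<rangle> s = 0" for i by (rule y0) (use n p in simp)
    show ?thesis unfolding iterate_formula by (simp add: first second)
  qed
  have "x = pr p x" using pr_wt[OF less.prems(1), of p] by simp
  then have "x \<in> vs.span {y. word p y}" using pr_words[of p x] by simp
  moreover have "y\<langle>n\<rangle> s = 0" if "word p y" for y
    using that
  proof (cases rule: word.cases)
    case word_vac
    then show ?thesis using less.prems(2) by (simp add: vacuum)
  next
    case (word_L q z k)
    show ?thesis unfolding word_L(2)
      by (rule gen[of L 2 z q k]) (use word_L less.prems in \<open>auto simp: word_wt L_modes_s\<close>)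
  next
    case (word_W q z k)
    show ?thesis unfolding word_W(2)
      by (rule gen[of W 3 z q k]) (use word_W less.prems in \<open>auto simp: word_wt W_modes_s\<close>)
  qed
  moreover have "vs.subspace {x. x\<langle>n\<rangle> s = 0}" by (auto simp: vs.subspace_def)
  ultimately show ?case
    using vs.span_minimal[of "{y. word p y}" "{x. x\<langle>n\<rangle> s = 0}"] by blast
qed

text \<open>The ideal generated by s: by associativity one layer of modes applied to s is already
  closed under further modes.\<close>

definition orbit :: "'v set" where
  "orbit = vs.span {c\<langle>n\<rangle> s |c n. True}"

lemma orbit_subspace: "vs.subspace orbit"
  unfolding orbit_def by (rule vs.subspace_span)

lemma orbit_mode_s: "c\<langle>n\<rangle> s \<in> orbit"
  unfolding orbit_def by (rule vs.span_base) blast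

text \<open>Borcherds' identity with \<open>m\<close> so large that \<open>a\<^bsub>(m+i)\<^esub>s = 0\<close>, by descending induction on \<open>n\<close>.\<close>

lemma orbit_mode_mode: "a\<langle>r\<rangle> (b\<langle>n\<rangle> s) \<in> orbit"
proof -
  obtain N where N: "\<And>i. i \<ge> N \<Longrightarrow> b\<langle>i\<rangle> s = 0" using truncation[of b s] by blast
  obtain m where m: "\<And>i. i \<ge> m \<Longrightarrow> a\<langle>i\<rangle> s = 0" using truncation[of a s] by blast
  show ?thesis
  proof (induction "nat (N - n)" arbitrary: r n rule: less_induct)
    case less
    show ?case
    proof (cases "n \<ge> N")
      case False
      let ?l = "r - m"
      let ?g = "\<lambda>i. ((-1) ^ i * (of_int ?l gchoose i)) \<cdot> a\<langle>m + ?l - int i\<rangle> (b\<langle>n + int i\<rangle> s)"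
      have ev: "eventually_zero ?g"
        by (rule eventually_zeroI[of "nat (N - n)"]) (simp add: N)
      have "a\<langle>m + int i\<rangle> s = 0" for i by (rule m) simp
      then have "Sum_any ?g = Sum_any (\<lambda>i. (of_int m gchoose i) \<cdot> (a\<langle>?l + int i\<rangle> b)\<langle>m + n - int i\<rangle> s)"
        using borcherds_identity[of ?l a m b n s] by simp
      also have "\<dots> \<in> orbit"
        by (rule subspace_Sum_any[OF orbit_subspace]) (rule vs.subspace_scale[OF orbit_subspace orbit_mode_s])
      finally have 1: "Sum_any ?g \<in> orbit" .
      have 2: "Sum_any ?g = a\<langle>r\<rangle> (b\<langle>n\<rangle> s) + Sum_any (\<lambda>i. ?g (Suc i))"
        by (subst Sum_any_Suc[OF ev]) simp
      have 3: "Sum_any (\<lambda>i. ?g (Suc i)) \<in> orbit"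
      proof (rule subspace_Sum_any[OF orbit_subspace], rule vs.subspace_scale[OF orbit_subspace])
        fix i
        show "a\<langle>m + ?l - int (Suc i)\<rangle> (b\<langle>n + int (Suc i)\<rangle> s) \<in> orbit"
          by (rule less.hyps) (use False in simp)
      qed
      show ?thesis using vs.subspace_diff[OF orbit_subspace 1 3] unfolding 2 add_diff_cancel_right' .
    qed (simp add: N vs.subspace_0[OF orbit_subspace])
  qed
qed

lemma orbit_left: "x \<in> orbit \<Longrightarrow> a\<langle>n\<rangle> x \<in> orbit"
proof -
  have 1: "vs.subspace {x. a\<langle>n\<rangle> x \<in> orbit}"
    using orbit_subspace by (auto simp: vs.subspace_def)
  have 2: "{c\<langle>n\<rangle> s |c n. True} \<subseteq> {x. a\<langle>n\<rangle> x \<in> orbit}" using orbit_mode_mode by blast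
  have "orbit \<subseteq> {x. a\<langle>n\<rangle> x \<in> orbit}"
    using vs.span_minimal[OF 2 1] unfolding orbit_def[symmetric] .
  then show "x \<in> orbit \<Longrightarrow> a\<langle>n\<rangle> x \<in> orbit" by blast
qed

lemma orbit_T: "x \<in> orbit \<Longrightarrow> T x \<in> orbit"
  using orbit_left[of x L 0] by simp

lemma orbit_right: "x \<in> orbit \<Longrightarrow> x\<langle>n\<rangle> a \<in> orbit"
proof -
  assume x: "x \<in> orbit"
  have d: "dpow t y \<in> orbit" if "y \<in> orbit" for t y
    using that by (induction t) (auto simp: dpow_Suc orbit_T vs.subspace_scale[OF orbit_subspace] simp del: of_nat_Suc)
  show "x\<langle>n\<rangle> a \<in> orbit"
    unfolding skew_symmetry_Sum_any[of x n a]
    by (rule subspace_Sum_any[OF orbit_subspace]) (intro vs.subspace_scale[OF orbit_subspace] d orbit_left x)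
qed

lemma orbit_graded: "vs.span (\<Union>n. orbit \<inter> weight_space V L n) = orbit"
proof
  show "vs.span (\<Union>n. orbit \<inter> weight_space V L n) \<subseteq> orbit"
    by (rule vs.span_minimal[OF _ orbit_subspace]) blast
  have "c\<langle>n\<rangle> s \<in> vs.span (\<Union>n. orbit \<inter> weight_space V L n)" for c n
  proof (induction c rule: homogeneous_induct)
    case (1 p c)
    show ?case
    proof (cases "n \<ge> int p")
      case False
      have "wt (c\<langle>n\<rangle> s) (int (nat (int p + 5 - n)))" by (rule wt_mode[OF 1 wt_s]) (use False in simp)
      then have "c\<langle>n\<rangle> s \<in> orbit \<inter> weight_space V L (nat (int p + 5 - n))"
        unfolding wt_weight_space using orbit_mode_s by blast
      then show ?thesis by (intro vs.span_base) blast
    qed (simp add: lowering_modes_s[OF 1] vs.span_zero)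
  next
    case (2 x y)
    then show ?case by (simp add: vs.span_add)
  qed
  then show "orbit \<subseteq> vs.span (\<Union>n. orbit \<inter> weight_space V L n)"
    unfolding orbit_def[of] by (intro vs.span_minimal vs.subspace_span) (auto simp flip: orbit_def)
qed

text \<open>By \<open>lowering_modes_s\<close> only modes with n < p survive, and c_(n) s then has
  weight p + 5 - n \<ge> 6. So the ideal misses the vacuum.\<close>

lemma orbit_pr_0: "x \<in> orbit \<Longrightarrow> pr 0 x = 0"
proof -
  have "pr 0 (c\<langle>n\<rangle> s) = 0" for c n
  proof (induction c rule: homogeneous_induct)
    case (1 p c)
    show ?case
    proof (cases "n \<ge> int p")
      case False
      have "wt (c\<langle>n\<rangle> s) (int (nat (int p + 5 - n)))" by (rule wt_mode[OF 1 wt_s]) (use False in simp)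
      from pr_wt[OF this, of 0] show ?thesis using False by simp
    qed (simp add: lowering_modes_s[OF 1])
  qed simp
  moreover have "vs.subspace {x. pr 0 x = 0}" by (auto simp: vs.subspace_def)
  ultimately have "orbit \<subseteq> {x. pr 0 x = 0}" unfolding orbit_def by (intro vs.span_minimal) auto
  then show "x \<in> orbit \<Longrightarrow> pr 0 x = 0" by blast
qed

end

locale W3_quotient = W3_algebra V L W for V :: "'v::ab_group_add va" and L W :: 'v +
  assumes simple: "\<And>I. proper_graded_ideal V L I \<Longrightarrow> I = {0}"
begin

lemma s_eq_0: "s = 0"
proof -
  have "vac V \<notin> orbit" using orbit_pr_0[of "vac V"] pr_wt[of "vac V" 0 0] nontrivial by auto
  then have "proper_graded_ideal V L orbit"
    unfolding proper_graded_ideal_def va_ideal_def va_span_def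
    using orbit_subspace orbit_T orbit_left orbit_right orbit_graded by auto
  then have "orbit = {0}" by (rule simple)
  then show ?thesis using orbit_mode_s[of "vac V" "-1"] by (simp add: vacuum)
qed

text \<open>The left side is a quadratic expression in F^1 while the right side lies in F^3, so 12
  l' w - 8 l w' vanishes in gr.\<close>

lemma singular_relation: "12 \<cdot> (T L)\<langle>-1\<rangle> W - 8 \<cdot> L\<langle>-1\<rangle> (T W) = - T (T (T W))"
  using s_eq_0 unfolding s_def by (simp add: T_left algebra_simps eq_neg_iff_add_eq_0)

text \<open>W_(2) is applied to s = 0. Modulo F^1 the term T^3 W contributes nothing, -8 L_(-1) T W
  gives -72 L_(-1) L_(-1) L and 12 L_(-2) W gives 72 W_(-1) W.\<close>

lemma cuspidal_relation: "W\<langle>-1\<rangle> W - L\<langle>-1\<rangle> (L\<langle>-1\<rangle> L) \<in> F 1"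
proof -
  have TF: "T x \<in> F 1" for x using F_T[OF F_0, of x] by simp
  have LF: "L\<langle>-2\<rangle> x \<in> F 1" for x using F_mode_negative[OF F_0, of 1 1 L x] by simp
  have w2t: "W\<langle>2\<rangle> (T W) = 9 \<cdot> L\<langle>-1\<rangle> L"
    by (simp add: mode_T vs.scale_right_diff_distrib)
  have t1: "W\<langle>2\<rangle> (T (T (T W))) \<in> F 1"
  proof -
    have "W\<langle>0\<rangle> (T W) = T (W\<langle>0\<rangle> W)" using mode_T[of W 0 W] by simp
    then have "W\<langle>0\<rangle> (T W) \<in> F 1" by (simp only: TF)
    moreover have "W\<langle>1\<rangle> (T (T W)) = T (W\<langle>1\<rangle> (T W)) + W\<langle>0\<rangle> (T W)" using mode_T[of W 1 "T W"] by simp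
    ultimately have "W\<langle>1\<rangle> (T (T W)) \<in> F 1" by (simp only: F_add TF)
    moreover have "W\<langle>2\<rangle> (T (T (T W))) = T (W\<langle>2\<rangle> (T (T W))) + 2 \<cdot> W\<langle>1\<rangle> (T (T W))" using mode_T[of W 2 "T (T W)"] by simp
    ultimately show ?thesis by (simp only: F_add F_scale TF)
  qed
  have t2: "W\<langle>2\<rangle> (L\<langle>-1\<rangle> (T W)) = 9 \<cdot> L\<langle>-1\<rangle> (L\<langle>-1\<rangle> L) + 4 \<cdot> T (W\<langle>0\<rangle> W)"
    by (subst W_mode_L, subst w2t) (simp add: mode_T)
  have t3: "W\<langle>2\<rangle> (L\<langle>-2\<rangle> W) = L\<langle>-2\<rangle> (W\<langle>2\<rangle> W) + 6 \<cdot> W\<langle>-1\<rangle> W"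
    by (subst W_mode_L) simp
  have "0 = W\<langle>2\<rangle> s" by (simp add: s_eq_0)
  then have "72 \<cdot> (W\<langle>-1\<rangle> W - L\<langle>-1\<rangle> (L\<langle>-1\<rangle> L)) =
      - (W\<langle>2\<rangle> (T (T (T W)))) + 32 \<cdot> T (W\<langle>0\<rangle> W) - 12 \<cdot> L\<langle>-2\<rangle> (W\<langle>2\<rangle> W)"
    unfolding s_def by (simp add: t2 t3 vs.scale_right_distrib vs.scale_right_diff_distrib algebra_simps del: W_W_modes)
  also have "\<dots> \<in> F 1"
    by (intro F_add F_diff F_scale F_neg t1 TF LF)
  finally have "(1/72) \<cdot> (72 \<cdot> (W\<langle>-1\<rangle> W - L\<langle>-1\<rangle> (L\<langle>-1\<rangle> L))) \<in> F 1" by (rule F_scale)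
  then show ?thesis by simp
qed

subsection \<open>Low weights of the Li filtration\<close>

text \<open>Few pairs of components reach weight at most 5: the vacuum component of a is
  annihilated, weight 1 is empty, and besides derivatives only L_(-2) L appears, in weight
  5.\<close>

lemma pr_C2_generator:
  "pr 0 (a\<langle>-2\<rangle> b) = 0" "pr (Suc 0) (a\<langle>-2\<rangle> b) = 0" "pr 2 (a\<langle>-2\<rangle> b) = 0" "\<exists>c. pr 3 (a\<langle>-2\<rangle> b) = c \<cdot> T L"
  "\<exists>c d. pr 4 (a\<langle>-2\<rangle> b) = c \<cdot> T (T L) + d \<cdot> T W"
  "\<exists>c y d. pr 5 (a\<langle>-2\<rangle> b) = c \<cdot> L\<langle>-2\<rangle> L + d \<cdot> T (pr 4 y)"
proof -
  have m: "pr n (a\<langle>-2\<rangle> b) = (if n < 1 then 0 else \<Sum>i\<le>n - 1. pr i a\<langle>-2\<rangle> pr (n - 1 - i) b)" for n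
    using pr_mode[of n a 1 b] by simp
  obtain a0 b0 where 0: "pr 0 a = a0 \<cdot> vac V" "pr 0 b = b0 \<cdot> vac V" using pr_low(1) by meson
  obtain a2 b2 where 2: "pr 2 a = a2 \<cdot> L" "pr 2 b = b2 \<cdot> L" using pr_low(3) by meson
  obtain a3 a3' where 3: "pr 3 a = a3 \<cdot> T L + a3' \<cdot> W" using pr_low(4) by meson
  have v: "x\<langle>-2\<rangle> vac V = T x" for x using dpow_1[of x] by (simp add: mode_vac)
  have a0': "pr 0 a\<langle>-2\<rangle> x = 0" for x by (simp add: 0 vacuum)
  note p1 = pr_low(2)
  have s1: "{..Suc 0} = {0, Suc 0}" "{..2::nat} = {0, Suc 0, 2}" "{..3::nat} = {0, Suc 0, 2, 3}" "{..4::nat} = {0, Suc 0, 2, 3, 4}" by auto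
  show "pr 0 (a\<langle>-2\<rangle> b) = 0" by (simp add: m)
  show "pr (Suc 0) (a\<langle>-2\<rangle> b) = 0" by (simp add: m a0')
  show "pr 2 (a\<langle>-2\<rangle> b) = 0" by (simp add: m s1 a0' p1)
  have "pr 3 (a\<langle>-2\<rangle> b) = (b0 * a2) \<cdot> T L" by (simp add: m s1 a0' p1 0 2 v vacuum)
  then show "\<exists>c. pr 3 (a\<langle>-2\<rangle> b) = c \<cdot> T L" by blast
  have "pr 4 (a\<langle>-2\<rangle> b) = b0 \<cdot> T (pr 3 a)" by (simp add: m s1 a0' p1 0 v vacuum)
  then have "pr 4 (a\<langle>-2\<rangle> b) = (b0 * a3) \<cdot> T (T L) + (b0 * a3') \<cdot> T W" by (simp add: 3 vs.scale_right_distrib)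
  then show "\<exists>c d. pr 4 (a\<langle>-2\<rangle> b) = c \<cdot> T (T L) + d \<cdot> T W" by blast
  have "pr 5 (a\<langle>-2\<rangle> b) = (a2 * b2) \<cdot> L\<langle>-2\<rangle> L + b0 \<cdot> T (pr 4 a)" by (simp add: m s1 a0' p1 0 2 v vacuum mult.commute)
  then show "\<exists>c y d. pr 5 (a\<langle>-2\<rangle> b) = c \<cdot> L\<langle>-2\<rangle> L + d \<cdot> T (pr 4 y)" by blast
qed

lemma F_1_induct [consumes 1]:
  assumes "x \<in> F 1" "vs.subspace {x. P x}" "\<And>a b. P (a\<langle>-2\<rangle> b)"
  shows "P x"
proof -
  have "C2 V \<subseteq> {x. P x}" unfolding C2_def va_span_def by (rule vs.span_minimal) (use assms in auto)
  then show ?thesis using assms(1) by (auto simp: C2_eq_F)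
qed

text \<open>Upper bounds for F^1 in low weight, checked on the generators of \<open>C2\<close>; they
  make the functionals on gr well defined.\<close>

lemma pr_F_1:
  assumes x: "x \<in> F 1"
  shows "n \<le> 2 \<Longrightarrow> pr n x = 0" "\<exists>c. pr 3 x = c \<cdot> T L" "\<exists>c d. pr 4 x = c \<cdot> T (T L) + d \<cdot> T W"
proof -
  have "pr 0 x = 0 \<and> pr (Suc 0) x = 0 \<and> pr 2 x = 0"
    using x by (rule F_1_induct) (auto simp: vs.subspace_def pr_C2_generator)
  moreover have "n = 0 \<or> n = Suc 0 \<or> n = 2" if "n \<le> 2" using that by linarith
  ultimately show "n \<le> 2 \<Longrightarrow> pr n x = 0" by auto
  show "\<exists>c. pr 3 x = c \<cdot> T L"
    using x
  proof (rule F_1_induct)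
    have "vs.subspace {x. pr 3 x \<in> vs.span {T L}}"
      by (auto simp: vs.subspace_def vs.span_zero intro: vs.span_add vs.span_scale)
    then show "vs.subspace {x. \<exists>c. pr 3 x = c \<cdot> T L}" by (simp add: vs.span_singleton image_iff)
  qed (rule pr_C2_generator)
  show "\<exists>c d. pr 4 x = c \<cdot> T (T L) + d \<cdot> T W"
    using x
  proof (rule F_1_induct)
    have "vs.subspace {x. pr 4 x \<in> vs.span {T (T L), T W}}"
      by (auto simp: vs.subspace_def vs.span_zero intro: vs.span_add vs.span_scale)
    moreover have "pr 4 x \<in> vs.span {T (T L), T W} \<longleftrightarrow> (\<exists>c d. pr 4 x = c \<cdot> T (T L) + d \<cdot> T W)" for x
    proof
      assume "\<exists>c d. pr 4 x = c \<cdot> T (T L) + d \<cdot> T W"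
      then obtain c d where eq: "pr 4 x = c \<cdot> T (T L) + d \<cdot> T W" by blast
      show "pr 4 x \<in> vs.span {T (T L), T W}"
        unfolding eq by (intro vs.span_add vs.span_scale vs.span_base) auto
    qed (rule span_pair)
    ultimately show "vs.subspace {x. \<exists>c d. pr 4 x = c \<cdot> T (T L) + d \<cdot> T W}" by simp
  qed (rule pr_C2_generator)
qed

text \<open>Two derivatives need weight at least 4, where only T^2 L is possible. For the leading
  factor, k = 0 uses the induction hypothesis, k = 1 uses \<open>pr_F_1\<close> for the tail, and k
  \<ge> 2 is a direct count of weights.\<close>

lemma pr_F_2:
  assumes x: "x \<in> F 2"
  shows "n \<le> 3 \<Longrightarrow> pr n x = 0" "\<exists>c. pr 4 x = c \<cdot> T (T L)"
proof -
  define P where "P x \<longleftrightarrow> pr 3 x = 0 \<and> pr 4 x \<in> vs.span {T (T L)}" for x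
  have mon: "q \<ge> 2 \<Longrightarrow> P x" if "li_monomial q x" for q x
    using that
  proof (induction rule: li_monomial.induct)
    case (li_step q y k a)
    have y: "y \<in> F q" using li_step.hyps by (rule li_monomial_in_F) simp
    have m: "pr n (a\<langle>- 1 - int k\<rangle> y) = (if n < k then 0 else \<Sum>i\<le>n - k. pr i a\<langle>- 1 - int k\<rangle> pr (n - k - i) y)" for n
      by (rule pr_mode)
    obtain a0 where a0: "pr 0 a = a0 \<cdot> vac V" using pr_low(1) by meson
    obtain a2 where a2: "pr 2 a = a2 \<cdot> L" using pr_low(3) by meson
    obtain y0 where y0: "pr 0 y = y0 \<cdot> vac V" using pr_low(1) by meson
    have s1: "{..Suc 0} = {0, Suc 0}" "{..2::nat} = {0, Suc 0, 2}" "{..3::nat} = {0, Suc 0, 2, 3}" "{..4::nat} = {0, Suc 0, 2, 3, 4}" by auto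
    have "k = 0 \<or> k = 1 \<or> k \<ge> 2" by linarith
    then have "P (a\<langle>- 1 - int k\<rangle> y)"
    proof (elim disjE)
      assume k: "k = 0"
      then have "P y" "q \<ge> 2" using li_step by auto
      then have p: "pr 0 y = 0" "pr (Suc 0) y = 0" "pr 2 y = 0" "pr 3 y = 0" "pr 4 y \<in> vs.span {T (T L)}"
        using pr_F_1(1)[OF F_antimonoD[OF y, of 1]] by (auto simp: P_def)
      show ?thesis unfolding P_def m using p(5)
        by (simp add: k s1 p(1-4) a0 vacuum vs.span_scale)
    next
      assume k: "k = 1"
      then have "y \<in> F 1" using F_antimonoD[OF y, of 1] li_step.prems by simp
      then have p: "pr 0 y = 0" "pr (Suc 0) y = 0" "pr 2 y = 0" using pr_F_1(1) by auto
      show ?thesis unfolding P_def m by (simp add: k s1 p a0 vacuum vs.span_zero)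
    next
      assume k: "k \<ge> 2"
      have v3: "L\<langle>-3\<rangle> vac V = (1/2) \<cdot> T (T L)" by (simp add: mode_vac dpow_2)
      consider "k = 2" | "k = 3" | "k = 4" | "k > 4" using k by linarith
      then show ?thesis
      proof cases
        case 1
        have "pr 3 (a\<langle>-3\<rangle> y) = 0" using m[of 3] by (simp add: 1 s1 a0 vacuum pr_low(2))
        moreover have "pr 4 (a\<langle>-3\<rangle> y) = (y0 * a2 / 2) \<cdot> T (T L)"
          using m[of 4] by (simp add: 1 s1 a0 a2 y0 vacuum pr_low(2) v3)
        ultimately show ?thesis unfolding P_def by (simp add: 1) (intro vs.span_scale vs.span_base, simp)
      next
        case 2
        have "pr 3 (a\<langle>-4\<rangle> y) = 0" "pr 4 (a\<langle>-4\<rangle> y) = 0" using m[of 3] m[of 4] by (simp_all add: 2 s1 a0 vacuum pr_low(2))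
        then show ?thesis unfolding P_def by (simp add: 2 vs.span_zero)
      next
        case 3
        have "pr 3 (a\<langle>-5\<rangle> y) = 0" "pr 4 (a\<langle>-5\<rangle> y) = 0" using m[of 3] m[of 4] by (simp_all add: 3 s1 a0 vacuum pr_low(2))
        then show ?thesis unfolding P_def by (simp add: 3 vs.span_zero)
      next
        case 4
        then show ?thesis unfolding P_def m by (simp add: vs.span_zero)
      qed
    qed
    then have "P (fact k \<cdot> a\<langle>- 1 - int k\<rangle> y)" by (simp add: P_def vs.span_scale)
    then show ?case by (simp add: T_pow_normal_product)
  qed simp
  have "P x" using x
    by (rule F_induct) (use mon in \<open>auto simp: P_def vs.span_zero intro: vs.span_add vs.span_scale\<close>)
  then have "pr 3 x = 0" "\<exists>c. pr 4 x = c \<cdot> T (T L)" by (auto simp: P_def vs.span_singleton)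
  moreover have "n \<le> 2 \<Longrightarrow> pr n x = 0" using pr_F_1(1)[OF F_antimonoD[OF x, of 1]] by simp
  ultimately show "n \<le> 3 \<Longrightarrow> pr n x = 0" "\<exists>c. pr 4 x = c \<cdot> T (T L)" by (metis le_antisym not_less_eq_eq numeral_3_eq_3 numeral_2_eq_2, blast)
qed

text \<open>The pairings that separate generators from derivatives: W_(5) ignores T L but detects W,
  W_(6) ignores T^2 L but detects T W, and L_(4) detects T L.\<close>

lemma W_mode_TL: "W\<langle>5\<rangle> (T L) = 0" "W\<langle>6\<rangle> (T (T L)) = 0" "W\<langle>6\<rangle> (T W) = (- 27 / 4) \<cdot> vac V" "L\<langle>4\<rangle> (T L) = (-4) \<cdot> vac V"
  by (simp_all add: mode_T)

text \<open>Except for the vacuum and L, where that part is 0, each vector is separated from the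
  part of F^1 in its weight by modes whose values in the end produce a nonzero multiple of the
  vacuum.\<close>

lemma not_in_F_1: "vac V \<notin> F 1" "L \<notin> F 1" "W \<notin> F 1" "L\<langle>-1\<rangle> L \<notin> F 1" "L\<langle>-1\<rangle> W \<notin> F 1"
proof -
  show "vac V \<notin> F 1" using pr_F_1(1)[of "vac V" 0] pr_wt[of "vac V" 0 0] nontrivial by auto
  show "L \<notin> F 1"
  proof
    assume "L \<in> F 1"
    then have "L = 0" using pr_F_1(1)[of L 2] pr_wt[of L 2 2] by simp
    then have "L\<langle>3\<rangle> L = 0" by simp
    then show False using nontrivial by simp
  qed
  show "W \<notin> F 1"
  proof
    assume "W \<in> F 1"
    then obtain c where "W = c \<cdot> T L" using pr_F_1(2)[of W] pr_wt[of W 3 3] by auto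
    then have "W\<langle>5\<rangle> W = c \<cdot> W\<langle>5\<rangle> (T L)" by (metis mode_right_linear(3))
    then show False using nontrivial by (simp add: W_mode_TL)
  qed
  show "L\<langle>-1\<rangle> L \<notin> F 1"
  proof
    \<comment> \<open>The factors 10 and 3 cancel T^2 L, where the two mode expressions give 12 L
      and 40 L. T W is killed as well, and L_(-1) L goes to (60 - 36) L.\<close>
    define g where "g x = 10 \<cdot> L\<langle>3\<rangle> x - 3 \<cdot> L\<langle>2\<rangle> (L\<langle>2\<rangle> x)" for x
    have wtx: "wt (L\<langle>-1\<rangle> L) (int 4)" by (rule wt_mode[OF wt_L wt_L]) simp
    assume "L\<langle>-1\<rangle> L \<in> F 1"
    then obtain c d where "L\<langle>-1\<rangle> L = c \<cdot> T (T L) + d \<cdot> T W" using pr_F_1(3)[of "L\<langle>-1\<rangle> L"] pr_wt[OF wtx, of 4] by auto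
    then have "g (L\<langle>-1\<rangle> L) = g (c \<cdot> T (T L) + d \<cdot> T W)" by simp
    then have "24 \<cdot> L = 0"
      unfolding g_def by (simp add: L_modes_low vs.scale_right_distrib collect mult_ac)
    then have "L = 0" by simp
    then have "L\<langle>3\<rangle> L = 0" by simp
    then show False using nontrivial by simp
  qed
  show "L\<langle>-1\<rangle> W \<notin> F 1"
  proof
    \<comment> \<open>The factors 14 and 3 cancel T^2 W, where the two mode expressions give 18 W
      and 84 W. On L_(-2) L and T^3 L the bracket is a multiple of T L, killed by W_(5), while
      L_(-1) W goes to (154 - 54) W_(5) W.\<close>
    define g where "g x = W\<langle>5\<rangle> (14 \<cdot> L\<langle>3\<rangle> x - 3 \<cdot> L\<langle>2\<rangle> (L\<langle>2\<rangle> x))" for x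
    have g_lin: "g (x + y) = g x + g y" "g (c \<cdot> x) = c \<cdot> g x" "g 0 = 0" for x y c
      by (simp_all add: g_def vs.scale_right_distrib vs.scale_right_diff_distrib algebra_simps)
    have gB: "g (L\<langle>-2\<rangle> L) = 0" by (simp add: g_def L_modes_low W_mode_TL)
    have gA: "g (T (T (T L))) = 0" by (simp add: g_def L_modes_low W_mode_TL)
    have gW: "g (T (T W)) = 0" by (simp add: g_def L_modes_low)
    have gT: "g (T (pr 4 y)) = 0" for y
    proof -
      obtain a b c where "pr 4 y = a \<cdot> T (T L) + b \<cdot> T W + c \<cdot> L\<langle>-1\<rangle> L" using pr_low(5) by meson
      then show ?thesis by (simp add: g_lin gA gW gB T_LL)
    qed
    have *: "g (pr 5 x) = 0" if "x \<in> F 1" for x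
      using that
    proof (rule F_1_induct)
      show "vs.subspace {x. g (pr 5 x) = 0}" by (auto simp: vs.subspace_def g_lin)
      fix a b
      show "g (pr 5 (a\<langle>-2\<rangle> b)) = 0" using pr_C2_generator(6)[of a b] by (auto simp: g_lin gB gT)
    qed
    assume "L\<langle>-1\<rangle> W \<in> F 1"
    moreover have wtx: "wt (L\<langle>-1\<rangle> W) (int 5)" by (rule wt_mode[OF wt_L wt_W]) simp
    ultimately have "g (L\<langle>-1\<rangle> W) = 0" using *[of "L\<langle>-1\<rangle> W"] pr_wt[OF wtx, of 5] by simp
    moreover have "g (L\<langle>-1\<rangle> W) = 100 \<cdot> W\<langle>5\<rangle> W" by (simp add: g_def L_modes_low collect del: W_W_modes)
    ultimately show False using nontrivial by simp
  qed
qed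

text \<open>The coefficient of the vacuum in the weight 0 component; it becomes the augmentation of
  gr.\<close>

definition vc :: "'v \<Rightarrow> complex" where
  "vc x = (SOME c. pr 0 x = c \<cdot> vac V)"

lemma vc: "pr 0 x = vc x \<cdot> vac V"
  unfolding vc_def by (rule someI_ex[OF pr_low(1)])

lemma vc_eqI: "pr 0 x = c \<cdot> vac V \<Longrightarrow> vc x = c"
  using vc[of x] nontrivial by simp

lemma vc_linear [simp]: "vc (x + y) = vc x + vc y" "vc (x - y) = vc x - vc y" "vc (c \<cdot> x) = c * vc x" "vc 0 = 0"
  "vc (- x) = - vc x" "vc (vac V) = 1"
proof -
  show "vc (x + y) = vc x + vc y" by (rule vc_eqI) (simp add: vc vs.scale_left_distrib)
  show "vc (x - y) = vc x - vc y" by (rule vc_eqI) (simp add: vc vs.scale_left_diff_distrib)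
  show "vc (c \<cdot> x) = c * vc x" by (rule vc_eqI) (simp add: vc)
  show "vc 0 = 0" by (rule vc_eqI) simp
  show "vc (- x) = - vc x" by (rule vc_eqI) (simp add: vc)
  show "vc (vac V) = 1" by (rule vc_eqI) (use pr_wt[of "vac V" 0 0] in simp)
qed

lemma vc_wt: "wt x (int n) \<Longrightarrow> n > 0 \<Longrightarrow> vc x = 0"
  by (rule vc_eqI) (simp add: pr_wt)

lemma vc_F_1: "x \<in> F 1 \<Longrightarrow> vc x = 0"
  by (rule vc_eqI) (simp add: pr_F_1)

text \<open>Weights are nonnegative and add up in a normally ordered product, so only the two vacuum
  components meet in weight 0.\<close>

lemma vc_mult: "vc (x\<langle>-1\<rangle> y) = vc x * vc y"
proof -
  have "pr 0 (x\<langle>-1\<rangle> y) = pr 0 x\<langle>-1\<rangle> pr 0 y" using pr_mode[of 0 x 0 y] by simp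
  then have "pr 0 (x\<langle>-1\<rangle> y) = (vc x \<cdot> vac V)\<langle>-1\<rangle> (vc y \<cdot> vac V)" by (simp only: vc[of x] vc[of y])
  then show ?thesis by (intro vc_eqI) (simp add: vacuum)
qed

end

section \<open>The map Phi\<close>

context vertex_algebra
begin

lemma R_carrierE:
  assumes "x \<in> carrier (R_alg V)"
  obtains a where "x = rcl a"
  using assms by (auto simp: R_alg_simps)

lemma R_carrierI [simp]: "rcl a \<in> carrier (R_alg V)"
  by (simp add: R_alg_simps)

lemma R_calg: "calg (R_alg V)"
proof (intro calg.intro R_alg_cring calg_axioms.intro)
  show "\<And>x c. x \<in> carrier (R_alg V) \<Longrightarrow> c \<odot>\<^bsub>R_alg V\<^esub> x \<in> carrier (R_alg V)"
    by (elim R_carrierE) (simp add: R_alg_simps)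
  show "\<And>x c d. x \<in> carrier (R_alg V) \<Longrightarrow> (c + d) \<odot>\<^bsub>R_alg V\<^esub> x = c \<odot>\<^bsub>R_alg V\<^esub> x \<oplus>\<^bsub>R_alg V\<^esub> d \<odot>\<^bsub>R_alg V\<^esub> x"
    by (elim R_carrierE) (simp add: R_alg_simps vs.scale_left_distrib)
  show "\<And>x y c. x \<in> carrier (R_alg V) \<Longrightarrow> y \<in> carrier (R_alg V) \<Longrightarrow>
      c \<odot>\<^bsub>R_alg V\<^esub> (x \<oplus>\<^bsub>R_alg V\<^esub> y) = c \<odot>\<^bsub>R_alg V\<^esub> x \<oplus>\<^bsub>R_alg V\<^esub> c \<odot>\<^bsub>R_alg V\<^esub> y"
    by (elim R_carrierE) (simp add: R_alg_simps vs.scale_right_distrib)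
  show "\<And>x c d. x \<in> carrier (R_alg V) \<Longrightarrow> (c * d) \<odot>\<^bsub>R_alg V\<^esub> x = c \<odot>\<^bsub>R_alg V\<^esub> (d \<odot>\<^bsub>R_alg V\<^esub> x)"
    by (elim R_carrierE) (simp add: R_alg_simps)
  show "\<And>x. x \<in> carrier (R_alg V) \<Longrightarrow> 1 \<odot>\<^bsub>R_alg V\<^esub> x = x"
    by (elim R_carrierE) (simp add: R_alg_simps)
  show "\<And>x y c. x \<in> carrier (R_alg V) \<Longrightarrow> y \<in> carrier (R_alg V) \<Longrightarrow>
      (c \<odot>\<^bsub>R_alg V\<^esub> x) \<otimes>\<^bsub>R_alg V\<^esub> y = c \<odot>\<^bsub>R_alg V\<^esub> (x \<otimes>\<^bsub>R_alg V\<^esub> y)"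
    by (elim R_carrierE) (simp add: R_alg_simps)
qed

lemma conv_scale_left: "conv (\<lambda>p. c \<cdot> x p) y = (\<lambda>p. c \<cdot> conv x y p)"
  by (simp add: conv_def vs.scale_sum_right fun_eq_iff)

lemma shift_der_add: "shift_der (\<lambda>p. x p + y p) = (\<lambda>p. shift_der x p + shift_der y p)"
  and shift_der_scale: "shift_der (\<lambda>p. c \<cdot> x p) = (\<lambda>p. c \<cdot> shift_der x p)"
  by (auto simp: shift_der_def fun_eq_iff split: nat.split)

lemma gr_calg: "calg (gr_alg V)"
proof (intro calg.intro gr_cring calg_axioms.intro)
  show "\<And>x c. x \<in> carrier (gr_alg V) \<Longrightarrow> c \<odot>\<^bsub>gr_alg V\<^esub> x \<in> carrier (gr_alg V)"
    by (elim gr_carrierE) (simp only: gr_smult gr_carrierI gr_rep_scale)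
  show "\<And>x c d. x \<in> carrier (gr_alg V) \<Longrightarrow> (c + d) \<odot>\<^bsub>gr_alg V\<^esub> x = c \<odot>\<^bsub>gr_alg V\<^esub> x \<oplus>\<^bsub>gr_alg V\<^esub> d \<odot>\<^bsub>gr_alg V\<^esub> x"
    by (elim gr_carrierE) (simp only: gr_smult gr_add vs.scale_left_distrib)
  show "\<And>x y c. x \<in> carrier (gr_alg V) \<Longrightarrow> y \<in> carrier (gr_alg V) \<Longrightarrow>
      c \<odot>\<^bsub>gr_alg V\<^esub> (x \<oplus>\<^bsub>gr_alg V\<^esub> y) = c \<odot>\<^bsub>gr_alg V\<^esub> x \<oplus>\<^bsub>gr_alg V\<^esub> c \<odot>\<^bsub>gr_alg V\<^esub> y"
    by (elim gr_carrierE) (simp only: gr_smult gr_add vs.scale_right_distrib)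
  show "\<And>x c d. x \<in> carrier (gr_alg V) \<Longrightarrow> (c * d) \<odot>\<^bsub>gr_alg V\<^esub> x = c \<odot>\<^bsub>gr_alg V\<^esub> (d \<odot>\<^bsub>gr_alg V\<^esub> x)"
    by (elim gr_carrierE) (simp only: gr_smult vs.scale_scale)
  show "\<And>x. x \<in> carrier (gr_alg V) \<Longrightarrow> 1 \<odot>\<^bsub>gr_alg V\<^esub> x = x"
    by (elim gr_carrierE) (simp only: gr_smult vs.scale_one)
  show "\<And>x y c. x \<in> carrier (gr_alg V) \<Longrightarrow> y \<in> carrier (gr_alg V) \<Longrightarrow>
      (c \<odot>\<^bsub>gr_alg V\<^esub> x) \<otimes>\<^bsub>gr_alg V\<^esub> y = c \<odot>\<^bsub>gr_alg V\<^esub> (x \<otimes>\<^bsub>gr_alg V\<^esub> y)"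
    by (elim gr_carrierE) (simp only: gr_smult gr_mult gr_rep_scale conv_scale_left)
qed

lemma gr_diff_calg: "diff_calg (gr_alg V) (gr_der V)"
proof (intro diff_calg.intro gr_calg diff_calg_axioms.intro)
  show "\<And>x. x \<in> carrier (gr_alg V) \<Longrightarrow> gr_der V x \<in> carrier (gr_alg V)"
    by (elim gr_carrierE) (simp only: gr_der_gcl gr_carrierI gr_rep_shift_der)
  show "\<And>x y. x \<in> carrier (gr_alg V) \<Longrightarrow> y \<in> carrier (gr_alg V) \<Longrightarrow>
      gr_der V (x \<oplus>\<^bsub>gr_alg V\<^esub> y) = gr_der V x \<oplus>\<^bsub>gr_alg V\<^esub> gr_der V y"
    by (elim gr_carrierE) (simp only: gr_der_gcl gr_add shift_der_add)
  show "\<And>x y. x \<in> carrier (gr_alg V) \<Longrightarrow> y \<in> carrier (gr_alg V) \<Longrightarrow>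
      gr_der V (x \<otimes>\<^bsub>gr_alg V\<^esub> y) = gr_der V x \<otimes>\<^bsub>gr_alg V\<^esub> y \<oplus>\<^bsub>gr_alg V\<^esub> x \<otimes>\<^bsub>gr_alg V\<^esub> gr_der V y"
    by (elim gr_carrierE) (simp only: gr_der_gcl gr_add gr_mult gr_rep_shift_der shift_der_conv)
  show "\<And>x c. x \<in> carrier (gr_alg V) \<Longrightarrow> gr_der V (c \<odot>\<^bsub>gr_alg V\<^esub> x) = c \<odot>\<^bsub>gr_alg V\<^esub> gr_der V x"
    by (elim gr_carrierE) (simp only: gr_der_gcl gr_smult shift_der_scale)
qed

lemma R_in_gr_hom: "R_in_gr V \<in> alg_hom (R_alg V) (gr_alg V)"
proof -
  have "R_in_gr V \<in> ring_hom (R_alg V) (gr_alg V)"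
  proof (rule ring_hom_memI)
    show "\<And>x. x \<in> carrier (R_alg V) \<Longrightarrow> R_in_gr V x \<in> carrier (gr_alg V)"
      by (elim R_carrierE) (simp only: R_in_gr_rcl gr_carrierI gr_rep_conc F_0)
    show "\<And>x y. x \<in> carrier (R_alg V) \<Longrightarrow> y \<in> carrier (R_alg V) \<Longrightarrow>
        R_in_gr V (x \<otimes>\<^bsub>R_alg V\<^esub> y) = R_in_gr V x \<otimes>\<^bsub>gr_alg V\<^esub> R_in_gr V y"
      by (elim R_carrierE) (simp only: R_alg_simps R_in_gr_rcl gr_mult_conc[OF F_0 F_0] add_0_right)
    show "\<And>x y. x \<in> carrier (R_alg V) \<Longrightarrow> y \<in> carrier (R_alg V) \<Longrightarrow>
        R_in_gr V (x \<oplus>\<^bsub>R_alg V\<^esub> y) = R_in_gr V x \<oplus>\<^bsub>gr_alg V\<^esub> R_in_gr V y"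
      by (elim R_carrierE) (simp only: R_alg_simps R_in_gr_rcl gr_add_conc)
    show "R_in_gr V \<one>\<^bsub>R_alg V\<^esub> = \<one>\<^bsub>gr_alg V\<^esub>"
      by (simp only: R_alg_simps R_in_gr_rcl gr_one)
  qed
  moreover have "R_in_gr V (c \<odot>\<^bsub>R_alg V\<^esub> x) = c \<odot>\<^bsub>gr_alg V\<^esub> R_in_gr V x" if "x \<in> carrier (R_alg V)" for c x
    using that by (elim R_carrierE) (simp only: R_alg_simps R_in_gr_rcl gr_smult_conc)
  ultimately show ?thesis by (simp add: alg_hom_def)
qed

lemma R_in_gr_zero: "R_in_gr V \<zero>\<^bsub>R_alg V\<^esub> = \<zero>\<^bsub>gr_alg V\<^esub>"
  by (simp only: R_alg_simps R_in_gr_rcl gcl_conc_eq_zero[OF F_0I])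

lemma gr_component_iff: "\<xi> \<in> gr_component V n \<longleftrightarrow> (\<exists>a\<in>F n. \<xi> = gcl (conc n a))"
proof
  assume \<xi>: "\<xi> \<in> gr_component V n"
  then obtain x where x: "gr_rep x" "\<xi> = gcl x" unfolding gr_component_def by (auto elim: gr_carrierE)
  have "gcl x p = F (Suc p)" if "p \<noteq> n" for p using \<xi> that x(2) by (simp add: gr_component_def)
  then have "x p \<in> F (Suc p)" if "p \<noteq> n" for p
    using that coset_eq_iff[of "x p" "Suc p" 0] by (simp add: gcl_def coset_zero)
  then have "gcl x = gcl (conc n (x n))" by (intro gcl_eqI) (simp add: conc_def)
  then show "\<exists>a\<in>F n. \<xi> = gcl (conc n a)" using x gr_repD by blast
next
  assume "\<exists>a\<in>F n. \<xi> = gcl (conc n a)"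
  then obtain a where a: "a \<in> F n" "\<xi> = gcl (conc n a)" by blast
  have "gcl (conc n a) p = F (Suc p)" if "p \<noteq> n" for p using that by (simp add: gcl_def conc_def coset_zero)
  then show "\<xi> \<in> gr_component V n"
    unfolding gr_component_def a(2) using gr_carrierI[OF gr_rep_conc[OF a(1)]] by blast
qed

lemma gr_component_zero: "\<zero>\<^bsub>gr_alg V\<^esub> \<in> gr_component V n"
  unfolding gr_component_iff using gcl_conc_eq_zero[OF F_0I, of n] by (metis F_0I)

lemma gr_component_add: "\<xi> \<in> gr_component V n \<Longrightarrow> \<eta> \<in> gr_component V n \<Longrightarrow> \<xi> \<oplus>\<^bsub>gr_alg V\<^esub> \<eta> \<in> gr_component V n"
  unfolding gr_component_iff by (elim bexE) (auto simp: gr_add_conc intro: F_add)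

lemma gr_component_smult: "\<xi> \<in> gr_component V n \<Longrightarrow> c \<odot>\<^bsub>gr_alg V\<^esub> \<xi> \<in> gr_component V n"
  unfolding gr_component_iff by (elim bexE) (auto simp: gr_smult_conc intro: F_scale)

lemma gr_component_mult:
  "\<xi> \<in> gr_component V n \<Longrightarrow> \<eta> \<in> gr_component V m \<Longrightarrow> \<xi> \<otimes>\<^bsub>gr_alg V\<^esub> \<eta> \<in> gr_component V (n + m)"
  unfolding gr_component_iff by (elim bexE) (auto simp: gr_mult_conc intro: F_mult)

lemma gr_component_one: "\<one>\<^bsub>gr_alg V\<^esub> \<in> gr_component V 0"
  unfolding gr_component_iff gr_one by (rule bexI[of _ "vac V"]) simp_all

lemma F_T_pow: "(T ^^ k) a \<in> F k"
  by (induction k) (auto intro: F_T)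

lemma presentation_arc_target:
  "presentation r Fs \<psi> (R_alg V) \<Longrightarrow> arc_target r Fs (gr_alg V) (gr_der V) \<psi> (R_alg V) (R_in_gr V)"
  by (intro arc_target.intro arc_presentation.intro gr_diff_calg arc_target_axioms.intro R_in_gr_hom R_in_gr_zero)
    (rule presentation_presented)

lemma arc_lift_surj:
  assumes pres: "presentation r Fs \<psi> (R_alg V)"
  shows "arc_target.arc_lift r Fs (gr_alg V) (gr_der V) \<psi> (R_in_gr V) ` carrier (arc_alg r Fs) = carrier (gr_alg V)"
proof -
  interpret A: arc_target r Fs "gr_alg V" "gr_der V" \<psi> "R_alg V" "R_in_gr V" by (rule presentation_arc_target[OF pres])
  interpret C: diff_calg "arc_alg r Fs" "arc_der r Fs" by (rule A.arc_diff_calg)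
  note hom = alg_homD[OF A.arc_lift_hom]
  show ?thesis
  proof (rule gr_generated)
    show "A.arc_lift ` carrier (arc_alg r Fs) \<subseteq> carrier (gr_alg V)" using hom(1) by blast
    fix a
    have "\<psi> ` carrier (base_alg r) = carrier (R_alg V)" using pres by (simp add: presentation_def)
    then have "rcl a \<in> \<psi> ` {p. in_vars ({..<r} \<times> {0}) p}" by (simp add: carrier_poly_alg)
    then obtain p where p: "in_vars ({..<r} \<times> {0}) p" "\<psi> p = rcl a" by blast
    have "A.arc_lift (A.cls p) = gcl (conc 0 a)" using A.arc_lift_base[OF p(1)] by (simp only: p(2) R_in_gr_rcl)
    moreover have "A.cls p \<in> carrier (arc_alg r Fs)"
      unfolding A.arc_alg_Q by (rule A.Q_carrierI[OF base_in_jet[OF p(1)]])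
    ultimately show "gcl (conc 0 a) \<in> A.arc_lift ` carrier (arc_alg r Fs)" by (metis imageI)
  next
    fix x y assume "x \<in> A.arc_lift ` carrier (arc_alg r Fs)" "y \<in> A.arc_lift ` carrier (arc_alg r Fs)"
    then obtain u v where uv: "u \<in> carrier (arc_alg r Fs)" "v \<in> carrier (arc_alg r Fs)" "x = A.arc_lift u" "y = A.arc_lift v"
      by blast
    show "x \<oplus>\<^bsub>gr_alg V\<^esub> y \<in> A.arc_lift ` carrier (arc_alg r Fs)"
      unfolding uv(3,4) hom(3)[OF uv(1,2), symmetric] using uv by (intro imageI C.a_closed)
    show "x \<otimes>\<^bsub>gr_alg V\<^esub> y \<in> A.arc_lift ` carrier (arc_alg r Fs)"
      unfolding uv(3,4) hom(2)[OF uv(1,2), symmetric] using uv by (intro imageI C.m_closed)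
  next
    fix c x assume "x \<in> A.arc_lift ` carrier (arc_alg r Fs)"
    then obtain u where u: "u \<in> carrier (arc_alg r Fs)" "x = A.arc_lift u" by blast
    show "c \<odot>\<^bsub>gr_alg V\<^esub> x \<in> A.arc_lift ` carrier (arc_alg r Fs)"
      unfolding u(2) hom(5)[OF u(1), symmetric] using u by (intro imageI C.smult_closed)
  next
    fix x assume "x \<in> A.arc_lift ` carrier (arc_alg r Fs)"
    then obtain u where u: "u \<in> carrier (arc_alg r Fs)" "x = A.arc_lift u" by blast
    show "gr_der V x \<in> A.arc_lift ` carrier (arc_alg r Fs)"
      unfolding u(2) A.arc_lift_der[OF u(1), symmetric] using u by (intro imageI C.\<delta>_closed)
  qed
qed

text \<open>A jet of order i has degree i in gr, so a monomial lands in the degree given by its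
  height.\<close>

lemma arc_lift_component:
  assumes pres: "presentation r Fs \<psi> (R_alg V)"
  shows "arc_target.arc_lift r Fs (gr_alg V) (gr_der V) \<psi> (R_in_gr V) ` arc_component r Fs n \<subseteq> gr_component V n"
proof -
  interpret A: arc_target r Fs "gr_alg V" "gr_der V" \<psi> "R_alg V" "R_in_gr V" by (rule presentation_arc_target[OF pres])
  interpret R: calg "R_alg V" by (rule R_calg)
  have start: "\<exists>a. (if j < r then R_in_gr V (\<psi> (pvar (j, 0))) else \<zero>\<^bsub>gr_alg V\<^esub>) = gcl (conc 0 a)" for j
  proof (cases "j < r")
    case True
    then have "\<psi> (pvar (j, 0)) \<in> carrier (R_alg V)"
      by (intro alg_homD(1)[OF A.\<psi>_hom]) (simp add: poly_carrier in_vars_pvar)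
    then obtain a where "\<psi> (pvar (j, 0)) = rcl a" by (rule R_carrierE)
    then show ?thesis using True by (auto simp: R_in_gr_rcl)
  next
    case False
    then show ?thesis using gcl_conc_eq_zero[OF F_0I, of 0] by (intro exI[of _ 0]) simp
  qed
  have jet: "A.jet_values (j, i) \<in> gr_component V i" for j i
  proof -
    obtain a where a: "(if j < r then R_in_gr V (\<psi> (pvar (j, 0))) else \<zero>\<^bsub>gr_alg V\<^esub>) = gcl (conc 0 a)" using start by blast
    have "A.jet_values (j, i) = gcl (conc i ((T ^^ i) a))"
      unfolding A.jet_values_def A.B.jets_apply a gr_der_pow_conc by simp
    then show ?thesis unfolding gr_component_iff using F_T_pow by blast
  qed
  have pow: "A.jet_values v [^]\<^bsub>gr_alg V\<^esub> (e::nat) \<in> gr_component V (snd v * e)" for v e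
  proof (induction e)
    case (Suc e)
    have "A.jet_values v \<in> gr_component V (snd v)" using jet[of "fst v" "snd v"] by simp
    from gr_component_mult[OF Suc this] show ?case by (simp add: algebra_simps)
  qed (simp add: gr_component_one)
  have mon: "A.B.mon_eval A.jet_values m \<in> gr_component V (jet_height m)" for m
  proof -
    have "(\<Otimes>\<^bsub>gr_alg V\<^esub>v\<in>S. A.jet_values v [^]\<^bsub>gr_alg V\<^esub> lk m v) \<in> gr_component V (\<Sum>v\<in>S. snd v * lk m v)" if "finite S" for S
      using that
    proof induction
      case (insert v S)
      have "(\<Otimes>\<^bsub>gr_alg V\<^esub>v\<in>insert v S. A.jet_values v [^]\<^bsub>gr_alg V\<^esub> lk m v) =
          A.jet_values v [^]\<^bsub>gr_alg V\<^esub> lk m v \<otimes>\<^bsub>gr_alg V\<^esub> (\<Otimes>\<^bsub>gr_alg V\<^esub>v\<in>S. A.jet_values v [^]\<^bsub>gr_alg V\<^esub> lk m v)"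
        by (rule A.B.finprod_insert) (use insert A.jet_values_closed in auto)
      then show ?case using gr_component_mult[OF pow[of v "lk m v"] insert.IH] insert.hyps by simp
    qed (simp add: gr_component_one)
    from this[OF finite_keys, of m] show ?thesis
      unfolding A.B.mon_eval_def jet_height_def by (simp add: case_prod_unfold)
  qed
  show ?thesis
  proof
    fix \<xi> assume "\<xi> \<in> A.arc_lift ` arc_component r Fs n"
    then obtain p where p: "in_vars ({..<r} \<times> UNIV) p" "\<forall>m\<in>ks p. jet_height m = n" "\<xi> = A.arc_lift (A.cls p)"
      unfolding arc_component_def A.arc_class_cls by (auto simp: poly_carrier)
    have "(\<Oplus>\<^bsub>gr_alg V\<^esub>m\<in>S. lk p m \<odot>\<^bsub>gr_alg V\<^esub> A.B.mon_eval A.jet_values m) \<in> gr_component V n" if "finite S" "S \<subseteq> ks p" for S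
      using that
    proof induction
      case (insert m S)
      have cl: "lk p m \<odot>\<^bsub>gr_alg V\<^esub> A.B.mon_eval A.jet_values m \<in> carrier (gr_alg V)" for m
        by (intro A.B.smult_closed A.B.mon_eval_closed A.jet_values_closed)
      have "(\<Oplus>\<^bsub>gr_alg V\<^esub>m\<in>insert m S. lk p m \<odot>\<^bsub>gr_alg V\<^esub> A.B.mon_eval A.jet_values m) =
          lk p m \<odot>\<^bsub>gr_alg V\<^esub> A.B.mon_eval A.jet_values m \<oplus>\<^bsub>gr_alg V\<^esub> (\<Oplus>\<^bsub>gr_alg V\<^esub>m\<in>S. lk p m \<odot>\<^bsub>gr_alg V\<^esub> A.B.mon_eval A.jet_values m)"
        by (rule A.B.finsum_insert) (use insert cl in auto)
      moreover have "A.B.mon_eval A.jet_values m \<in> gr_component V n" using mon[of m] p(2) insert.prems by simp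
      ultimately show ?case using gr_component_add[OF gr_component_smult insert.IH] insert.prems by simp
    qed (simp add: gr_component_zero)
    from this[OF finite_keys, of p] show "\<xi> \<in> gr_component V n"
      unfolding p(3) A.arc_lift_cls[OF p(1)] A.B.poly_eval_def by simp
  qed
qed

text \<open>The definite description is satisfied by the universal lift, and
  \<open>arc_hom_unique\<close> shows that nothing else satisfies it.\<close>

lemma Phi_eq_arc_lift:
  assumes pres: "presentation r Fs \<psi> (R_alg V)"
  shows "Phi V r Fs \<psi> = arc_target.arc_lift r Fs (gr_alg V) (gr_der V) \<psi> (R_in_gr V)"
proof -
  interpret A: arc_target r Fs "gr_alg V" "gr_der V" \<psi> "R_alg V" "R_in_gr V" by (rule presentation_arc_target[OF pres])
  show ?thesis
    unfolding Phi_def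
  proof (rule the_equality)
    show "A.arc_lift \<in> extensional (carrier (arc_alg r Fs)) \<and>
        A.arc_lift \<in> alg_hom (arc_alg r Fs) (gr_alg V) \<and>
        A.arc_lift ` carrier (arc_alg r Fs) = carrier (gr_alg V) \<and>
        (\<forall>X\<in>carrier (arc_alg r Fs). A.arc_lift (arc_der r Fs X) = gr_der V (A.arc_lift X)) \<and>
        (\<forall>n. A.arc_lift ` arc_component r Fs n \<subseteq> gr_component V n) \<and>
        (\<forall>p\<in>carrier (base_alg r). A.arc_lift (arc_class r Fs p) = R_in_gr V (\<psi> p))"
    proof (intro conjI allI ballI)
      show "A.arc_lift \<in> extensional (carrier (arc_alg r Fs))" unfolding A.arc_lift_def by (rule restrict_extensional)
      show "A.arc_lift (arc_class r Fs p) = R_in_gr V (\<psi> p)" if "p \<in> carrier (base_alg r)" for p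
        using that by (simp only: A.arc_class_cls poly_carrier A.arc_lift_base)
    qed (rule A.arc_lift_hom arc_lift_surj[OF pres] A.arc_lift_der arc_lift_component[OF pres], assumption?)+
    fix \<Phi> assume \<Phi>: "\<Phi> \<in> extensional (carrier (arc_alg r Fs)) \<and>
        \<Phi> \<in> alg_hom (arc_alg r Fs) (gr_alg V) \<and>
        \<Phi> ` carrier (arc_alg r Fs) = carrier (gr_alg V) \<and>
        (\<forall>X\<in>carrier (arc_alg r Fs). \<Phi> (arc_der r Fs X) = gr_der V (\<Phi> X)) \<and>
        (\<forall>n. \<Phi> ` arc_component r Fs n \<subseteq> gr_component V n) \<and>
        (\<forall>p\<in>carrier (base_alg r). \<Phi> (arc_class r Fs p) = R_in_gr V (\<psi> p))"
    show "\<Phi> = A.arc_lift"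
    proof (rule extensionalityI)
      show "\<Phi> \<in> extensional (carrier (arc_alg r Fs))" using \<Phi> by simp
      show "A.arc_lift \<in> extensional (carrier (arc_alg r Fs))" unfolding A.arc_lift_def by (rule restrict_extensional)
      fix x assume x: "x \<in> carrier (arc_alg r Fs)"
      show "\<Phi> x = A.arc_lift x"
      proof (rule A.arc_hom_unique[OF gr_diff_calg _ _ A.arc_lift_hom A.arc_lift_der _ x])
        show "\<Phi> \<in> alg_hom (arc_alg r Fs) (gr_alg V)" using \<Phi> by simp
        show "\<Phi> (arc_der r Fs x) = gr_der V (\<Phi> x)" if "x \<in> carrier (arc_alg r Fs)" for x using \<Phi> that by simp
        fix j assume "j < r"
        then have "in_vars ({..<r} \<times> {0}) (pvar (j, 0))" by (intro in_vars_pvar) simp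
        then show "\<Phi> (A.cls (pvar (j, 0))) = A.arc_lift (A.cls (pvar (j, 0)))"
          using \<Phi> by (simp add: A.arc_lift_base poly_carrier A.arc_class_cls)
      qed
    qed
  qed
qed

lemma Phi_inj_ring_iso:
  assumes pres: "presentation r Fs \<psi> (R_alg V)" and inj: "inj_on (Phi V r Fs \<psi>) (carrier (arc_alg r Fs))"
  shows "Phi V r Fs \<psi> \<in> ring_iso (arc_alg r Fs) (gr_alg V)"
proof -
  interpret A: arc_target r Fs "gr_alg V" "gr_der V" \<psi> "R_alg V" "R_in_gr V" by (rule presentation_arc_target[OF pres])
  have "Phi V r Fs \<psi> \<in> ring_hom (arc_alg r Fs) (gr_alg V)"
    using A.arc_lift_hom by (simp add: Phi_eq_arc_lift[OF pres] alg_hom_def)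
  then show ?thesis
    using inj arc_lift_surj[OF pres] by (simp add: ring_iso_def bij_betw_def Phi_eq_arc_lift[OF pres])
qed

end

section \<open>Point derivations\<close>

locale augmented_algebra = calg B for B :: "(complex, 'b) module" (structure) +
  fixes \<epsilon> :: "'b \<Rightarrow> complex"
  assumes \<epsilon>_add: "x \<in> carrier B \<Longrightarrow> y \<in> carrier B \<Longrightarrow> \<epsilon> (x \<oplus> y) = \<epsilon> x + \<epsilon> y"
    and \<epsilon>_mult: "x \<in> carrier B \<Longrightarrow> y \<in> carrier B \<Longrightarrow> \<epsilon> (x \<otimes> y) = \<epsilon> x * \<epsilon> y"
    and \<epsilon>_smult: "x \<in> carrier B \<Longrightarrow> \<epsilon> (c \<odot> x) = c * \<epsilon> x"
    and \<epsilon>_one [simp]: "\<epsilon> \<one> = 1"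
begin

definition aug :: "'b set" where
  "aug = {x \<in> carrier B. \<epsilon> x = 0}"

text \<open>Tangent vectors at the point \<open>aug\<close>, again only additive. They vanish on the
  square of \<open>aug\<close>, so they can be composed with a derivation modulo that
  square.\<close>

definition point_derivation :: "('b \<Rightarrow> complex) \<Rightarrow> bool" where
  "point_derivation \<chi> \<longleftrightarrow> (\<forall>x\<in>carrier B. \<forall>y\<in>carrier B.
     \<chi> (x \<oplus> y) = \<chi> x + \<chi> y \<and> \<chi> (x \<otimes> y) = \<epsilon> x * \<chi> y + \<epsilon> y * \<chi> x)"

lemma additive_minus:
  assumes add: "\<And>x y. x \<in> carrier B \<Longrightarrow> y \<in> carrier B \<Longrightarrow> \<chi> (x \<oplus> y) = \<chi> x + (\<chi> y :: complex)"
  shows "\<chi> \<zero> = 0" "x \<in> carrier B \<Longrightarrow> \<chi> (\<ominus> x) = - \<chi> x" "x \<in> carrier B \<Longrightarrow> y \<in> carrier B \<Longrightarrow> \<chi> (x \<ominus> y) = \<chi> x - \<chi> y"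
proof -
  show z: "\<chi> \<zero> = 0" using add[of \<zero> \<zero>] by simp
  show m: "\<chi> (\<ominus> x) = - \<chi> x" if "x \<in> carrier B" for x
    using add[of "\<ominus> x" x] that z by (simp add: l_neg eq_neg_iff_add_eq_0)
  show "\<chi> (x \<ominus> y) = \<chi> x - \<chi> y" if "x \<in> carrier B" "y \<in> carrier B"
    using that by (simp add: a_minus_def add m)
qed

lemmas \<epsilon>_zero [simp] = additive_minus(1)[OF \<epsilon>_add] and \<epsilon>_neg = additive_minus(2)[OF \<epsilon>_add]

text \<open>The zero map gives the augmentation ideal itself, a point derivation an ideal containing
  its square.\<close>

lemma ideal_aug_kernel:
  assumes "\<And>x y. x \<in> carrier B \<Longrightarrow> y \<in> carrier B \<Longrightarrow> \<chi> (x \<oplus> y) = \<chi> x + (\<chi> y :: complex)"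
    and "\<And>x y. x \<in> carrier B \<Longrightarrow> y \<in> carrier B \<Longrightarrow> \<chi> (x \<otimes> y) = \<epsilon> x * \<chi> y + \<epsilon> y * \<chi> x"
  shows "ideal {x \<in> aug. \<chi> x = 0} B"
proof (rule idealI)
  show "subgroup {x \<in> aug. \<chi> x = 0} (add_monoid B)"
  proof
    fix x assume "x \<in> {x \<in> aug. \<chi> x = 0}"
    then show "inv\<^bsub>add_monoid B\<^esub> x \<in> {x \<in> aug. \<chi> x = 0}"
      by (simp add: aug_def \<epsilon>_neg additive_minus(2)[OF assms(1)] flip: a_inv_def)
  qed (auto simp: aug_def \<epsilon>_add assms(1) additive_minus(1)[OF assms(1)])
qed (auto simp: aug_def \<epsilon>_mult assms(2) ring_axioms)

lemma aug_ideal: "ideal aug B"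
  using ideal_aug_kernel[of "\<lambda>_. 0"] by simp

lemma aug_maximal: "maximalideal aug B"
proof (rule maximalidealI[OF aug_ideal])
  show "carrier B \<noteq> aug"
  proof
    assume "carrier B = aug"
    then have "\<one> \<in> aug" using one_closed by simp
    then show False by (simp add: aug_def)
  qed
  fix J assume J: "ideal J B" "aug \<subseteq> J" "J \<subseteq> carrier B"
  interpret J: ideal J B by (rule J(1))
  show "J = aug \<or> J = carrier B"
  proof (cases "J \<subseteq> aug")
    case False
    then obtain x where x: "x \<in> J" "x \<notin> aug" by blast
    then have xc: "x \<in> carrier B" "\<epsilon> x \<noteq> 0" using J(3) by (auto simp: aug_def)
    let ?y = "((1 / \<epsilon> x) \<odot> \<one>) \<otimes> x"
    have y: "?y \<in> J" using x xc by (intro J.I_l_closed) auto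
    have "\<one> \<ominus> ?y \<in> aug" using xc by (simp add: aug_def additive_minus(3)[OF \<epsilon>_add] \<epsilon>_mult \<epsilon>_smult)
    then have "(\<one> \<ominus> ?y) \<oplus> ?y \<in> J" using J(2) y additive_subgroup.a_closed[OF J.is_additive_subgroup] by blast
    moreover have "(\<one> \<ominus> ?y) \<oplus> ?y = \<one>" using xc by (simp add: a_minus_def a_assoc l_neg)
    ultimately show ?thesis using J.one_imp_carrier by simp
  qed (use J in blast)
qed

lemma square_subset:
  assumes \<chi>: "point_derivation \<chi>" and x: "x \<in> square_ideal B aug"
  shows "\<chi> x = 0" "\<epsilon> x = 0"
proof -
  have "square_ideal B aug \<subseteq> {x \<in> aug. \<chi> x = 0}"
    by (rule square_ideal_subset[OF ring_axioms ideal_aug_kernel])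
      (use \<chi> in \<open>auto simp: point_derivation_def aug_def \<epsilon>_mult\<close>)
  then show "\<chi> x = 0" "\<epsilon> x = 0" using x by (auto simp: aug_def)
qed

context
  fixes d
  assumes d: "derivation_mod_square B aug d"
begin

lemma d_closed: "x \<in> carrier B \<Longrightarrow> d x \<in> carrier B"
  using d by (auto simp: derivation_mod_square_def)

text \<open>The errors of \<open>d\<close> lie in the square of \<open>aug\<close>, which
  \<open>\<chi>\<close> and \<open>\<epsilon>\<close> kill, so the compositions obey exact rules.
  For x, y in \<open>aug\<close> only \<epsilon>(d x) \<chi>(y) + \<epsilon>(d y) \<chi>(x) remains
  of the third one.\<close>

lemma point_derivation_d:
  assumes \<chi>: "point_derivation \<chi>" and xy: "x \<in> carrier B" "y \<in> carrier B"
  shows "\<chi> (d (x \<oplus> y)) = \<chi> (d x) + \<chi> (d y)" "\<epsilon> (d (x \<oplus> y)) = \<epsilon> (d x) + \<epsilon> (d y)"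
    "\<chi> (d (x \<otimes> y)) = \<epsilon> (d x) * \<chi> y + \<epsilon> y * \<chi> (d x) + \<epsilon> x * \<chi> (d y) + \<epsilon> (d y) * \<chi> x"
    "\<epsilon> (d (x \<otimes> y)) = \<epsilon> x * \<epsilon> (d y) + \<epsilon> y * \<epsilon> (d x)"
proof -
  have \<chi>_add: "\<chi> (x \<oplus> y) = \<chi> x + \<chi> y" and \<chi>_mult: "\<chi> (x \<otimes> y) = \<epsilon> x * \<chi> y + \<epsilon> y * \<chi> x"
    if "x \<in> carrier B" "y \<in> carrier B" for x y using \<chi> that by (auto simp: point_derivation_def)
  have 1: "d (x \<oplus> y) \<ominus> (d x \<oplus> d y) \<in> square_ideal B aug"
    and 2: "d (x \<otimes> y) \<ominus> (d x \<otimes> y \<oplus> x \<otimes> d y) \<in> square_ideal B aug"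
    using d xy by (auto simp: derivation_mod_square_def)
  have cl: "d x \<in> carrier B" "d y \<in> carrier B" "d (x \<oplus> y) \<in> carrier B" "d (x \<otimes> y) \<in> carrier B"
    using xy by (auto intro: d_closed)
  show "\<chi> (d (x \<oplus> y)) = \<chi> (d x) + \<chi> (d y)"
    using square_subset(1)[OF \<chi> 1] cl by (simp add: additive_minus(3)[OF \<chi>_add] \<chi>_add)
  show "\<epsilon> (d (x \<oplus> y)) = \<epsilon> (d x) + \<epsilon> (d y)"
    using square_subset(2)[OF \<chi> 1] cl by (simp add: additive_minus(3)[OF \<epsilon>_add] \<epsilon>_add)
  show "\<chi> (d (x \<otimes> y)) = \<epsilon> (d x) * \<chi> y + \<epsilon> y * \<chi> (d x) + \<epsilon> x * \<chi> (d y) + \<epsilon> (d y) * \<chi> x"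
    using square_subset(1)[OF \<chi> 2] cl xy by (simp add: additive_minus(3)[OF \<chi>_add] \<chi>_add \<chi>_mult)
  show "\<epsilon> (d (x \<otimes> y)) = \<epsilon> x * \<epsilon> (d y) + \<epsilon> y * \<epsilon> (d x)"
    using square_subset(2)[OF \<chi> 2] cl xy by (simp add: additive_minus(3)[OF \<epsilon>_add] \<epsilon>_add \<epsilon>_mult)
qed

lemma point_derivation_zero: "point_derivation (\<lambda>_. 0)"
  by (simp add: point_derivation_def)

text \<open>\<open>\<epsilon> \<circ> d\<close> is itself a point derivation, so it vanishes on the augmentation ideal once it vanishes
  on algebra generators there.\<close>

lemma d_aug_subset:
  assumes g: "\<And>v. g v \<in> aug" and gen: "\<And>x. x \<in> carrier B \<Longrightarrow> \<exists>p. in_vars X p \<and> x = poly_eval g p"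
    and dg: "\<And>v. v \<in> X \<Longrightarrow> \<epsilon> (d (g v)) = 0"
  shows "d ` aug \<subseteq> aug"
proof -
  have gc: "g v \<in> carrier B" for v using g by (auto simp: aug_def)
  note D = point_derivation_d[OF point_derivation_zero]
  let ?N = "{x \<in> aug. \<epsilon> (d x) = 0}"
  have N: "ideal ?N B" by (rule ideal_aug_kernel) (simp_all add: D)
  have N_add: "x \<oplus> y \<in> ?N" if "x \<in> ?N" "y \<in> ?N" for x y
    using additive_subgroup.a_closed[OF ideal.axioms(1)[OF N] that] .
  \<comment> \<open>Since \<open>d\<close> is not linear over the complex numbers, its value on c 1
    is unknown; the constant is therefore split off, and for elements of \<open>aug\<close> it is
    0.\<close>
  have "\<exists>c. \<exists>n\<in>?N. poly_eval g p = c \<odot> \<one> \<oplus> n" if "in_vars X p" for p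
    using that
  proof (induction rule: in_vars_induct)
    case (const c)
    have "poly_eval g (pconst c) = c \<odot> \<one> \<oplus> \<zero>" by (simp add: poly_eval_pconst[OF gc])
    then show ?case using additive_subgroup.zero_closed[OF ideal.axioms(1)[OF N]] by blast
  next
    case (var v)
    have "poly_eval g (pvar v) = 0 \<odot> \<one> \<oplus> g v" by (simp add: poly_eval_pvar[OF gc] gc)
    then show ?case using g dg[OF var] by blast
  next
    case (add p q)
    then obtain c m e n where 1: "m \<in> ?N" "poly_eval g p = c \<odot> \<one> \<oplus> m" "n \<in> ?N" "poly_eval g q = e \<odot> \<one> \<oplus> n" by blast
    have mn: "m \<in> carrier B" "n \<in> carrier B" using 1 by (auto simp: aug_def)
    have "poly_eval g (p + q) = (c + e) \<odot> \<one> \<oplus> (m \<oplus> n)"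
      using mn by (simp add: poly_eval_add[OF gc] 1 smult_l_distr a_ac)
    then show ?case using N_add[OF 1(1,3)] by blast
  next
    case (mult p q)
    then obtain c m e n where 1: "m \<in> ?N" "poly_eval g p = c \<odot> \<one> \<oplus> m" "n \<in> ?N" "poly_eval g q = e \<odot> \<one> \<oplus> n" by blast
    have mn: "m \<in> carrier B" "n \<in> carrier B" using 1 by (auto simp: aug_def)
    have "(c \<odot> \<one> \<oplus> m) \<otimes> (e \<odot> \<one> \<oplus> n) = (c \<odot> \<one>) \<otimes> (e \<odot> \<one>) \<oplus> ((c \<odot> \<one>) \<otimes> n \<oplus> (e \<odot> \<one> \<oplus> n) \<otimes> m)"
      using mn by (simp add: l_distr r_distr m_ac a_ac)
    moreover have "(c \<odot> \<one>) \<otimes> (e \<odot> \<one>) = (c * e) \<odot> \<one>" by (simp add: smult_smult_mult)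
    ultimately have "poly_eval g (p * q) = (c * e) \<odot> \<one> \<oplus> ((c \<odot> \<one>) \<otimes> n \<oplus> (e \<odot> \<one> \<oplus> n) \<otimes> m)"
      by (simp only: poly_eval_mult[OF gc] 1(2,4))
    moreover have "(c \<odot> \<one>) \<otimes> n \<oplus> (e \<odot> \<one> \<oplus> n) \<otimes> m \<in> ?N"
    proof (rule N_add)
      show "(c \<odot> \<one>) \<otimes> n \<in> ?N" by (rule ideal.I_l_closed[OF N 1(3)]) simp
      show "(e \<odot> \<one> \<oplus> n) \<otimes> m \<in> ?N" by (rule ideal.I_l_closed[OF N 1(1)]) (use mn in simp)
    qed
    ultimately show ?case by blast
  qed
  note decomp = this
  show ?thesis
  proof
    fix y assume "y \<in> d ` aug"
    then obtain x where x: "x \<in> aug" "y = d x" by blast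
    then have xc: "x \<in> carrier B" "\<epsilon> x = 0" by (auto simp: aug_def)
    then obtain p where "in_vars X p" "x = poly_eval g p" using gen by blast
    then obtain c n where n: "n \<in> ?N" "x = c \<odot> \<one> \<oplus> n" using decomp by blast
    have nc: "n \<in> carrier B" "\<epsilon> n = 0" using n(1) by (auto simp: aug_def)
    have "c = 0" using xc(2) nc by (simp add: n(2) \<epsilon>_add \<epsilon>_smult)
    then have "x = n" using n(2) nc by simp
    then show "y \<in> aug" using n(1) x xc by (auto simp: aug_def d_closed)
  qed
qed

end

end

section \<open>The singular support has a rigid point\<close>

context vertex_algebra
begin

text \<open>An additive functional on the vertex algebra that kills F^(p+1) descends to the degree p
  part of gr; the value is then the same for every representative.\<close>

definition gr_functional :: "('v \<Rightarrow> complex) \<Rightarrow> nat \<Rightarrow> (nat \<Rightarrow> 'v set) \<Rightarrow> complex" where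
  "gr_functional \<phi> p \<xi> = \<phi> (SOME a. a \<in> \<xi> p)"

lemma gr_functional_gcl:
  assumes add: "\<And>a b. \<phi> (a + b) = \<phi> a + \<phi> b" and zero: "\<And>a. a \<in> F (Suc p) \<Longrightarrow> \<phi> a = 0"
  shows "gr_functional \<phi> p (gcl x) = \<phi> (x p)"
proof -
  have "x p \<in> gcl x p" by (simp add: gcl_def coset_iff)
  then have "(SOME a. a \<in> gcl x p) \<in> gcl x p" by (rule someI)
  then have "(SOME a. a \<in> gcl x p) - x p \<in> F (Suc p)" by (simp add: gcl_def coset_iff)
  then show ?thesis using zero add[of "(SOME a. a \<in> gcl x p) - x p" "x p"] by (simp add: gr_functional_def)
qed

lemma normal_product_T_pow: "(T ^^ n) (a\<langle>-1\<rangle> b) = (\<Sum>i\<le>n. of_nat (n choose i) \<cdot> ((T ^^ i) a)\<langle>-1\<rangle> ((T ^^ (n - i)) b))"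
proof (induction n)
  case (Suc n)
  let ?t = "\<lambda>i j. ((T ^^ i) a)\<langle>-1\<rangle> ((T ^^ j) b)"
  have "(T ^^ Suc n) (a\<langle>-1\<rangle> b) = (\<Sum>i\<le>n. of_nat (n choose i) \<cdot> ?t (Suc i) (n - i)) + (\<Sum>i\<le>n. of_nat (n choose i) \<cdot> ?t i (Suc n - i))"
    by (simp add: Suc T_sum T_derivation vs.scale_right_distrib sum.distrib Suc_diff_le)
  also have "(\<Sum>i\<le>n. of_nat (n choose i) \<cdot> ?t i (Suc n - i)) = (\<Sum>i\<le>Suc n. of_nat (n choose i) \<cdot> ?t i (Suc n - i))"
    by (simp add: sum.atMost_Suc)
  also have "(\<Sum>i\<le>Suc n. of_nat (n choose i) \<cdot> ?t i (Suc n - i)) =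
      ?t 0 (Suc n) + (\<Sum>i\<le>n. of_nat (n choose Suc i) \<cdot> ?t (Suc i) (n - i))"
    by (subst sum.atMost_Suc_shift) simp
  finally have "(T ^^ Suc n) (a\<langle>-1\<rangle> b) = ?t 0 (Suc n) + (\<Sum>i\<le>n. of_nat (Suc n choose Suc i) \<cdot> ?t (Suc i) (n - i))"
    by (simp add: vs.scale_left_distrib sum.distrib algebra_simps)
  also have "\<dots> = (\<Sum>i\<le>Suc n. of_nat (Suc n choose i) \<cdot> ?t i (Suc n - i))"
    by (subst sum.atMost_Suc_shift) simp
  finally show ?case .
qed simp

end

context W3_quotient
begin

definition \<epsilon> :: "(nat \<Rightarrow> 'v set) \<Rightarrow> complex" where
  "\<epsilon> = gr_functional vc 0"

lemma \<epsilon>_gcl: "\<epsilon> (gcl x) = vc (x 0)"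
  unfolding \<epsilon>_def by (rule gr_functional_gcl) (simp_all add: vc_F_1)

lemma gr_augmented: "augmented_algebra (gr_alg V) \<epsilon>"
proof (intro augmented_algebra.intro gr_calg augmented_algebra_axioms.intro)
  show "\<And>x y. x \<in> carrier (gr_alg V) \<Longrightarrow> y \<in> carrier (gr_alg V) \<Longrightarrow> \<epsilon> (x \<oplus>\<^bsub>gr_alg V\<^esub> y) = \<epsilon> x + \<epsilon> y"
    by (elim gr_carrierE) (simp add: gr_add \<epsilon>_gcl)
  show "\<And>x y. x \<in> carrier (gr_alg V) \<Longrightarrow> y \<in> carrier (gr_alg V) \<Longrightarrow> \<epsilon> (x \<otimes>\<^bsub>gr_alg V\<^esub> y) = \<epsilon> x * \<epsilon> y"
    by (elim gr_carrierE) (simp add: gr_mult \<epsilon>_gcl conv_def vc_mult)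
  show "\<And>x c. x \<in> carrier (gr_alg V) \<Longrightarrow> \<epsilon> (c \<odot>\<^bsub>gr_alg V\<^esub> x) = c * \<epsilon> x"
    by (elim gr_carrierE) (simp add: gr_smult \<epsilon>_gcl)
  show "\<epsilon> \<one>\<^bsub>gr_alg V\<^esub> = 1" by (simp add: gr_one \<epsilon>_gcl conc_def)
qed

sublocale G: augmented_algebra "gr_alg V" \<epsilon>
  by (rule gr_augmented)

section \<open>Tangent vectors of the associated graded algebra\<close>

lemma pr_normal_product: "pr n (a\<langle>-1\<rangle> b) = (\<Sum>i\<le>n. pr i a\<langle>-1\<rangle> pr (n - i) b)"
  using pr_mode[of n a 0 b] by simp

lemma atMost_low: "{..2::nat} = {0, Suc 0, 2}" "{..3::nat} = {0, Suc 0, 2, 3}" "{..4::nat} = {0, Suc 0, 2, 3, 4}"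
  by auto

text \<open>Two nonzero components of positive weight have total weight at least 4, so below that
  one factor must be a vacuum component. This is the Leibniz rule behind the functionals of degree
  0.\<close>

lemma pr_product_0:
  "pr 2 (a\<langle>-1\<rangle> b) = vc a \<cdot> pr 2 b + vc b \<cdot> pr 2 a"
  "pr 3 (a\<langle>-1\<rangle> b) = vc a \<cdot> pr 3 b + vc b \<cdot> pr 3 a"
  by (simp_all add: pr_normal_product[of 2] pr_normal_product[of 3] atMost_low pr_low(2) vc[of a] vc[of b] vacuum creation)

text \<open>An element of F^1 starts in weight 3 and weight 1 is empty, so in weights 3 and 4 its
  partner contributes only its vacuum component.\<close>

lemma pr_product_1:
  assumes "b \<in> F 1"
  shows "pr 3 (a\<langle>-1\<rangle> b) = vc a \<cdot> pr 3 b" "pr 4 (a\<langle>-1\<rangle> b) = vc a \<cdot> pr 4 b"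
    "pr 3 (b\<langle>-1\<rangle> a) = vc a \<cdot> pr 3 b" "pr 4 (b\<langle>-1\<rangle> a) = vc a \<cdot> pr 4 b"
proof -
  have z: "pr 0 b = 0" "pr (Suc 0) b = 0" "pr 2 b = 0" using pr_F_1(1)[OF assms] by simp_all
  show "pr 3 (a\<langle>-1\<rangle> b) = vc a \<cdot> pr 3 b" "pr 4 (a\<langle>-1\<rangle> b) = vc a \<cdot> pr 4 b"
    "pr 3 (b\<langle>-1\<rangle> a) = vc a \<cdot> pr 3 b" "pr 4 (b\<langle>-1\<rangle> a) = vc a \<cdot> pr 4 b"
    by (simp_all add: pr_normal_product[of 3] pr_normal_product[of 4] atMost_low pr_low(2) z vc[of a] vacuum creation)
qed

lemma point_derivation_0:
  assumes "\<And>a b. \<phi> (a + b) = \<phi> a + \<phi> b" "\<And>a. a \<in> F 1 \<Longrightarrow> \<phi> a = 0"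
    and "\<And>a b. \<phi> (a\<langle>-1\<rangle> b) = vc a * \<phi> b + vc b * \<phi> a"
  shows "G.point_derivation (gr_functional \<phi> 0)"
proof -
  have g: "gr_functional \<phi> 0 (gcl x) = \<phi> (x 0)" for x
    by (rule gr_functional_gcl) (use assms in auto)
  show ?thesis
    unfolding G.point_derivation_def
    by (intro ballI conjI; elim gr_carrierE) (simp_all add: gr_add gr_mult g \<epsilon>_gcl conv_def assms)
qed

lemma point_derivation_1:
  assumes add: "\<And>a b. \<phi> (a + b) = \<phi> a + \<phi> b" and zero: "\<And>a. a \<in> F 2 \<Longrightarrow> \<phi> a = 0"
    and mult: "\<And>a b. b \<in> F 1 \<Longrightarrow> \<phi> (a\<langle>-1\<rangle> b) = vc a * \<phi> b \<and> \<phi> (b\<langle>-1\<rangle> a) = vc a * \<phi> b"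
  shows "G.point_derivation (gr_functional \<phi> 1)"
proof -
  have g: "gr_functional \<phi> 1 (gcl x) = \<phi> (x 1)" for x
    by (rule gr_functional_gcl) (use assms in \<open>auto simp: numeral_2_eq_2\<close>)
  have m: "\<phi> (conv x y 1) = vc (x 0) * \<phi> (y 1) + vc (y 0) * \<phi> (x 1)" if "gr_rep x" "gr_rep y" for x y
  proof -
    have "x 1 \<in> F 1" "y 1 \<in> F 1" using gr_repD[OF that(1)] gr_repD[OF that(2)] by auto
    then show ?thesis using mult by (simp add: conv_def add)
  qed
  show ?thesis
    unfolding G.point_derivation_def
    by (intro ballI conjI; elim gr_carrierE) (simp_all only: gr_add gr_mult g \<epsilon>_gcl m add)
qed

abbreviation jet_L :: "nat \<Rightarrow> nat \<Rightarrow> 'v set" where "jet_L i \<equiv> gcl (conc i ((T ^^ i) L))"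
abbreviation jet_W :: "nat \<Rightarrow> nat \<Rightarrow> 'v set" where "jet_W i \<equiv> gcl (conc i ((T ^^ i) W))"

lemma vc_L [simp]: "vc L = 0" and vc_W [simp]: "vc W = 0"
  using vc_wt[of L 2] vc_wt[of W 3] by simp_all

lemma jets_aug: "jet_L i \<in> G.aug" "jet_W i \<in> G.aug"
  unfolding G.aug_def using gr_carrierI[OF gr_rep_conc[OF F_T_pow]]
  by (auto simp: \<epsilon>_gcl conc_def)

lemma jets_carrier: "jet_L i \<in> carrier (gr_alg V)" "jet_W i \<in> carrier (gr_alg V)"
  using jets_aug by (auto simp: G.aug_def)

lemma jets_\<epsilon>: "\<epsilon> (jet_L i) = 0" "\<epsilon> (jet_W i) = 0"
  using jets_aug by (auto simp: G.aug_def)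

end

context W3_quotient
begin

text \<open>The n-th derivative of the singular relation. The scalars are written as integers
  because they will be pulled out of a map that is merely additive.\<close>

lemma singular_relation_sum:
  "(\<Sum>i\<le>n. of_int (12 * int (n choose i)) \<cdot> ((T ^^ Suc i) L)\<langle>-1\<rangle> ((T ^^ (n - i)) W)
     + of_int (- 8 * int (n choose i)) \<cdot> ((T ^^ i) L)\<langle>-1\<rangle> ((T ^^ Suc (n - i)) W)) \<in> F (n + 2)"
proof -
  have "(\<Sum>i\<le>n. of_int (12 * int (n choose i)) \<cdot> ((T ^^ Suc i) L)\<langle>-1\<rangle> ((T ^^ (n - i)) W)
     + of_int (- 8 * int (n choose i)) \<cdot> ((T ^^ i) L)\<langle>-1\<rangle> ((T ^^ Suc (n - i)) W))
     = (T ^^ n) (12 \<cdot> (T L)\<langle>-1\<rangle> W - 8 \<cdot> L\<langle>-1\<rangle> (T W))"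
    by (simp only: T_pow_linear normal_product_T_pow funpow_Suc_right comp_apply)
      (simp add: vs.scale_sum_right sum_subtractf)
  also have "\<dots> = - ((T ^^ (n + 3)) W)"
  proof -
    have "(T ^^ (n + 3)) W = (T ^^ n) (T (T (T W)))"
      by (simp only: funpow_add comp_apply) (simp add: numeral_3_eq_3)
    then show ?thesis unfolding singular_relation by (simp only: T_pow_linear)
  qed
  finally show ?thesis using F_neg[OF F_antimonoD[OF F_T_pow, of "n + 2" "n + 3" W]] by simp
qed

context
  fixes d
  assumes d: "derivation_mod_square (gr_alg V) G.aug d"
begin

text \<open>\<open>\<chi>\<close> after \<open>d\<close> is applied to the n-th derivative of 12 l'
  w - 8 l w' = 0. All factors lie in \<open>aug\<close>, so each product contributes two
  terms.\<close>

lemma d_relation: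
  assumes \<chi>: "G.point_derivation \<chi>"
  shows "(\<Sum>i\<le>n. of_int (12 * int (n choose i)) * (\<epsilon> (d (jet_L (Suc i))) * \<chi> (jet_W (n - i)) + \<epsilon> (d (jet_W (n - i))) * \<chi> (jet_L (Suc i)))
     + of_int (- 8 * int (n choose i)) * (\<epsilon> (d (jet_L i)) * \<chi> (jet_W (Suc (n - i))) + \<epsilon> (d (jet_W (Suc (n - i)))) * \<chi> (jet_L i))) = 0"
proof -
  define \<theta> where "\<theta> v = \<chi> (d (gcl (conc (Suc n) v)))" for v
  note pd = G.point_derivation_d[OF d \<chi>]
  have cc: "gcl (conc (Suc n) v) \<in> carrier (gr_alg V)" if "v \<in> F (Suc n)" for v
    using that by (intro gr_carrierI gr_rep_conc)
  have add: "\<theta> (u + v) = \<theta> u + \<theta> v" if "u \<in> F (Suc n)" "v \<in> F (Suc n)" for u v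
    unfolding \<theta>_def gr_add_conc[symmetric] by (rule pd(1)) (use that cc in auto)
  have zero: "\<theta> 0 = 0" using add[of 0 0] by simp
  have neg: "\<theta> (- v) = - \<theta> v" if "v \<in> F (Suc n)" for v
    using add[OF F_neg[OF that] that] zero by (simp add: eq_neg_iff_add_eq_0)
  have nat: "\<theta> (of_nat k \<cdot> v) = of_nat k * \<theta> v" if "v \<in> F (Suc n)" for k v
    by (induction k) (use that in \<open>simp_all add: zero add vs.scale_left_distrib F_scale distrib_right\<close>)
  have int: "\<theta> (of_int k \<cdot> v) = of_int k * \<theta> v" if "v \<in> F (Suc n)" for k v
  proof (cases k)
    case (nonneg m)
    then show ?thesis using nat[OF that, of m] by simp
  next
    case (neg m)
    then have "of_int k \<cdot> v = - (of_nat (Suc m) \<cdot> v)" by (simp del: of_nat_Suc)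
    then show ?thesis using nat[OF that, of "Suc m"] \<open>\<And>v. v \<in> F (Suc n) \<Longrightarrow> \<theta> (- v) = - \<theta> v\<close>[OF F_scale[OF that]] neg
      by (simp del: of_nat_Suc)
  qed
  have sum: "\<theta> (\<Sum>i\<in>S. f i) = (\<Sum>i\<in>S. \<theta> (f i))" if "finite S" "\<And>i. i \<in> S \<Longrightarrow> f i \<in> F (Suc n)" for S and f :: "nat \<Rightarrow> 'v"
    using that by induction (simp_all add: zero add F_sum)
  have prod: "((T ^^ a) L)\<langle>-1\<rangle> ((T ^^ b) W) \<in> F (Suc n)"
    "\<theta> (((T ^^ a) L)\<langle>-1\<rangle> ((T ^^ b) W)) = \<epsilon> (d (jet_L a)) * \<chi> (jet_W b) + \<epsilon> (d (jet_W b)) * \<chi> (jet_L a)"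
    if "a + b = Suc n" for a b
  proof -
    show "((T ^^ a) L)\<langle>-1\<rangle> ((T ^^ b) W) \<in> F (Suc n)" by (rule F_mult[OF F_T_pow F_T_pow]) (use that in simp)
    have "\<theta> (((T ^^ a) L)\<langle>-1\<rangle> ((T ^^ b) W)) = \<chi> (d (jet_L a \<otimes>\<^bsub>gr_alg V\<^esub> jet_W b))"
      unfolding \<theta>_def gr_mult_conc[OF F_T_pow F_T_pow] that by (rule refl)
    also have "\<dots> = \<epsilon> (d (jet_L a)) * \<chi> (jet_W b) + \<epsilon> (d (jet_W b)) * \<chi> (jet_L a)"
      unfolding pd(3)[OF jets_carrier] by (simp add: jets_\<epsilon>)
    finally show "\<theta> (((T ^^ a) L)\<langle>-1\<rangle> ((T ^^ b) W)) = \<epsilon> (d (jet_L a)) * \<chi> (jet_W b) + \<epsilon> (d (jet_W b)) * \<chi> (jet_L a)" .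
  qed
  define A where "A i = ((T ^^ Suc i) L)\<langle>-1\<rangle> ((T ^^ (n - i)) W)" for i
  define B where "B i = ((T ^^ i) L)\<langle>-1\<rangle> ((T ^^ Suc (n - i)) W)" for i
  define u where "u = (\<Sum>i\<le>n. of_int (12 * int (n choose i)) \<cdot> A i + of_int (- 8 * int (n choose i)) \<cdot> B i)"
  have A: "A i \<in> F (Suc n)"
      "\<theta> (A i) = \<epsilon> (d (jet_L (Suc i))) * \<chi> (jet_W (n - i)) + \<epsilon> (d (jet_W (n - i))) * \<chi> (jet_L (Suc i))"
    and B: "B i \<in> F (Suc n)"
      "\<theta> (B i) = \<epsilon> (d (jet_L i)) * \<chi> (jet_W (Suc (n - i))) + \<epsilon> (d (jet_W (Suc (n - i)))) * \<chi> (jet_L i)"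
    if "i \<le> n" for i
  proof -
    have "Suc i + (n - i) = Suc n" "i + Suc (n - i) = Suc n" using that by simp_all
    from prod[OF this(1)] prod[OF this(2)] show "A i \<in> F (Suc n)"
      "\<theta> (A i) = \<epsilon> (d (jet_L (Suc i))) * \<chi> (jet_W (n - i)) + \<epsilon> (d (jet_W (n - i))) * \<chi> (jet_L (Suc i))"
      "B i \<in> F (Suc n)"
      "\<theta> (B i) = \<epsilon> (d (jet_L i)) * \<chi> (jet_W (Suc (n - i))) + \<epsilon> (d (jet_W (Suc (n - i)))) * \<chi> (jet_L i)"
      unfolding A_def B_def by (simp_all only:)
  qed
  have u: "u \<in> F (Suc (Suc n))"
    unfolding u_def A_def B_def using singular_relation_sum[of n] by (simp only: add_2_eq_Suc')
  have "gcl (conc (Suc n) u) = gcl (conc (Suc n) 0)"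
    unfolding gcl_conc_eq_zero[OF u] gcl_conc_eq_zero[OF F_0I] by (rule refl)
  then have "\<theta> u = 0" using zero unfolding \<theta>_def by simp
  moreover have "\<theta> u = (\<Sum>i\<le>n. \<theta> (of_int (12 * int (n choose i)) \<cdot> A i + of_int (- 8 * int (n choose i)) \<cdot> B i))"
    unfolding u_def by (rule sum) (simp_all only: finite_atMost F_add F_scale A(1) B(1) atMost_iff)
  moreover have "(\<Sum>i\<le>n. \<theta> (of_int (12 * int (n choose i)) \<cdot> A i + of_int (- 8 * int (n choose i)) \<cdot> B i)) =
      (\<Sum>i\<le>n. of_int (12 * int (n choose i)) * (\<epsilon> (d (jet_L (Suc i))) * \<chi> (jet_W (n - i)) + \<epsilon> (d (jet_W (n - i))) * \<chi> (jet_L (Suc i)))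
       + of_int (- 8 * int (n choose i)) * (\<epsilon> (d (jet_L i)) * \<chi> (jet_W (Suc (n - i))) + \<epsilon> (d (jet_W (Suc (n - i)))) * \<chi> (jet_L i)))"
  proof (rule sum.cong[OF refl])
    fix i assume "i \<in> {..n}"
    then have i: "i \<le> n" by simp
    show "\<theta> (of_int (12 * int (n choose i)) \<cdot> A i + of_int (- 8 * int (n choose i)) \<cdot> B i) =
      of_int (12 * int (n choose i)) * (\<epsilon> (d (jet_L (Suc i))) * \<chi> (jet_W (n - i)) + \<epsilon> (d (jet_W (n - i))) * \<chi> (jet_L (Suc i)))
       + of_int (- 8 * int (n choose i)) * (\<epsilon> (d (jet_L i)) * \<chi> (jet_W (Suc (n - i))) + \<epsilon> (d (jet_W (Suc (n - i)))) * \<chi> (jet_L i))"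
      unfolding add[OF F_scale[OF A(1)[OF i]] F_scale[OF B(1)[OF i]]] int[OF A(1)[OF i]] int[OF B(1)[OF i]]
        A(2)[OF i] B(2)[OF i] by (rule refl)
  qed
  ultimately show ?thesis by (simp only:)
qed

lemma wt_TL: "wt (T L) (int 3)" and wt_TW: "wt (T W) (int 4)"
  using wt_T[OF wt_L] wt_T[OF wt_W] by simp_all

lemma pr_generators: "pr 2 L = L" "pr 3 L = 0" "pr 4 L = 0" "pr 2 W = 0" "pr 3 W = W" "pr 4 W = 0"
    "pr 3 (T L) = T L" "pr 4 (T L) = 0" "pr 3 (T W) = 0" "pr 4 (T W) = T W"
  using pr_wt[of L 2] pr_wt[of W 3] pr_wt[OF wt_TL] pr_wt[OF wt_TW] by simp_all

text \<open>The functionals \<open>\<phi>1\<close>, \<open>\<phi>2\<close>, \<open>\<phi>3\<close>,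
  \<open>\<phi>4\<close> give tangent vectors dual, up to nonzero scalars, to w, l, w', l' and zero
  on all other jets; each isolates a single unknown in \<open>d_relation\<close>.\<close>

lemma d_jets: "\<epsilon> (d (jet_L i)) = 0" "\<epsilon> (d (jet_W i)) = 0"
proof -
  define \<phi>1 where "\<phi>1 a = vc (W\<langle>5\<rangle> (pr 3 a))" for a
  define \<phi>2 where "\<phi>2 a = vc (L\<langle>3\<rangle> (pr 2 a))" for a
  define \<phi>3 where "\<phi>3 a = vc (W\<langle>6\<rangle> (pr 4 a))" for a
  define \<phi>4 where "\<phi>4 a = vc (L\<langle>4\<rangle> (pr 3 a))" for a
  have z1: "\<phi>1 a = 0" "\<phi>2 a = 0" if "a \<in> F 1" for a
    using pr_F_1(1)[OF that, of 2] pr_F_1(2)[OF that] by (auto simp: \<phi>1_def \<phi>2_def W_mode_TL)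
  have z2: "\<phi>3 a = 0" "\<phi>4 a = 0" if "a \<in> F 2" for a
    using pr_F_2(1)[OF that, of 3] pr_F_2(2)[OF that] by (auto simp: \<phi>3_def \<phi>4_def W_mode_TL)
  have 1: "G.point_derivation (gr_functional \<phi>1 0)"
    by (rule point_derivation_0) (simp_all add: z1, simp_all add: \<phi>1_def pr_product_0)
  have 2: "G.point_derivation (gr_functional \<phi>2 0)"
    by (rule point_derivation_0) (simp_all add: z1, simp_all add: \<phi>2_def pr_product_0)
  have 3: "G.point_derivation (gr_functional \<phi>3 1)"
    by (rule point_derivation_1) (simp_all add: z2, simp_all add: \<phi>3_def pr_product_1)
  have 4: "G.point_derivation (gr_functional \<phi>4 1)"
    by (rule point_derivation_1) (simp_all add: z2, simp_all add: \<phi>4_def pr_product_1)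
  have lin: "\<phi>1 (a + b) = \<phi>1 a + \<phi>1 b" "\<phi>2 (a + b) = \<phi>2 a + \<phi>2 b" "\<phi>3 (a + b) = \<phi>3 a + \<phi>3 b" "\<phi>4 (a + b) = \<phi>4 a + \<phi>4 b" for a b
    by (simp_all add: \<phi>1_def \<phi>2_def \<phi>3_def \<phi>4_def)
  have g1: "gr_functional \<phi>1 0 (gcl x) = \<phi>1 (x 0)" for x by (rule gr_functional_gcl) (simp_all add: lin z1)
  have g2: "gr_functional \<phi>2 0 (gcl x) = \<phi>2 (x 0)" for x by (rule gr_functional_gcl) (simp_all add: lin z1)
  have g3: "gr_functional \<phi>3 1 (gcl x) = \<phi>3 (x 1)" for x by (rule gr_functional_gcl) (simp_all add: lin z2 flip: numeral_2_eq_2)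
  have g4: "gr_functional \<phi>4 1 (gcl x) = \<phi>4 (x 1)" for x by (rule gr_functional_gcl) (simp_all add: lin z2 flip: numeral_2_eq_2)
  have e1: "gr_functional \<phi>1 0 (jet_W i) = (if i = 0 then -9/8 else 0)" and e1': "gr_functional \<phi>1 0 (jet_L i) = 0" for i
    unfolding g1 by (simp_all add: conc_def \<phi>1_def pr_generators)
  have e2: "gr_functional \<phi>2 0 (jet_W i) = 0" and e2': "gr_functional \<phi>2 0 (jet_L i) = (if i = 0 then -1 else 0)" for i
    unfolding g2 by (simp_all add: conc_def \<phi>2_def pr_generators)
  have e3: "gr_functional \<phi>3 1 (jet_W i) = (if i = 1 then -27/4 else 0)" and e3': "gr_functional \<phi>3 1 (jet_L i) = 0" for i
    unfolding g3 by (auto simp: conc_def \<phi>3_def pr_generators W_mode_TL)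
  have e4: "gr_functional \<phi>4 1 (jet_W i) = 0" and e4': "gr_functional \<phi>4 1 (jet_L i) = (if i = 1 then -4 else 0)" for i
    unfolding g4 by (auto simp: conc_def \<phi>4_def pr_generators W_mode_TL)
  \<comment> \<open>Dual to w: in the first family only i = n contains w itself, and the second
    family contains derivatives of w throughout.\<close>
  have L_pos: "\<epsilon> (d (jet_L (Suc n))) = 0" for n
  proof -
    have "(\<Sum>i\<le>n. of_int (12 * int (n choose i)) * (\<epsilon> (d (jet_L (Suc i))) * (if i = n then -9/8 else 0))) = 0"
      using d_relation[OF 1, of n] unfolding e1 e1' by (simp cong: sum.cong if_cong)
        (smt (verit) atMost_iff diff_is_0_eq le_antisym sum.cong)
    then show ?thesis by (simp add: if_distrib[of "\<lambda>x. _ * x"] sum.delta cong: if_cong)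
  qed
  \<comment> \<open>Dual to l: only i = 0 in the second family remains.\<close>
  have W_pos: "\<epsilon> (d (jet_W (Suc n))) = 0" for n
  proof -
    have "(\<Sum>i\<le>n. of_int (- 8 * int (n choose i)) * (\<epsilon> (d (jet_W (Suc (n - i)))) * (if i = 0 then -1 else 0))) = 0"
      using d_relation[OF 2, of n] unfolding e2 e2' by simp
    then show ?thesis by (simp add: if_distrib[of "\<lambda>x. _ * x"] sum.delta cong: if_cong)
  qed
  \<comment> \<open>The values on l and w themselves are reached with n = 0, through the tangent
    vectors dual to w' and l'.\<close>
  have "\<epsilon> (d (jet_L 0)) = 0" using d_relation[OF 3, of 0] unfolding e3 e3' by simp
  then show "\<epsilon> (d (jet_L i)) = 0" using L_pos by (cases i) auto
  have "\<epsilon> (d (jet_W 0)) = 0" using d_relation[OF 4, of 0] unfolding e4 e4' by simp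
  then show "\<epsilon> (d (jet_W i)) = 0" using W_pos by (cases i) auto
qed

end

subsection \<open>A cuspidal presentation\<close>

sublocale R: calg "R_alg V" by (rule R_calg)

text \<open>Every index other than 0 is sent to the class of W so that all values lie in the
  carrier; the presentation uses the indices 0 and 1.\<close>

definition gen :: "nat \<times> nat \<Rightarrow> 'v set" where
  "gen v = (if fst v = 0 then rcl L else rcl W)"

lemma gen_closed [simp]: "gen v \<in> carrier (R_alg V)"
  by (simp add: gen_def)

abbreviation \<psi> where "\<psi> \<equiv> R.poly_eval gen"

abbreviation y0 :: jet_poly where "y0 \<equiv> pvar (0, 0)"
abbreviation y1 :: jet_poly where "y1 \<equiv> pvar (1, 0)"
abbreviation base :: "(nat \<times> nat) set" where "base \<equiv> {..<2} \<times> {0}"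

lemmas \<psi>_simps = R.poly_eval_add[where g = gen, OF gen_closed] R.poly_eval_mult[where g = gen, OF gen_closed] R.poly_eval_pconst[where g = gen, OF gen_closed]
  R.poly_eval_pvar[where g = gen, OF gen_closed] R.poly_eval_1[where g = gen, OF gen_closed] R.poly_eval_0[where g = gen, OF gen_closed]

lemma y_vars [simp]: "in_vars base y0" "in_vars base y1"
  by (auto intro!: in_vars_pvar)

lemma \<psi>_y: "\<psi> y0 = rcl L" "\<psi> y1 = rcl W"
  using R.poly_eval_pvar[where g = gen, OF gen_closed, of "(0, 0)"] R.poly_eval_pvar[where g = gen, OF gen_closed, of "(1, 0)"]
  by (simp_all only: gen_def fst_conv simp_thms if_True if_False one_neq_zero)

lemma \<psi>_hom: "\<psi> \<in> alg_hom (base_alg 2) (R_alg V)"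
  by (rule R.poly_eval_alg_hom) simp

lemma rcl_eq_zero: "rcl a = \<zero>\<^bsub>R_alg V\<^esub> \<longleftrightarrow> a \<in> F 1"
  by (simp add: R_alg_simps rcl_eq_iff)

lemma \<psi>_surj: "\<psi> ` carrier (base_alg 2) = carrier (R_alg V)"
proof
  show "\<psi> ` carrier (base_alg 2) \<subseteq> carrier (R_alg V)" using alg_homD(1)[OF \<psi>_hom] by blast
  have "\<exists>p. in_vars base p \<and> \<psi> p = rcl a" for a
  proof (induction a rule: state_induct)
    case zero
    then show ?case by (intro exI[of _ 0]) (simp add: \<psi>_simps R_alg_simps)
  next
    case (add x y)
    then obtain p q where "in_vars base p" "\<psi> p = rcl x" "in_vars base q" "\<psi> q = rcl y" by blast
    then show ?case by (intro exI[of _ "p + q"]) (simp add: \<psi>_simps R_alg_simps)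
  next
    case (scale c x)
    then obtain p where "in_vars base p" "\<psi> p = rcl x" by blast
    then show ?case by (intro exI[of _ "pconst c * p"]) (simp add: \<psi>_simps R_alg_simps vacuum)
  next
    case vac
    show ?case by (intro exI[of _ 1]) (simp add: \<psi>_simps R_alg_simps)
  next
    case (L k x)
    then obtain p where p: "in_vars base p" "\<psi> p = rcl x" by blast
    show ?case
    proof (cases k)
      case 0
      have "\<psi> (y0 * p) = rcl (L\<langle>-1\<rangle> x)" by (simp only: \<psi>_simps(2) \<psi>_y p(2) R_alg_simps(2))
      then show ?thesis using in_vars_mult[OF y_vars(1) p(1)] 0 by auto
    next
      case (Suc j)
      then have "L\<langle>- 1 - int k\<rangle> x \<in> F 1" by (intro F_mode_negative[OF F_0]) simp
      then have "rcl (L\<langle>- 1 - int k\<rangle> x) = \<zero>\<^bsub>R_alg V\<^esub>" by (simp only: rcl_eq_zero)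
      then show ?thesis by (intro exI[of _ 0]) (simp only: \<psi>_simps in_vars_0 simp_thms)
    qed
  next
    case (W k x)
    then obtain p where p: "in_vars base p" "\<psi> p = rcl x" by blast
    show ?case
    proof (cases k)
      case 0
      have "\<psi> (y1 * p) = rcl (W\<langle>-1\<rangle> x)" by (simp only: \<psi>_simps(2) \<psi>_y p(2) R_alg_simps(2))
      then show ?thesis using in_vars_mult[OF y_vars(2) p(1)] 0 by auto
    next
      case (Suc j)
      then have "W\<langle>- 1 - int k\<rangle> x \<in> F 1" by (intro F_mode_negative[OF F_0]) simp
      then have "rcl (W\<langle>- 1 - int k\<rangle> x) = \<zero>\<^bsub>R_alg V\<^esub>" by (simp only: rcl_eq_zero)
      then show ?thesis by (intro exI[of _ 0]) (simp only: \<psi>_simps in_vars_0 simp_thms)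
    qed
  qed
  then show "carrier (R_alg V) \<subseteq> \<psi> ` carrier (base_alg 2)"
    by (auto elim!: R_carrierE simp: carrier_poly_alg) (metis (mono_tags) image_eqI mem_Collect_eq)
qed

text \<open>The cusp together with the first vanishing power of l and the first vanishing l^a w, if
  they exist. Whether they exist is left open; the set is finite either way.\<close>

definition relations :: "jet_poly set" where
  "relations = insert (y1 ^ 2 - y0 ^ 3)
     ({y0 ^ a |a. \<psi> (y0 ^ a) = \<zero>\<^bsub>R_alg V\<^esub> \<and> (\<forall>b<a. \<psi> (y0 ^ b) \<noteq> \<zero>\<^bsub>R_alg V\<^esub>)} \<union>
      {y0 ^ a * y1 |a. \<psi> (y0 ^ a * y1) = \<zero>\<^bsub>R_alg V\<^esub> \<and> (\<forall>b<a. \<psi> (y0 ^ b * y1) \<noteq> \<zero>\<^bsub>R_alg V\<^esub>)})"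

lemma relations_finite: "finite relations"
proof -
  have 1: "finite {f a |a. P a \<and> (\<forall>b<a. \<not> P b)}" for f :: "nat \<Rightarrow> jet_poly" and P
  proof -
    have "{f a |a. P a \<and> (\<forall>b<a. \<not> P b)} \<subseteq> {f (LEAST a. P a)}"
    proof
      fix x assume "x \<in> {f a |a. P a \<and> (\<forall>b<a. \<not> P b)}"
      then obtain a where a: "x = f a" "P a" "\<forall>b<a. \<not> P b" by blast
      have "(LEAST a. P a) = a"
        by (rule Least_equality[of P a, OF a(2)]) (use a(3) not_less in blast)
      then show "x \<in> {f (LEAST a. P a)}" using a(1) by simp
    qed
    then show ?thesis by (rule finite_subset) simp
  qed
  show ?thesis unfolding relations_def
    using 1[of "\<lambda>a. y0 ^ a" "\<lambda>a. \<psi> (y0 ^ a) = \<zero>\<^bsub>R_alg V\<^esub>"] 1[of "\<lambda>a. y0 ^ a * y1" "\<lambda>a. \<psi> (y0 ^ a * y1) = \<zero>\<^bsub>R_alg V\<^esub>"]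
    by simp
qed

lemma relations_vars:
  assumes "f \<in> relations"
  shows "in_vars base f"
proof -
  have "f = y1 ^ 2 - y0 ^ 3 \<or> (\<exists>a. f = y0 ^ a) \<or> (\<exists>a. f = y0 ^ a * y1)"
    using assms unfolding relations_def by blast
  moreover have "in_vars base (y1 ^ 2 - y0 ^ 3)" by (intro in_vars_diff in_vars_power y_vars)
  moreover have "in_vars base (y0 ^ a)" for a by (intro in_vars_power y_vars)
  moreover have "in_vars base (y0 ^ a * y1)" for a by (intro in_vars_mult in_vars_power y_vars)
  ultimately show ?thesis by (elim disjE exE) (simp_all only:)
qed

lemma relations_carrier: "relations \<subseteq> carrier (base_alg 2)"
  using relations_vars by (auto simp: carrier_poly_alg)

abbreviation I where "I \<equiv> Idl\<^bsub>base_alg 2\<^esub> relations"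

lemma I_poly_ideal: "poly_ideal base I"
  by (rule poly_ideal.intro) (rule ring.genideal_ideal[OF cring.axioms(1)[OF poly_alg_cring] relations_carrier])

sublocale I: poly_ideal base I by (rule I_poly_ideal)

lemma relations_in_I: "relations \<subseteq> I"
  by (rule ring.genideal_self[OF cring.axioms(1)[OF poly_alg_cring] relations_carrier])

lemma \<psi>_power: "\<psi> q = rcl v \<Longrightarrow> \<psi> (y0 ^ a * q) = rcl (((\<lambda>x. L\<langle>-1\<rangle> x) ^^ a) v)"
proof (induction a)
  case (Suc a)
  then have "\<psi> (y0 * (y0 ^ a * q)) = rcl (L\<langle>-1\<rangle> (((\<lambda>x. L\<langle>-1\<rangle> x) ^^ a) v))"
    by (simp only: \<psi>_simps(2)[of y0] \<psi>_y R_alg_simps(2))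
  then show ?case by (simp only: power_Suc mult.assoc funpow.simps comp_apply)
qed simp

text \<open>The normal form in weight n for l of weight 2 and w of weight 3: every weight other than
  1 carries exactly one monomial of the form l^a or l^a w. The case n = 1 is set to 0 because the
  truncated (1 - 3) div 2 would produce w, which has weight 3.\<close>

definition std :: "nat \<Rightarrow> jet_poly" where
  "std n = (if n = 1 then 0 else if even n then y0 ^ (n div 2) else y0 ^ ((n - 3) div 2) * y1)"

definition std_vec :: "nat \<Rightarrow> 'v" where
  "std_vec n = (if n = 1 then 0 else if even n then ((\<lambda>x. L\<langle>-1\<rangle> x) ^^ (n div 2)) (vac V)
     else ((\<lambda>x. L\<langle>-1\<rangle> x) ^^ ((n - 3) div 2)) W)"

lemma \<psi>_std: "\<psi> (std n) = rcl (std_vec n)"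
  using \<psi>_power[of 1 "vac V" "n div 2"] \<psi>_power[of y1 W "(n - 3) div 2"]
  by (auto simp: std_def std_vec_def \<psi>_simps R_alg_simps gen_def)

lemma wt_std: "wt (std_vec n) (int n)"
proof -
  have w: "wt (((\<lambda>x. L\<langle>-1\<rangle> x) ^^ a) v) (int (p + 2 * a))" if "wt v (int p)" for a v p
  proof (induction a)
    case (Suc a)
    show ?case unfolding funpow.simps comp_apply by (rule wt_mode[OF wt_L Suc]) simp
  qed (use that in simp)
  have "\<exists>k. n = 3 + 2 * k" if ne: "n \<noteq> 1" and od: "odd n"
  proof -
    obtain j where "n = 2 * j + 1" using od by (rule oddE)
    then show ?thesis using ne by (intro exI[of _ "j - 1"]) auto
  qed
  then show ?thesis
    using w[of "vac V" 0 "n div 2"] w[of W 3 "(n - 3) div 2"] by (auto simp: std_vec_def)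
qed

text \<open>A vanishing normal form is a multiple of the first vanishing one of its kind, which is
  among the relations.\<close>

lemma std_in_I: "std_vec n \<in> F 1 \<Longrightarrow> std n \<in> I"
proof -
  have least: "\<exists>b\<le>a. P b \<and> (\<forall>c<b. \<not> P c)" if "P a" for P and a :: nat
    using that by (intro exI[of _ "LEAST a. P a"]) (auto intro: LeastI Least_le dest: not_less_Least)
  have even_case: "y0 ^ a \<in> I" if z: "\<psi> (y0 ^ a) = \<zero>\<^bsub>R_alg V\<^esub>" for a
  proof -
    obtain b where b: "b \<le> a" "\<psi> (y0 ^ b) = \<zero>\<^bsub>R_alg V\<^esub>" "\<forall>c<b. \<psi> (y0 ^ c) \<noteq> \<zero>\<^bsub>R_alg V\<^esub>"
      using least[of "\<lambda>a. \<psi> (y0 ^ a) = \<zero>\<^bsub>R_alg V\<^esub>", OF z] by blast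
    then have "y0 ^ b \<in> relations" unfolding relations_def by blast
    then have "y0 ^ b \<in> I" using relations_in_I by blast
    then have "y0 ^ (a - b) * y0 ^ b \<in> I" by (rule I.I_mult) (intro in_vars_power y_vars)
    then show ?thesis using b(1) by (simp flip: power_add)
  qed
  have odd_case: "y0 ^ a * y1 \<in> I" if z: "\<psi> (y0 ^ a * y1) = \<zero>\<^bsub>R_alg V\<^esub>" for a
  proof -
    obtain b where b: "b \<le> a" "\<psi> (y0 ^ b * y1) = \<zero>\<^bsub>R_alg V\<^esub>" "\<forall>c<b. \<psi> (y0 ^ c * y1) \<noteq> \<zero>\<^bsub>R_alg V\<^esub>"
      using least[of "\<lambda>a. \<psi> (y0 ^ a * y1) = \<zero>\<^bsub>R_alg V\<^esub>", OF z] by blast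
    then have "y0 ^ b * y1 \<in> relations" unfolding relations_def by blast
    then have "y0 ^ b * y1 \<in> I" using relations_in_I by blast
    then have "y0 ^ (a - b) * (y0 ^ b * y1) \<in> I" by (rule I.I_mult) (intro in_vars_power y_vars)
    then show ?thesis using b(1) by (simp flip: power_add mult.assoc)
  qed
  assume "std_vec n \<in> F 1"
  then have "\<psi> (std n) = \<zero>\<^bsub>R_alg V\<^esub>" unfolding \<psi>_std rcl_eq_zero .
  then show ?thesis using even_case odd_case by (auto simp: std_def split: if_splits)
qed

text \<open>Replacing w^2 by l^3 keeps the weight 2 i + 3 j and lowers j by 2.\<close>

lemma monomial_reduce: "y0 ^ i * y1 ^ j - std (2 * i + 3 * j) \<in> I"
proof (induction j arbitrary: i rule: less_induct)
  case (less j)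
  consider "j = 0" | "j = 1" | k where "j = Suc (Suc k)" by (metis One_nat_def not0_implies_Suc)
  then show ?case
  proof cases
    case 1
    then show ?thesis by (simp add: std_def)
  next
    case 2
    then show ?thesis by (simp add: std_def)
  next
    case (3 k)
    have "y1 ^ 2 - y0 ^ 3 \<in> I" using relations_in_I by (auto simp: relations_def)
    moreover have "in_vars base (y0 ^ i * y1 ^ k)" by (intro in_vars_mult in_vars_power y_vars)
    ultimately have "(y0 ^ i * y1 ^ k) * (y1 ^ 2 - y0 ^ 3) \<in> I" by (rule I.I_mult)
    moreover have "y0 ^ (i + 3) * y1 ^ k - std (2 * (i + 3) + 3 * k) \<in> I" by (rule less.IH) (simp add: 3)
    ultimately have "(y0 ^ i * y1 ^ k) * (y1 ^ 2 - y0 ^ 3) + (y0 ^ (i + 3) * y1 ^ k - std (2 * (i + 3) + 3 * k)) \<in> I"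
      by (rule I.I_add)
    note 4 = this
    have "std (2 * (i + 3) + 3 * k) = std (2 * i + 3 * j)" by (rule arg_cong[where f = std]) (simp add: 3)
    moreover have "(y0 ^ i * y1 ^ k) * (y1 ^ 2 - y0 ^ 3) + y0 ^ (i + 3) * y1 ^ k = y0 ^ i * y1 ^ j"
      by (simp add: 3 algebra_simps power_add power2_eq_square)
    ultimately show ?thesis using 4 unfolding add_diff_eq by (simp only:)
  qed
qed

inductive monomial_sum :: "jet_poly \<Rightarrow> bool" where
  monomial_sum_0: "monomial_sum 0"
| monomial_sum_add: "monomial_sum p \<Longrightarrow> monomial_sum (p + pconst c * (y0 ^ i * y1 ^ j))"

lemma monomial_sum:
  assumes "in_vars base p"
  shows "monomial_sum p"
proof -
  have one: "monomial_sum (pconst c * (y0 ^ i * y1 ^ j))" for c i j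
    using monomial_sum_add[OF monomial_sum_0, of c i j] by simp
  have plus: "monomial_sum (p + q)" if p: "monomial_sum p" and q: "monomial_sum q" for p q
    using q
  proof induction
    case (monomial_sum_add q c i j)
    then show ?case using monomial_sum.monomial_sum_add[of "p + q" c i j] by (simp add: add.assoc)
  qed (use p in simp)
  have times: "monomial_sum (p * (pconst c * (y0 ^ i * y1 ^ j)))" if "monomial_sum p" for p c i j
    using that
  proof induction
    case (monomial_sum_add p e k l)
    have "pconst (e * c) = pconst e * pconst c" by (simp add: pconst_def mult_single)
    then have "(pconst e * (y0 ^ k * y1 ^ l)) * (pconst c * (y0 ^ i * y1 ^ j)) = pconst (e * c) * (y0 ^ (k + i) * y1 ^ (l + j))"
      by (simp add: power_add algebra_simps)
    then show ?case unfolding distrib_right by (simp only: plus[OF monomial_sum_add.IH one])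
  qed (simp add: monomial_sum_0)
  have mult: "monomial_sum (p * q)" if p: "monomial_sum p" and q: "monomial_sum q" for p q
    using q
  proof induction
    case (monomial_sum_add q c i j)
    then show ?case unfolding distrib_left by (intro plus times p)
  qed (simp add: monomial_sum_0)
  show ?thesis
    using assms
  proof (induction rule: in_vars_induct)
    case (const c)
    show ?case using one[of c 0 0] by simp
  next
    case (var v)
    then have "v = (0, 0) \<or> v = (1, 0)" by (cases v) auto
    then show ?case using one[of 1 1 0] one[of 1 0 1] by (auto simp: pconst_def)
  next
    case (add p q)
    then show ?case by (intro plus)
  next
    case (mult p q)
    then show ?case by (intro \<open>\<And>p q. monomial_sum p \<Longrightarrow> monomial_sum q \<Longrightarrow> monomial_sum (p * q)\<close>)
  qed
qed

lemma normal_form: "in_vars base p \<Longrightarrow> \<exists>N c. p - (\<Sum>n<N. pconst (c n) * std n) \<in> I"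
proof -
  assume "in_vars base p"
  then have "monomial_sum p" by (rule monomial_sum)
  then have "\<exists>N c. (\<forall>n\<ge>N. c n = 0) \<and> p - (\<Sum>n<N. pconst (c n) * std n) \<in> I"
  proof induction
    case monomial_sum_0
    show ?case by (intro exI[of _ 0] exI[of _ "\<lambda>_. 0"]) simp
  next
    case (monomial_sum_add p e i j)
    then obtain N c where c: "\<forall>n\<ge>N. c n = 0" "p - (\<Sum>n<N. pconst (c n) * std n) \<in> I" by blast
    let ?m = "2 * i + 3 * j"
    let ?M = "max N (Suc ?m)" and ?c = "\<lambda>n. c n + (if n = ?m then e else 0)"
    have pc: "pconst (a + b) = pconst a + pconst b" "pconst 0 = 0" for a b by (simp_all add: pconst_def single_add)
    have 1: "(\<Sum>n<?M. pconst (c n) * std n) = (\<Sum>n<N. pconst (c n) * std n)"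
      by (rule sum.mono_neutral_right) (use c(1) in \<open>auto simp: pc\<close>)
    have 2: "(\<Sum>n<?M. pconst (if n = ?m then e else 0) * std n) = pconst e * std ?m"
    proof -
      have "(\<Sum>n<?M. pconst (if n = ?m then e else 0) * std n) = (\<Sum>n<?M. if n = ?m then pconst e * std ?m else 0)"
        by (rule sum.cong) (auto simp: pc)
      then show ?thesis by (simp add: sum.delta)
    qed
    have "(\<Sum>n<?M. pconst (?c n) * std n) = (\<Sum>n<N. pconst (c n) * std n) + pconst e * std ?m"
      unfolding 1[symmetric] 2[symmetric] by (simp only: pc distrib_right sum.distrib)
    moreover have "pconst e * (y0 ^ i * y1 ^ j - std ?m) \<in> I" by (rule I.I_mult[OF monomial_reduce]) simp
    then have "(p - (\<Sum>n<N. pconst (c n) * std n)) + pconst e * (y0 ^ i * y1 ^ j - std ?m) \<in> I" by (rule I.I_add[OF c(2)])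
    ultimately have "p + pconst e * (y0 ^ i * y1 ^ j) - (\<Sum>n<?M. pconst (?c n) * std n) \<in> I"
      by (simp add: algebra_simps)
    then show ?case using c(1) by (intro exI[of _ ?M] exI[of _ ?c]) auto
  qed
  then show ?thesis by blast
qed

lemma \<psi>_I: "p \<in> I \<Longrightarrow> \<psi> p = \<zero>\<^bsub>R_alg V\<^esub>"
proof -
  have "ideal {p \<in> carrier (base_alg 2). \<psi> p \<in> {\<zero>\<^bsub>R_alg V\<^esub>}} (base_alg 2)"
    by (rule preimage_ideal[OF cring.axioms(1)[OF poly_alg_cring] R.ring_axioms _ R.zeroideal])
      (use \<psi>_hom in \<open>simp add: alg_hom_def\<close>)
  moreover have "relations \<subseteq> {p \<in> carrier (base_alg 2). \<psi> p \<in> {\<zero>\<^bsub>R_alg V\<^esub>}}"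
  proof -
    have y02: "\<psi> (y0 ^ 3) = rcl (L\<langle>-1\<rangle> (L\<langle>-1\<rangle> L))"
      using \<psi>_power[of y0 L 2] by (simp add: \<psi>_simps gen_def numeral_2_eq_2 numeral_3_eq_3 mult_ac)
    have y12: "\<psi> (y1 ^ 2) = rcl (W\<langle>-1\<rangle> W)"
      by (simp add: \<psi>_simps gen_def power2_eq_square R_alg_simps)
    have "\<psi> (y1 ^ 2) = \<psi> ((y1 ^ 2 - y0 ^ 3) + y0 ^ 3)" by simp
    also have "\<dots> = \<psi> (y1 ^ 2 - y0 ^ 3) \<oplus>\<^bsub>R_alg V\<^esub> \<psi> (y0 ^ 3)" by (rule R.poly_eval_add[where g = gen, OF gen_closed])
    finally have "\<psi> (y1 ^ 2 - y0 ^ 3) \<oplus>\<^bsub>R_alg V\<^esub> rcl (L\<langle>-1\<rangle> (L\<langle>-1\<rangle> L)) = rcl (W\<langle>-1\<rangle> W)"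
      unfolding y02 y12 by (rule sym)
    moreover obtain u where u: "\<psi> (y1 ^ 2 - y0 ^ 3) = rcl u"
      by (rule R_carrierE[OF R.poly_eval_closed[where g = gen, OF gen_closed, of "y1 ^ 2 - y0 ^ 3"]])
    ultimately have "u + L\<langle>-1\<rangle> (L\<langle>-1\<rangle> L) - W\<langle>-1\<rangle> W \<in> F 1" by (simp add: R_alg_simps rcl_eq_iff)
    from F_add[OF this cuspidal_relation] have "u \<in> F 1" by simp
    then have "\<psi> (y1 ^ 2 - y0 ^ 3) = \<zero>\<^bsub>R_alg V\<^esub>" unfolding u rcl_eq_zero .
    then show ?thesis using relations_carrier by (auto simp: relations_def)
  qed
  ultimately have "I \<subseteq> {p \<in> carrier (base_alg 2). \<psi> p \<in> {\<zero>\<^bsub>R_alg V\<^esub>}}"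
    by (rule ring.genideal_minimal[OF cring.axioms(1)[OF poly_alg_cring]])
  then show "p \<in> I \<Longrightarrow> \<psi> p = \<zero>\<^bsub>R_alg V\<^esub>" by blast
qed

lemma pr_in_F_1: "x \<in> F 1 \<Longrightarrow> pr n x \<in> F 1"
proof (rule F_1_induct, assumption)
  show "vs.subspace {x. pr n x \<in> F 1}" by (auto simp: vs.subspace_def F_add F_scale)
  fix a b
  have "x\<langle>-2\<rangle> y \<in> F 1" for x y using F_mode_negative[OF F_0, of 1 1 x y] by simp
  then show "pr n (a\<langle>-2\<rangle> b) \<in> F 1" using pr_mode[of n a 1 b] by (auto intro: F_sum)
qed

text \<open>An element of the kernel reduces to a combination of normal forms of distinct weights.
  F^1 is graded, so every normal form with a nonzero coefficient has its vector in F^1 and lies in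
  the ideal by \<open>std_in_I\<close>.\<close>

lemma \<psi>_kernel: "in_vars base p \<Longrightarrow> \<psi> p = \<zero>\<^bsub>R_alg V\<^esub> \<Longrightarrow> p \<in> I"
proof -
  assume p: "in_vars base p" "\<psi> p = \<zero>\<^bsub>R_alg V\<^esub>"
  obtain N c where c: "p - (\<Sum>n<N. pconst (c n) * std n) \<in> I" using normal_form[OF p(1)] by blast
  let ?q = "\<Sum>n<N. pconst (c n) * std n"
  have "\<psi> p = \<psi> ((p - ?q) + ?q)" by simp
  also have "\<dots> = \<psi> (p - ?q) \<oplus>\<^bsub>R_alg V\<^esub> \<psi> ?q" by (rule R.poly_eval_add[where g = gen, OF gen_closed])
  finally have "\<psi> ?q = \<zero>\<^bsub>R_alg V\<^esub>"
    using \<psi>_I[OF c] p(2) R.poly_eval_closed[where g = gen, OF gen_closed, of ?q] by (simp del: R.poly_eval_closed)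
  moreover have "\<psi> (\<Sum>n<M. pconst (c n) * std n) = rcl (\<Sum>n<M. c n \<cdot> std_vec n)" for M
  proof (induction M)
    case 0
    then show ?case by (simp add: \<psi>_simps R_alg_simps)
  next
    case (Suc M)
    have "\<psi> (pconst (c M) * std M) = rcl (c M \<cdot> std_vec M)"
      by (simp add: \<psi>_simps \<psi>_std R_alg_simps vacuum)
    then show ?case using Suc by (simp add: R.poly_eval_add[where g = gen, OF gen_closed] R_alg_simps)
  qed
  ultimately have F1: "(\<Sum>n<N. c n \<cdot> std_vec n) \<in> F 1" by (simp add: rcl_eq_zero)
  have "pconst (c n) * std n \<in> I" if "n < N" for n
  proof (cases "c n = 0")
    case False
    have "pr n (\<Sum>k<N. c k \<cdot> std_vec k) = (\<Sum>k<N. if k = n then c n \<cdot> std_vec n else 0)"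
      unfolding pr_sum by (rule sum.cong) (auto simp: pr_wt[OF wt_std])
    also have "\<dots> = c n \<cdot> std_vec n" using that by (simp add: sum.delta)
    finally have "c n \<cdot> std_vec n \<in> F 1" using pr_in_F_1[OF F1, of n] by simp
    from F_scale[OF this, of "1 / c n"] have "std_vec n \<in> F 1" using False by simp
    then show ?thesis by (intro I.I_mult std_in_I) auto
  qed (simp add: pconst_def)
  then have "(\<Sum>n<M. pconst (c n) * std n) \<in> I" if "M \<le> N" for M
    using that by (induction M) (auto intro: I.I_add)
  then have "?q \<in> I" by simp
  from I.I_add[OF c this] show "p \<in> I" by simp
qed

lemma cuspidal_presentation: "presentation 2 relations \<psi> (R_alg V)"
  unfolding presentation_def
proof (intro conjI relations_finite relations_carrier \<psi>_hom \<psi>_surj)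
  show "{p \<in> carrier (base_alg 2). \<psi> p = \<zero>\<^bsub>R_alg V\<^esub>} = I"
    using \<psi>_I \<psi>_kernel I.I_in_vars by (auto simp: carrier_poly_alg)
qed

text \<open>1, l, l^2, w and l w are nonzero in R by \<open>not_in_F_1\<close>, so a vanishing power
  of l has exponent at least 3 and a vanishing l^a w has a at least 2.\<close>

lemma relations_cuspidal:
  assumes f: "f \<in> relations" and m: "m \<in> ks f"
  shows "cuspidal m"
proof -
  have y0p: "y0 ^ a = sg (sg (0, 0) a) 1" for a by (rule pvar_power)
  have y1p: "y0 ^ a * y1 = sg (sg (0, 0) a + sg (1, 0) 1) 1" for a
    unfolding pvar_power by (simp add: pvar_def mult_single)
  have nz: "a \<ge> 3" if "\<psi> (y0 ^ a) = \<zero>\<^bsub>R_alg V\<^esub>" for a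
  proof (rule ccontr)
    assume "\<not> a \<ge> 3"
    then have "a = 0 \<or> a = 1 \<or> a = 2" by linarith
    moreover have "((\<lambda>x. L\<langle>-1\<rangle> x) ^^ a) (vac V) \<in> F 1"
    proof -
      have "\<psi> 1 = rcl (vac V)" by (simp only: \<psi>_simps R_alg_simps)
      from \<psi>_power[OF this, of a] have "rcl (((\<lambda>x. L\<langle>-1\<rangle> x) ^^ a) (vac V)) = \<zero>\<^bsub>R_alg V\<^esub>"
        unfolding mult_1_right that by (rule sym)
      then show ?thesis by (simp only: rcl_eq_zero)
    qed
    ultimately show False using not_in_F_1 by (auto simp: numeral_2_eq_2 creation)
  qed
  have nz': "a \<ge> 2" if "\<psi> (y0 ^ a * y1) = \<zero>\<^bsub>R_alg V\<^esub>" for a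
  proof (rule ccontr)
    assume "\<not> a \<ge> 2"
    then have "a = 0 \<or> a = 1" by linarith
    moreover have "((\<lambda>x. L\<langle>-1\<rangle> x) ^^ a) W \<in> F 1"
      using \<psi>_power[of y1 W a] that by (simp add: \<psi>_simps gen_def rcl_eq_zero)
    ultimately show False using not_in_F_1 by auto
  qed
  have 3: "cuspidal (sg (0, 0) a)" if "a \<ge> 3" for a
    using that by (simp add: cuspidal_def)
  have 4: "cuspidal (sg (0, 0) a + sg (1, 0) 1)" if "a \<ge> 2" for a
    using that by (simp add: cuspidal_def wdeg_add)
  have 5: "cuspidal (sg (1, 0) 2)"
    by (simp add: cuspidal_def lookup_single)
  from f consider "f = y1 ^ 2 - y0 ^ 3" | a where "f = y0 ^ a" "a \<ge> 3" | a where "f = y0 ^ a * y1" "a \<ge> 2"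
    unfolding relations_def using nz nz' by blast
  then show ?thesis
  proof cases
    case 1
    have "ks f \<subseteq> ks (y1 ^ 2) \<union> ks (y0 ^ 3)" unfolding 1 by (rule keys_diff)
    then have "m = sg (1, 0) 2 \<or> m = sg (0, 0) 3" using m unfolding pvar_power by auto
    then show ?thesis using 3[of 3] 5 by auto
  next
    case (2 a)
    then show ?thesis using m 3 unfolding y0p by auto
  next
    case (3 a)
    then show ?thesis using m 4 unfolding y1p by auto
  qed
qed

text \<open>All relations are homogeneous for the weights 2 and 3, so the Euler derivation
  multiplies them by constants.\<close>

lemma relations_euler:
  assumes f: "f \<in> relations"
  shows "euler (\<lambda>j. if j = 0 then 2 else 3) f \<in> I"
proof -
  have sgc: "sg k (of_nat e * c) = pconst (of_nat e) * sg k c" for k :: "(nat \<times> nat) \<Rightarrow>\<^sub>0 nat" and e and c :: complex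
    unfolding pconst_def mult_single by simp
  have y1p: "y0 ^ a * y1 = sg (sg (0, 0) a + sg (1, 0) 1) 1" for a
    unfolding pvar_power by (simp add: pvar_def mult_single)
  have euler_diff: "euler w (p - q) = euler w p - euler w q" for w p q
    by (simp add: euler_def deriv_along_diff)
  have fI: "pconst c * f \<in> I" for c using relations_in_I f by (intro I.I_mult) auto
  from f consider "f = y1 ^ 2 - y0 ^ 3" | a where "f = y0 ^ a" | a where "f = y0 ^ a * y1"
    unfolding relations_def by blast
  then show ?thesis
  proof cases
    case 1
    have "euler (\<lambda>j. if j = 0 then 2 else 3) f = sg (sg (1, 0) 2) (of_nat 6 * 1) - sg (sg (0, 0) 3) (of_nat 6 * 1)"
      unfolding 1 pvar_power euler_diff euler_single by simp
    also have "\<dots> = pconst 6 * f" unfolding sgc 1 pvar_power by (simp add: right_diff_distrib)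
    finally show ?thesis using fI by simp
  next
    case (2 a)
    have "euler (\<lambda>j. if j = 0 then 2 else 3) f = pconst (of_nat (wdeg (\<lambda>j. if j = 0 then 2 else 3) (sg (0, 0) a))) * f"
      unfolding 2 pvar_power euler_single sgc ..
    then show ?thesis using fI by simp
  next
    case (3 a)
    have "euler (\<lambda>j. if j = 0 then 2 else 3) f =
        pconst (of_nat (wdeg (\<lambda>j. if j = 0 then 2 else 3) (sg (0, 0) a + sg (1, 0) 1))) * f"
      unfolding 3 y1p euler_single sgc ..
    then show ?thesis using fI by simp
  qed
qed

lemma arc_alg_not_rigid: "\<not> has_rigid_point (arc_alg 2 relations)"
proof -
  interpret A: arc_presentation 2 relations
    by (rule arc_presentation.intro) (rule presentation_presented[OF cuspidal_presentation])
  show ?thesis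
    by (rule A.arc_not_rigid[where w = "\<lambda>j. if j = 0 then 2 else 3"]) (auto intro: relations_cuspidal relations_euler)
qed

text \<open>Since Phi is onto, every element of gr is a polynomial in the jets of L and W, and
  \<open>d_aug_subset\<close> reduces rigidity to \<open>d_jets\<close>.\<close>

lemma gr_alg_rigid: "has_rigid_point (gr_alg V)"
  unfolding has_rigid_point_def
proof (intro exI[of _ G.aug] conjI allI impI G.aug_maximal)
  fix d assume d: "derivation_mod_square (gr_alg V) G.aug d"
  interpret A: arc_target 2 relations "gr_alg V" "gr_der V" \<psi> "R_alg V" "R_in_gr V"
    by (rule presentation_arc_target[OF cuspidal_presentation])
  let ?g = "\<lambda>(j, i). if j = (0::nat) then jet_L i else if j = 1 then jet_W i else \<zero>\<^bsub>gr_alg V\<^esub>"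
  have jv: "A.jet_values = ?g"
  proof
    fix v :: "nat \<times> nat"
    obtain j i where v: "v = (j, i)" by (cases v)
    have z: "\<zero>\<^bsub>gr_alg V\<^esub> = gcl (conc i 0)" for i by (rule gcl_conc_eq_zero[OF F_0I, symmetric])
    have "j = 0 \<or> j = 1 \<or> j \<ge> 2" by linarith
    then show "A.jet_values v = ?g v"
    proof (elim disjE)
      assume "j = 0"
      then show ?thesis using gr_der_pow_conc[of i 0 L]
        by (simp add: v A.jet_values_def \<psi>_simps gen_def R_in_gr_rcl)
    next
      assume "j = 1"
      then show ?thesis using gr_der_pow_conc[of i 0 W]
        by (simp add: v A.jet_values_def \<psi>_simps gen_def R_in_gr_rcl)
    next
      assume "j \<ge> 2"
      then show ?thesis using gr_der_pow_conc[of i 0 0] z[of 0] z[of i]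
        by (simp add: v A.jet_values_def)
    qed
  qed
  show "d ` G.aug \<subseteq> G.aug"
  proof (rule G.d_aug_subset[OF d, of A.jet_values "{..<2} \<times> UNIV"])
    fix v
    show "A.jet_values v \<in> G.aug"
      unfolding jv using jets_aug by (auto simp: G.aug_def split: prod.split)
    show "v \<in> {..<2} \<times> UNIV \<Longrightarrow> \<epsilon> (d (A.jet_values v)) = 0"
      unfolding jv using d_jets[OF d] by auto
  next
    fix x assume "x \<in> carrier (gr_alg V)"
    then obtain y where y: "y \<in> carrier (arc_alg 2 relations)" "x = A.arc_lift y"
      using arc_lift_surj[OF cuspidal_presentation] by blast
    then obtain p where "in_vars ({..<2} \<times> UNIV) p" "y = A.cls p" unfolding A.arc_alg_Q by (elim A.Q_carrierE) blast
    then show "\<exists>p. in_vars ({..<2} \<times> UNIV) p \<and> x = G.poly_eval A.jet_values p"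
      using y A.arc_lift_cls by blast
  qed
qed

section \<open>Transfer to an arbitrary presentation\<close>

lemma no_ring_iso:
  assumes pres: "presentation r Fs \<psi>' (R_alg V)"
  shows "h \<notin> ring_iso (arc_alg r Fs) (gr_alg V)"
proof
  assume h: "h \<in> ring_iso (arc_alg r Fs) (gr_alg V)"
  interpret A: arc_presentation r Fs by (rule arc_presentation.intro) (rule presentation_presented[OF pres])
  interpret B: arc_presentation 2 relations
    by (rule arc_presentation.intro) (rule presentation_presented[OF cuspidal_presentation])
  have A: "cring (arc_alg r Fs)" and B: "cring (arc_alg 2 relations)"
    unfolding A.arc_alg_Q B.arc_alg_Q by (rule A.Q_cring, rule B.Q_cring)
  obtain k where "k \<in> ring_iso (arc_alg 2 relations) (arc_alg r Fs)"
    using arc_alg_independent[OF cuspidal_presentation pres R_alg_cring] by blast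
  then have "has_rigid_point (arc_alg 2 relations)"
    using has_rigid_point_iso[OF B A] has_rigid_point_iso[OF A gr_cring h gr_alg_rigid] by blast
  then show False using arc_alg_not_rigid by blast
qed

lemma Phi_not_inj: "presentation r Fs \<psi>' (R_alg V) \<Longrightarrow> \<not> inj_on (Phi V r Fs \<psi>') (carrier (arc_alg r Fs))"
  using Phi_inj_ring_iso no_ring_iso by blast

lemma schemes_not_isomorphic:
  assumes pres: "presentation r Fs \<psi>' (R_alg V)"
  shows "\<not> isomorphic_schemes (Spec (arc_alg r Fs)) (Spec (gr_alg V))"
proof
  assume iso: "isomorphic_schemes (Spec (arc_alg r Fs)) (Spec (gr_alg V))"
  interpret A: arc_presentation r Fs by (rule arc_presentation.intro) (rule presentation_presented[OF pres])
  have A: "cring (arc_alg r Fs)" unfolding A.arc_alg_Q by (rule A.Q_cring)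
  obtain h where h: "h \<in> ring_iso (gr_alg V) (arc_alg r Fs)"
    using isomorphic_Spec_ring_iso[OF A gr_cring iso] by blast
  show False
    using ring_iso_set_sym[OF cring.axioms(1)[OF gr_cring] h] no_ring_iso[OF pres] by blast
qed

end

section \<open>The simple graded quotient\<close>

context W3_minus_two
begin

lemma strongly_generated:
  "va_span V {nop V xs |xs. set xs \<subseteq> range (\<lambda>k. (der V ^^ k) L) \<union> range (\<lambda>k. (der V ^^ k) W)} = UNIV"
proof -
  let ?M = "{kss. length kss = length [L, W] \<and> (\<forall>ks\<in>set kss. sorted_wrt (\<ge>) (ks :: nat list))}"
  have full: "vs.span (va_monomial V [L, W] ` ?M) = UNIV"
    using free by (simp add: freely_generates_def Let_def va_span_def)
  have "va_monomial V [L, W] ` ?M \<subseteq> {nop V xs |xs. set xs \<subseteq> range (\<lambda>k. (T ^^ k) L) \<union> range (\<lambda>k. (T ^^ k) W)}"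
  proof
    fix x assume "x \<in> va_monomial V [L, W] ` ?M"
    then obtain kss where "kss \<in> ?M" and kss: "x = va_monomial V [L, W] kss" by blast
    then have "length kss = 2" by simp
    then obtain as bs where "kss = [as, bs]" by (auto simp: length_Suc_conv numeral_2_eq_2)
    then have x: "x = nop V (map (\<lambda>k. (T ^^ k) L) as @ map (\<lambda>k. (T ^^ k) W) bs)"
      using kss by (simp add: va_monomial_def)
    show "x \<in> {nop V xs |xs. set xs \<subseteq> range (\<lambda>k. (T ^^ k) L) \<union> range (\<lambda>k. (T ^^ k) W)}"
      unfolding x mem_Collect_eq by (rule exI, rule conjI[OF refl]) auto
  qed
  from vs.span_mono[OF this] show ?thesis unfolding full va_span_def by auto
qed

end

theorem theorem5p1:
  fixes V :: "'v::ab_group_add va" and L W :: 'v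
    and \<W> :: "'w::ab_group_add va" and \<pi> :: "'v \<Rightarrow> 'w"
  assumes "W3_minus_two V L W"
    and "simple_graded_quotient V L \<W> \<pi>"
  shows "(\<exists>r F \<psi>. presentation r F \<psi> (R_alg \<W>)) \<and>
    (\<forall>r F \<psi>. presentation r F \<psi> (R_alg \<W>) \<longrightarrow>
       \<not> inj_on (Phi \<W> r F \<psi>) (carrier (arc_alg r F)) \<and>
       \<not> isomorphic_schemes (Spec (arc_alg r F)) (Spec (gr_alg \<W>)))"
proof -
  interpret V: W3_minus_two V L W by (rule assms(1))
  interpret Q: vertex_algebra \<W> using assms(2) by (simp add: simple_graded_quotient_def)
  have hom: "va_hom V \<W> \<pi>" and surj: "surj \<pi>" and max: "maximal_proper_graded_ideal V L {a. \<pi> a = 0}"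
    using assms(2) by (simp_all add: simple_graded_quotient_def)
  interpret pi: Vector_Spaces.linear "scal V" "scal \<W>" \<pi> using hom by (simp add: va_hom_def)
  have \<pi>_vac: "\<pi> (vac V) = vac \<W>" and \<pi>_der: "\<pi> (der V a) = der \<W> (\<pi> a)"
    and \<pi>_mode: "\<pi> (nprod V a n b) = nprod \<W> (\<pi> a) n (\<pi> b)" for a b n
    using hom by (simp_all add: va_hom_def)
  note \<pi>_lin = pi.add pi.diff pi.scale pi.zero
  have \<pi>_pow: "\<pi> ((der V ^^ k) a) = (der \<W> ^^ k) (\<pi> a)" for k a
    by (induction k) (simp_all add: \<pi>_der)
  have \<pi>_nop: "\<pi> (nop V xs) = nop \<W> (map \<pi> xs)" for xs
    by (induction xs) (simp_all add: nop_def \<pi>_vac \<pi>_mode)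
  have proper: "proper_graded_ideal V L {a. \<pi> a = 0}"
    using max by (simp add: maximal_proper_graded_ideal_def)
  obtain v where v: "\<pi> v \<noteq> 0" using proper by (auto simp: proper_graded_ideal_def)
  \<comment> \<open>The kernel is proper, so some vector has a nonzero image, and the vacuum acts on
    it as the identity.\<close>
  have nontrivial: "vac \<W> \<noteq> 0"
  proof
    assume "vac \<W> = 0"
    then have "\<pi> v = 0" using Q.vacuum[of "-1" "\<pi> v"] by simp
    then show False using v by simp
  qed
  have nontrivial_V: "vac V \<noteq> 0" using nontrivial \<pi>_vac pi.zero by metis
  interpret VW: W3_algebra V L W
    by unfold_locales (use V.L_virasoro V.W_primary V.W_W V.strongly_generated nontrivial_V in simp_all)
  have strong: "va_span \<W> {nop \<W> xs |xs. set xs \<subseteq> range (\<lambda>k. (der \<W> ^^ k) (\<pi> L)) \<union> range (\<lambda>k. (der \<W> ^^ k) (\<pi> W))} = UNIV"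
  proof -
    let ?S = "Q.vs.span {nop \<W> xs |xs. set xs \<subseteq> range (\<lambda>k. (der \<W> ^^ k) (\<pi> L)) \<union> range (\<lambda>k. (der \<W> ^^ k) (\<pi> W))}"
    have A: "V.vs.subspace {x. \<pi> x \<in> ?S}"
      by (auto simp: V.vs.subspace_def \<pi>_lin intro: Q.vs.span_add Q.vs.span_scale Q.vs.span_zero)
    have B: "{nop V xs |xs. set xs \<subseteq> range (\<lambda>k. (der V ^^ k) L) \<union> range (\<lambda>k. (der V ^^ k) W)} \<subseteq> {x. \<pi> x \<in> ?S}"
    proof clarify
      fix xs assume xs: "set xs \<subseteq> range (\<lambda>k. (der V ^^ k) L) \<union> range (\<lambda>k. (der V ^^ k) W)"
      then have "set (map \<pi> xs) \<subseteq> range (\<lambda>k. (der \<W> ^^ k) (\<pi> L)) \<union> range (\<lambda>k. (der \<W> ^^ k) (\<pi> W))"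
        by (auto simp: \<pi>_pow image_iff dest!: subsetD)
      then show "\<pi> (nop V xs) \<in> ?S" unfolding \<pi>_nop by (intro Q.vs.span_base) blast
    qed
    have "UNIV \<subseteq> {x. \<pi> x \<in> ?S}"
      using V.vs.span_minimal[OF B A] unfolding V.strongly_generated[unfolded va_span_def] .
    then have in_S: "\<pi> x \<in> ?S" for x by blast
    have "y \<in> ?S" for y
    proof -
      obtain x where "y = \<pi> x" using surj by (rule surjE)
      then show ?thesis using in_S by simp
    qed
    then have "UNIV = ?S" by (rule UNIV_eq_I)
    then show ?thesis unfolding va_span_def by (rule sym)
  qed
  interpret QW: W3_algebra \<W> "\<pi> L" "\<pi> W"
  proof unfold_locales
    note e = V.L_virasoro[unfolded virasoro_def] and p = V.W_primary[unfolded primary_def]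
    show "virasoro \<W> (-2) (\<pi> L)"
      using e unfolding virasoro_def by (metis \<pi>_mode \<pi>_der \<pi>_vac pi.scale pi.zero)
    show "primary \<W> (\<pi> L) 3 (\<pi> W)"
      using p unfolding primary_def by (metis \<pi>_mode \<pi>_der pi.scale pi.zero)
    show "\<forall>n\<ge>6. nprod \<W> (\<pi> W) n (\<pi> W) = 0" using V.W_W(1) by (metis \<pi>_mode pi.zero)
    show "nprod \<W> (\<pi> W) 5 (\<pi> W) = scal \<W> (-9/8) (vac \<W>)" using V.W_W(2) by (metis \<pi>_mode \<pi>_vac pi.scale)
    show "nprod \<W> (\<pi> W) 4 (\<pi> W) = 0" using V.W_W(3) by (metis \<pi>_mode pi.zero)
    show "nprod \<W> (\<pi> W) 3 (\<pi> W) = scal \<W> (27/8) (\<pi> L)" using V.W_W(4) by (metis \<pi>_mode pi.scale)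
    show "nprod \<W> (\<pi> W) 2 (\<pi> W) = scal \<W> (27/16) (der \<W> (\<pi> L))" using V.W_W(5) by (metis \<pi>_mode \<pi>_der pi.scale)
    show "nprod \<W> (\<pi> W) 1 (\<pi> W) = scal \<W> (9/2) (nprod \<W> (\<pi> L) (-1) (\<pi> L)) - scal \<W> (27/32) ((der \<W> ^^ 2) (\<pi> L))"
      using arg_cong[OF V.W_W(6), of \<pi>] by (simp only: \<pi>_mode \<pi>_pow \<pi>_lin)
    show "nprod \<W> (\<pi> W) 0 (\<pi> W) = scal \<W> (9/2) (nprod \<W> (der \<W> (\<pi> L)) (-1) (\<pi> L)) - scal \<W> (3/16) ((der \<W> ^^ 3) (\<pi> L))"
      using arg_cong[OF V.W_W(7), of \<pi>] by (simp only: \<pi>_mode \<pi>_pow \<pi>_der \<pi>_lin)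
  qed (rule strong nontrivial)+
  have wt_\<pi>: "QW.wt (\<pi> x) d" if "VW.wt x d" for x d
    using that unfolding QW.wt_def VW.wt_def by (metis \<pi>_mode pi.scale)
  \<comment> \<open>Weight vectors lift to weight vectors: the projection preserves weights, so by
    uniqueness of components the weight n component of any preimage maps onto u.\<close>
  have lift: "\<exists>x. VW.wt x (int n) \<and> \<pi> x = u" if u: "QW.wt u (int n)" for u n
  proof -
    obtain x where x: "\<pi> x = u" using surj by (metis surjD)
    have c: "VW.comps x (\<lambda>k. VW.pr k x)" by (rule VW.comps_pr)
    then have ev: "eventually_zero (\<lambda>k. VW.pr k x)" and sum: "x = Sum_any (\<lambda>k. VW.pr k x)" by (simp_all add: VW.comps_def)
    have "\<pi> (Sum_any (\<lambda>k. VW.pr k x)) = Sum_any (\<lambda>k. \<pi> (VW.pr k x))"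
      by (rule Sum_any_hom[OF ev]) (simp_all add: \<pi>_lin)
    then have "\<pi> x = Sum_any (\<lambda>k. \<pi> (VW.pr k x))" using sum by simp
    moreover have "eventually_zero (\<lambda>k. \<pi> (VW.pr k x))" by (rule eventually_zero_compose[OF ev]) (simp add: pi.zero)
    ultimately have "QW.comps u (\<lambda>k. \<pi> (VW.pr k x))" using x wt_\<pi>[OF VW.wt_pr] by (simp add: QW.comps_def)
    then have "QW.pr n u = \<pi> (VW.pr n x)" by (rule QW.pr_eqI)
    then have "\<pi> (VW.pr n x) = u" using QW.pr_wt[OF u, of n] by simp
    then show ?thesis using VW.wt_pr by blast
  qed
  \<comment> \<open>The preimage of a proper graded ideal is a proper graded ideal containing the
    kernel, hence equal to it by maximality.\<close>
  interpret QS: W3_quotient \<W> "\<pi> L" "\<pi> W"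
  proof unfold_locales
    fix I assume I: "proper_graded_ideal \<W> (\<pi> L) I"
    let ?J = "{x. \<pi> x \<in> I}"
    have I_sub: "Q.vs.subspace I" and I_der: "\<And>x. x \<in> I \<Longrightarrow> der \<W> x \<in> I"
      and I_mode: "\<And>a n x. x \<in> I \<Longrightarrow> nprod \<W> a n x \<in> I \<and> nprod \<W> x n a \<in> I"
      and I_proper: "I \<noteq> UNIV" and I_graded: "Q.vs.span (\<Union>n. I \<inter> weight_space \<W> (\<pi> L) n) = I"
      using I by (auto simp: proper_graded_ideal_def va_ideal_def va_span_def)
    have J_sub: "V.vs.subspace ?J"
      using I_sub by (auto simp: V.vs.subspace_def Q.vs.subspace_def \<pi>_lin)
    have ker: "a \<in> V.vs.span (\<Union>n. ?J \<inter> weight_space V L n)" if "\<pi> a = 0" for a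
    proof -
      have "a \<in> V.vs.span (\<Union>n. {a. \<pi> a = 0} \<inter> weight_space V L n)"
        using proper that by (auto simp: proper_graded_ideal_def va_span_def)
      moreover have "V.vs.span (\<Union>n. {a. \<pi> a = 0} \<inter> weight_space V L n) \<subseteq> V.vs.span (\<Union>n. ?J \<inter> weight_space V L n)"
        by (rule V.vs.span_mono) (use Q.vs.subspace_0[OF I_sub] in auto)
      ultimately show ?thesis by blast
    qed
    \<comment> \<open>For gradedness of the preimage: elements of I lift to sums of weight vectors
      in \<open>?J\<close>, and the error lies in the kernel, which is itself graded.\<close>
    have "\<exists>y\<in>V.vs.span (\<Union>n. ?J \<inter> weight_space V L n). \<pi> y = u" if "u \<in> I" for u
    proof -
      have "u \<in> Q.vs.span (\<Union>n. I \<inter> weight_space \<W> (\<pi> L) n)" using that I_graded by simp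
      then show ?thesis
      proof (induction rule: Q.vs.span_induct_alt)
        case base
        show ?case using V.vs.span_zero pi.zero by blast
      next
        case (step c u w)
        then obtain n where n: "u \<in> I" "u \<in> weight_space \<W> (\<pi> L) n" by blast
        then obtain x where x: "VW.wt x (int n)" "\<pi> x = u" using lift[of u n] by (auto simp: QW.wt_weight_space)
        then have "x \<in> V.vs.span (\<Union>n. ?J \<inter> weight_space V L n)"
          using n(1) by (intro V.vs.span_base) (auto simp: VW.wt_weight_space)
        moreover obtain y where y: "y \<in> V.vs.span (\<Union>n. ?J \<inter> weight_space V L n)" "\<pi> y = w" using step by blast
        ultimately have "scal V c x + y \<in> V.vs.span (\<Union>n. ?J \<inter> weight_space V L n)"
          by (intro V.vs.span_add V.vs.span_scale)
        then show ?case using x(2) y(2) by (intro bexI[of _ "scal V c x + y"]) (simp_all add: \<pi>_lin)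
      qed
    qed
    note lift_I = this
    have J_graded: "V.vs.span (\<Union>n. ?J \<inter> weight_space V L n) = ?J"
    proof
      show "V.vs.span (\<Union>n. ?J \<inter> weight_space V L n) \<subseteq> ?J" by (rule V.vs.span_minimal[OF _ J_sub]) blast
      show "?J \<subseteq> V.vs.span (\<Union>n. ?J \<inter> weight_space V L n)"
      proof
        fix x assume "x \<in> ?J"
        then obtain y where y: "y \<in> V.vs.span (\<Union>n. ?J \<inter> weight_space V L n)" "\<pi> y = \<pi> x" using lift_I[of "\<pi> x"] by auto
        then have "x - y \<in> V.vs.span (\<Union>n. ?J \<inter> weight_space V L n)" by (intro ker) (simp add: \<pi>_lin)
        from V.vs.span_add[OF this y(1)] show "x \<in> V.vs.span (\<Union>n. ?J \<inter> weight_space V L n)" by simp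
      qed
    qed
    have "?J \<noteq> UNIV"
    proof
      assume "?J = UNIV"
      then have "\<pi> x \<in> I" for x by blast
      then have "I = UNIV" using surj by (metis UNIV_eq_I surjD)
      then show False using I_proper by simp
    qed
    then have "proper_graded_ideal V L ?J"
      unfolding proper_graded_ideal_def va_ideal_def va_span_def
      using J_sub J_graded I_der I_mode by (simp add: \<pi>_der \<pi>_mode)
    moreover have "{a. \<pi> a = 0} \<subseteq> ?J" using Q.vs.subspace_0[OF I_sub] by auto
    ultimately have J_eq: "?J = {a. \<pi> a = 0}" using max unfolding maximal_proper_graded_ideal_def by blast
    show "I = {0}"
    proof
      show "I \<subseteq> {0}"
      proof
        fix u assume u: "u \<in> I"
        obtain x where "\<pi> x = u" using surj by (metis surjD)
        then show "u \<in> {0}" using u J_eq by blast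
      qed
    qed (use Q.vs.subspace_0[OF I_sub] in simp)
  qed
  show ?thesis
    using QS.cuspidal_presentation QS.Phi_not_inj QS.schemes_not_isomorphic by blast
qed

end
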